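(* Fix an integer $r>0$, an integer $p\ge1$, and partitions $\beta_1,\beta_2$. Let $1^p$ denote the single-column partition of length $p$. Then \[ \tau^r_{1^p,\emptyset}\cdot\tau^r_{\beta_1,\beta_2}=\sum_{\lambda}\Big(\tau^r_{\lambda,\beta_2}+\sum_{(\gamma_1,\gamma_2)}\tau^r_{\gamma_1,\gamma_2}\Big), \] where $\lambda$ runs over partitions with $\lambda/\beta_1$ a vertical strip of length $p$, and the inner sum runs over pairs $(\gamma_1,\gamma_2)$ such that for some $q\ge1$, $\gamma_1/\lambda$ and $\beta_2/\gamma_2$ are vertical strips of length $q$, $T_{\gamma_1/\lambda}\in\mathrm{RW}_{\gamma_1/\lambda}(\beta_2/\gamma_2)$, the arrow $a_{T_{\gamma_1/\lambda}}:(\lambda,\beta_2)\to(\gamma_1,\gamma_2)$ satisfies the $r$-th row rule, and the tableau $S=\mathrm{Slide}_{T_{\lambda/\beta_1}}(T_{\gamma_1/\lambda})$ satisfies the reverse $r$-th row rule with respect to $\beta_2/\gamma_2$ (i.e. $R_r(i)>\mathrm{row}_S(i)$ for all $i$).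
   Context: Tableaux: English Young diagrams (rows numbered top to bottom, columns left to right). A skew shape is a vertical strip of length $q$ if it has $q$ boxes, no two in the same row; for a vertical strip $\mu/\nu$, $T_{\mu/\nu}$ is the tableau labelling its boxes $1,2,\dots$ from top to bottom. $\mathrm{rl}(\alpha/\beta)$ writes $1,\dots,|\alpha/\beta|$ into $\alpha/\beta$ right to left along rows, rows top to bottom. $\mathrm{RW}_{\gamma/\delta}(\alpha/\beta)$: standard tableaux $T$ of shape $\gamma/\delta$ such that if $i,i+1$ share a row of $\mathrm{rl}(\alpha/\beta)$ then $i+1$ is strictly right of and weakly above $i$ in $T$, and if $i$ is directly above $j$ in a column of $\mathrm{rl}(\alpha/\beta)$ then $j$ is strictly below and weakly left of $i$ in $T$. Quiver and bases: $s_{\alpha_1,\alpha_2}=s_{\alpha_1}(x)s_{\alpha_2}(y)$ in $\Lambda_1\otimes_{\mathbb Z}\Lambda_2$. Arrows $a_T:(\alpha_1,\alpha_2)\to(\beta_1,\beta_2)$ between distinct pairs for each $T\in\mathrm{RW}_{\beta_1/\alpha_1}(\alpha_2/\beta_2)$. The $r$-th row rule filling of a partition has $r+i-j$ in row $i$, column $j$; for $a_T$ and each $i$, $R_r(i)$ is the entry of the row rule filling of $\alpha_2$ at the box of $\alpha_2/\beta_2$ labelled $i$ in $\mathrm{rl}(\alpha_2/\beta_2)$ and $\mathrm{row}_T(i)$ the row of $i$ in $T$; the $r$-th row rule is $R_r(i)\le\mathrm{row}_T(i)$ for all $i$, the reverse one $R_r(i)>\mathrm{row}_T(i)$ for all $i$.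 $\tau^r_{\alpha_1,\alpha_2}=s_{\alpha_1,\alpha_2}-\sum_a\tau^r_{t(a)}$ recursively in $|\alpha_2|$, over arrows with source $(\alpha_1,\alpha_2)$ satisfying the $r$-th row rule, $t(a)$ the target. Infusion: for $\alpha\subseteq\beta\subseteq\gamma$ and standard $T_1$ of shape $\beta/\alpha$, $T_2$ of shape $\gamma/\beta$, go through the boxes of $T_1$ in decreasing order of labels and perform a jeu-de-taquin slide of the current $T_2$ into each; the result is $\mathrm{Slide}_{T_1}(T_2)$. *)

theory Defs
  imports "HOL-Library.Multiset" "HOL-Library.While_Combinator"
begin

section \<open>Formal power series in arbitrarily many commuting variables\<close>

text \<open>A monomial is a finite multiset of variables. The ring \<open>\<int>[[x, y]]\<close> with variables
  \<open>x_k = Inl k\<close> and \<open>y_k = Inr k\<close> contains the tensor product \<open>\<Lambda>_1 \<otimes> \<Lambda>_2\<close> of the rings of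
  symmetric functions in \<open>x\<close> and in \<open>y\<close>, a pure tensor \<open>f \<otimes> g\<close> being the product \<open>f(x) g(y)\<close>.\<close>

typedef 'v mseries = "UNIV :: ('v multiset \<Rightarrow> int) set"
  morphisms mcoeff Abs_mseries ..

lemma mcoeff_Abs [simp]: "mcoeff (Abs_mseries f) = f"
  by (simp add: Abs_mseries_inverse)

lemma mseries_eqI: "(\<And>m. mcoeff f m = mcoeff g m) \<Longrightarrow> f = g"
  by (metis ext mcoeff_inject)

lemma finite_msplit: "finite {(a, b). a + b = (m :: 'v multiset)}"
proof -
  have "finite {a. a \<subseteq># m}"
  proof (induction m)
    case empty
    then show ?case by simp
  next
    case (add x m)
    have "{a. a \<subseteq># add_mset x m} \<subseteq> {a. a \<subseteq># m} \<union> add_mset x ` {a. a \<subseteq># m}"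
    proof
      fix a assume "a \<in> {a. a \<subseteq># add_mset x m}"
      then have a: "a \<subseteq># add_mset x m" by simp
      show "a \<in> {a. a \<subseteq># m} \<union> add_mset x ` {a. a \<subseteq># m}"
      proof (cases "x \<in># a")
        case True
        then obtain c where "a = add_mset x c" by (metis multi_member_split)
        with a show ?thesis by auto
      next
        case False
        with a have "a \<subseteq># m"
          by (metis diff_single_trivial subset_eq_diff_conv
              add_mset_add_single)
        then show ?thesis by simp
      qed
    qed
    then show ?case using add.IH by (meson finite_UnI finite_imageI finite_subset)
  qed
  then have "finite ((\<lambda>a. (a, m - a)) ` {a. a \<subseteq># m})" by simp
  moreover have "{(a, b). a + b = m} \<subseteq> (\<lambda>a. (a, m - a)) ` {a. a \<subseteq># m}" by auto
  ultimately show ?thesis by (rule finite_subset [rotated])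
qed

instantiation mseries :: (type) comm_ring_1
begin

definition zero_mseries_def: "0 = Abs_mseries (\<lambda>_. 0)"
definition one_mseries_def: "1 = Abs_mseries (\<lambda>m. if m = {#} then 1 else 0)"
definition plus_mseries_def: "f + g = Abs_mseries (\<lambda>m. mcoeff f m + mcoeff g m)"
definition uminus_mseries_def: "- f = Abs_mseries (\<lambda>m. - mcoeff f m)"
definition minus_mseries_def: "f - g = Abs_mseries (\<lambda>m. mcoeff f m - mcoeff g m)"
definition times_mseries_def:
  "f * g = Abs_mseries (\<lambda>m. \<Sum>(a, b) \<in> {(a, b). a + b = m}. mcoeff f a * mcoeff g b)"

lemma mcoeff_simps:
  fixes f g :: "'a mseries"
  shows
  "mcoeff (0 :: 'a mseries) m = 0"
  "mcoeff (1 :: 'a mseries) m = (if m = {#} then 1 else 0)"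
  "mcoeff (f + g) m = mcoeff f m + mcoeff g m"
  "mcoeff (- f) m = - mcoeff f m"
  "mcoeff (f - g) m = mcoeff f m - mcoeff g m"
  "mcoeff (f * g) m = (\<Sum>(a, b) \<in> {(a, b). a + b = m}. mcoeff f a * mcoeff g b)"
  by (simp_all only: zero_mseries_def one_mseries_def plus_mseries_def uminus_mseries_def
      minus_mseries_def times_mseries_def mcoeff_Abs)

instance
proof
  fix f g h :: "'a mseries"
  show "f + g + h = f + (g + h)" "f + g = g + f" "0 + f = f" "- f + f = 0" "f - g = f + - g"
    by (rule mseries_eqI; simp only: mcoeff_simps; linarith)+
  have "mcoeff (0 :: 'a mseries) {#} \<noteq> mcoeff 1 {#}" by (simp only: mcoeff_simps) simp
  then show "(0 :: 'a mseries) \<noteq> 1" by metis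
  show "(f + g) * h = f * h + g * h"
    by (rule mseries_eqI) (simp only: mcoeff_simps distrib_right case_prod_unfold sum.distrib)
  show "f * g = g * f"
  proof (rule mseries_eqI)
    fix m
    show "mcoeff (f * g) m = mcoeff (g * f) m"
      unfolding mcoeff_simps
      by (rule sum.reindex_bij_witness [where i = prod.swap and j = prod.swap])
        (auto simp: add.commute)
  qed
  show "1 * f = f"
  proof (rule mseries_eqI)
    fix m :: "'a multiset"
    have "(\<Sum>(a, b) \<in> {(a, b). a + b = m}. mcoeff 1 a * mcoeff f b)
        = (\<Sum>(a, b) \<in> {({#}, m)}. mcoeff 1 a * mcoeff f b)"
      by (rule sum.mono_neutral_right) (auto simp: finite_msplit mcoeff_simps split: if_splits)
    then show "mcoeff (1 * f) m = mcoeff f m"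
      by (simp add: mcoeff_simps)
  qed
  show "f * g * h = f * (g * h)"
  proof (rule mseries_eqI)
    fix m
    have "mcoeff (f * g * h) m = (\<Sum>((u, c), (a, b)) \<in>
        (SIGMA p : {(u, c). u + c = m}. {(a, b). a + b = fst p}).
        mcoeff f a * mcoeff g b * mcoeff h c)"
      by (simp add: mcoeff_simps sum_distrib_right case_prod_unfold sum.Sigma
          finite_msplit [unfolded case_prod_unfold])
    also have "\<dots> = (\<Sum>((a, u), (b, c)) \<in>
        (SIGMA p : {(a, u). a + u = m}. {(b, c). b + c = snd p}).
        mcoeff f a * (mcoeff g b * mcoeff h c))"
      by (rule sum.reindex_bij_witness
          [where j = "\<lambda>((u, c), (a, b)). ((a, b + c), (b, c))"
            and i = "\<lambda>((a, u), (b, c)). ((a + b, c), (a, b))"])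
        (auto simp: add.assoc mult.assoc)
    also have "\<dots> = mcoeff (f * (g * h)) m"
      by (simp add: mcoeff_simps sum_distrib_left case_prod_unfold sum.Sigma
          finite_msplit [unfolded case_prod_unfold])
    finally show "mcoeff (f * g * h) m = mcoeff (f * (g * h)) m" .
  qed
qed

end

section \<open>Partitions, skew shapes, tableaux\<close>

definition is_partition :: "nat list \<Rightarrow> bool" where
  "is_partition \<alpha> \<longleftrightarrow> sorted_wrt (\<ge>) \<alpha> \<and> 0 \<notin> set \<alpha>"

text \<open>Boxes are pairs (row, column), both numbered from 1.\<close>

type_synonym box = "nat \<times> nat"

definition diagram :: "nat list \<Rightarrow> box set" where
  "diagram \<alpha> = {(i, j). 1 \<le> i \<and> i \<le> length \<alpha> \<and> 1 \<le> j \<and> j \<le> \<alpha> ! (i - 1)}"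

definition skew :: "nat list \<Rightarrow> nat list \<Rightarrow> box set" where
  "skew \<alpha> \<beta> = diagram \<alpha> - diagram \<beta>"

text \<open>The domain of a tableau is its shape.\<close>

type_synonym tableau = "box \<rightharpoonup> nat"

definition box_of :: "tableau \<Rightarrow> nat \<Rightarrow> box" where
  "box_of T k = (THE b. T b = Some k)"

abbreviation row_of :: "tableau \<Rightarrow> nat \<Rightarrow> nat" where
  "row_of T k \<equiv> fst (box_of T k)"

abbreviation col_of :: "tableau \<Rightarrow> nat \<Rightarrow> nat" where
  "col_of T k \<equiv> snd (box_of T k)"

definition standard :: "box set \<Rightarrow> tableau \<Rightarrow> bool" where
  "standard D T \<longleftrightarrow> dom T = D \<and> bij_betw (the \<circ> T) D {1..card D} \<and>
     (\<forall>i j j'. (i, j) \<in> D \<and> (i, j') \<in> D \<and> j < j' \<longrightarrow> the (T (i, j)) < the (T (i, j'))) \<and>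
     (\<forall>i i' j. (i, j) \<in> D \<and> (i', j) \<in> D \<and> i < i' \<longrightarrow> the (T (i, j)) < the (T (i', j)))"

definition semistandard :: "box set \<Rightarrow> tableau \<Rightarrow> bool" where
  "semistandard D T \<longleftrightarrow> dom T = D \<and>
     (\<forall>i j j'. (i, j) \<in> D \<and> (i, j') \<in> D \<and> j < j' \<longrightarrow> the (T (i, j)) \<le> the (T (i, j'))) \<and>
     (\<forall>i i' j. (i, j) \<in> D \<and> (i', j) \<in> D \<and> i < i' \<longrightarrow> the (T (i, j)) < the (T (i', j)))"

text \<open>\<open>schur v \<alpha>\<close> is the Schur function \<open>s_\<alpha>\<close> in the variables \<open>v 0, v 1, \<dots>\<close>.\<close>

definition schur :: "(nat \<Rightarrow> 'v) \<Rightarrow> nat list \<Rightarrow> 'v mseries" where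
  "schur v \<alpha> = Abs_mseries (\<lambda>m. int (card {T. semistandard (diagram \<alpha>) T \<and>
     image_mset (\<lambda>b. v (the (T b))) (mset_set (diagram \<alpha>)) = m}))"

definition schur2 :: "nat list \<Rightarrow> nat list \<Rightarrow> (nat + nat) mseries" where
  "schur2 \<alpha>\<^sub>1 \<alpha>\<^sub>2 = schur Inl \<alpha>\<^sub>1 * schur Inr \<alpha>\<^sub>2"

definition vertical_strip :: "nat list \<Rightarrow> nat list \<Rightarrow> nat \<Rightarrow> bool" where
  "vertical_strip \<mu> \<nu> q \<longleftrightarrow> diagram \<nu> \<subseteq> diagram \<mu> \<and> card (skew \<mu> \<nu>) = q \<and>
     (\<forall>i j j'. (i, j) \<in> skew \<mu> \<nu> \<and> (i, j') \<in> skew \<mu> \<nu> \<longrightarrow> j = j')"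

text \<open>For a vertical strip \<open>D\<close>, \<open>strip_tableau D\<close> labels the boxes from top to bottom.\<close>

definition strip_tableau :: "box set \<Rightarrow> tableau" where
  "strip_tableau D = (\<lambda>b. if b \<in> D then Some (card {b' \<in> D. fst b' \<le> fst b}) else None)"

definition rl :: "box set \<Rightarrow> tableau" where
  "rl D = (\<lambda>b. if b \<in> D
     then Some (card {b' \<in> D. fst b' < fst b \<or> fst b' = fst b \<and> snd b \<le> snd b'})
     else None)"

text \<open>\<open>RW G D\<close> is the set of tableaux of skew shape \<open>G = \<gamma>/\<delta>\<close> with respect to \<open>D = \<alpha>/\<beta>\<close>; the
  two shapes must have the same number of boxes.\<close>

definition RW :: "box set \<Rightarrow> box set \<Rightarrow> tableau set" where
  "RW G D = {T. standard G T \<and> card G = card D \<and>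
     (\<forall>i. 1 \<le> i \<and> i + 1 \<le> card D \<and> row_of (rl D) i = row_of (rl D) (i + 1) \<longrightarrow>
        col_of T i < col_of T (i + 1) \<and> row_of T (i + 1) \<le> row_of T i) \<and>
     (\<forall>i\<in>{1..card D}. \<forall>j\<in>{1..card D}.
        row_of (rl D) j = row_of (rl D) i + 1 \<and> col_of (rl D) j = col_of (rl D) i \<longrightarrow>
        row_of T i < row_of T j \<and> col_of T j \<le> col_of T i)}"

section \<open>The quiver, the row rules, and the basis\<close>

definition arrow :: "nat list \<Rightarrow> nat list \<Rightarrow> nat list \<Rightarrow> nat list \<Rightarrow> tableau \<Rightarrow> bool" where
  "arrow \<alpha>\<^sub>1 \<alpha>\<^sub>2 \<beta>\<^sub>1 \<beta>\<^sub>2 T \<longleftrightarrow>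
     is_partition \<alpha>\<^sub>1 \<and> is_partition \<alpha>\<^sub>2 \<and> is_partition \<beta>\<^sub>1 \<and> is_partition \<beta>\<^sub>2 \<and>
     diagram \<alpha>\<^sub>1 \<subseteq> diagram \<beta>\<^sub>1 \<and> diagram \<beta>\<^sub>2 \<subseteq> diagram \<alpha>\<^sub>2 \<and>
     (\<alpha>\<^sub>1, \<alpha>\<^sub>2) \<noteq> (\<beta>\<^sub>1, \<beta>\<^sub>2) \<and> T \<in> RW (skew \<beta>\<^sub>1 \<alpha>\<^sub>1) (skew \<alpha>\<^sub>2 \<beta>\<^sub>2)"

definition row_rule_filling :: "int \<Rightarrow> box \<Rightarrow> int" where
  "row_rule_filling r b = r + int (fst b) - int (snd b)"

definition row_rule_entry :: "int \<Rightarrow> box set \<Rightarrow> nat \<Rightarrow> int" where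
  "row_rule_entry r D i = row_rule_filling r (box_of (rl D) i)"

text \<open>In both rules \<open>D\<close> stands for \<open>\<alpha>\<^sub>2/\<beta>\<^sub>2\<close>.\<close>

definition row_rule :: "int \<Rightarrow> box set \<Rightarrow> tableau \<Rightarrow> bool" where
  "row_rule r D T \<longleftrightarrow> (\<forall>i\<in>{1..card D}. row_rule_entry r D i \<le> int (row_of T i))"

definition reverse_row_rule :: "int \<Rightarrow> box set \<Rightarrow> tableau \<Rightarrow> bool" where
  "reverse_row_rule r D T \<longleftrightarrow> (\<forall>i\<in>{1..card D}. row_rule_entry r D i > int (row_of T i))"

lemma finite_diagram [simp]: "finite (diagram \<alpha>)"
proof (rule finite_subset)
  show "diagram \<alpha> \<subseteq> {..length \<alpha>} \<times> {..Max (set \<alpha>)}"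
    by (auto simp: diagram_def intro!: order_trans [OF _ Max_ge])
qed simp

lemma diagram_le_imp_nth_le:
  assumes "diagram \<alpha> \<subseteq> diagram \<beta>" "is_partition \<alpha>" "i < length \<alpha>"
  shows "i < length \<beta> \<and> \<alpha> ! i \<le> \<beta> ! i"
proof -
  have "\<alpha> ! i > 0" using assms(2,3) by (metis gr0I nth_mem is_partition_def)
  then have "(i + 1, \<alpha> ! i) \<in> diagram \<alpha>" using assms(3) by (simp add: diagram_def)
  then have "(i + 1, \<alpha> ! i) \<in> diagram \<beta>" using assms(1) by blast
  then show ?thesis by (simp add: diagram_def)
qed

lemma diagram_inject:
  assumes "diagram \<alpha> = diagram \<beta>" "is_partition \<alpha>" "is_partition \<beta>"
  shows "\<alpha> = \<beta>"
proof -
  have 1: "i < length \<beta> \<and> \<alpha> ! i \<le> \<beta> ! i" if "i < length \<alpha>" for i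
    using diagram_le_imp_nth_le [of \<alpha> \<beta>] assms that by blast
  have 2: "i < length \<alpha> \<and> \<beta> ! i \<le> \<alpha> ! i" if "i < length \<beta>" for i
    using diagram_le_imp_nth_le [of \<beta> \<alpha>] assms that by blast
  have "length \<alpha> = length \<beta>" using 1 2 by (meson linorder_neqE_nat less_irrefl)
  then show ?thesis using 1 2 by (intro nth_equalityI) (auto intro: antisym)
qed

lemma arrow_card_less:
  assumes "arrow \<alpha>\<^sub>1 \<alpha>\<^sub>2 \<beta>\<^sub>1 \<beta>\<^sub>2 T"
  shows "card (diagram \<beta>\<^sub>2) < card (diagram \<alpha>\<^sub>2)"
proof (rule psubset_card_mono)
  show "diagram \<beta>\<^sub>2 \<subset> diagram \<alpha>\<^sub>2"
  proof (rule ccontr)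
    assume "\<not> diagram \<beta>\<^sub>2 \<subset> diagram \<alpha>\<^sub>2"
    with assms have eq2: "diagram \<beta>\<^sub>2 = diagram \<alpha>\<^sub>2" by (auto simp: arrow_def)
    then have "card (skew \<beta>\<^sub>1 \<alpha>\<^sub>1) = 0"
      using assms by (auto simp: arrow_def RW_def skew_def)
    then have "diagram \<beta>\<^sub>1 = diagram \<alpha>\<^sub>1"
      using assms by (auto simp: arrow_def skew_def)
    with eq2 show False using assms diagram_inject by (auto simp: arrow_def)
  qed
qed simp

function tau :: "int \<Rightarrow> nat list \<Rightarrow> nat list \<Rightarrow> (nat + nat) mseries" where
  "tau r \<alpha>\<^sub>1 \<alpha>\<^sub>2 = schur2 \<alpha>\<^sub>1 \<alpha>\<^sub>2 -
     (\<Sum>(\<beta>\<^sub>1, \<beta>\<^sub>2, T) \<in> {(\<beta>\<^sub>1, \<beta>\<^sub>2, T). arrow \<alpha>\<^sub>1 \<alpha>\<^sub>2 \<beta>\<^sub>1 \<beta>\<^sub>2 T \<and> row_rule r (skew \<alpha>\<^sub>2 \<beta>\<^sub>2) T}.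
        tau r \<beta>\<^sub>1 \<beta>\<^sub>2)"
  by pat_completeness auto
termination
  by (relation "measure (\<lambda>(r, \<alpha>\<^sub>1, \<alpha>\<^sub>2). card (diagram \<alpha>\<^sub>2))") (auto intro: arrow_card_less)

declare tau.simps [simp del]

section \<open>Jeu de taquin and infusion\<close>

text \<open>The hole moves towards the smaller of the entries to its right and below it, as long as
  there is one.\<close>

fun slide_cond :: "tableau \<times> box \<Rightarrow> bool" where
  "slide_cond (T, (i, j)) \<longleftrightarrow> T (i, j + 1) \<noteq> None \<or> T (i + 1, j) \<noteq> None"

fun slide_step :: "tableau \<times> box \<Rightarrow> tableau \<times> box" where
  "slide_step (T, (i, j)) =
     (let b = (case (T (i, j + 1), T (i + 1, j)) of
                 (Some x, Some y) \<Rightarrow> if x < y then (i, j + 1) else (i + 1, j)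
               | (Some x, None) \<Rightarrow> (i, j + 1)
               | (None, _) \<Rightarrow> (i + 1, j))
      in (T((i, j) := T b, b := None), b))"

definition jdt_slide :: "box \<Rightarrow> tableau \<Rightarrow> tableau" where
  "jdt_slide b T = fst (while slide_cond slide_step (T, b))"

definition Slide :: "tableau \<Rightarrow> tableau \<Rightarrow> tableau" where
  "Slide T\<^sub>1 T\<^sub>2 = fold (\<lambda>k. jdt_slide (box_of T\<^sub>1 k)) (rev [1..<card (dom T\<^sub>1) + 1]) T\<^sub>2"

text \<open>The loop in \<open>jdt_slide\<close> terminates on every finite tableau.\<close>

lemma slide_terminates:
  assumes "finite (dom T)"
  shows "\<exists>s. while_option slide_cond slide_step (T, b) = Some s"
proof (rule measure_while_option_Some
    [where P = "\<lambda>(T, b). finite (dom T)"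
      and f = "\<lambda>(T, b). card {c \<in> dom T. fst b + snd b < fst c + snd c}", THEN exE])
  fix s assume P: "(\<lambda>(T, b). finite (dom T)) s" and c: "slide_cond s"
  obtain T i j where s: "s = (T, (i, j))" by (metis surj_pair)
  define b where "b = (case (T (i, j + 1), T (i + 1, j)) of
                 (Some x, Some y) \<Rightarrow> if x < y then (i, j + 1) else (i + 1, j)
               | (Some x, None) \<Rightarrow> (i, j + 1)
               | (None, _) \<Rightarrow> (i + 1, j))"
  have b: "fst b + snd b = i + j + 1" "b \<in> dom T"
    using c by (auto simp: b_def s split: option.splits)
  have step: "slide_step s = (T((i, j) := T b, b := None), b)"
    by (simp add: s b_def Let_def)
  have fin: "finite (dom T)" using P s by simp
  have sub: "dom (T((i, j) := T b, b := None)) \<subseteq> insert (i, j) (dom T)" by auto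
  have "{c \<in> dom (T((i, j) := T b, b := None)). fst b + snd b < fst c + snd c}
      \<subset> {c \<in> dom T. i + j < fst c + snd c}"
    using sub b by (fastforce simp: psubset_eq)
  then have "card {c \<in> dom (T((i, j) := T b, b := None)). fst b + snd b < fst c + snd c}
      < card {c \<in> dom T. i + j < fst c + snd c}"
    using fin by (intro psubset_card_mono) auto
  moreover have "finite (dom (T((i, j) := T b, b := None)))"
    using sub fin finite_subset by blast
  ultimately show "(\<lambda>(T, b). finite (dom T)) (slide_step s) \<and>
      (\<lambda>(T, b). card {c \<in> dom T. fst b + snd b < fst c + snd c}) (slide_step s)
      < (\<lambda>(T, b). card {c \<in> dom T. fst b + snd b < fst c + snd c}) s"
    unfolding step unfolding s prod.case fst_conv snd_conv by blast
qed (use assms in auto)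

end

(* Rewrite a Remmel-Whitney tableau T as the filling of alpha_2/beta_2 whose entry at the box labelled i
   is the row of i in T: it is semistandard, its reading word adds boxes to alpha_1 through
   partitions, and the row rule bounds its entries from below. The entries attaining that bound for r
   form a vertical strip on the inner boundary, and removing them leaves a filling obeying the
   rule for r + 1. Hence tau^(r+1) is a sum of tau^r over a step N^r that removes the last boxes of some
   rows of alpha_2 and adds to alpha_1 a box in each of the rows named by the row rule filling there.

   On the right-hand side at most one lambda leads to a given (gamma_1, gamma_2). It exists iff
   gamma_1/beta_1 is a vertical strip containing all the rows named by the row rule filling at the boxes
   of beta_2/gamma_2, none of which is shorter in beta_1 than the row above it. This
   describes a multiplicity-free step C^r with C^(r+1) N^r = N^r C^r: both composites add to alpha_1 the
   rows named at the removed boxes together with arbitrary further rows, as long as the result is a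
   partition. For large r one has tau^r = s and the claim is the Pieri rule; downward induction on r,
   with an inner induction on |beta_2|, gives the rest. *)

theory Submission
  imports Defs "HOL-Library.FuncSet"
begin

section \<open>Row lengths and vertical strips\<close>

text \<open>Solving the recursion of \<open>tau\<close> for \<open>schur2\<close>, which does not
  involve r, gives the sum of tau^r over all fillings obeying the r-th rule, the empty filling
  standing for the pair itself. Equating the sums for r and r + 1 and cancelling smaller second
  partitions yields tau^(r+1) = N^r tau^r. No change of basis is inverted: N^r is unitriangular in
  the size of the second partition, so once the commutation (steps performed from left to right) has
  turned the claim for r + 1 into the sum over N^r of the claims for r, all terms but one cancel by
  induction. The obstacle on the right-hand side is \<open>Slide\<close>, which depends on a whole
  tableau, while C^r sees only sets of rows. Sliding a vertical strip into a vertical strip moves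
  boxes left, or up within blocks of rows of equal length in beta_1, so the number of boxes down to
  the end of each block is kept. Both rules therefore become inequalities between counting
  functions, and the one for the slid tableau needs checking only at ends of blocks, where the
  tableau before sliding has the same counts.\<close>

definition prow :: "nat list \<Rightarrow> nat \<Rightarrow> nat" where
  "prow \<alpha> i = (if 1 \<le> i \<and> i \<le> length \<alpha> then \<alpha> ! (i - 1) else 0)"

text \<open>Row lengths extended by zero past the end reduce containment, equality and vertical
  strips to pointwise conditions on the rows i \<ge> 1.\<close>

lemma diagram_prow: "diagram \<alpha> = {(i, j). 1 \<le> i \<and> 1 \<le> j \<and> j \<le> prow \<alpha> i}"
  by (auto simp: diagram_def prow_def split: if_splits)

lemma prow_antimono:
  assumes "is_partition \<alpha>" "1 \<le> i" "i \<le> j"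
  shows "prow \<alpha> j \<le> prow \<alpha> i"
proof (cases "j \<le> length \<alpha> \<and> i \<noteq> j")
  case True
  then have "i - 1 < j - 1" "j - 1 < length \<alpha>" using assms by auto
  then have "\<alpha> ! (j - 1) \<le> \<alpha> ! (i - 1)"
    using assms(1) unfolding is_partition_def sorted_wrt_iff_nth_less by blast
  then show ?thesis using assms True by (auto simp: prow_def)
qed (use assms in \<open>auto simp: prow_def\<close>)

lemma prow_Suc_le: "is_partition \<alpha> \<Longrightarrow> 1 \<le> i \<Longrightarrow> prow \<alpha> (Suc i) \<le> prow \<alpha> i"
  by (rule prow_antimono) auto

lemma diagram_subset_iff:
  "diagram \<alpha> \<subseteq> diagram \<beta> \<longleftrightarrow> (\<forall>i\<ge>1. prow \<alpha> i \<le> prow \<beta> i)"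
proof
  assume s: "diagram \<alpha> \<subseteq> diagram \<beta>"
  show "\<forall>i\<ge>1. prow \<alpha> i \<le> prow \<beta> i"
  proof (intro allI impI)
    fix i :: nat assume i: "i \<ge> 1"
    show "prow \<alpha> i \<le> prow \<beta> i"
    proof (cases "prow \<alpha> i = 0")
      case False
      then have "(i, prow \<alpha> i) \<in> diagram \<alpha>" using i by (auto simp: diagram_prow)
      then have "(i, prow \<alpha> i) \<in> diagram \<beta>" using s by blast
      then show ?thesis by (auto simp: diagram_prow)
    qed simp
  qed
qed (auto simp: diagram_prow intro: order_trans)

lemma prow_eqI:
  assumes "is_partition \<alpha>" "is_partition \<beta>" "\<And>i. 1 \<le> i \<Longrightarrow> prow \<alpha> i = prow \<beta> i"
  shows "\<alpha> = \<beta>"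
proof (rule diagram_inject)
  show "diagram \<alpha> = diagram \<beta>"
    using assms(3) by (auto simp: diagram_prow)
qed (use assms in auto)

lemma prow_beyond: "length \<alpha> < i \<Longrightarrow> prow \<alpha> i = 0"
  by (simp add: prow_def)

text \<open>One zero suffices: being weakly decreasing from 1 on, \<open>f\<close> vanishes from its
  first zero onwards, and the positive values before it form the list.\<close>

lemma partition_of_fun:
  fixes f :: "nat \<Rightarrow> nat"
  assumes "\<And>i. 1 \<le> i \<Longrightarrow> f (Suc i) \<le> f i" "f (Suc N) = 0"
  shows "\<exists>\<alpha>. is_partition \<alpha> \<and> (\<forall>i\<ge>1. prow \<alpha> i = f i)"
proof -
  define n where "n = (LEAST n. f (Suc n) = 0)"
  have n0: "f (Suc n) = 0" unfolding n_def using assms(2) by (rule LeastI)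
  have npos: "f (Suc k) > 0" if "k < n" for k
    using not_less_Least[of k "\<lambda>n. f (Suc n) = 0"] that by (auto simp: n_def)
  have anti: "f (Suc j) \<le> f (Suc i)" if "i \<le> j" for i j
    using that
  proof (induction j rule: dec_induct)
    case (step n)
    then show ?case using assms(1)[of "Suc n"] by simp
  qed simp
  define \<alpha> where "\<alpha> = map (\<lambda>i. f (Suc i)) [0..<n]"
  have "is_partition \<alpha>"
    unfolding is_partition_def sorted_wrt_iff_nth_less \<alpha>_def
    using anti by (auto dest: npos) (metis npos less_numeral_extra(3)) 
  moreover have "prow \<alpha> i = f i" if "i \<ge> 1" for i
  proof (cases "i \<le> n")
    case True
    then show ?thesis using that by (auto simp: prow_def \<alpha>_def)
  next
    case False
    then have "f i \<le> f (Suc n)" using anti[of n "i - 1"] that by auto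
    then show ?thesis using that False n0 by (auto simp: prow_def \<alpha>_def)
  qed
  ultimately show ?thesis by blast
qed

lemma card_diagram_sum:
  assumes "length \<alpha> \<le> n"
  shows "card (diagram \<alpha>) = (\<Sum>i = 1..n. prow \<alpha> i)"
proof -
  have "diagram \<alpha> = (SIGMA i:{1..n}. {1..prow \<alpha> i})"
    using assms by (auto simp: diagram_prow prow_def split: if_splits)
  then show ?thesis by simp
qed

lemma length_le_card_diagram: "is_partition \<alpha> \<Longrightarrow> length \<alpha> \<le> card (diagram \<alpha>)"
proof -
  assume p: "is_partition \<alpha>"
  have "(\<lambda>i. (i, 1)) ` {1..length \<alpha>} \<subseteq> diagram \<alpha>"
  proof -
    have "\<alpha> ! (i - 1) \<ge> 1" if "1 \<le> i" "i \<le> length \<alpha>" for i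
    proof -
      have "\<alpha> ! (i - 1) \<in> set \<alpha>" using that by auto
      then show ?thesis using p unfolding is_partition_def by (metis not_one_le_zero le_zero_eq linorder_not_le less_one)
    qed
    then show ?thesis by (auto simp: diagram_def)
  qed
  then have "card ((\<lambda>i. (i, 1::nat)) ` {1..length \<alpha>}) \<le> card (diagram \<alpha>)"
    by (intro card_mono) auto
  then show ?thesis by (simp add: card_image inj_on_def)
qed

lemma finite_partitions: "finite {\<alpha>. is_partition \<alpha> \<and> card (diagram \<alpha>) \<le> n}"
proof (rule finite_subset)
  show "{\<alpha>. is_partition \<alpha> \<and> card (diagram \<alpha>) \<le> n} \<subseteq> {\<alpha>. set \<alpha> \<subseteq> {..n} \<and> length \<alpha> \<le> n}"
  proof clarify
    fix \<alpha> assume a: "is_partition \<alpha>" "card (diagram \<alpha>) \<le> n"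
    have len: "length \<alpha> \<le> n" using length_le_card_diagram a by fastforce
    have "x \<le> n" if x: "x \<in> set \<alpha>" for x
    proof -
      obtain k where k: "k < length \<alpha>" "x = \<alpha> ! k" using x by (metis in_set_conv_nth)
      then have "x = prow \<alpha> (Suc k)" by (auto simp: prow_def)
      also have "\<dots> \<le> (\<Sum>i = 1..n. prow \<alpha> i)"
        by (rule member_le_sum) (use k len in auto)
      also have "\<dots> = card (diagram \<alpha>)" using card_diagram_sum[OF len] by simp
      finally show ?thesis using a by simp
    qed
    then show "set \<alpha> \<subseteq> {..n} \<and> length \<alpha> \<le> n" using len by auto
  qed
  show "finite {\<alpha>. set \<alpha> \<subseteq> {..n} \<and> length \<alpha> \<le> n}"
    by (rule finite_lists_length_le) simp
qed

text \<open>Vertical strips are encoded by the set of rows that receive a box. Given this set, each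
  of the two partitions determines the other, and the partitions determine the set, so most of what
  follows is a calculation with sets of rows.\<close>

definition add_strip :: "nat list \<Rightarrow> nat set \<Rightarrow> nat list \<Rightarrow> bool" where
  "add_strip \<alpha> G \<gamma> \<longleftrightarrow> is_partition \<alpha> \<and> is_partition \<gamma> \<and> finite G \<and> G \<subseteq> {1..} \<and>
     (\<forall>i\<ge>1. prow \<gamma> i = prow \<alpha> i + of_bool (i \<in> G))"

lemma add_stripD:
  assumes "add_strip \<alpha> G \<gamma>"
  shows "is_partition \<alpha>" "is_partition \<gamma>" "finite G" "G \<subseteq> {1..}"
    "\<And>i. i \<ge> 1 \<Longrightarrow> prow \<gamma> i = prow \<alpha> i + of_bool (i \<in> G)"
  using assms by (auto simp: add_strip_def)

lemma add_strip_set_unique: "add_strip \<alpha> G \<gamma> \<Longrightarrow> add_strip \<alpha> G' \<gamma> \<Longrightarrow> G = G'"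
proof (rule set_eqI)
  fix i assume a: "add_strip \<alpha> G \<gamma>" "add_strip \<alpha> G' \<gamma>"
  show "i \<in> G \<longleftrightarrow> i \<in> G'"
  proof (cases "i \<ge> 1")
    case True
    then have "prow \<alpha> i + of_bool (i \<in> G) = prow \<alpha> i + (of_bool (i \<in> G') :: nat)"
      using a add_stripD(5) by metis
    then show ?thesis by (auto simp: of_bool_def split: if_splits)
  next
    case False
    then show ?thesis using a add_stripD(4) by fastforce
  qed
qed

lemma add_strip_upper_unique: "add_strip \<alpha> G \<gamma> \<Longrightarrow> add_strip \<alpha> G \<gamma>' \<Longrightarrow> \<gamma> = \<gamma>'"
  by (rule prow_eqI) (auto simp: add_strip_def)

lemma add_strip_lower_unique: "add_strip \<alpha> G \<gamma> \<Longrightarrow> add_strip \<alpha>' G \<gamma> \<Longrightarrow> \<alpha> = \<alpha>'"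
  by (rule prow_eqI) (auto simp: add_strip_def)

lemma add_strip_empty_iff: "add_strip \<alpha> {} \<gamma> \<longleftrightarrow> is_partition \<alpha> \<and> \<gamma> = \<alpha>"
  by (auto simp: add_strip_def intro: prow_eqI)

lemma add_strip_skew:
  assumes "add_strip \<alpha> G \<gamma>"
  shows "skew \<gamma> \<alpha> = (\<lambda>i. (i, Suc (prow \<alpha> i))) ` G"
proof -
  have iff: "(1 \<le> i \<and> 1 \<le> j \<and> j \<le> prow \<gamma> i \<and> \<not> j \<le> prow \<alpha> i) \<longleftrightarrow> i \<in> G \<and> j = Suc (prow \<alpha> i)" for i j
    using add_stripD(4)[OF assms] add_stripD(5)[OF assms, of i]
    by (cases "1 \<le> i"; cases "i \<in> G") (auto simp: of_bool_def)
  show ?thesis unfolding skew_def diagram_prow using iff by auto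
qed

lemma add_strip_diagram_subset: "add_strip \<alpha> G \<gamma> \<Longrightarrow> diagram \<alpha> \<subseteq> diagram \<gamma>"
  unfolding diagram_subset_iff using add_stripD(5) by fastforce

lemma add_strip_card_skew: "add_strip \<alpha> G \<gamma> \<Longrightarrow> card (skew \<gamma> \<alpha>) = card G"
  by (simp add: add_strip_skew card_image inj_on_def)

lemma card_diagram_skew:
  assumes "diagram \<alpha> \<subseteq> diagram \<gamma>"
  shows "card (diagram \<gamma>) = card (diagram \<alpha>) + card (skew \<gamma> \<alpha>)"
proof -
  have "card (diagram \<alpha>) \<le> card (diagram \<gamma>)"
    using assms by (intro card_mono) auto
  then show ?thesis unfolding skew_def using assms by (simp add: card_Diff_subset)
qed

lemma add_strip_card: "add_strip \<alpha> G \<gamma> \<Longrightarrow> card (diagram \<gamma>) = card (diagram \<alpha>) + card G"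
  using card_diagram_skew add_strip_diagram_subset add_strip_card_skew by metis

lemma vertical_strip_iff:
  assumes "is_partition \<mu>" "is_partition \<nu>"
  shows "vertical_strip \<mu> \<nu> q \<longleftrightarrow> (\<exists>G. add_strip \<nu> G \<mu> \<and> card G = q)"
proof
  assume v: "vertical_strip \<mu> \<nu> q"
  have sub: "prow \<nu> i \<le> prow \<mu> i" if "i \<ge> 1" for i
    using v that by (auto simp: vertical_strip_def diagram_subset_iff)
  have le: "prow \<mu> i \<le> Suc (prow \<nu> i)" if "i \<ge> 1" for i
  proof (rule ccontr)
    assume "\<not> ?thesis"
    then have "(i, Suc (prow \<nu> i)) \<in> skew \<mu> \<nu>" "(i, Suc (Suc (prow \<nu> i))) \<in> skew \<mu> \<nu>"
      using that by (auto simp: skew_def diagram_prow)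
    then show False using v unfolding vertical_strip_def by (metis n_not_Suc_n)
  qed
  define G where "G = {i. 1 \<le> i \<and> prow \<mu> i \<noteq> prow \<nu> i}"
  have "G \<subseteq> {1..max (length \<mu>) (length \<nu>)}" by (auto simp: G_def prow_def split: if_splits)
  then have "finite G" by (rule finite_subset) simp
  moreover have "prow \<mu> i = prow \<nu> i + of_bool (i \<in> G)" if "i \<ge> 1" for i
    using sub[OF that] le[OF that] that by (auto simp: G_def)
  ultimately have a: "add_strip \<nu> G \<mu>" using assms by (auto simp: add_strip_def G_def)
  moreover have "card G = q"
    using add_strip_card_skew[OF a] v by (simp add: vertical_strip_def)
  ultimately show "\<exists>G. add_strip \<nu> G \<mu> \<and> card G = q" by blast
next
  assume "\<exists>G. add_strip \<nu> G \<mu> \<and> card G = q"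
  then obtain G where "add_strip \<nu> G \<mu>" "card G = q" by blast
  then show "vertical_strip \<mu> \<nu> q"
    unfolding vertical_strip_def
    using add_strip_diagram_subset add_strip_card_skew add_strip_skew by auto
qed

text \<open>Weak decrease can fail only between two rows of equal length of which just the lower one
  receives a box.\<close>

lemma add_strip_exists_upper:
  assumes "is_partition \<alpha>" "finite G" "G \<subseteq> {1..}"
    and "\<And>i. 1 \<le> i \<Longrightarrow> Suc i \<in> G \<Longrightarrow> prow \<alpha> (Suc i) = prow \<alpha> i \<Longrightarrow> i \<in> G"
  shows "\<exists>\<gamma>. add_strip \<alpha> G \<gamma>"
proof -
  obtain M where M: "\<And>x. x \<in> G \<Longrightarrow> x \<le> M" using assms(2) finite_nat_set_iff_bounded_le by auto
  have "\<exists>\<gamma>. is_partition \<gamma> \<and> (\<forall>i\<ge>1. prow \<gamma> i = prow \<alpha> i + of_bool (i \<in> G))"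
  proof (rule partition_of_fun)
    fix i :: nat assume "1 \<le> i"
    then show "prow \<alpha> (Suc i) + of_bool (Suc i \<in> G) \<le> prow \<alpha> i + of_bool (i \<in> G)"
      using assms(4)[of i] prow_Suc_le[OF assms(1), of i] by (auto simp: le_less)
  next
    show "prow \<alpha> (Suc (length \<alpha> + M)) + of_bool (Suc (length \<alpha> + M) \<in> G) = 0"
      using M by (force simp: prow_def)
  qed
  then show ?thesis using assms by (auto simp: add_strip_def)
qed

text \<open>Weak decrease can fail only between two rows of equal length of which just the upper one
  loses its last box.\<close>

lemma add_strip_exists_lower:
  assumes "is_partition \<gamma>" "finite G" "G \<subseteq> {1..}" "\<And>i. i \<in> G \<Longrightarrow> 1 \<le> prow \<gamma> i"
    and "\<And>i. 1 \<le> i \<Longrightarrow> i \<in> G \<Longrightarrow> prow \<gamma> (Suc i) = prow \<gamma> i \<Longrightarrow> Suc i \<in> G"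
  shows "\<exists>\<alpha>. add_strip \<alpha> G \<gamma>"
proof -
  have "\<exists>\<alpha>. is_partition \<alpha> \<and> (\<forall>i\<ge>1. prow \<alpha> i = prow \<gamma> i - of_bool (i \<in> G))"
  proof (rule partition_of_fun)
    fix i :: nat assume "1 \<le> i"
    then show "prow \<gamma> (Suc i) - of_bool (Suc i \<in> G) \<le> prow \<gamma> i - of_bool (i \<in> G)"
      using assms(5)[of i] prow_Suc_le[OF assms(1), of i] by (auto simp: le_less)
  next
    show "prow \<gamma> (Suc (length \<gamma>)) - of_bool (Suc (length \<gamma>) \<in> G) = 0"
      by (simp add: prow_def)
  qed
  then obtain \<alpha> where \<alpha>: "is_partition \<alpha>" "\<forall>i\<ge>1. prow \<alpha> i = prow \<gamma> i - of_bool (i \<in> G)"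
    by blast
  have "prow \<gamma> i = prow \<alpha> i + of_bool (i \<in> G)" if "i \<ge> 1" for i
    using assms(4)[of i] \<alpha>(2) that by auto
  then have "add_strip \<alpha> G \<gamma>" using assms \<alpha> unfolding add_strip_def by blast
  then show ?thesis by blast
qed

text \<open>In a block of rows of equal length a vertical strip fills an initial segment, as a lower
  row must not overtake an upper one. Most order arguments below come down to this.\<close>

lemma add_strip_top:
  assumes "add_strip \<alpha> G \<gamma>" "x \<le> y" "1 \<le> x" "y \<in> G" "prow \<alpha> x = prow \<alpha> y"
  shows "x \<in> G"
proof -
  have "prow \<gamma> y \<le> prow \<gamma> x" using assms add_stripD(2) prow_antimono by blast
  then show ?thesis using add_stripD(5)[OF assms(1), of x] add_stripD(5)[OF assms(1), of y] assms by (auto simp: of_bool_def split: if_splits)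
qed

lemma prow_const_between:
  assumes "is_partition \<alpha>" "1 \<le> x" "x \<le> z" "z \<le> y" "prow \<alpha> x = prow \<alpha> y"
  shows "prow \<alpha> z = prow \<alpha> x"
  using prow_antimono[OF assms(1), of x z] prow_antimono[OF assms(1), of z y] assms by auto

section \<open>The Pieri rule for single columns\<close>

definition mmonom :: "'v multiset \<Rightarrow> 'v mseries" where
  "mmonom M = Abs_mseries (\<lambda>m. of_bool (m = M))"

lemma mcoeff_mmonom_mult:
  "mcoeff (mmonom M * f) m = (if M \<subseteq># m then mcoeff f (m - M) else 0)"
proof -
  have e: "mcoeff (mmonom M * f) m = (\<Sum>(a, b) \<in> {(a, b). a + b = m}. of_bool (a = M) * mcoeff f b)"
    by (simp add: mcoeff_simps mmonom_def)
  show ?thesis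
  proof (cases "M \<subseteq># m")
    case True
    have "(\<Sum>(a, b) \<in> {(a, b). a + b = m}. of_bool (a = M) * mcoeff f b) =
      (\<Sum>(a, b) \<in> {(M, m - M)}. of_bool (a = M) * mcoeff f b)"
      by (rule sum.mono_neutral_right) (use True finite_msplit in auto)
    then show ?thesis using e True by simp
  next
    case False
    have "(\<Sum>(a, b) \<in> {(a, b). a + b = m}. of_bool (a = M) * mcoeff f b) = 0"
      by (rule sum.neutral) (use False in auto)
    then show ?thesis using e False by simp
  qed
qed

lemma mmonom_mult: "mmonom M * mmonom N = mmonom (M + N)"
proof (rule mseries_eqI)
  fix m
  show "mcoeff (mmonom M * mmonom N) m = mcoeff (mmonom (M + N)) m"
    unfolding mcoeff_mmonom_mult
    by (auto simp: mmonom_def subset_mset.le_iff_add of_bool_def)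
qed

lemma mmonom_empty: "mmonom {#} = 1"
  by (rule mseries_eqI) (simp add: mcoeff_simps mmonom_def)

lemma mcoeff_sum: "mcoeff (sum f A) m = (\<Sum>a\<in>A. mcoeff (f a) m)"
  by (induction A rule: infinite_finite_induct) (simp_all add: mcoeff_simps)

text \<open>Interlacing row lengths say that \<mu>/\<nu> is a horizontal strip, with at most one box
  per column.\<close>

definition hstrip :: "nat list \<Rightarrow> nat list \<Rightarrow> bool" where
  "hstrip \<nu> \<mu> \<longleftrightarrow> is_partition \<nu> \<and> is_partition \<mu> \<and>
     (\<forall>i\<ge>1. prow \<nu> i \<le> prow \<mu> i \<and> prow \<mu> (Suc i) \<le> prow \<nu> i)"

lemma hstrip_diagram: "hstrip \<nu> \<mu> \<Longrightarrow> diagram \<nu> \<subseteq> diagram \<mu>"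
  by (simp add: hstrip_def diagram_subset_iff)

lemma hstrip_card_le: "hstrip \<nu> \<mu> \<Longrightarrow> card (diagram \<nu>) \<le> card (diagram \<mu>)"
  by (intro card_mono hstrip_diagram) auto

lemma finite_hstrips: "finite {\<nu>. hstrip \<nu> \<mu>}"
  by (rule finite_subset[OF _ finite_partitions[of "card (diagram \<mu>)"]])
    (auto simp: hstrip_card_le, simp add: hstrip_def)

text \<open>Schur polynomials in the first \<open>n\<close> variables, by splitting off the boxes with the largest entry.\<close>

primrec schur_poly :: "(nat \<Rightarrow> 'v) \<Rightarrow> nat \<Rightarrow> nat list \<Rightarrow> 'v mseries" where
  "schur_poly v 0 \<alpha> = of_bool (\<alpha> = [])"
| "schur_poly v (Suc n) \<alpha> = (\<Sum>\<nu> \<in> {\<nu>. hstrip \<nu> \<alpha>}.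
     mmonom (replicate_mset (card (diagram \<alpha>) - card (diagram \<nu>)) (v n)) * schur_poly v n \<nu>)"

section \<open>Tableaux with bounded entries and the branching rule\<close>

definition content :: "(nat \<Rightarrow> 'v) \<Rightarrow> nat list \<Rightarrow> tableau \<Rightarrow> 'v multiset" where
  "content v \<alpha> T = image_mset (\<lambda>b. v (the (T b))) (mset_set (diagram \<alpha>))"

text \<open>Entries index the variables \<open>v 0\<close>, \<open>v 1\<close>, ..., so the bound
  \<open>n\<close> leaves exactly the first \<open>n\<close> variables, and with
  \<open>Suc n\<close> variables the largest admissible entry is \<open>n\<close>.\<close>

definition ssyts :: "(nat \<Rightarrow> 'v) \<Rightarrow> nat \<Rightarrow> nat list \<Rightarrow> 'v multiset \<Rightarrow> tableau set" where
  "ssyts v n \<alpha> m = {T. semistandard (diagram \<alpha>) T \<and> (\<forall>b\<in>diagram \<alpha>. the (T b) < n) \<and> content v \<alpha> T = m}"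

lemma diagram_Nil [simp]: "diagram [] = {}" by (auto simp: diagram_prow prow_def)

lemma finite_ssyts: "finite (ssyts v n \<alpha> m)"
proof (rule finite_subset)
  show "ssyts v n \<alpha> m \<subseteq> {T. dom T = diagram \<alpha> \<and> ran T \<subseteq> {..<n}}"
  proof
    fix T assume T: "T \<in> ssyts v n \<alpha> m"
    then have d: "dom T = diagram \<alpha>" by (simp add: ssyts_def semistandard_def)
    have "x < n" if "x \<in> ran T" for x
    proof -
      obtain b where b: "T b = Some x" using \<open>x \<in> ran T\<close> by (auto simp: ran_def)
      then have "b \<in> diagram \<alpha>" using d by auto
      then show ?thesis using T b by (fastforce simp: ssyts_def)
    qed
    then show "T \<in> {T. dom T = diagram \<alpha> \<and> ran T \<subseteq> {..<n}}" using d by auto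
  qed
  show "finite {T :: tableau. dom T = diagram \<alpha> \<and> ran T \<subseteq> {..<n}}"
    by (rule finite_set_of_finite_maps) auto
qed

definition extend :: "nat \<Rightarrow> nat list \<Rightarrow> nat list \<Rightarrow> tableau \<Rightarrow> tableau" where
  "extend n \<alpha> \<nu> T = (\<lambda>b. if b \<in> diagram \<nu> then T b else if b \<in> diagram \<alpha> then Some n else None)"

lemma content_extend:
  assumes "diagram \<nu> \<subseteq> diagram \<alpha>"
  shows "content v \<alpha> (extend n \<alpha> \<nu> T) =
    content v \<nu> T + replicate_mset (card (diagram \<alpha>) - card (diagram \<nu>)) (v n)"
proof -
  have "mset_set (diagram \<alpha>) = mset_set (diagram \<nu>) + mset_set (diagram \<alpha> - diagram \<nu>)"
    using assms by (subst mset_set_Union[symmetric]) (auto simp: Un_absorb1)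
  then have "content v \<alpha> (extend n \<alpha> \<nu> T) =
    image_mset (\<lambda>b. v (the (extend n \<alpha> \<nu> T b))) (mset_set (diagram \<nu>)) +
    image_mset (\<lambda>b. v (the (extend n \<alpha> \<nu> T b))) (mset_set (diagram \<alpha> - diagram \<nu>))"
    by (simp add: content_def)
  also have "image_mset (\<lambda>b. v (the (extend n \<alpha> \<nu> T b))) (mset_set (diagram \<nu>)) = content v \<nu> T"
    unfolding content_def by (rule image_mset_cong) (simp add: extend_def)
  also have "image_mset (\<lambda>b. v (the (extend n \<alpha> \<nu> T b))) (mset_set (diagram \<alpha> - diagram \<nu>)) =
    image_mset (\<lambda>b. v n) (mset_set (diagram \<alpha> - diagram \<nu>))"
    by (rule image_mset_cong) (auto simp: extend_def)
  also have "\<dots> = replicate_mset (card (diagram \<alpha>) - card (diagram \<nu>)) (v n)"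
    using assms by (simp add: image_mset_const_eq card_Diff_subset)
  finally show ?thesis .
qed

lemma semistandard_extend:
  assumes h: "hstrip \<nu> \<alpha>" and T: "semistandard (diagram \<nu>) T" and lt: "\<And>b. b \<in> diagram \<nu> \<Longrightarrow> the (T b) < n"
  shows "semistandard (diagram \<alpha>) (extend n \<alpha> \<nu> T)"
proof -
  have p: "is_partition \<nu>" "is_partition \<alpha>" using h by (auto simp: hstrip_def)
  have sub: "diagram \<nu> \<subseteq> diagram \<alpha>" by (rule hstrip_diagram[OF h])
  have dT: "dom T = diagram \<nu>" using T by (simp add: semistandard_def)
  have dm: "dom (extend n \<alpha> \<nu> T) = diagram \<alpha>"
    using sub dT by (auto simp: extend_def dom_def split: if_splits)
  show ?thesis
    unfolding semistandard_def
  proof (intro conjI allI impI dm)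
    fix i j j' assume a: "(i, j) \<in> diagram \<alpha> \<and> (i, j') \<in> diagram \<alpha> \<and> j < j'"
    show "the (extend n \<alpha> \<nu> T (i, j)) \<le> the (extend n \<alpha> \<nu> T (i, j'))"
    proof (cases "(i, j') \<in> diagram \<nu>")
      case True
      then have "(i, j) \<in> diagram \<nu>" using a by (auto simp: diagram_prow)
      then show ?thesis using True T a unfolding semistandard_def by (simp add: extend_def)
    next
      case False
      then show ?thesis using a lt[of "(i, j)"] by (auto simp: extend_def)
    qed
  next
    fix i i' j assume a: "(i, j) \<in> diagram \<alpha> \<and> (i', j) \<in> diagram \<alpha> \<and> i < i'"
    \<comment> \<open>Interlacing puts the upper one of two boxes in a column into \<nu>, so the new
      entry \<open>n\<close> never occurs twice in a column.\<close>
    have "prow \<alpha> i' \<le> prow \<alpha> (Suc i)" using a by (intro prow_antimono[OF p(2)]) auto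
    also have "\<dots> \<le> prow \<nu> i" using h a by (auto simp: hstrip_def diagram_prow)
    finally have ij: "(i, j) \<in> diagram \<nu>" using a by (auto simp: diagram_prow)
    show "the (extend n \<alpha> \<nu> T (i, j)) < the (extend n \<alpha> \<nu> T (i', j))"
    proof (cases "(i', j) \<in> diagram \<nu>")
      case True
      then show ?thesis using ij T a unfolding semistandard_def by (simp add: extend_def)
    next
      case False
      then show ?thesis using a ij lt[OF ij] by (simp add: extend_def)
    qed
  qed
qed

text \<open>Weak increase along rows makes the boxes with entry below \<open>n\<close> an initial
  segment of each row; strict increase down columns makes the lengths of these segments interlace
  with the rows of \<alpha>.\<close>

lemma semistandard_peel:
  assumes p: "is_partition \<alpha>" and T: "semistandard (diagram \<alpha>) T"
    and lt: "\<And>b. b \<in> diagram \<alpha> \<Longrightarrow> the (T b) < Suc n"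
  obtains \<nu> where "hstrip \<nu> \<alpha>" "diagram \<nu> = {b \<in> diagram \<alpha>. the (T b) < n}"
proof -
  define f where "f i = card {j \<in> {1..prow \<alpha> i}. the (T (i, j)) < n}" for i
  have row: "the (T (i, j)) \<le> the (T (i, j'))" if "(i, j) \<in> diagram \<alpha>" "(i, j') \<in> diagram \<alpha>" "j \<le> j'" for i j j'
  proof (cases "j = j'")
    case False
    then have "j < j'" using that by simp
    then show ?thesis using T that unfolding semistandard_def by blast
  qed simp
  have seg: "{j \<in> {1..prow \<alpha> i}. the (T (i, j)) < n} = {1..f i}" if i: "1 \<le> i" for i
  proof -
    define J where "J = {j \<in> {1..prow \<alpha> i}. the (T (i, j)) < n}"
    have fJ: "finite J" by (simp add: J_def)
    have J: "J = {1..Max (insert 0 J)}"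
    proof
      show "J \<subseteq> {1..Max (insert 0 J)}" using fJ by (auto simp: J_def)
      show "{1..Max (insert 0 J)} \<subseteq> J"
      proof
        fix j assume j: "j \<in> {1..Max (insert 0 J)}"
        define M where "M = Max (insert 0 J)"
        have "M \<in> insert 0 J" unfolding M_def by (rule Max_in) (use fJ in auto)
        then have m: "M \<in> J" and j: "1 \<le> j" "j \<le> M" using j by (auto simp: M_def)
        then have "the (T (i, j)) \<le> the (T (i, M))"
          using j i by (intro row) (auto simp: J_def diagram_prow)
        then have "the (T (i, j)) < n" using m unfolding J_def by simp
        moreover have "j \<le> prow \<alpha> i" using m j unfolding J_def by simp
        ultimately show "j \<in> J" using j by (simp add: J_def)
      qed
    qed
    moreover have "card J = Max (insert 0 J)" by (subst J) simp
    ultimately show ?thesis unfolding f_def J_def[symmetric] by simp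
  qed
  have fle: "f i \<le> prow \<alpha> i" for i
  proof -
    have "f i \<le> card {1..prow \<alpha> i}" unfolding f_def by (rule card_mono) auto
    then show ?thesis by simp
  qed
  have step: "prow \<alpha> (Suc i) \<le> f i" if i: "1 \<le> i" for i
  proof (cases "prow \<alpha> (Suc i) = 0")
    case False
    define j where "j = prow \<alpha> (Suc i)"
    have b: "(Suc i, j) \<in> diagram \<alpha>" "(i, j) \<in> diagram \<alpha>"
      using False i prow_Suc_le[OF p i] by (auto simp: diagram_prow j_def)
    have "the (T (i, j)) < the (T (Suc i, j))" using T b unfolding semistandard_def by blast
    then have "the (T (i, j)) < n" using lt[OF b(1)] by simp
    then have "j \<in> {1..f i}" unfolding seg[OF i, symmetric] using b(2) by (auto simp: diagram_prow)
    then show ?thesis by (simp add: j_def)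
  qed simp
  obtain \<nu> where nu: "is_partition \<nu>" "\<forall>i\<ge>1. prow \<nu> i = f i"
  proof -
    have "\<exists>\<nu>. is_partition \<nu> \<and> (\<forall>i\<ge>1. prow \<nu> i = f i)"
    proof (rule partition_of_fun)
      show "f (Suc i) \<le> f i" if "1 \<le> i" for i using fle[of "Suc i"] step[OF that] by simp
      show "f (Suc (length \<alpha>)) = 0" using fle[of "Suc (length \<alpha>)"] prow_beyond[of \<alpha> "Suc (length \<alpha>)"] by simp
    qed
    then show thesis using that by blast
  qed
  have "hstrip \<nu> \<alpha>" unfolding hstrip_def using nu p fle step by simp
  moreover have "diagram \<nu> = {b \<in> diagram \<alpha>. the (T b) < n}"
  proof (rule set_eqI)
    fix b :: box
    obtain i j where b: "b = (i, j)" by (cases b)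
    show "b \<in> diagram \<nu> \<longleftrightarrow> b \<in> {b \<in> diagram \<alpha>. the (T b) < n}"
    proof (cases "1 \<le> i")
      case True
      have "b \<in> diagram \<nu> \<longleftrightarrow> j \<in> {1..f i}" using True nu by (auto simp: b diagram_prow)
      also have "\<dots> \<longleftrightarrow> b \<in> {b \<in> diagram \<alpha>. the (T b) < n}"
        unfolding seg[OF True, symmetric] using True by (auto simp: b diagram_prow)
      finally show ?thesis .
    qed (auto simp: b diagram_prow)
  qed
  ultimately show thesis by (rule that)
qed

lemma ssyts_Suc:
  assumes p: "is_partition \<alpha>"
  shows "ssyts v (Suc n) \<alpha> m = (\<Union>\<nu>\<in>{\<nu>. hstrip \<nu> \<alpha>}. extend n \<alpha> \<nu> ` {T. semistandard (diagram \<nu>) T \<and>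
    (\<forall>b\<in>diagram \<nu>. the (T b) < n) \<and>
    content v \<nu> T + replicate_mset (card (diagram \<alpha>) - card (diagram \<nu>)) (v n) = m})" (is "_ = ?R")
proof
  show "?R \<subseteq> ssyts v (Suc n) \<alpha> m"
  proof
    fix T assume "T \<in> ?R"
    then obtain \<nu> T' where h: "hstrip \<nu> \<alpha>" and T: "T = extend n \<alpha> \<nu> T'"
      and T': "semistandard (diagram \<nu>) T'" "\<forall>b\<in>diagram \<nu>. the (T' b) < n"
        "content v \<nu> T' + replicate_mset (card (diagram \<alpha>) - card (diagram \<nu>)) (v n) = m" by blast
    have "the (T b) < Suc n" if "b \<in> diagram \<alpha>" for b
      using that T T'(2) by (auto simp: extend_def less_Suc_eq)
    then show "T \<in> ssyts v (Suc n) \<alpha> m"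
      unfolding ssyts_def using semistandard_extend[OF h T'(1)] T' content_extend[OF hstrip_diagram[OF h], of v n T'] T by simp
  qed
  show "ssyts v (Suc n) \<alpha> m \<subseteq> ?R"
  proof
    fix T assume "T \<in> ssyts v (Suc n) \<alpha> m"
    then have T: "semistandard (diagram \<alpha>) T" "\<And>b. b \<in> diagram \<alpha> \<Longrightarrow> the (T b) < Suc n" "content v \<alpha> T = m"
      by (simp_all add: ssyts_def)
    obtain \<nu> where h: "hstrip \<nu> \<alpha>" and d: "diagram \<nu> = {b \<in> diagram \<alpha>. the (T b) < n}"
      using semistandard_peel[OF p T(1,2)] by blast
    define T' where "T' = T |` diagram \<nu>"
    have dT: "dom T = diagram \<alpha>" using T(1) by (simp add: semistandard_def)
    have eT: "extend n \<alpha> \<nu> T' = T"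
    proof (rule ext)
      fix b
      show "extend n \<alpha> \<nu> T' b = T b"
      proof (cases "b \<in> diagram \<alpha>")
        case True
        then obtain x where x: "T b = Some x" using dT by auto
        show ?thesis
        proof (cases "b \<in> diagram \<nu>")
          case False
          then have "x = n" using d True x T(2)[OF True] by simp
          then show ?thesis using False True x by (simp add: extend_def)
        qed (simp add: extend_def T'_def)
      next
        case False
        then have "b \<notin> diagram \<nu>" "T b = None" using d dT by auto
        then show ?thesis using False by (simp add: extend_def)
      qed
    qed
    have "semistandard (diagram \<nu>) T'"
    proof -
      have "dom T' = diagram \<nu>" using dT d by (auto simp: T'_def)
      moreover have "diagram \<nu> \<subseteq> diagram \<alpha>" using d by auto
      ultimately show ?thesis using T(1) unfolding semistandard_def by (simp add: T'_def subset_iff)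
    qed
    moreover have "\<forall>b\<in>diagram \<nu>. the (T' b) < n" using d by (auto simp: T'_def)
    moreover have "content v \<nu> T' + replicate_mset (card (diagram \<alpha>) - card (diagram \<nu>)) (v n) = m"
      using content_extend[OF hstrip_diagram[OF h], of v n T'] eT T(3) by simp
    ultimately show "T \<in> ?R" using h eT by blast
  qed
qed

lemma mcoeff_schur_poly:
  assumes "is_partition \<alpha>"
  shows "mcoeff (schur_poly v n \<alpha>) m = int (card (ssyts v n \<alpha> m))"
  using assms
proof (induction n arbitrary: \<alpha> m)
  case 0
  show ?case
  proof (cases "\<alpha> = []")
    case True
    have "ssyts v 0 \<alpha> m = (if m = {#} then {Map.empty} else {})"
      using True by (auto simp: ssyts_def semistandard_def content_def)
    then show ?thesis using True by (simp add: mcoeff_simps)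
  next
    case False
    then have "prow \<alpha> 1 \<noteq> 0" using 0 unfolding prow_def is_partition_def
      by (metis One_nat_def Suc_leI diff_self_eq_0 length_greater_0_conv nth_mem le_refl)
    then have "(1, 1) \<in> diagram \<alpha>" by (simp add: diagram_prow)
    then have "ssyts v 0 \<alpha> m = {}" by (auto simp: ssyts_def)
    then show ?thesis using False by (simp add: mcoeff_simps)
  qed
next
  case (Suc n)
  define K where "K \<nu> = {T. semistandard (diagram \<nu>) T \<and> (\<forall>b\<in>diagram \<nu>. the (T b) < n) \<and>
    content v \<nu> T + replicate_mset (card (diagram \<alpha>) - card (diagram \<nu>)) (v n) = m}" for \<nu>
  have K: "K \<nu> = (if replicate_mset (card (diagram \<alpha>) - card (diagram \<nu>)) (v n) \<subseteq># m then
    ssyts v n \<nu> (m - replicate_mset (card (diagram \<alpha>) - card (diagram \<nu>)) (v n)) else {})" for \<nu>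
  proof -
    have iff: "c + R = m \<longleftrightarrow> R \<subseteq># m \<and> c = m - R" for c R :: "'a multiset"
      by auto
    show ?thesis unfolding K_def ssyts_def iff by auto
  qed
  have fK: "finite (K \<nu>)" for \<nu> unfolding K by (simp add: finite_ssyts)
  \<comment> \<open>The inner shape is recovered as the set of boxes with entry below
    \<open>n\<close>, which makes the union over \<nu> disjoint.\<close>
  have low: "{b \<in> diagram \<alpha>. the (extend n \<alpha> \<nu> T b) < n} = diagram \<nu>" if "hstrip \<nu> \<alpha>" "T \<in> K \<nu>" for \<nu> T
    using that hstrip_diagram[OF that(1)] by (auto simp: K_def extend_def split: if_splits)
  have inj: "inj_on (extend n \<alpha> \<nu>) (K \<nu>)" for \<nu>
  proof (rule inj_onI)
    fix T T' assume T: "T \<in> K \<nu>" "T' \<in> K \<nu>" and e: "extend n \<alpha> \<nu> T = extend n \<alpha> \<nu> T'"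
    show "T = T'"
    proof (rule ext)
      fix b
      have "dom T = diagram \<nu>" "dom T' = diagram \<nu>" using T by (auto simp: K_def semistandard_def)
      then show "T b = T' b"
        using fun_cong[OF e, of b] by (cases "b \<in> diagram \<nu>") (simp add: extend_def, metis domIff)
    qed
  qed
  have "card (ssyts v (Suc n) \<alpha> m) = card (\<Union>\<nu>\<in>{\<nu>. hstrip \<nu> \<alpha>}. extend n \<alpha> \<nu> ` K \<nu>)"
    unfolding ssyts_Suc[OF Suc.prems] K_def ..
  also have "\<dots> = (\<Sum>\<nu>\<in>{\<nu>. hstrip \<nu> \<alpha>}. card (extend n \<alpha> \<nu> ` K \<nu>))"
  proof (rule card_UN_disjoint)
    show "finite {\<nu>. hstrip \<nu> \<alpha>}" by (rule finite_hstrips)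
    show "\<forall>\<nu>\<in>{\<nu>. hstrip \<nu> \<alpha>}. finite (extend n \<alpha> \<nu> ` K \<nu>)" using fK by simp
    show "\<forall>\<nu>\<in>{\<nu>. hstrip \<nu> \<alpha>}. \<forall>\<nu>'\<in>{\<nu>. hstrip \<nu> \<alpha>}. \<nu> \<noteq> \<nu>' \<longrightarrow>
        extend n \<alpha> \<nu> ` K \<nu> \<inter> extend n \<alpha> \<nu>' ` K \<nu>' = {}"
    proof (intro ballI impI, rule ccontr)
      fix \<nu> \<nu>' assume h: "\<nu> \<in> {\<nu>. hstrip \<nu> \<alpha>}" "\<nu>' \<in> {\<nu>. hstrip \<nu> \<alpha>}" "\<nu> \<noteq> \<nu>'"
        and "extend n \<alpha> \<nu> ` K \<nu> \<inter> extend n \<alpha> \<nu>' ` K \<nu>' \<noteq> {}"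
      then obtain T T' where "T \<in> K \<nu>" "T' \<in> K \<nu>'" "extend n \<alpha> \<nu> T = extend n \<alpha> \<nu>' T'" by blast
      then have "diagram \<nu> = diagram \<nu>'" using low[of \<nu> T] low[of \<nu>' T'] h by simp
      then show False using h diagram_inject by (auto simp: hstrip_def)
    qed
  qed
  also have "\<dots> = (\<Sum>\<nu>\<in>{\<nu>. hstrip \<nu> \<alpha>}. card (K \<nu>))"
    by (rule sum.cong) (simp_all add: card_image[OF inj])
  finally have "int (card (ssyts v (Suc n) \<alpha> m)) = (\<Sum>\<nu>\<in>{\<nu>. hstrip \<nu> \<alpha>}. int (card (K \<nu>)))" by simp
  also have "\<dots> = mcoeff (schur_poly v (Suc n) \<alpha>) m"
    unfolding schur_poly.simps mcoeff_sum mcoeff_mmonom_mult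
  proof (rule sum.cong[OF refl])
    fix \<nu> assume "\<nu> \<in> {\<nu>. hstrip \<nu> \<alpha>}"
    then have "is_partition \<nu>" by (simp add: hstrip_def)
    then show "int (card (K \<nu>)) = (if replicate_mset (card (diagram \<alpha>) - card (diagram \<nu>)) (v n) \<subseteq># m then
      mcoeff (schur_poly v n \<nu>) (m - replicate_mset (card (diagram \<alpha>) - card (diagram \<nu>)) (v n)) else 0)"
      using Suc.IH unfolding K by simp
  qed
  finally show ?case by simp
qed

text \<open>Only tableaux whose entries index variables of the monomial contribute to its
  coefficient, so finitely many variables suffice for each coefficient.\<close>

lemma mcoeff_schur_eq:
  assumes "is_partition \<alpha>" "\<And>k. v k \<in># m \<Longrightarrow> k < n"
  shows "mcoeff (schur v \<alpha>) m = mcoeff (schur_poly v n \<alpha>) m"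
proof -
  have "{T. semistandard (diagram \<alpha>) T \<and> content v \<alpha> T = m} = ssyts v n \<alpha> m"
  proof -
    have "the (T b) < n" if "content v \<alpha> T = m" "b \<in> diagram \<alpha>" for T b
      using that by (intro assms(2)) (auto simp: content_def)
    then show ?thesis by (auto simp: ssyts_def)
  qed
  then show ?thesis using mcoeff_schur_poly[OF assms(1), of v n m] by (simp add: schur_def content_def)
qed

subsection \<open>Commuting horizontal and vertical strips\<close>

definition vstrips :: "nat \<Rightarrow> nat list \<Rightarrow> nat list set" where
  "vstrips p \<kappa> = {\<mu>. \<exists>S. add_strip \<kappa> S \<mu> \<and> card S = p}"

lemma vstrips_card: "\<mu> \<in> vstrips p \<kappa> \<Longrightarrow> card (diagram \<mu>) = card (diagram \<kappa>) + p"
  unfolding vstrips_def using add_strip_card by blast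

lemma finite_vstrips: "finite (vstrips p \<kappa>)"
  by (rule finite_subset[OF _ finite_partitions[of "card (diagram \<kappa>) + p"]])
    (auto simp: vstrips_card, auto simp: vstrips_def dest: add_stripD)

lemma card_between:
  assumes "finite B" "Z \<subseteq> B"
  shows "card {S. Z \<subseteq> S \<and> S \<subseteq> B \<and> card S = p} = (if card Z \<le> p then (card B - card Z) choose (p - card Z) else 0)"
proof (cases "card Z \<le> p")
  case True
  have fZ: "finite Z" using assms finite_subset by blast
  have "bij_betw (\<lambda>S. S \<union> Z) {S. S \<subseteq> B - Z \<and> card S = p - card Z} {S. Z \<subseteq> S \<and> S \<subseteq> B \<and> card S = p}"
  proof (rule bij_betwI[where g = "\<lambda>S. S - Z"])
    show "(\<lambda>S. S \<union> Z) \<in> {S. S \<subseteq> B - Z \<and> card S = p - card Z} \<rightarrow> {S. Z \<subseteq> S \<and> S \<subseteq> B \<and> card S = p}"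
    proof
      fix S assume "S \<in> {S. S \<subseteq> B - Z \<and> card S = p - card Z}"
      then have S: "S \<subseteq> B - Z" "card S = p - card Z" by auto
      have "finite S" using S(1) assms(1) finite_subset by blast
      then have "card (S \<union> Z) = card S + card Z" using S(1) fZ by (intro card_Un_disjoint) auto
      then show "S \<union> Z \<in> {S. Z \<subseteq> S \<and> S \<subseteq> B \<and> card S = p}" using S True assms(2) by auto
    qed
    show "(\<lambda>S. S - Z) \<in> {S. Z \<subseteq> S \<and> S \<subseteq> B \<and> card S = p} \<rightarrow> {S. S \<subseteq> B - Z \<and> card S = p - card Z}"
      using fZ by (auto simp: card_Diff_subset)
  qed auto
  then have "card {S. Z \<subseteq> S \<and> S \<subseteq> B \<and> card S = p} = card {S. S \<subseteq> B - Z \<and> card S = p - card Z}"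
    by (rule bij_betw_same_card[symmetric])
  also have "\<dots> = (card B - card Z) choose (p - card Z)"
    using n_subsets[of "B - Z" "p - card Z"] assms fZ by (simp add: card_Diff_subset)
  finally show ?thesis using True by simp
next
  case False
  have "card S \<noteq> p" if "Z \<subseteq> S" "S \<subseteq> B" for S
    using card_mono[of S Z] finite_subset[OF that(2) assms(1)] that(1) False by auto
  then have "{S. Z \<subseteq> S \<and> S \<subseteq> B \<and> card S = p} = {}" by blast
  then have "card {S. Z \<subseteq> S \<and> S \<subseteq> B \<and> card S = p} = 0" by (metis card.empty)
  then show ?thesis using False by simp
qed


text \<open>It lets partitions reached by strips be counted through the row sets of the
  strips.\<close>

lemma card_one_one_relation:
  assumes "\<And>a b b'. P a b \<Longrightarrow> P a b' \<Longrightarrow> b = b'" "\<And>a a' b. P a b \<Longrightarrow> P a' b \<Longrightarrow> a = a'"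
  shows "card {a. \<exists>b. P a b} = card {b. \<exists>a. P a b}"
proof -
  define f where "f a = (SOME b. P a b)" for a
  have f: "P a (f a)" if "\<exists>b. P a b" for a unfolding f_def using that by (rule someI_ex)
  have "bij_betw f {a. \<exists>b. P a b} {b. \<exists>a. P a b}"
  proof (rule bij_betw_imageI)
    show "inj_on f {a. \<exists>b. P a b}"
    proof (rule inj_onI)
      fix a a' assume "a \<in> {a. \<exists>b. P a b}" "a' \<in> {a. \<exists>b. P a b}" "f a = f a'"
      then have "P a (f a)" "P a' (f a)" using f[of a] f[of a'] by simp_all
      then show "a = a'" by (rule assms(2))
    qed
    show "f ` {a. \<exists>b. P a b} = {b. \<exists>a. P a b}"
    proof
      show "f ` {a. \<exists>b. P a b} \<subseteq> {b. \<exists>a. P a b}" using f by blast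
      show "{b. \<exists>a. P a b} \<subseteq> f ` {a. \<exists>b. P a b}"
      proof
        fix b assume "b \<in> {b. \<exists>a. P a b}"
        then obtain a where a: "P a b" by blast
        then have "f a = b" using f assms(1) by blast
        then show "b \<in> f ` {a. \<exists>b. P a b}" using a by blast
      qed
    qed
  qed
  then show ?thesis by (rule bij_betw_same_card)
qed

text \<open>With both endpoints fixed, the intermediate shapes are counted by the rows of the
  vertical strip. Rows in \<open>Z\<close>, where \<nu> sticks out of \<kappa>, must be used on
  either route. Going down first, row i can be used iff row i of \<nu> may lose a box without
  becoming shorter than row i + 1 of \<kappa>, that is, iff i is in \<open>B\<close>. Going up
  first, the same condition governs row i + 1, and row 1 is free in addition.\<close>

lemma card_vstrips_hstrip:
  assumes p: "is_partition \<kappa>" "is_partition \<nu>"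
    and K: "\<And>i. 1 \<le> i \<Longrightarrow> prow \<nu> i \<le> Suc (prow \<kappa> i)" "\<And>i. 1 \<le> i \<Longrightarrow> prow \<kappa> (Suc i) \<le> prow \<nu> i"
  defines "Z \<equiv> {i. 1 \<le> i \<and> prow \<nu> i = Suc (prow \<kappa> i)}"
    and "B \<equiv> {i. 1 \<le> i \<and> prow \<kappa> (Suc i) < prow \<nu> i}"
  shows "card {\<mu> \<in> vstrips q \<kappa>. hstrip \<nu> \<mu>} = card {S. Z \<subseteq> S \<and> S \<subseteq> insert 1 (Suc ` B) \<and> card S = q}"
    and "card {\<rho>. hstrip \<rho> \<kappa> \<and> \<nu> \<in> vstrips q \<rho>} = card {S. Z \<subseteq> S \<and> S \<subseteq> B \<and> card S = q}"
    and "finite B" "Z \<subseteq> B" "Z \<subseteq> insert 1 (Suc ` B)"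
proof -
  have "B \<subseteq> {1..length \<nu>}" by (auto simp: B_def prow_def split: if_splits)
  then show fB: "finite B" by (rule finite_subset) simp
  show "Z \<subseteq> B" using prow_Suc_le[OF p(1)] by (auto simp: Z_def B_def le_Suc_eq less_Suc_eq_le)
  show "Z \<subseteq> insert 1 (Suc ` B)"
  proof
    fix i assume i: "i \<in> Z"
    show "i \<in> insert 1 (Suc ` B)"
    proof (cases "i = 1")
      case False
      then obtain k where k: "i = Suc k" "1 \<le> k" using i by (cases i) (auto simp: Z_def)
      then have "k \<in> B" using i prow_Suc_le[OF p(2) k(2)] by (auto simp: Z_def B_def)
      then show ?thesis using k by blast
    qed simp
  qed
  have "(\<exists>\<mu>. add_strip \<kappa> S \<mu> \<and> card S = q \<and> hstrip \<nu> \<mu>) \<longleftrightarrow> Z \<subseteq> S \<and> S \<subseteq> insert 1 (Suc ` B) \<and> card S = q" for S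
  proof
    assume "\<exists>\<mu>. add_strip \<kappa> S \<mu> \<and> card S = q \<and> hstrip \<nu> \<mu>"
    then obtain \<mu> where m: "add_strip \<kappa> S \<mu>" "card S = q" "hstrip \<nu> \<mu>" by blast
    note a = add_stripD[OF m(1)]
    have "Z \<subseteq> S"
    proof
      fix i assume i: "i \<in> Z"
      then have "1 \<le> i" by (simp add: Z_def)
      then have "prow \<nu> i \<le> prow \<mu> i" using m(3) by (simp add: hstrip_def)
      then show "i \<in> S" using a(5)[of i] i by (auto simp: Z_def of_bool_def split: if_splits)
    qed
    moreover have "S \<subseteq> insert 1 (Suc ` B)"
    proof
      fix i assume i: "i \<in> S"
      show "i \<in> insert 1 (Suc ` B)"
      proof (cases "i = 1")
        case False
        then obtain k where k: "i = Suc k" "1 \<le> k" using i a(4) by (cases i) auto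
        have "prow \<mu> (Suc k) \<le> prow \<nu> k" using m(3) k by (simp add: hstrip_def)
        then have "k \<in> B" using a(5)[of "Suc k"] i k by (simp add: B_def)
        then show ?thesis using k by blast
      qed simp
    qed
    ultimately show "Z \<subseteq> S \<and> S \<subseteq> insert 1 (Suc ` B) \<and> card S = q" using m(2) by blast
  next
    assume S: "Z \<subseteq> S \<and> S \<subseteq> insert 1 (Suc ` B) \<and> card S = q"
    then have fS: "finite S" using fB by (meson finite.insertI finite_imageI finite_subset)
    have S1: "S \<subseteq> {1..}" using S by auto
    have up: "prow \<kappa> (Suc i) + of_bool (Suc i \<in> S) \<le> prow \<nu> i" if "1 \<le> i" for i
      using K(2)[OF that] S that by (auto simp: B_def)
    have lo: "prow \<nu> i \<le> prow \<kappa> i + of_bool (i \<in> S)" if "1 \<le> i" for i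
      using K(1)[OF that] S that by (auto simp: Z_def le_Suc_eq)
    have "\<exists>\<mu>. add_strip \<kappa> S \<mu>"
    proof (rule add_strip_exists_upper[OF p(1) fS S1])
      fix i :: nat assume i: "1 \<le> i" "Suc i \<in> S" "prow \<kappa> (Suc i) = prow \<kappa> i"
      then show "i \<in> S" using up[OF i(1)] lo[OF i(1)] by (auto simp: of_bool_def split: if_splits)
    qed
    then obtain \<mu> where m: "add_strip \<kappa> S \<mu>" by blast
    have "hstrip \<nu> \<mu>" unfolding hstrip_def
      using p add_stripD(2)[OF m] add_stripD(5)[OF m] up lo by simp
    then show "\<exists>\<mu>. add_strip \<kappa> S \<mu> \<and> card S = q \<and> hstrip \<nu> \<mu>" using m S by blast
  qed
  then have "{S. Z \<subseteq> S \<and> S \<subseteq> insert 1 (Suc ` B) \<and> card S = q} = {S. \<exists>\<mu>. add_strip \<kappa> S \<mu> \<and> card S = q \<and> hstrip \<nu> \<mu>}"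
    by simp
  moreover have "{\<mu> \<in> vstrips q \<kappa>. hstrip \<nu> \<mu>} = {\<mu>. \<exists>S. add_strip \<kappa> S \<mu> \<and> card S = q \<and> hstrip \<nu> \<mu>}"
    by (auto simp: vstrips_def)
  ultimately show "card {\<mu> \<in> vstrips q \<kappa>. hstrip \<nu> \<mu>} = card {S. Z \<subseteq> S \<and> S \<subseteq> insert 1 (Suc ` B) \<and> card S = q}"
    using card_one_one_relation[of "\<lambda>S \<mu>. add_strip \<kappa> S \<mu> \<and> card S = q \<and> hstrip \<nu> \<mu>"]
      add_strip_set_unique add_strip_upper_unique by (smt (verit, best))
  have "(\<exists>\<rho>. add_strip \<rho> S \<nu> \<and> card S = q \<and> hstrip \<rho> \<kappa>) \<longleftrightarrow> Z \<subseteq> S \<and> S \<subseteq> B \<and> card S = q" for S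
  proof
    assume "\<exists>\<rho>. add_strip \<rho> S \<nu> \<and> card S = q \<and> hstrip \<rho> \<kappa>"
    then obtain \<rho> where m: "add_strip \<rho> S \<nu>" "card S = q" "hstrip \<rho> \<kappa>" by blast
    note a = add_stripD[OF m(1)]
    have "Z \<subseteq> S"
    proof
      fix i assume i: "i \<in> Z"
      then have "prow \<rho> i \<le> prow \<kappa> i" using m(3) by (simp add: hstrip_def Z_def)
      then show "i \<in> S" using a(5)[of i] i by (auto simp: Z_def of_bool_def split: if_splits)
    qed
    moreover have "S \<subseteq> B"
    proof
      fix i assume i: "i \<in> S"
      then have i1: "1 \<le> i" using a(4) by auto
      have "prow \<kappa> (Suc i) \<le> prow \<rho> i" using m(3) i1 by (simp add: hstrip_def)
      then show "i \<in> B" using a(5)[OF i1] i i1 by (simp add: B_def)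
    qed
    ultimately show "Z \<subseteq> S \<and> S \<subseteq> B \<and> card S = q" using m(2) by blast
  next
    assume S: "Z \<subseteq> S \<and> S \<subseteq> B \<and> card S = q"
    then have fS: "finite S" using fB finite_subset by blast
    have S1: "S \<subseteq> {1..}" using S by (auto simp: B_def)
    have up: "prow \<kappa> (Suc i) + of_bool (i \<in> S) \<le> prow \<nu> i" if "1 \<le> i" for i
      using K(2)[OF that] S that by (auto simp: B_def)
    have lo: "prow \<nu> i \<le> prow \<kappa> i + of_bool (i \<in> S)" if "1 \<le> i" for i
      using K(1)[OF that] S that by (auto simp: Z_def le_Suc_eq)
    have "\<exists>\<rho>. add_strip \<rho> S \<nu>"
    proof (rule add_strip_exists_lower[OF p(2) fS S1])
      show "1 \<le> prow \<nu> i" if "i \<in> S" for i using up[of i] that S1 by auto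
      fix i :: nat assume i: "1 \<le> i" "i \<in> S" "prow \<nu> (Suc i) = prow \<nu> i"
      then show "Suc i \<in> S" using up[OF i(1)] lo[of "Suc i"] by (auto simp: of_bool_def split: if_splits)
    qed
    then obtain \<rho> where m: "add_strip \<rho> S \<nu>" by blast
    have "hstrip \<rho> \<kappa>" unfolding hstrip_def
    proof (intro conjI allI impI)
      show "is_partition \<rho>" "is_partition \<kappa>" using add_stripD(1)[OF m] p by auto
      fix i :: nat assume i: "1 \<le> i"
      show "prow \<rho> i \<le> prow \<kappa> i" "prow \<kappa> (Suc i) \<le> prow \<rho> i"
        using add_stripD(5)[OF m i] up[OF i] lo[OF i] by simp_all
    qed
    then show "\<exists>\<rho>. add_strip \<rho> S \<nu> \<and> card S = q \<and> hstrip \<rho> \<kappa>" using m S by blast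
  qed
  then have "{S. Z \<subseteq> S \<and> S \<subseteq> B \<and> card S = q} = {S. \<exists>\<rho>. add_strip \<rho> S \<nu> \<and> card S = q \<and> hstrip \<rho> \<kappa>}"
    by simp
  moreover have "{\<rho>. hstrip \<rho> \<kappa> \<and> \<nu> \<in> vstrips q \<rho>} = {\<rho>. \<exists>S. add_strip \<rho> S \<nu> \<and> card S = q \<and> hstrip \<rho> \<kappa>}"
    by (auto simp: vstrips_def)
  ultimately show "card {\<rho>. hstrip \<rho> \<kappa> \<and> \<nu> \<in> vstrips q \<rho>} = card {S. Z \<subseteq> S \<and> S \<subseteq> B \<and> card S = q}"
    using card_one_one_relation[of "\<lambda>S \<rho>. add_strip \<rho> S \<nu> \<and> card S = q \<and> hstrip \<rho> \<kappa>"]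
      add_strip_set_unique add_strip_lower_unique by (smt (verit, best))
qed

text \<open>The free first row makes the range of admissible rows larger by one on the left, so this
  is Pascal's rule for the binomial coefficients supplied by \<open>card_between\<close>. If the
  endpoints are too far apart, all counts vanish.\<close>

lemma card_vstrips_hstrip_commute:
  assumes p: "is_partition \<kappa>" "is_partition \<nu>"
  shows "card {\<mu> \<in> vstrips q \<kappa>. hstrip \<nu> \<mu>} = card {\<rho>. hstrip \<rho> \<kappa> \<and> \<nu> \<in> vstrips q \<rho>} +
    (case q of 0 \<Rightarrow> 0 | Suc q' \<Rightarrow> card {\<rho>. hstrip \<rho> \<kappa> \<and> \<nu> \<in> vstrips q' \<rho>})"
proof (cases "\<forall>i\<ge>1. prow \<nu> i \<le> Suc (prow \<kappa> i) \<and> prow \<kappa> (Suc i) \<le> prow \<nu> i")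
  case True
  define Z where "Z = {i. 1 \<le> i \<and> prow \<nu> i = Suc (prow \<kappa> i)}"
  define B where "B = {i. 1 \<le> i \<and> prow \<kappa> (Suc i) < prow \<nu> i}"
  have t: "\<And>i. 1 \<le> i \<Longrightarrow> prow \<nu> i \<le> Suc (prow \<kappa> i)" "\<And>i. 1 \<le> i \<Longrightarrow> prow \<kappa> (Suc i) \<le> prow \<nu> i"
    using True by auto
  have c: "card {\<mu> \<in> vstrips q \<kappa>. hstrip \<nu> \<mu>} = card {S. Z \<subseteq> S \<and> S \<subseteq> insert 1 (Suc ` B) \<and> card S = q}"
    "card {\<rho>. hstrip \<rho> \<kappa> \<and> \<nu> \<in> vstrips q \<rho>} = card {S. Z \<subseteq> S \<and> S \<subseteq> B \<and> card S = q}"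
    "finite B" "Z \<subseteq> B" "Z \<subseteq> insert 1 (Suc ` B)" for q
    unfolding Z_def B_def by (rule card_vstrips_hstrip[OF p t]; assumption)+
  have "1 \<notin> Suc ` B" by (auto simp: B_def)
  then have cB: "card (insert 1 (Suc ` B)) = Suc (card B)" using c(3) by (simp add: card_image)
  have f: "finite (insert 1 (Suc ` B))" using c(3) by simp
  have le: "card Z \<le> card B" using c(3,4) by (rule card_mono)
  show ?thesis
    unfolding c(1,2) card_between[OF f c(5)] card_between[OF c(3,4)] cB
    using le by (cases q) (auto simp: Suc_diff_le le_Suc_eq)
next
  case False
  then obtain i where i: "1 \<le> i" "\<not> (prow \<nu> i \<le> Suc (prow \<kappa> i) \<and> prow \<kappa> (Suc i) \<le> prow \<nu> i)" by blast
  have "\<not> hstrip \<nu> \<mu>" if m: "\<mu> \<in> vstrips q \<kappa>" for \<mu>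
  proof
    assume "hstrip \<nu> \<mu>"
    then have "prow \<nu> i \<le> prow \<mu> i" "prow \<mu> (Suc i) \<le> prow \<nu> i" using i(1) by (auto simp: hstrip_def)
    moreover obtain S where "add_strip \<kappa> S \<mu>" using m by (auto simp: vstrips_def)
    ultimately show False using i add_stripD(5)[of \<kappa> S \<mu> i] add_stripD(5)[of \<kappa> S \<mu> "Suc i"]
      by (auto simp: of_bool_def split: if_splits)
  qed
  then have 1: "{\<mu> \<in> vstrips q \<kappa>. hstrip \<nu> \<mu>} = {}" by blast
  have "\<not> hstrip \<rho> \<kappa>" if m: "\<nu> \<in> vstrips q' \<rho>" for \<rho> q'
  proof
    assume "hstrip \<rho> \<kappa>"
    then have "prow \<rho> i \<le> prow \<kappa> i" "prow \<kappa> (Suc i) \<le> prow \<rho> i" using i(1) by (auto simp: hstrip_def)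
    moreover obtain S where "add_strip \<rho> S \<nu>" using m by (auto simp: vstrips_def)
    ultimately show False using i add_stripD(5)[of \<rho> S \<nu> i]
      by (auto simp: of_bool_def split: if_splits)
  qed
  then have 2: "{\<rho>. hstrip \<rho> \<kappa> \<and> \<nu> \<in> vstrips q' \<rho>} = {}" for q' by blast
  show ?thesis unfolding 1 2 by (simp split: nat.split)
qed

section \<open>Elementary symmetric polynomials and the Pieri rule\<close>

primrec elem_poly :: "(nat \<Rightarrow> 'v) \<Rightarrow> nat \<Rightarrow> nat \<Rightarrow> 'v mseries" where
  "elem_poly v 0 q = of_bool (q = 0)"
| "elem_poly v (Suc n) q = elem_poly v n q +
     (case q of 0 \<Rightarrow> 0 | Suc q' \<Rightarrow> mmonom {#v n#} * elem_poly v n q')"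

lemma sum_hstrip_vstrips:
  assumes p: "is_partition \<kappa>" and N: "card (diagram \<kappa>) + q \<le> N"
  shows "(\<Sum>\<rho>\<in>{\<rho>. hstrip \<rho> \<kappa>}. \<Sum>\<nu>\<in>vstrips q \<rho>. g \<nu>) =
    (\<Sum>\<nu>\<in>{\<nu>. is_partition \<nu> \<and> card (diagram \<nu>) \<le> N}.
       of_nat (card {\<rho>. hstrip \<rho> \<kappa> \<and> \<nu> \<in> vstrips q \<rho>}) * (g \<nu> :: 'a :: comm_ring_1))"
proof -
  define U where "U = {\<nu>. is_partition \<nu> \<and> card (diagram \<nu>) \<le> N}"
  have fU: "finite U" unfolding U_def by (rule finite_partitions)
  have "(\<Sum>\<rho>\<in>{\<rho>. hstrip \<rho> \<kappa>}. \<Sum>\<nu>\<in>vstrips q \<rho>. g \<nu>) =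
    (\<Sum>\<rho>\<in>{\<rho>. hstrip \<rho> \<kappa>}. \<Sum>\<nu>\<in>{\<nu> \<in> U. \<nu> \<in> vstrips q \<rho>}. g \<nu>)"
  proof (rule sum.cong[OF refl])
    fix \<rho> assume "\<rho> \<in> {\<rho>. hstrip \<rho> \<kappa>}"
    then have "card (diagram \<rho>) \<le> card (diagram \<kappa>)" using hstrip_card_le by simp
    then have "\<nu> \<in> U" if "\<nu> \<in> vstrips q \<rho>" for \<nu>
      using N vstrips_card[OF that] that by (auto simp: U_def vstrips_def dest: add_stripD(2))
    then have "vstrips q \<rho> = {\<nu> \<in> U. \<nu> \<in> vstrips q \<rho>}" by blast
    then show "(\<Sum>\<nu>\<in>vstrips q \<rho>. g \<nu>) = (\<Sum>\<nu>\<in>{\<nu> \<in> U. \<nu> \<in> vstrips q \<rho>}. g \<nu>)" by simp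
  qed
  also have "\<dots> = (\<Sum>\<nu>\<in>U. \<Sum>\<rho>\<in>{\<rho> \<in> {\<rho>. hstrip \<rho> \<kappa>}. \<nu> \<in> vstrips q \<rho>}. g \<nu>)"
    by (rule sum.swap_restrict[OF finite_hstrips fU])
  finally show ?thesis by (simp add: U_def)
qed

text \<open>Induction on the number of variables. Splitting off the largest entries goes down a
  horizontal strip after going up a vertical one; exchanging the two yields vertical strips of q and
  of q - 1 boxes, matching the two summands in the recursion of \<open>elem_poly\<close>.\<close>

lemma schur_poly_pieri:
  assumes "is_partition \<kappa>"
  shows "(\<Sum>\<mu>\<in>vstrips q \<kappa>. schur_poly v n \<mu>) = elem_poly v n q * schur_poly v n \<kappa>"
  using assms
proof (induction n arbitrary: q \<kappa>)
  case 0
  have iff: "\<mu> = [] \<longleftrightarrow> \<kappa> = [] \<and> q = 0" if "\<mu> \<in> vstrips q \<kappa>" for \<mu>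
  proof -
    have e: "\<alpha> = [] \<longleftrightarrow> card (diagram \<alpha>) = 0" if "is_partition \<alpha>" for \<alpha>
      using length_le_card_diagram[OF that] by auto
    have "is_partition \<mu>" using that by (auto simp: vstrips_def dest: add_stripD)
    then show ?thesis using vstrips_card[OF that] e[of \<mu>] e[OF 0] by simp
  qed
  show ?case
  proof (cases "\<kappa> = [] \<and> q = 0")
    case True
    then have "vstrips q \<kappa> = {[]}" using 0 iff add_strip_empty_iff[of \<kappa> "[]"]
      by (auto simp: vstrips_def)
    then show ?thesis using True by simp
  next
    case False
    have "(\<Sum>\<mu>\<in>vstrips q \<kappa>. schur_poly v 0 \<mu>) = 0"
      by (rule sum.neutral) (use iff False in auto)
    then show ?thesis using False by auto
  qed
next
  case (Suc n)
  define c where "c = card (diagram \<kappa>)"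
  define N where "N = c + q"
  define U where "U = {\<nu>. is_partition \<nu> \<and> card (diagram \<nu>) \<le> N}"
  have fU: "finite U" unfolding U_def by (rule finite_partitions)
  define x where "x k = mmonom (replicate_mset k (v n))" for k
  have x_add: "x i * x j = x (i + j)" for i j
    unfolding x_def mmonom_mult by (rule arg_cong[where f = mmonom]) (simp add: multiset_eq_iff)
  \<comment> \<open>All shapes in \<open>vstrips q \<kappa>\<close> have \<open>c + q\<close> boxes,
    so the exponent of the split-off variable depends on \<nu> alone.\<close>
  define g where "g \<nu> = x (c + q - card (diagram \<nu>)) * schur_poly v n \<nu>" for \<nu>
  have "(\<Sum>\<mu>\<in>vstrips q \<kappa>. schur_poly v (Suc n) \<mu>) = (\<Sum>\<mu>\<in>vstrips q \<kappa>. \<Sum>\<nu>\<in>{\<nu> \<in> U. hstrip \<nu> \<mu>}. g \<nu>)"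
  proof (rule sum.cong[OF refl])
    fix \<mu> assume m: "\<mu> \<in> vstrips q \<kappa>"
    have cm: "card (diagram \<mu>) = c + q" using vstrips_card[OF m] by (simp add: c_def)
    have "{\<nu>. hstrip \<nu> \<mu>} = {\<nu> \<in> U. hstrip \<nu> \<mu>}"
      using hstrip_card_le[of _ \<mu>] cm by (auto simp: U_def N_def hstrip_def)
    then show "schur_poly v (Suc n) \<mu> = (\<Sum>\<nu>\<in>{\<nu> \<in> U. hstrip \<nu> \<mu>}. g \<nu>)"
      by (simp add: g_def x_def cm)
  qed
  also have "\<dots> = (\<Sum>\<nu>\<in>U. \<Sum>\<mu>\<in>{\<mu> \<in> vstrips q \<kappa>. hstrip \<nu> \<mu>}. g \<nu>)"
    by (rule sum.swap_restrict[OF finite_vstrips fU])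
  also have "\<dots> = (\<Sum>\<nu>\<in>U. of_nat (card {\<mu> \<in> vstrips q \<kappa>. hstrip \<nu> \<mu>}) * g \<nu>)" by simp
  also have "\<dots> = (\<Sum>\<nu>\<in>U. of_nat (card {\<rho>. hstrip \<rho> \<kappa> \<and> \<nu> \<in> vstrips q \<rho>}) * g \<nu>) +
    (case q of 0 \<Rightarrow> 0 | Suc q' \<Rightarrow> (\<Sum>\<nu>\<in>U. of_nat (card {\<rho>. hstrip \<rho> \<kappa> \<and> \<nu> \<in> vstrips q' \<rho>}) * g \<nu>))"
  proof -
    have "(\<Sum>\<nu>\<in>U. of_nat (card {\<mu> \<in> vstrips q \<kappa>. hstrip \<nu> \<mu>}) * g \<nu>) =
      (\<Sum>\<nu>\<in>U. of_nat (card {\<rho>. hstrip \<rho> \<kappa> \<and> \<nu> \<in> vstrips q \<rho>} +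
        (case q of 0 \<Rightarrow> 0 | Suc q' \<Rightarrow> card {\<rho>. hstrip \<rho> \<kappa> \<and> \<nu> \<in> vstrips q' \<rho>})) * g \<nu>)"
      by (rule sum.cong[OF refl]) (simp add: U_def card_vstrips_hstrip_commute[OF Suc.prems])
    then show ?thesis by (cases q) (simp_all add: distrib_right sum.distrib)
  qed
  also have "(\<Sum>\<nu>\<in>U. of_nat (card {\<rho>. hstrip \<rho> \<kappa> \<and> \<nu> \<in> vstrips q \<rho>}) * g \<nu>) =
    elem_poly v n q * schur_poly v (Suc n) \<kappa>"
  proof -
    have "(\<Sum>\<nu>\<in>U. of_nat (card {\<rho>. hstrip \<rho> \<kappa> \<and> \<nu> \<in> vstrips q \<rho>}) * g \<nu>) =
      (\<Sum>\<rho>\<in>{\<rho>. hstrip \<rho> \<kappa>}. \<Sum>\<nu>\<in>vstrips q \<rho>. g \<nu>)"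
      unfolding U_def by (rule sum_hstrip_vstrips[symmetric, OF Suc.prems]) (simp add: N_def c_def)
    also have "\<dots> = (\<Sum>\<rho>\<in>{\<rho>. hstrip \<rho> \<kappa>}. elem_poly v n q * (x (c - card (diagram \<rho>)) * schur_poly v n \<rho>))"
    proof (rule sum.cong[OF refl])
      fix \<rho> assume r: "\<rho> \<in> {\<rho>. hstrip \<rho> \<kappa>}"
      have "(\<Sum>\<nu>\<in>vstrips q \<rho>. g \<nu>) = (\<Sum>\<nu>\<in>vstrips q \<rho>. x (c - card (diagram \<rho>)) * schur_poly v n \<nu>)"
        by (rule sum.cong[OF refl]) (simp add: g_def vstrips_card)
      also have "\<dots> = x (c - card (diagram \<rho>)) * (elem_poly v n q * schur_poly v n \<rho>)"
        using Suc.IH[of \<rho> q] r by (simp add: sum_distrib_left[symmetric] hstrip_def)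
      finally show "(\<Sum>\<nu>\<in>vstrips q \<rho>. g \<nu>) = elem_poly v n q * (x (c - card (diagram \<rho>)) * schur_poly v n \<rho>)"
        by (simp add: mult.left_commute)
    qed
    also have "\<dots> = elem_poly v n q * schur_poly v (Suc n) \<kappa>" by (simp add: sum_distrib_left x_def c_def)
    finally show ?thesis .
  qed
  also have "(case q of 0 \<Rightarrow> 0 | Suc q' \<Rightarrow> (\<Sum>\<nu>\<in>U. of_nat (card {\<rho>. hstrip \<rho> \<kappa> \<and> \<nu> \<in> vstrips q' \<rho>}) * g \<nu>)) =
    (case q of 0 \<Rightarrow> 0 | Suc q' \<Rightarrow> mmonom {#v n#} * elem_poly v n q') * schur_poly v (Suc n) \<kappa>"
  proof (cases q)
    case (Suc q')
    have "(\<Sum>\<nu>\<in>U. of_nat (card {\<rho>. hstrip \<rho> \<kappa> \<and> \<nu> \<in> vstrips q' \<rho>}) * g \<nu>) =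
      (\<Sum>\<rho>\<in>{\<rho>. hstrip \<rho> \<kappa>}. \<Sum>\<nu>\<in>vstrips q' \<rho>. g \<nu>)"
      unfolding U_def by (rule sum_hstrip_vstrips[symmetric, OF Suc.prems]) (simp add: N_def c_def Suc)
    also have "\<dots> = (\<Sum>\<rho>\<in>{\<rho>. hstrip \<rho> \<kappa>}. x 1 * elem_poly v n q' * (x (c - card (diagram \<rho>)) * schur_poly v n \<rho>))"
    proof (rule sum.cong[OF refl])
      fix \<rho> assume r: "\<rho> \<in> {\<rho>. hstrip \<rho> \<kappa>}"
      then have le: "card (diagram \<rho>) \<le> c" using hstrip_card_le by (simp add: c_def)
      \<comment> \<open>The vertical strip is one box shorter here, which leaves one more factor
        \<open>v n\<close>, the extra monomial in the recursion of \<open>elem_poly\<close>.\<close>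
      have "(\<Sum>\<nu>\<in>vstrips q' \<rho>. g \<nu>) = (\<Sum>\<nu>\<in>vstrips q' \<rho>. x 1 * x (c - card (diagram \<rho>)) * schur_poly v n \<nu>)"
        by (rule sum.cong[OF refl]) (use le Suc in \<open>simp add: g_def vstrips_card x_add Suc_diff_le\<close>)
      also have "\<dots> = x 1 * x (c - card (diagram \<rho>)) * (elem_poly v n q' * schur_poly v n \<rho>)"
        using Suc.IH[of \<rho> q'] r by (simp add: sum_distrib_left[symmetric] hstrip_def)
      finally show "(\<Sum>\<nu>\<in>vstrips q' \<rho>. g \<nu>) = x 1 * elem_poly v n q' * (x (c - card (diagram \<rho>)) * schur_poly v n \<rho>)"
        by (simp add: mult_ac)
    qed
    also have "\<dots> = x 1 * elem_poly v n q' * schur_poly v (Suc n) \<kappa>" by (simp add: sum_distrib_left x_def c_def)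
    finally show ?thesis using Suc by (simp add: x_def)
  qed simp
  finally show ?case by (simp add: distrib_right)
qed

text \<open>All rows of the empty partition are equal, so a strip on it fills the topmost rows. With
  the Pieri rule at the empty partition this identifies column Schur polynomials with elementary
  symmetric ones.\<close>

lemma vstrips_Nil: "vstrips q [] = {replicate q 1}"
proof -
  have p0: "is_partition []" by (simp add: is_partition_def)
  have pr: "prow (replicate q 1) i = of_bool (i \<in> {1..q})" for i
    by (auto simp: prow_def)
  have pq: "is_partition (replicate q 1)" by (auto simp: is_partition_def sorted_wrt_iff_nth_less)
  have "add_strip [] {1..q} (replicate q 1)"
    using p0 pq unfolding add_strip_def by (auto simp: pr) (auto simp: prow_def)
  then have "replicate q 1 \<in> vstrips q []" unfolding vstrips_def by force
  moreover have "\<mu> = replicate q 1" if m: "\<mu> \<in> vstrips q []" for \<mu>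
  proof -
    obtain S where S: "add_strip [] S \<mu>" "card S = q" using m by (auto simp: vstrips_def)
    note a = add_stripD[OF S(1)]
    have down: "x \<in> S" if "1 \<le> x" "x \<le> y" "y \<in> S" for x y
      using add_strip_top[OF S(1) that(2,1,3)] by (simp add: prow_def)
    have "S = {1..q}"
    proof (cases "S = {}")
      case False
      define M where "M = Max S"
      have "M \<in> S" "\<And>x. x \<in> S \<Longrightarrow> x \<le> M" using False a(3) by (simp_all add: M_def)
      then have "S = {1..M}" using a(4) down[of _ M] by auto
      moreover from this have "q = M" using S(2) by simp
      ultimately show ?thesis by simp
    qed (use S in auto)
    then show ?thesis using S(1) \<open>add_strip [] {1..q} (replicate q 1)\<close> add_strip_upper_unique by blast
  qed
  ultimately show ?thesis by blast
qed

lemma mcoeff_mult_cong: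
  assumes "\<And>a. a \<subseteq># m \<Longrightarrow> mcoeff f a = mcoeff f' a" "\<And>a. a \<subseteq># m \<Longrightarrow> mcoeff g a = mcoeff g' a"
  shows "mcoeff (f * g) m = mcoeff (f' * g') m"
  unfolding mcoeff_simps by (rule sum.cong) (auto intro!: arg_cong2[where f = times] assms)

theorem schur_pieri:
  fixes v :: "nat \<Rightarrow> 'v"
  assumes v: "inj v" and p: "is_partition \<kappa>"
  shows "schur v (replicate q 1) * schur v \<kappa> = (\<Sum>\<mu>\<in>vstrips q \<kappa>. schur v \<mu>)"
proof (rule mseries_eqI)
  fix m :: "'v multiset"
  \<comment> \<open>The preimage is finite because \<open>v\<close> is injective, so some
    \<open>n\<close> exceeds the index of every variable in the monomial.\<close>
  have "finite (v -` set_mset m)" using v by (simp add: finite_vimageI)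
  then obtain n where "\<forall>k\<in>v -` set_mset m. k < n" using finite_nat_set_iff_bounded by blast
  then have n: "k < n" if "v k \<in># m" for k using that by simp
  have n': "k < n" if "a \<subseteq># m" "v k \<in># a" for a k using n[OF mset_subset_eqD[OF that]] .
  have p0: "is_partition []" by (simp add: is_partition_def)
  have pq: "is_partition (replicate q 1)" by (auto simp: is_partition_def sorted_wrt_iff_nth_less)
  have one: "schur_poly v n [] = 1" for n
  proof (induction n)
    case (Suc n)
    have "{\<nu>. hstrip \<nu> []} = {[]}"
    proof -
      have "\<nu> = []" if "hstrip \<nu> []" for \<nu>
        using that by (intro prow_eqI) (auto simp: hstrip_def prow_def split: if_splits)
      moreover have "hstrip [] []" using p0 by (simp add: hstrip_def prow_def)
      ultimately show ?thesis by blast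
    qed
    then show ?case using Suc by (simp add: mmonom_empty)
  qed simp
  have e: "schur_poly v n (replicate q 1) = elem_poly v n q"
    using schur_poly_pieri[OF p0, where q = q and v = v and n = n] vstrips_Nil[of q] one by simp
  have "mcoeff (schur v (replicate q 1) * schur v \<kappa>) m = mcoeff (schur_poly v n (replicate q 1) * schur_poly v n \<kappa>) m"
  proof (rule mcoeff_mult_cong)
    fix a assume a: "a \<subseteq># m"
    show "mcoeff (schur v (replicate q 1)) a = mcoeff (schur_poly v n (replicate q 1)) a"
      by (rule mcoeff_schur_eq[OF pq]) (rule n'[OF a])
    show "mcoeff (schur v \<kappa>) a = mcoeff (schur_poly v n \<kappa>) a"
      by (rule mcoeff_schur_eq[OF p]) (rule n'[OF a])
  qed
  also have "\<dots> = mcoeff (\<Sum>\<mu>\<in>vstrips q \<kappa>. schur_poly v n \<mu>) m"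
    unfolding schur_poly_pieri[OF p] e ..
  also have "\<dots> = mcoeff (\<Sum>\<mu>\<in>vstrips q \<kappa>. schur v \<mu>) m"
    unfolding mcoeff_sum
    by (rule sum.cong[OF refl]) (auto simp: vstrips_def intro!: mcoeff_schur_eq[symmetric] n dest: add_stripD)
  finally show "mcoeff (schur v (replicate q 1) * schur v \<kappa>) m = mcoeff (\<Sum>\<mu>\<in>vstrips q \<kappa>. schur v \<mu>) m" .
qed

section \<open>Reading order\<close>

definition rdle :: "box \<Rightarrow> box \<Rightarrow> bool" where
  "rdle c b \<longleftrightarrow> fst c < fst b \<or> fst c = fst b \<and> snd b \<le> snd c"

definition rdlab :: "box set \<Rightarrow> box \<Rightarrow> nat" where
  "rdlab D b = card {c \<in> D. rdle c b}"

lemma rdle_refl [simp]: "rdle b b" by (simp add: rdle_def)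

lemma rdle_trans: "rdle a b \<Longrightarrow> rdle b c \<Longrightarrow> rdle a c" by (auto simp: rdle_def)

lemma rdle_total: "rdle a b \<or> rdle b a" by (auto simp: rdle_def)

lemma rdle_antisym: "rdle a b \<Longrightarrow> rdle b a \<Longrightarrow> a = b" by (auto simp: rdle_def prod_eq_iff)

lemma rl_eq: "rl D b = (if b \<in> D then Some (rdlab D b) else None)"
  by (simp add: rl_def rdlab_def rdle_def)

lemma rdlab_less:
  assumes "finite D" "b \<in> D" "rdle c b" "c \<noteq> b"
  shows "rdlab D c < rdlab D b"
  unfolding rdlab_def
proof (rule psubset_card_mono)
  have "b \<notin> {x \<in> D. rdle x c}" using rdle_antisym assms by blast
  moreover have "b \<in> {x \<in> D. rdle x b}" using assms by simp
  moreover have "{x \<in> D. rdle x c} \<subseteq> {x \<in> D. rdle x b}" using rdle_trans assms(3) by blast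
  ultimately show "{x \<in> D. rdle x c} \<subset> {x \<in> D. rdle x b}" by blast
qed (use assms in auto)

lemma rdlab_le_iff:
  assumes "finite D" "b \<in> D" "c \<in> D"
  shows "rdlab D c \<le> rdlab D b \<longleftrightarrow> rdle c b"
  using rdlab_less[OF assms(1,2), of c] rdlab_less[OF assms(1,3), of b] rdle_total[of b c]
  by (metis le_less linorder_not_less rdle_refl)

lemma rdlab_less_iff:
  assumes "finite D" "b \<in> D" "c \<in> D"
  shows "rdlab D c < rdlab D b \<longleftrightarrow> rdle c b \<and> c \<noteq> b"
  using rdlab_le_iff[OF assms] rdlab_le_iff[OF assms(1,3,2)] rdle_antisym
  by (metis linorder_not_le rdle_total rdle_refl)

lemma rdlab_bij:
  assumes "finite D"
  shows "bij_betw (rdlab D) D {1..card D}"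
proof -
  have inj: "inj_on (rdlab D) D"
  proof (rule inj_onI)
    fix b c assume "b \<in> D" "c \<in> D" "rdlab D b = rdlab D c"
    then show "b = c" using rdlab_less_iff[OF assms, of b c] rdlab_less_iff[OF assms, of c b] rdle_total[of b c]
      by auto
  qed
  have "rdlab D ` D \<subseteq> {1..card D}"
  proof clarify
    fix b assume b: "b \<in> D"
    have "rdlab D b \<le> card D" unfolding rdlab_def by (rule card_mono) (use assms in auto)
    moreover have "b \<in> {c \<in> D. rdle c b}" "finite {c \<in> D. rdle c b}" using b assms by simp_all
    then have "card {c \<in> D. rdle c b} > 0" using card_gt_0_iff by blast
    ultimately show "rdlab D b \<in> {1..card D}" unfolding rdlab_def by auto
  qed
  moreover have "card (rdlab D ` D) = card {1..card D}" using inj by (simp add: card_image)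
  ultimately have "rdlab D ` D = {1..card D}" by (intro card_subset_eq) auto
  then show ?thesis using inj by (simp add: bij_betw_def)
qed

lemma box_of_eq:
  assumes "T b = Some k" "\<And>c. T c = Some k \<Longrightarrow> c = b"
  shows "box_of T k = b"
  unfolding box_of_def using assms by blast

lemma box_of_rl:
  assumes "finite D" "b \<in> D"
  shows "box_of (rl D) (rdlab D b) = b"
proof (rule box_of_eq)
  show "rl D b = Some (rdlab D b)" using assms by (simp add: rl_eq)
  fix c assume "rl D c = Some (rdlab D b)"
  then have "c \<in> D" "rdlab D c = rdlab D b" by (auto simp: rl_eq split: if_splits)
  then show "c = b" using rdlab_bij[OF assms(1)] assms(2) by (auto simp: bij_betw_def inj_on_def)
qed

text \<open>Convexity for the order from north-west to south-east is what the arguments use of a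
  skew shape; it frees them from its two bounding partitions.\<close>

definition skew_convex :: "box set \<Rightarrow> bool" where
  "skew_convex D \<longleftrightarrow> finite D \<and> (\<forall>(i, j)\<in>D. 1 \<le> i \<and> 1 \<le> j) \<and>
     (\<forall>i j i' j' x y. (i, j) \<in> D \<and> (i', j') \<in> D \<and> i \<le> x \<and> x \<le> i' \<and> j \<le> y \<and> y \<le> j' \<longrightarrow> (x, y) \<in> D)"

lemma skew_iff: "(i, j) \<in> skew \<alpha> \<gamma> \<longleftrightarrow> 1 \<le> i \<and> 1 \<le> j \<and> prow \<gamma> i < j \<and> j \<le> prow \<alpha> i"
  by (auto simp: skew_def diagram_prow)

lemma finite_skew [simp]: "finite (skew \<alpha> \<gamma>)" by (simp add: skew_def)

lemma skew_convex_skew: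
  assumes "is_partition \<alpha>" "is_partition \<gamma>"
  shows "skew_convex (skew \<alpha> \<gamma>)"
  unfolding skew_convex_def
proof (intro conjI allI impI)
  show "\<forall>(i, j)\<in>skew \<alpha> \<gamma>. 1 \<le> i \<and> 1 \<le> j" by (auto simp: skew_iff)
  fix i j i' j' x y
  assume "(i, j) \<in> skew \<alpha> \<gamma> \<and> (i', j') \<in> skew \<alpha> \<gamma> \<and> i \<le> x \<and> x \<le> i' \<and> j \<le> y \<and> y \<le> j'"
  then have h: "1 \<le> i" "1 \<le> j" "prow \<gamma> i < j" "j' \<le> prow \<alpha> i'" "i \<le> x" "x \<le> i'" "j \<le> y" "y \<le> j'"
    unfolding skew_iff by auto
  have "prow \<gamma> x \<le> prow \<gamma> i" "prow \<alpha> i' \<le> prow \<alpha> x"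
    using prow_antimono[OF assms(2) h(1,5)] prow_antimono[OF assms(1) _ h(6)] h by auto
  then show "(x, y) \<in> skew \<alpha> \<gamma>" using h unfolding skew_iff by linarith
qed simp

lemma skew_convexD:
  assumes "skew_convex D" "(i, j) \<in> D" "(i', j') \<in> D" "i \<le> x" "x \<le> i'" "j \<le> y" "y \<le> j'"
  shows "(x, y) \<in> D"
  using assms unfolding skew_convex_def by blast

lemma standard_mono:
  assumes "standard G T" "skew_convex G" "(a, j) \<in> G" "(a', j') \<in> G" "a \<le> a'" "j \<le> j'"
  shows "the (T (a, j)) \<le> the (T (a', j'))"
proof -
  have "(a, j') \<in> G" using skew_convexD[OF assms(2-4)] assms by auto
  moreover have "the (T (a, j)) \<le> the (T (a, j'))"
    using assms(1,3,6) \<open>(a, j') \<in> G\<close> unfolding standard_def by (cases "j = j'") (auto simp: order.strict_iff_order)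
  moreover have "the (T (a, j')) \<le> the (T (a', j'))"
    using assms(1,4,5) \<open>(a, j') \<in> G\<close> unfolding standard_def by (cases "a = a'") (auto simp: order.strict_iff_order)
  ultimately show ?thesis by simp
qed

section \<open>Remmel--Whitney tableaux as lattice fillings\<close>

text \<open>When \<open>b\<close> has just been read, row \<open>a\<close> of the partition growing
  from \<alpha> has length \<open>prow \<alpha> a + cnt D L a b\<close>.\<close>

definition cnt :: "box set \<Rightarrow> (box \<Rightarrow> nat) \<Rightarrow> nat \<Rightarrow> box \<Rightarrow> nat" where
  "cnt D L a b = card {c \<in> D. L c = a \<and> rdle c b}"

text \<open>\<open>lattice_filling D \<alpha> \<gamma> L\<close>: the filling \<open>L\<close> of \<open>D\<close> is semistandard, and adding to \<open>\<alpha>\<close> a box in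
  row \<open>L b\<close> for each \<open>b\<close> in reading order passes only through partitions and ends at \<open>\<gamma>\<close>.\<close>

definition lattice_filling :: "box set \<Rightarrow> nat list \<Rightarrow> nat list \<Rightarrow> (box \<Rightarrow> nat) \<Rightarrow> bool" where
  "lattice_filling D \<alpha> \<gamma> L \<longleftrightarrow> (\<forall>b. b \<notin> D \<longrightarrow> L b = 0) \<and> (\<forall>b\<in>D. 1 \<le> L b) \<and>
     (\<forall>i j. (i, j) \<in> D \<and> (i, Suc j) \<in> D \<longrightarrow> L (i, j) \<le> L (i, Suc j)) \<and>
     (\<forall>i j. (i, j) \<in> D \<and> (Suc i, j) \<in> D \<longrightarrow> L (i, j) < L (Suc i, j)) \<and>
     (\<forall>b\<in>D. \<forall>a\<ge>1. L b = Suc a \<longrightarrow> prow \<alpha> (Suc a) + cnt D L (Suc a) b \<le> prow \<alpha> a + cnt D L a b) \<and>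
     (\<forall>a\<ge>1. prow \<gamma> a = prow \<alpha> a + card {c \<in> D. L c = a})"

lemma lattice_fillingD:
  assumes "lattice_filling D \<alpha> \<gamma> L"
  shows "\<And>b. b \<notin> D \<Longrightarrow> L b = 0" "\<And>b. b \<in> D \<Longrightarrow> 1 \<le> L b"
    "\<And>i j. (i, j) \<in> D \<Longrightarrow> (i, Suc j) \<in> D \<Longrightarrow> L (i, j) \<le> L (i, Suc j)"
    "\<And>i j. (i, j) \<in> D \<Longrightarrow> (Suc i, j) \<in> D \<Longrightarrow> L (i, j) < L (Suc i, j)"
    "\<And>b a. b \<in> D \<Longrightarrow> 1 \<le> a \<Longrightarrow> L b = Suc a \<Longrightarrow>
        prow \<alpha> (Suc a) + cnt D L (Suc a) b \<le> prow \<alpha> a + cnt D L a b"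
    "\<And>a. 1 \<le> a \<Longrightarrow> prow \<gamma> a = prow \<alpha> a + card {c \<in> D. L c = a}"
  using assms unfolding lattice_filling_def by blast+

lemma row_weak_mono:
  assumes "skew_convex D" and r: "\<And>i j. (i, j) \<in> D \<Longrightarrow> (i, Suc j) \<in> D \<Longrightarrow> L (i, j) \<le> (L (i, Suc j) :: nat)"
    and "(i, j) \<in> D" "(i, j') \<in> D" "j \<le> j'"
  shows "L (i, j) \<le> L (i, j')"
  using assms(5,4)
proof (induction j' rule: dec_induct)
  case (step n)
  have "(i, n) \<in> D" using skew_convexD[OF assms(1,3) step.prems] step by auto
  then show ?case using step r[of i n] by fastforce
qed simp

lemma col_strict_mono:
  assumes "skew_convex D" and r: "\<And>i j. (i, j) \<in> D \<Longrightarrow> (Suc i, j) \<in> D \<Longrightarrow> L (i, j) < (L (Suc i, j) :: nat)"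
    and "(i, j) \<in> D" "(i', j) \<in> D" "i \<le> i'"
  shows "L (i, j) + (i' - i) \<le> L (i', j)"
  using assms(5,4)
proof (induction i' rule: dec_induct)
  case (step n)
  have "(n, j) \<in> D" using skew_convexD[OF assms(1,3) step.prems] step by auto
  then show ?case using step r[of n j] by fastforce
qed simp

lemma cnt_mono: "finite D \<Longrightarrow> rdle b c \<Longrightarrow> cnt D L a b \<le> cnt D L a c"
  unfolding cnt_def by (rule card_mono) (auto intro: rdle_trans)

lemma cnt_less:
  assumes "finite D" "c \<in> D" "L c = a" "rdle b c" "b \<noteq> c"
  shows "cnt D L a b < cnt D L a c"
  unfolding cnt_def
proof (rule psubset_card_mono)
  have "c \<notin> {x \<in> D. L x = a \<and> rdle x b}" using rdle_antisym assms by blast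
  moreover have "c \<in> {x \<in> D. L x = a \<and> rdle x c}" using assms by simp
  moreover have "{x \<in> D. L x = a \<and> rdle x b} \<subseteq> {x \<in> D. L x = a \<and> rdle x c}" using rdle_trans assms(4) by blast
  ultimately show "{x \<in> D. L x = a \<and> rdle x b} \<subset> {x \<in> D. L x = a \<and> rdle x c}" by blast
qed (use assms in auto)

lemma last_in_prefix:
  assumes "finite D" "c0 \<in> D" "P c0" "rdle c0 b"
  obtains c where "c \<in> D" "P c" "rdle c b" "\<And>x. x \<in> D \<Longrightarrow> P x \<Longrightarrow> rdle x b \<Longrightarrow> rdle x c"
proof -
  define S where "S = {x \<in> D. P x \<and> rdle x b}"
  have "finite S" using assms by (simp add: S_def)
  moreover have "c0 \<in> S" using assms by (simp add: S_def)
  ultimately have "finite S" "S \<noteq> {}" by blast+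
  then have "Max (rdlab D ` S) \<in> rdlab D ` S" by (intro Max_in) auto
  then obtain c where c: "c \<in> S" "rdlab D c = Max (rdlab D ` S)" by (metis imageE)
  have "rdle x c" if "x \<in> S" for x
  proof -
    have "rdlab D x \<le> rdlab D c" using c \<open>finite S\<close> that by simp
    then show ?thesis using rdlab_le_iff[OF assms(1), of c x] c that by (auto simp: S_def)
  qed
  then show thesis using that[of c] c by (auto simp: S_def)
qed

text \<open>Only reading an entry \<open>Suc a\<close> can endanger this inequality, so its truth at
  the last such entry read so far carries over to any box.\<close>

lemma lattice_anywhere_Suc:
  assumes "lattice_filling D \<alpha> \<gamma> L" "finite D" "is_partition \<alpha>" "1 \<le> a"
  shows "prow \<alpha> (Suc a) + cnt D L (Suc a) b \<le> prow \<alpha> a + cnt D L a b"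
proof (cases "\<exists>c\<in>D. L c = Suc a \<and> rdle c b")
  case True
  then obtain c0 where "c0 \<in> D" "L c0 = Suc a" "rdle c0 b" by blast
  then obtain c where c: "c \<in> D" "L c = Suc a" "rdle c b"
    "\<And>x. x \<in> D \<Longrightarrow> L x = Suc a \<Longrightarrow> rdle x b \<Longrightarrow> rdle x c"
    using last_in_prefix[OF assms(2), of c0 "\<lambda>x. L x = Suc a" b] by blast
  have "{x \<in> D. L x = Suc a \<and> rdle x b} = {x \<in> D. L x = Suc a \<and> rdle x c}"
    using c rdle_trans by blast
  then have "cnt D L (Suc a) b = cnt D L (Suc a) c" by (simp add: cnt_def)
  then show ?thesis
    using lattice_fillingD(5)[OF assms(1) c(1) assms(4) c(2)] cnt_mono[OF assms(2) c(3), of L a] by simp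
next
  case False
  then have "{x \<in> D. L x = Suc a \<and> rdle x b} = {}" by blast
  then have "cnt D L (Suc a) b = 0" unfolding cnt_def by (metis card.empty)
  then show ?thesis using prow_Suc_le[OF assms(3,4)] by simp
qed

lemma lattice_anywhere:
  assumes "lattice_filling D \<alpha> \<gamma> L" "finite D" "is_partition \<alpha>" "1 \<le> a" "a \<le> a'"
  shows "prow \<alpha> a' + cnt D L a' b \<le> prow \<alpha> a + cnt D L a b"
  using assms(5)
proof (induction a' rule: dec_induct)
  case (step n)
  then show ?case using lattice_anywhere_Suc[OF assms(1-3), of n b] assms(4) by simp
qed simp

text \<open>The value 0 off \<open>D\<close> makes the filling a canonical total function, so that
  fillings can be compared and summed over.\<close>

definition filling_of :: "box set \<Rightarrow> tableau \<Rightarrow> box \<Rightarrow> nat" where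
  "filling_of D T b = (if b \<in> D then row_of T (rdlab D b) else 0)"

text \<open>\<open>F\<close> below is the picture (in the sense of Zelevinsky) encoded by \<open>T\<close>.\<close>

lemma picture_of_standard:
  assumes st: "standard G T" and fD: "finite D" and cGD: "card G = card D"
    and F: "F = (\<lambda>b. box_of T (rdlab D b))"
  shows "bij_betw F D G" "\<And>b. b \<in> D \<Longrightarrow> T (F b) = Some (rdlab D b)"
    "\<And>b. b \<in> D \<Longrightarrow> filling_of D T b = fst (F b)"
proof -
  have dT: "dom T = G" and bT: "bij_betw (the \<circ> T) G {1..card D}"
    using st cGD by (auto simp: standard_def)
  have TF: "F b \<in> G \<and> T (F b) = Some (rdlab D b)" if b: "b \<in> D" for b
  proof -
    have "rdlab D b \<in> {1..card D}" using rdlab_bij[OF fD] b by (auto simp: bij_betw_def)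
    then have "rdlab D b \<in> (the \<circ> T) ` G" using bT unfolding bij_betw_def by simp
    then obtain g where g: "g \<in> G" "the (T g) = rdlab D b" by (auto simp del: split_paired_Ex)
    have Tg: "T g = Some (rdlab D b)" using g dT by auto
    have "box_of T (rdlab D b) = g"
    proof (rule box_of_eq[where T = T and b = g, OF Tg])
      fix c assume c: "T c = Some (rdlab D b)"
      then have "c \<in> G" using dT by auto
      then show "c = g" using bT g c by (auto simp: bij_betw_def inj_on_def)
    qed
    then show ?thesis using g(1) Tg F by simp
  qed
  then show "\<And>b. b \<in> D \<Longrightarrow> T (F b) = Some (rdlab D b)" by blast
  show "bij_betw F D G"
  proof (rule bij_betw_imageI)
    show "inj_on F D"
    proof (rule inj_onI)
      fix b c assume bc: "b \<in> D" "c \<in> D" "F b = F c"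
      then have "rdlab D b = rdlab D c" using TF by (metis option.inject)
      then show "b = c" using rdlab_bij[OF fD] bc by (auto simp: bij_betw_def inj_on_def)
    qed
    show "F ` D = G"
    proof
      show "F ` D \<subseteq> G" using TF by auto
      show "G \<subseteq> F ` D"
      proof
        fix g assume g: "g \<in> G"
        then have "the (T g) \<in> {1..card D}" using bT by (auto simp: bij_betw_def)
        then obtain b where b: "b \<in> D" "rdlab D b = the (T g)"
          using rdlab_bij[OF fD] unfolding bij_betw_def by (metis imageE)
        have "F b \<in> G" "the (T (F b)) = the (T g)" using TF[OF b(1)] b(2) by auto
        then have "F b = g" using bT g by (auto simp: bij_betw_def inj_on_def)
        then show "g \<in> F ` D" using b by blast
      qed
    qed
  qed
  show "\<And>b. b \<in> D \<Longrightarrow> filling_of D T b = fst (F b)" by (simp add: filling_of_def F)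
qed

text \<open>\<open>T\<close> increases along rows, so the entries \<open>a\<close> met in reading
  order occupy row \<open>a\<close> of \<gamma>/\<alpha> from left to right without gaps. The
  filling alone thus determines the whole picture.\<close>

lemma picture_column:
  assumes st: "standard (skew \<gamma> \<alpha>) T" and fD: "finite D" and cGD: "card (skew \<gamma> \<alpha>) = card D"
    and F: "F = (\<lambda>b. box_of T (rdlab D b))" and b: "b \<in> D"
  shows "F b = (filling_of D T b, prow \<alpha> (filling_of D T b) + cnt D (filling_of D T) (filling_of D T b) b)"
proof -
  note p = picture_of_standard[OF st fD cGD F]
  define a j where "a = fst (F b)" and "j = snd (F b)"
  have Fb: "F b = (a, j)" by (simp add: a_def j_def)
  have bG: "(a, j) \<in> skew \<gamma> \<alpha>" using p(1) b Fb by (metis bij_betwE)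
  have La: "filling_of D T b = a" using p(3)[OF b] a_def by simp
  define S where "S = {c \<in> D. filling_of D T c = a \<and> rdle c b}"
  have "bij_betw (\<lambda>c. snd (F c)) S {prow \<alpha> a<..j}"
  proof (rule bij_betw_imageI)
    show "inj_on (\<lambda>c. snd (F c)) S"
    proof (rule inj_onI)
      fix c d assume cd: "c \<in> S" "d \<in> S" "snd (F c) = snd (F d)"
      then have "fst (F c) = fst (F d)" using p(3)[of c] p(3)[of d] by (simp add: S_def)
      then have "F c = F d" using cd by (simp add: prod_eq_iff)
      then show "c = d" using p(1) cd by (auto simp: S_def bij_betw_def inj_on_def)
    qed
    have rowT: "the (T (a, x)) < the (T (a, y))" if "(a, x) \<in> skew \<gamma> \<alpha>" "(a, y) \<in> skew \<gamma> \<alpha>" "x < y" for x y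
      using st that unfolding standard_def by blast
    show "(\<lambda>c. snd (F c)) ` S = {prow \<alpha> a<..j}"
    proof
      show "(\<lambda>c. snd (F c)) ` S \<subseteq> {prow \<alpha> a<..j}"
      proof clarify
        fix c assume c: "c \<in> S"
        then have cD: "c \<in> D" "fst (F c) = a" "rdle c b" using p(3)[of c] by (simp_all add: S_def)
        then have cG: "(a, snd (F c)) \<in> skew \<gamma> \<alpha>" using p(1) by (metis bij_betwE prod.collapse)
        have "snd (F c) \<le> j"
        proof (rule ccontr)
          assume "\<not> snd (F c) \<le> j"
          then have "the (T (F b)) < the (T (F c))" using rowT[OF bG cG] Fb cD(2) by (metis linorder_not_le prod.collapse)
          then have "rdlab D b < rdlab D c" using p(2) b cD by simp
          then show False using rdlab_le_iff[OF fD b cD(1)] cD(3) by simp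
        qed
        then show "snd (F c) \<in> {prow \<alpha> a<..j}" using cG by (simp add: skew_iff)
      qed
      show "{prow \<alpha> a<..j} \<subseteq> (\<lambda>c. snd (F c)) ` S"
      proof
        fix x assume x: "x \<in> {prow \<alpha> a<..j}"
        then have xG: "(a, x) \<in> skew \<gamma> \<alpha>" using bG by (auto simp: skew_iff)
        then obtain c where c: "c \<in> D" "F c = (a, x)" using p(1) unfolding bij_betw_def by (metis imageE)
        have "the (T (a, x)) \<le> the (T (a, j))" using rowT[OF xG bG] x by (cases "x = j") auto
        then have "rdlab D c \<le> rdlab D b" using p(2)[OF b] p(2)[OF c(1)] c(2) Fb by simp
        then have "c \<in> S" using rdlab_le_iff[OF fD b c(1)] c p(3) by (simp add: S_def)
        then show "x \<in> (\<lambda>c. snd (F c)) ` S" using c by (metis image_eqI snd_conv)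
      qed
    qed
  qed
  then have "card S = j - prow \<alpha> a" using bij_betw_same_card by fastforce
  then have "j = prow \<alpha> a + card S" using bG by (simp add: skew_iff)
  then show ?thesis unfolding La Fb cnt_def S_def by simp
qed


text \<open>The row conditions of \<open>RW\<close> become weak increase along rows and strict
  increase down columns. The lattice inequality expresses the column condition of \<open>T\<close>:
  a box in row a + 1 is filled only after the one above it in row a.\<close>

lemma RW_imp_lattice_filling:
  assumes pa: "is_partition \<alpha>" and pg: "is_partition \<gamma>" and sub: "diagram \<alpha> \<subseteq> diagram \<gamma>"
    and D: "skew_convex D" and T: "T \<in> RW (skew \<gamma> \<alpha>) D"
  shows "lattice_filling D \<alpha> \<gamma> (filling_of D T)"
proof -
  have fD: "finite D" using D by (simp add: skew_convex_def)
  define F where "F = (\<lambda>b. box_of T (rdlab D b))"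
  define L where "L = filling_of D T"
  have st: "standard (skew \<gamma> \<alpha>) T" and cGD: "card (skew \<gamma> \<alpha>) = card D" using T by (auto simp: RW_def)
  have rowc: "row_of T (k + 1) \<le> row_of T k"
    if "1 \<le> k" "k + 1 \<le> card D" "row_of (rl D) k = row_of (rl D) (k + 1)" for k
    using T that unfolding RW_def by blast
  have colc: "row_of T k < row_of T l"
    if "k \<in> {1..card D}" "l \<in> {1..card D}" "row_of (rl D) l = row_of (rl D) k + 1" "col_of (rl D) l = col_of (rl D) k" for k l
    using T that unfolding RW_def by blast
  note p = picture_of_standard[OF st fD cGD F_def, folded L_def]
  note pc = picture_column[OF st fD cGD F_def, folded L_def]
  have rng: "rdlab D b \<in> {1..card D}" if "b \<in> D" for b using rdlab_bij[OF fD] that by (auto simp: bij_betw_def)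
  have Lrow: "L b = row_of T (rdlab D b)" if "b \<in> D" for b using that by (simp add: L_def filling_of_def)
  have FG: "F b \<in> skew \<gamma> \<alpha>" if "b \<in> D" for b using p(1) that by (metis bij_betwE)
  have Lpos: "1 \<le> L b" if "b \<in> D" for b
    using FG[OF that] p(3)[OF that] by (metis prod.collapse skew_iff)
  have rows: "L (i, j) \<le> L (i, Suc j)" if ij: "(i, j) \<in> D" "(i, Suc j) \<in> D" for i j
  proof -
    \<comment> \<open>Rows are read from right to left, so the right neighbour has the preceding
      label.\<close>
    have "{c \<in> D. rdle c (i, j)} = insert (i, j) {c \<in> D. rdle c (i, Suc j)}"
      using ij by (auto simp: rdle_def)
    moreover have "(i, j) \<notin> {c \<in> D. rdle c (i, Suc j)}" by (auto simp: rdle_def)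
    ultimately have e: "rdlab D (i, j) = rdlab D (i, Suc j) + 1" using fD by (simp add: rdlab_def)
    show ?thesis
      using rowc[of "rdlab D (i, Suc j)"] rng[OF ij(1)] rng[OF ij(2)] e Lrow ij box_of_rl[OF fD] by force
  qed
  have cols: "L (i, j) < L (Suc i, j)" if ij: "(i, j) \<in> D" "(Suc i, j) \<in> D" for i j
    using colc[OF rng[OF ij(1)] rng[OF ij(2)]] Lrow ij box_of_rl[OF fD] by force
  have lat: "prow \<alpha> (Suc a) + cnt D L (Suc a) b \<le> prow \<alpha> a + cnt D L a b"
    if b: "b \<in> D" "1 \<le> a" "L b = Suc a" for a b
  proof (rule ccontr)
    define j where "j = prow \<alpha> (Suc a) + cnt D L (Suc a) b"
    assume "\<not> ?thesis"
    then have j: "prow \<alpha> a + cnt D L a b < j" by (simp add: j_def)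
    have Fb: "F b = (Suc a, j)" using pc[OF b(1)] b(3) by (simp add: j_def)
    have bG: "(Suc a, j) \<in> skew \<gamma> \<alpha>" using FG[OF b(1)] Fb by simp
    \<comment> \<open>The box above lies inside \<gamma>, a partition, and outside \<alpha>, because
      row a has not reached column j. \<open>T\<close> gives it a smaller label, so it should
      already have been counted.\<close>
    then have aG: "(a, j) \<in> skew \<gamma> \<alpha>" using j b(2) prow_Suc_le[OF pg b(2)] by (auto simp: skew_iff)
    then obtain c where c: "c \<in> D" "F c = (a, j)" using p(1) unfolding bij_betw_def by (metis imageE)
    have Lc: "L c = a" using p(3)[OF c(1)] c(2) by simp
    have "the (T (a, j)) \<le> the (T (Suc a, j))"
      using standard_mono[OF st skew_convex_skew[OF pg pa] aG bG] by simp
    then have "rdlab D c \<le> rdlab D b" using p(2)[OF b(1)] p(2)[OF c(1)] Fb c(2) by simp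
    then have "rdle c b" using rdlab_le_iff[OF fD b(1) c(1)] by simp
    then have "cnt D L a c \<le> cnt D L a b" by (rule cnt_mono[OF fD])
    moreover have "j = prow \<alpha> a + cnt D L a c" using pc[OF c(1)] c(2) Lc by simp
    ultimately show False using j by simp
  qed
  have cont: "prow \<gamma> a = prow \<alpha> a + card {c \<in> D. L c = a}" if a: "1 \<le> a" for a
  proof -
    have im: "F ` {c \<in> D. L c = a} = {a} \<times> {prow \<alpha> a<..prow \<gamma> a}"
    proof
      show "F ` {c \<in> D. L c = a} \<subseteq> {a} \<times> {prow \<alpha> a<..prow \<gamma> a}"
      proof
        fix g assume "g \<in> F ` {c \<in> D. L c = a}"
        then obtain c where c: "c \<in> D" "L c = a" "g = F c" by blast
        obtain x y where xy: "F c = (x, y)" by (cases "F c")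
        have "x = a" using p(3)[OF c(1)] c(2) xy by simp
        moreover have "(x, y) \<in> skew \<gamma> \<alpha>" using FG[OF c(1)] xy by simp
        ultimately show "g \<in> {a} \<times> {prow \<alpha> a<..prow \<gamma> a}"
          using c xy by (simp add: skew_iff)
      qed
      show "{a} \<times> {prow \<alpha> a<..prow \<gamma> a} \<subseteq> F ` {c \<in> D. L c = a}"
      proof clarify
        fix y assume "y \<in> {prow \<alpha> a<..prow \<gamma> a}"
        then have "(a, y) \<in> skew \<gamma> \<alpha>" using a by (auto simp: skew_iff)
        then obtain c where c: "c \<in> D" "F c = (a, y)" using p(1) unfolding bij_betw_def by (metis imageE)
        then have "L c = a" using p(3) by simp
        then show "(a, y) \<in> F ` {c \<in> D. L c = a}" using c by (intro image_eqI[of _ _ c]) auto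
      qed
    qed
    have inj: "inj_on F {c \<in> D. L c = a}" using p(1) by (auto simp: bij_betw_def inj_on_def)
    have "card {c \<in> D. L c = a} = card ({a} \<times> {prow \<alpha> a<..prow \<gamma> a})"
      using card_image[OF inj] im by simp
    moreover have "prow \<alpha> a \<le> prow \<gamma> a" using sub a by (simp add: diagram_subset_iff)
    ultimately show ?thesis by (simp add: card_cartesian_product)
  qed
  show ?thesis
    unfolding lattice_filling_def L_def[symmetric]
  proof (intro conjI)
    show "\<forall>b. b \<notin> D \<longrightarrow> L b = 0" by (simp add: L_def filling_of_def)
  qed (use Lpos rows cols lat cont in blast)+
qed

lemma filling_of_inj:
  assumes fD: "finite D" and T: "T \<in> RW (skew \<gamma> \<alpha>) D" and T': "T' \<in> RW (skew \<gamma> \<alpha>) D"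
    and e: "filling_of D T = filling_of D T'"
  shows "T = T'"
proof -
  have st: "standard (skew \<gamma> \<alpha>) T" "standard (skew \<gamma> \<alpha>) T'" and cGD: "card (skew \<gamma> \<alpha>) = card D"
    using T T' by (auto simp: RW_def)
  define F where "F = (\<lambda>b. box_of T (rdlab D b))"
  define F' where "F' = (\<lambda>b. box_of T' (rdlab D b))"
  note p = picture_of_standard[OF st(1) fD cGD F_def] and p' = picture_of_standard[OF st(2) fD cGD F'_def]
  have FF: "F b = F' b" if "b \<in> D" for b
    using picture_column[OF st(1) fD cGD F_def that] picture_column[OF st(2) fD cGD F'_def that] e by simp
  show ?thesis
  proof (rule ext)
    fix g show "T g = T' g"
    proof (cases "g \<in> skew \<gamma> \<alpha>")
      case True
      then obtain b where b: "b \<in> D" "F b = g" using p(1) unfolding bij_betw_def by (metis imageE)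
      then show ?thesis using p(2)[OF b(1)] p'(2)[OF b(1)] FF[OF b(1)] by simp
    next
      case False
      moreover have "dom T = skew \<gamma> \<alpha>" "dom T' = skew \<gamma> \<alpha>" using st by (simp_all add: standard_def)
      ultimately have "T g = None" "T' g = None" by (metis domIff)+
      then show ?thesis by simp
    qed
  qed
qed

text \<open>\<open>T\<close> is rebuilt from the position formula of \<open>picture_column\<close>.
  The filling records rows only; the column conditions of \<open>RW\<close> are recovered from the
  fact that boxes further south-east in \<gamma>/\<alpha> are read later.\<close>

lemma lattice_filling_imp_RW:
  assumes pa: "is_partition \<alpha>" and pg: "is_partition \<gamma>"
    and D: "skew_convex D" and L: "lattice_filling D \<alpha> \<gamma> L"
  shows "\<exists>T \<in> RW (skew \<gamma> \<alpha>) D. filling_of D T = L"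
proof -
  have fD: "finite D" using D by (simp add: skew_convex_def)
  note l = lattice_fillingD[OF L]
  define G where "G = skew \<gamma> \<alpha>"
  have G: "skew_convex G" using skew_convex_skew[OF pg pa] by (simp add: G_def)
  define F where "F = (\<lambda>b. (L b, prow \<alpha> (L b) + cnt D L (L b) b))"
  have rng: "rdlab D b \<in> {1..card D}" if "b \<in> D" for b using rdlab_bij[OF fD] that by (auto simp: bij_betw_def)
  have cnt_lt: "cnt D L (L c) c < cnt D L (L b) b" if "b \<in> D" "c \<in> D" "L b = L c" "rdlab D c < rdlab D b" for b c
    using cnt_less[OF fD that(1), of L "L b" c] rdlab_less_iff[OF fD that(1,2)] that by simp
  have inj: "inj_on F D"
  proof (rule inj_onI)
    fix b c assume bc: "b \<in> D" "c \<in> D" "F b = F c"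
    then have "L b = L c" "cnt D L (L b) b = cnt D L (L c) c" by (auto simp: F_def)
    then have "rdlab D b = rdlab D c" using cnt_lt[of b c] cnt_lt[of c b] bc by (metis less_irrefl linorder_neqE_nat)
    then show "b = c" using rdlab_bij[OF fD] bc by (auto simp: bij_betw_def inj_on_def)
  qed
  have cnt1: "1 \<le> cnt D L (L b) b \<and> cnt D L (L b) b \<le> card {c \<in> D. L c = L b}" if "b \<in> D" for b
  proof -
    have "b \<in> {c \<in> D. L c = L b \<and> rdle c b}" using that by simp
    then have "card {c \<in> D. L c = L b \<and> rdle c b} > 0" using fD card_gt_0_iff by fastforce
    moreover have "cnt D L (L b) b \<le> card {c \<in> D. L c = L b}"
      unfolding cnt_def by (rule card_mono) (use fD in auto)
    ultimately show ?thesis by (simp add: cnt_def)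
  qed
  have FG: "F b \<in> G" if "b \<in> D" for b
    using l(2)[OF that] cnt1[OF that] l(6)[OF l(2)[OF that]] by (simp add: F_def G_def skew_iff)
  have bij: "bij_betw F D G"
  proof (rule bij_betw_imageI[OF inj])
    show "F ` D = G"
    proof
      show "F ` D \<subseteq> G" using FG by auto
      show "G \<subseteq> F ` D"
      proof
        fix g assume g: "g \<in> G"
        obtain a j where aj: "g = (a, j)" by (cases g)
        have h: "1 \<le> a" "prow \<alpha> a < j" "j \<le> prow \<gamma> a" using g aj by (auto simp: G_def skew_iff)
        define S where "S = {c \<in> D. L c = a}"
        have "inj_on (\<lambda>c. cnt D L a c) S"
        proof (rule inj_onI)
          fix b c assume "b \<in> S" "c \<in> S" "cnt D L a b = cnt D L a c"
          then show "b = c" using inj by (auto simp: S_def inj_on_def F_def)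
        qed
        moreover have "(\<lambda>c. cnt D L a c) ` S \<subseteq> {1..card S}" using cnt1 by (auto simp: S_def)
        ultimately have "(\<lambda>c. cnt D L a c) ` S = {1..card S}"
          by (intro card_subset_eq) (auto simp: card_image)
        moreover have "j - prow \<alpha> a \<in> {1..card S}" using h l(6)[OF h(1)] by (auto simp: S_def)
        ultimately obtain c where c: "c \<in> S" "j - prow \<alpha> a = cnt D L a c" by (metis imageE)
        then have "F c = g" using h aj by (auto simp: S_def F_def)
        then show "g \<in> F ` D" using c by (auto simp: S_def)
      qed
    qed
  qed
  have cGD: "card G = card D" using bij bij_betw_same_card by metis
  define T where "T = (\<lambda>g. if g \<in> G then Some (rdlab D (inv_into D F g)) else None)"
  have TF: "T (F b) = Some (rdlab D b)" if "b \<in> D" for b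
    using FG[OF that] inv_into_f_f[OF inj that] by (simp add: T_def)
  have exF: "\<exists>b\<in>D. F b = g" if "g \<in> G" for g
    using bij that unfolding bij_betw_def by (metis imageE)
  have boxF: "box_of T (rdlab D b) = F b" if b: "b \<in> D" for b
  proof (rule box_of_eq[where T = T and b = "F b", OF TF[OF b]])
    fix g assume g: "T g = Some (rdlab D b)"
    then have "g \<in> G" by (simp add: T_def split: if_splits)
    then obtain c where c: "c \<in> D" "F c = g" using exF by blast
    then have "rdlab D c = rdlab D b" using TF[OF c(1)] g by simp
    then have "c = b" using rdlab_bij[OF fD] b c by (auto simp: bij_betw_def inj_on_def)
    then show "g = F b" using c by simp
  qed
  have st: "standard G T"
    unfolding standard_def
  proof (intro conjI allI impI)
    show "dom T = G" by (auto simp: T_def split: if_splits)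
    have "bij_betw (rdlab D \<circ> inv_into D F) G {1..card D}"
      using bij_betw_inv_into[OF bij] rdlab_bij[OF fD] by (rule bij_betw_trans)
    then show "bij_betw (the \<circ> T) G {1..card G}"
      unfolding cGD by (rule bij_betw_cong[THEN iffD1, rotated]) (simp add: T_def)
  next
    fix a j j' assume h: "(a, j) \<in> G \<and> (a, j') \<in> G \<and> j < j'"
    obtain b where b: "b \<in> D" "F b = (a, j)" using h exF by blast
    obtain b' where b': "b' \<in> D" "F b' = (a, j')" using h exF by blast
    have "L b = L b'" "cnt D L (L b) b < cnt D L (L b') b'" using b b' h by (auto simp: F_def)
    then have "\<not> rdle b' b" using cnt_mono[OF fD, of b' b L "L b"] by fastforce
    then have "rdlab D b < rdlab D b'" using rdlab_le_iff[OF fD b(1) b'(1)] by simp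
    then show "the (T (a, j)) < the (T (a, j'))" using TF b b' by (metis option.sel)
  next
    fix a a' j assume h: "(a, j) \<in> G \<and> (a', j) \<in> G \<and> a < a'"
    obtain b where b: "b \<in> D" "F b = (a, j)" using h exF by blast
    obtain b' where b': "b' \<in> D" "F b' = (a', j)" using h exF by blast
    have Lb: "L b = a" "L b' = a'" using b b' by (auto simp: F_def)
    have j: "j = prow \<alpha> a + cnt D L a b" "j = prow \<alpha> a' + cnt D L a' b'" using b b' by (auto simp: F_def)
    \<comment> \<open>When \<open>b'\<close> is read, row a is at least as long as row a' and has
      thus reached column j: the box (a, j) was filled before.\<close>
    have "prow \<alpha> a' + cnt D L a' b' \<le> prow \<alpha> a + cnt D L a b'"
      using lattice_anywhere[OF L fD pa l(2)[OF b(1)], of a' b'] Lb h by simp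
    then have "cnt D L a b \<le> cnt D L a b'" using j by linarith
    moreover have "b \<noteq> b'" using Lb h by auto
    ultimately have "\<not> rdle b' b" using cnt_less[where L = L, OF fD b(1) Lb(1), of b'] by auto
    then have "rdlab D b < rdlab D b'" using rdlab_le_iff[OF fD b(1) b'(1)] by simp
    then show "the (T (a, j)) < the (T (a', j))" using TF b b' by (metis option.sel)
  qed
  have nw: "rdle b c" if "b \<in> D" "c \<in> D" "fst (F b) \<le> fst (F c)" "snd (F b) \<le> snd (F c)" for b c
  proof -
    have "(fst (F b), snd (F b)) \<in> G" "(fst (F c), snd (F c)) \<in> G" using FG that by auto
    from standard_mono[OF st G this that(3,4)] have "rdlab D b \<le> rdlab D c" using TF that by simp
    then show ?thesis using rdlab_le_iff[OF fD that(2,1)] by simp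
  qed
  have rowl: "snd (F (x, y)) < snd (F (x, y')) \<and> L (x, y') \<le> L (x, y)"
    if h: "(x, y') \<in> D" "(x, y) \<in> D" "y' < y" for x y y'
  proof -
    have le: "L (x, y') \<le> L (x, y)" using row_weak_mono[where L = L, OF D l(3)] h by simp
    have "\<not> rdle (x, y') (x, y)" using h by (auto simp: rdle_def)
    then have "\<not> snd (F (x, y')) \<le> snd (F (x, y))" using nw[OF h(1,2)] le by (auto simp: F_def)
    then show ?thesis using le by simp
  qed
  \<comment> \<open>Suppose the lower box went strictly further right than the upper one, which is
    in column d. The box in the row of the lower image and in column d lies between both images, so
    it was read between them: either in row x weakly left of y, where entries are too small, or in
    row x + 1 right of y. There the claim for its column, known by induction from the right, puts it
    strictly left of d.\<close>
  have coll: "snd (F (Suc x, y)) \<le> snd (F (x, y))" if h: "(x, y) \<in> D" "(Suc x, y) \<in> D" for x y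
  proof -
    obtain M where M: "\<And>x y. (x, y) \<in> D \<Longrightarrow> y \<le> M"
    proof -
      have "finite (snd ` D)" using fD by simp
      then obtain M where "\<forall>y\<in>snd ` D. y \<le> M" using finite_nat_set_iff_bounded_le by auto
      then show thesis using that by force
    qed
    show ?thesis using h
    proof (induction "M - y" arbitrary: y rule: less_induct)
      case less
      show ?case
      proof (rule ccontr)
        assume n: "\<not> ?case"
        define d where "d = snd (F (x, y))"
        define a' where "a' = L (Suc x, y)"
        have lt: "L (x, y) < a'" using l(4)[OF less.prems] by (simp add: a'_def)
        have "F (x, y) = (L (x, y), d)" "F (Suc x, y) = (a', snd (F (Suc x, y)))"
          by (auto simp: F_def d_def a'_def)
        then have g: "(L (x, y), d) \<in> G" "(a', snd (F (Suc x, y))) \<in> G"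
          using FG[OF less.prems(1)] FG[OF less.prems(2)] by simp_all
        have "(a', d) \<in> G" using skew_convexD[OF G g, of a' d] n lt by (simp add: d_def)
        then obtain e where e: "e \<in> D" "F e = (a', d)" using exF by blast
        have Le: "L e = a'" using e by (simp add: F_def)
        have r1: "rdle (x, y) e" using nw[OF less.prems(1) e(1)] lt unfolding e(2) by (simp add: F_def d_def)
        have r2: "rdle e (Suc x, y)" 
        proof (rule nw[OF e(1) less.prems(2)])
          show "fst (F e) \<le> fst (F (Suc x, y))" unfolding e(2) by (simp add: F_def a'_def)
          show "snd (F e) \<le> snd (F (Suc x, y))" unfolding e(2) using n by (simp add: d_def)
        qed
        obtain u q where uq: "e = (u, q)" by (cases e)
        have "e \<noteq> (Suc x, y)" using e(2) n by (auto simp: d_def)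
        then consider "u = x" "q \<le> y" | "u = Suc x" "q > y"
          using r1 r2 uq by (auto simp: rdle_def)
        then show False
        proof cases
          case 1
          then have "L (x, q) \<le> L (x, y)" using rowl[of x q y] less.prems(1) e(1) uq by (cases "q = y") auto
          then show False using Le uq 1 lt by simp
        next
          case 2
          have qD: "(x, q) \<in> D" using skew_convexD[OF D less.prems(1), of "Suc x" q x q] e(1) uq 2 by simp
          have qM: "q \<le> M" using M e(1) uq by blast
          have "snd (F (Suc x, q)) \<le> snd (F (x, q))"
            using less.hyps[of q] qD e(1) uq 2 qM by simp
          moreover have "snd (F (x, q)) < d" using rowl[OF less.prems(1) qD] 2 by (simp add: d_def)
          ultimately show False using e(2) uq 2 by simp
        qed
      qed
    qed
  qed
  have rlbox: "\<exists>b\<in>D. rdlab D b = k \<and> box_of (rl D) k = b \<and> box_of T k = F b" if k: "k \<in> {1..card D}" for k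
  proof -
    obtain b where "b \<in> D" "rdlab D b = k" using rdlab_bij[OF fD] k unfolding bij_betw_def by (metis imageE)
    then show ?thesis using box_of_rl[OF fD] boxF by blast
  qed
  have "T \<in> RW G D"
    unfolding RW_def
  proof (intro CollectI conjI allI ballI impI)
    show "standard G T" "card G = card D" by fact+
  next
    fix k assume h: "1 \<le> k \<and> k + 1 \<le> card D \<and> row_of (rl D) k = row_of (rl D) (k + 1)"
    have kk: "k \<in> {1..card D}" "k + 1 \<in> {1..card D}" using h by auto
    obtain b where b: "b \<in> D" "rdlab D b = k" "box_of (rl D) k = b" "box_of T k = F b"
      using rlbox[OF kk(1)] by blast
    obtain c where c: "c \<in> D" "rdlab D c = k + 1" "box_of (rl D) (k + 1) = c" "box_of T (k + 1) = F c"
      using rlbox[OF kk(2)] by blast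
    obtain x y y' where xy: "b = (x, y)" "c = (x, y')" using b(3) c(3) h by (metis prod.collapse)
    have "\<not> rdle c b" using rdlab_le_iff[OF fD b(1) c(1)] b(2) c(2) by simp
    then have "y' < y" using xy by (auto simp: rdle_def)
    then have "snd (F b) < snd (F c)" "L c \<le> L b" using rowl[of x y' y] b c xy by auto
    then show "col_of T k < col_of T (k + 1)" "row_of T (k + 1) \<le> row_of T k"
      using b(4) c(4) by (auto simp: F_def)
  next
    fix k m assume km: "k \<in> {1..card D}" "m \<in> {1..card D}"
      and h: "row_of (rl D) m = row_of (rl D) k + 1 \<and> col_of (rl D) m = col_of (rl D) k"
    obtain b where b: "b \<in> D" "box_of (rl D) k = b" "box_of T k = F b" using rlbox[OF km(1)] by blast
    obtain c where c: "c \<in> D" "box_of (rl D) m = c" "box_of T m = F c" using rlbox[OF km(2)] by blast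
    obtain x y where xy: "b = (x, y)" "c = (Suc x, y)" using b(2) c(2) h by (metis Suc_eq_plus1 prod.collapse)
    have "L b < L c" "snd (F c) \<le> snd (F b)" using l(4) coll b(1) c(1) xy by auto
    then show "row_of T k < row_of T m" "col_of T m \<le> col_of T k" using b(3) c(3) by (auto simp: F_def)
  qed
  moreover have "filling_of D T = L"
  proof (rule ext)
    fix b show "filling_of D T b = L b"
      using boxF[of b] l(1)[of b] by (auto simp: filling_of_def F_def)
  qed
  ultimately show ?thesis unfolding G_def by blast
qed

lemma row_rule_filling_of:
  assumes "finite D"
  shows "row_rule r D T \<longleftrightarrow> (\<forall>b\<in>D. row_rule_filling r b \<le> int (filling_of D T b))"
proof -
  have "row_rule r D T \<longleftrightarrow> (\<forall>k\<in>rdlab D ` D. row_rule_entry r D k \<le> int (row_of T k))"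
    using rdlab_bij[OF assms] unfolding row_rule_def bij_betw_def by simp
  also have "\<dots> \<longleftrightarrow> (\<forall>b\<in>D. row_rule_filling r b \<le> int (filling_of D T b))"
    using box_of_rl[OF assms] by (auto simp: row_rule_entry_def filling_of_def)
  finally show ?thesis .
qed

section \<open>The two steps and their commutation\<close>

text \<open>\<open>rlab r \<alpha> i\<close> is the entry of the \<open>r\<close>-th row rule filling at the last box of row \<open>i\<close> of \<open>\<alpha>\<close>.\<close>

definition rlab :: "int \<Rightarrow> nat list \<Rightarrow> nat \<Rightarrow> int" where
  "rlab r \<alpha> i = r + int i - int (prow \<alpha> i)"

text \<open>The sets are compared as integers, which forces the labels of the removed boxes to be
  positive row numbers. Labels are taken in the larger partition, where a removed box ends its
  row.\<close>

definition Nstep :: "int \<Rightarrow> nat list \<times> nat list \<Rightarrow> nat list \<times> nat list \<Rightarrow> bool" where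
  "Nstep r \<alpha> \<gamma> \<longleftrightarrow> (\<exists>Q I. add_strip (fst \<alpha>) Q (fst \<gamma>) \<and> add_strip (snd \<gamma>) I (snd \<alpha>) \<and>
     int ` Q = rlab r (snd \<alpha>) ` I)"

text \<open>Writing the named row as \<open>Suc x\<close> with x \<ge> 1 excludes row 1, which has
  no row above it. Row x then belongs to \<open>G\<close> as well, by
  \<open>add_strip_top\<close>.\<close>

definition Cstep :: "int \<Rightarrow> nat \<Rightarrow> nat list \<times> nat list \<Rightarrow> nat list \<times> nat list \<Rightarrow> bool" where
  "Cstep r p \<alpha> \<gamma> \<longleftrightarrow> (\<exists>G I. add_strip (fst \<alpha>) G (fst \<gamma>) \<and> add_strip (snd \<gamma>) I (snd \<alpha>) \<and>
     card G = p + card I \<and>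
     (\<forall>i\<in>I. \<exists>x\<ge>1. int (Suc x) = rlab r (snd \<alpha>) i \<and> Suc x \<in> G \<and>
        prow (fst \<alpha>) (Suc x) = prow (fst \<alpha>) x))"

text \<open>The common description of both composites. A row in both \<open>P\<close> and
  \<open>H\<close> receives two boxes, so the first partitions need not differ by a vertical
  strip.\<close>

definition Zstep :: "int \<Rightarrow> nat \<Rightarrow> nat list \<times> nat list \<Rightarrow> nat list \<times> nat list \<Rightarrow> bool" where
  "Zstep r p \<alpha> \<gamma> \<longleftrightarrow> (\<exists>C P H. is_partition (fst \<alpha>) \<and> is_partition (fst \<gamma>) \<and>
     add_strip (snd \<gamma>) C (snd \<alpha>) \<and> int ` P = rlab r (snd \<alpha>) ` C \<and>
     P \<subseteq> {1..} \<and> finite H \<and> H \<subseteq> {1..} \<and> card H = p \<and>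
     (\<forall>x\<ge>1. prow (fst \<gamma>) x = prow (fst \<alpha>) x + of_bool (x \<in> P) + of_bool (x \<in> H)))"

section \<open>Labels along a partition\<close>

lemma rlab_mono:
  assumes "is_partition \<alpha>" "1 \<le> i" "i < j"
  shows "rlab r \<alpha> i < rlab r \<alpha> j"
  using prow_antimono[OF assms(1,2), of j] assms by (auto simp: rlab_def)

lemma rlab_inj:
  assumes "is_partition \<alpha>" "1 \<le> i" "1 \<le> j" "rlab r \<alpha> i = rlab r \<alpha> j"
  shows "i = j"
proof (cases i j rule: linorder_cases)
  case less
  then show ?thesis using rlab_mono[OF assms(1,2) less, of r] assms(4) by simp
next
  case greater
  then show ?thesis using rlab_mono[OF assms(1,3) greater, of r] assms(4) by linarith
qed

text \<open>One row down, the label grows by 1 plus the drop in length; labels that differ by 1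
  therefore sit in adjacent rows of equal length.\<close>

lemma rlab_step:
  assumes "is_partition \<alpha>" "1 \<le> i" "1 \<le> j" "rlab r \<alpha> j = rlab r \<alpha> i + 1"
  shows "j = Suc i \<and> prow \<alpha> j = prow \<alpha> i"
proof -
  have "i < j"
  proof (rule ccontr)
    assume "\<not> i < j"
    then have "rlab r \<alpha> j \<le> rlab r \<alpha> i"
      using rlab_mono[OF assms(1,3), of i r] by (cases "i = j") auto
    then show False using assms(4) by linarith
  qed
  then show ?thesis using prow_antimono[OF assms(1), of i j] assms by (auto simp: rlab_def)
qed

lemma card_rlab:
  assumes "is_partition \<alpha>" "C \<subseteq> {1..}" "int ` P = rlab r \<alpha> ` C"
  shows "card P = card C"
proof -
  have "inj_on (rlab r \<alpha>) C" using rlab_inj[OF assms(1)] assms(2) by (auto simp: inj_on_def)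
  then have "card (rlab r \<alpha> ` C) = card C" by (rule card_image)
  moreover have "card (int ` P) = card P" by (simp add: card_image)
  ultimately show ?thesis using assms(3) by metis
qed

text \<open>Let \<open>P\<close> be the rows named at all removed boxes and \<open>H\<close> the further rows. Of \<open>P\<close>, the step \<open>C\<close>
  takes care of the runs ending directly above a row of \<open>H - P\<close> of equal length if it comes first,
  and of those starting directly below such a row if it comes second.\<close>

definition down_runs :: "nat list \<Rightarrow> nat set \<Rightarrow> nat set \<Rightarrow> nat set" where
  "down_runs \<kappa> P H = {x \<in> P - H. \<exists>y>x. y \<in> H - P \<and> {x..<y} \<subseteq> P - H \<and> prow \<kappa> x = prow \<kappa> y}"

definition up_runs :: "nat list \<Rightarrow> nat set \<Rightarrow> nat set \<Rightarrow> nat set" where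
  "up_runs \<kappa> P H = {x \<in> P - H. \<exists>y<x. y \<in> H - P \<and> {y<..x} \<subseteq> P - H \<and> prow \<kappa> x = prow \<kappa> y}"

section \<open>First C, then N\<close>

lemma add_strip_union:
  assumes "add_strip \<alpha> A \<beta>" "add_strip \<beta> B \<gamma>" "A \<inter> B = {}"
  shows "add_strip \<alpha> (A \<union> B) \<gamma>"
  using assms by (auto simp: add_strip_def)

text \<open>\<open>PA\<close> collects the labels, for r, of the boxes removed by the first step.
  Labels for r + 1 are larger by one, so that step demands row x + 1 for each x in
  \<open>PA\<close>, at a place where rows x and x + 1 are equally long; hence both lie in
  \<open>G\<close>. The last claim recovers \<open>PA\<close> from data that depend only on the
  endpoints, which is what uniqueness needs.\<close>

lemma CN_structure:
  assumes G: "add_strip \<alpha>\<^sub>1 G \<delta>\<^sub>1" and A: "add_strip \<delta>\<^sub>2 A \<alpha>\<^sub>2"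
    and cA: "\<And>i. i \<in> A \<Longrightarrow> \<exists>x\<ge>1. int (Suc x) = rlab (r + 1) \<alpha>\<^sub>2 i \<and> Suc x \<in> G \<and> prow \<alpha>\<^sub>1 (Suc x) = prow \<alpha>\<^sub>1 x"
    and Q: "add_strip \<delta>\<^sub>1 Q \<gamma>\<^sub>1" and I: "add_strip \<gamma>\<^sub>2 I \<delta>\<^sub>2" and QI: "int ` Q = rlab r \<delta>\<^sub>2 ` I"
    and PA_def: "PA = nat ` rlab r \<alpha>\<^sub>2 ` A"
  shows "A \<inter> I = {}" "int ` PA = rlab r \<alpha>\<^sub>2 ` A" "int ` Q = rlab r \<alpha>\<^sub>2 ` I" "PA \<inter> Q = {}"
    "PA \<subseteq> G" "PA \<subseteq> {1..}" "PA = down_runs \<alpha>\<^sub>1 (PA \<union> Q) (G - PA)"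
proof -
  note pa = add_stripD[OF G] and pb = add_stripD[OF A] and pc = add_stripD[OF Q] and pd = add_stripD[OF I]
  have PA: "\<exists>x\<ge>1. int x = rlab r \<alpha>\<^sub>2 i \<and> Suc x \<in> G \<and> x \<in> G \<and> prow \<alpha>\<^sub>1 (Suc x) = prow \<alpha>\<^sub>1 x"
    if "i \<in> A" for i
  proof -
    from cA[OF that] obtain x where x: "x \<ge> 1" "int (Suc x) = rlab (r + 1) \<alpha>\<^sub>2 i" "Suc x \<in> G"
      "prow \<alpha>\<^sub>1 (Suc x) = prow \<alpha>\<^sub>1 x" by blast
    moreover have "x \<in> G" using add_strip_top[OF G, of x "Suc x"] x by auto
    ultimately show ?thesis by (intro exI[of _ x]) (auto simp: rlab_def)
  qed
  \<comment> \<open>If row i loses two boxes, the second one has label y + 1, and the equal lengths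
    of rows y and y + 1 drag y into \<open>Q\<close>. The row naming y is then i - 1, equally long,
    and loses two boxes as well. The argument repeats upwards and must stop.\<close>
  have disj: "i \<in> A \<Longrightarrow> i \<notin> I" for i
  proof (induction i rule: less_induct)
    case (less i)
    show ?case
    proof
      assume iI: "i \<in> I"
      have i1: "i \<ge> 1" using less.prems pb by auto
      from PA[OF less.prems] obtain y where y: "y \<ge> 1" "int y = rlab r \<alpha>\<^sub>2 i" "Suc y \<in> G" "y \<in> G"
        "prow \<alpha>\<^sub>1 (Suc y) = prow \<alpha>\<^sub>1 y" by blast
      have "rlab r \<delta>\<^sub>2 i = int (Suc y)" using pb(5)[OF i1] less.prems y by (auto simp: rlab_def)
      then have "int (Suc y) \<in> int ` Q" using QI iI by (metis imageI)
      then have "Suc y \<in> Q" by (metis imageE of_nat_eq_iff)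
      moreover have "prow \<delta>\<^sub>1 (Suc y) = prow \<delta>\<^sub>1 y" using pa(5)[of y] pa(5)[of "Suc y"] y by simp
      ultimately have "y \<in> Q" using add_strip_top[OF Q, of y "Suc y"] y by auto
      then obtain j where j: "j \<in> I" "int y = rlab r \<delta>\<^sub>2 j" using QI by (metis image_iff)
      have j1: "j \<ge> 1" using j pd by auto
      have st: "i = Suc j \<and> prow \<delta>\<^sub>2 i = prow \<delta>\<^sub>2 j"
        using rlab_step[OF pb(1) j1 i1, of r] j(2) \<open>rlab r \<delta>\<^sub>2 i = int (Suc y)\<close> by linarith
      have "prow \<alpha>\<^sub>2 i \<le> prow \<alpha>\<^sub>2 j" using prow_antimono[OF pb(2) j1, of i] st by auto
      then have "j \<in> A" using pb(5)[OF i1] pb(5)[OF j1] less.prems st by (auto simp: of_bool_def split: if_splits)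
      then show False using less.IH[of j] st j by auto
    qed
  qed
  then show AI: "A \<inter> I = {}" by blast
  show PAA: "int ` PA = rlab r \<alpha>\<^sub>2 ` A"
    
  proof -
    have "int (nat (rlab r \<alpha>\<^sub>2 i)) = rlab r \<alpha>\<^sub>2 i" if i: "i \<in> A" for i
    proof -
      obtain x where "int x = rlab r \<alpha>\<^sub>2 i" using PA[OF i] by blast
      then show ?thesis by linarith
    qed
    then show ?thesis unfolding PA_def image_image by (rule image_cong[OF refl])
  qed
  have "rlab r \<delta>\<^sub>2 i = rlab r \<alpha>\<^sub>2 i" if "i \<in> I" for i
  proof -
    have "i \<ge> 1" "i \<notin> A" using that disj pd by auto
    then show ?thesis using pb(5)[of i] by (simp add: rlab_def)
  qed
  then show QI': "int ` Q = rlab r \<alpha>\<^sub>2 ` I" using QI by simp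
  have PAx: "x \<ge> 1 \<and> Suc x \<in> G \<and> x \<in> G \<and> prow \<alpha>\<^sub>1 (Suc x) = prow \<alpha>\<^sub>1 x" if xPA: "x \<in> PA" for x
  proof -
    obtain i where "i \<in> A" "int x = rlab r \<alpha>\<^sub>2 i" using xPA PAA by (metis image_iff)
    then show ?thesis using PA[of i] by (metis of_nat_eq_iff)
  qed
  show PQ: "PA \<inter> Q = {}"
  proof (rule ccontr)
    assume "PA \<inter> Q \<noteq> {}"
    then obtain x where x: "x \<in> PA" "x \<in> Q" by blast
    obtain i where i: "i \<in> A" "int x = rlab r \<alpha>\<^sub>2 i" using x PAA by (metis image_iff)
    obtain j where j: "j \<in> I" "int x = rlab r \<alpha>\<^sub>2 j" using x QI' by (metis image_iff)
    have "i = j" using rlab_inj[OF pb(2), of i j r] i j pb pd by auto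
    then show False using i j AI by auto
  qed
  show PG: "PA \<subseteq> G" and P1: "PA \<subseteq> {1..}" using PAx by auto
  have "finite PA" using PG pa(3) finite_subset by blast
  show "PA = down_runs \<alpha>\<^sub>1 (PA \<union> Q) (G - PA)"
  proof (rule set_eqI, rule iffI)
    fix x assume x: "x \<in> PA"
    \<comment> \<open>The first row below x missed by \<open>PA\<close>. The row above it is in
      \<open>PA\<close>, so it lies in \<open>G\<close>; it will be the row that ends the
      run.\<close>
    define y where "y = (LEAST y. y > x \<and> y \<notin> PA)"
    have ex: "\<exists>y. y > x \<and> y \<notin> PA"
    proof -
      obtain m where "\<forall>n\<in>PA. n < m" using \<open>finite PA\<close> finite_nat_set_iff_bounded by blast
      then have "Suc (max m x) > x \<and> Suc (max m x) \<notin> PA" by (auto simp: max_def)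
      then show ?thesis by blast
    qed
    have y: "y > x" "y \<notin> PA" using LeastI_ex[OF ex] by (auto simp: y_def)
    have bet: "z \<in> PA" if "x \<le> z" "z < y" for z
      using not_less_Least[of z "\<lambda>y. y > x \<and> y \<notin> PA"] that x unfolding y_def
      by (cases "z = x") auto
    have const: "prow \<alpha>\<^sub>1 z = prow \<alpha>\<^sub>1 x" if "x \<le> z" "z \<le> y" for z
      using that
    proof (induction z rule: dec_induct)
      case (step n)
      then show ?case using PAx[of n] bet[of n] by auto
    qed simp
    obtain w where w: "y = Suc w" using y by (cases y) auto
    have wPA: "w \<in> PA" using bet[of w] w y by auto
    then have yG: "y \<in> G" using PAx w by auto
    \<comment> \<open>Otherwise y - 1 and y would be named by adjacent rows of equal length, of
      which the first step shortens only the upper one.\<close>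
    have "y \<notin> Q"
    proof
      assume "y \<in> Q"
      obtain i where i: "i \<in> A" "int w = rlab r \<alpha>\<^sub>2 i" using wPA PAA by (metis image_iff)
      obtain j where j: "j \<in> I" "int y = rlab r \<alpha>\<^sub>2 j" using \<open>y \<in> Q\<close> QI' by (metis image_iff)
      have ij: "i \<ge> 1" "j \<ge> 1" using i j pb pd by auto
      have "j = Suc i \<and> prow \<alpha>\<^sub>2 j = prow \<alpha>\<^sub>2 i"
        using rlab_step[OF pb(2) ij, of r] i j w by auto
      moreover have "prow \<alpha>\<^sub>2 j = prow \<delta>\<^sub>2 j" using pb(5)[OF ij(2)] j AI by auto
      moreover have "prow \<alpha>\<^sub>2 i = Suc (prow \<delta>\<^sub>2 i)" using pb(5)[OF ij(1)] i by auto
      ultimately show False using prow_Suc_le[OF pb(1) ij(1)] by auto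
    qed
    then show "x \<in> down_runs \<alpha>\<^sub>1 (PA \<union> Q) (G - PA)"
      unfolding down_runs_def using x y yG bet const[of y] by auto
  next
    fix x assume "x \<in> down_runs \<alpha>\<^sub>1 (PA \<union> Q) (G - PA)"
    then obtain y where y: "x \<in> PA \<union> Q" "x \<notin> G - PA" "y > x" "y \<in> G" "prow \<alpha>\<^sub>1 x = prow \<alpha>\<^sub>1 y"
      unfolding down_runs_def by blast
    have "x \<ge> 1" using y P1 pc by auto
    then have "x \<in> G" using add_strip_top[OF G, of x y] y by auto
    then show "x \<in> PA" using y by auto
  qed
qed

lemma CN_imp_Z:
  assumes "Cstep (r + 1) p \<alpha> \<delta>" "Nstep r \<delta> \<gamma>"
  shows "Zstep r p \<alpha> \<gamma>"
proof -
  obtain \<alpha>\<^sub>1 \<alpha>\<^sub>2 \<delta>\<^sub>1 \<delta>\<^sub>2 \<gamma>\<^sub>1 \<gamma>\<^sub>2 where e: "\<alpha> = (\<alpha>\<^sub>1, \<alpha>\<^sub>2)" "\<delta> = (\<delta>\<^sub>1, \<delta>\<^sub>2)" "\<gamma> = (\<gamma>\<^sub>1, \<gamma>\<^sub>2)"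
    by (metis surj_pair)
  obtain G A where GA: "add_strip \<alpha>\<^sub>1 G \<delta>\<^sub>1" "add_strip \<delta>\<^sub>2 A \<alpha>\<^sub>2" "card G = p + card A"
    "\<And>i. i \<in> A \<Longrightarrow> \<exists>x\<ge>1. int (Suc x) = rlab (r + 1) \<alpha>\<^sub>2 i \<and> Suc x \<in> G \<and> prow \<alpha>\<^sub>1 (Suc x) = prow \<alpha>\<^sub>1 x"
    using assms(1) unfolding Cstep_def e fst_conv snd_conv by blast
  obtain Q I where QI: "add_strip \<delta>\<^sub>1 Q \<gamma>\<^sub>1" "add_strip \<gamma>\<^sub>2 I \<delta>\<^sub>2" "int ` Q = rlab r \<delta>\<^sub>2 ` I"
    using assms(2) unfolding Nstep_def e fst_conv snd_conv by blast
  define PA where "PA = nat ` rlab r \<alpha>\<^sub>2 ` A"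
  note s = CN_structure[OF GA(1,2,4) QI PA_def]
  have fP: "finite PA" using s(5) add_stripD(3)[OF GA(1)] finite_subset by blast
  have "card PA = card A"
    using card_rlab[OF add_stripD(2)[OF GA(2)] add_stripD(4)[OF GA(2)] s(2)] .
  then have "card (G - PA) = p" using GA(3) s(5) fP by (simp add: card_Diff_subset)
  moreover have "add_strip \<gamma>\<^sub>2 (I \<union> A) \<alpha>\<^sub>2"
    using add_strip_union[OF QI(2) GA(2)] s(1) by blast
  moreover have "int ` (PA \<union> Q) = rlab r \<alpha>\<^sub>2 ` (I \<union> A)" using s(2,3) by auto
  moreover have "prow \<gamma>\<^sub>1 x = prow \<alpha>\<^sub>1 x + of_bool (x \<in> PA \<union> Q) + of_bool (x \<in> G - PA)" if "x \<ge> 1" for x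
    using add_stripD(5)[OF GA(1) that] add_stripD(5)[OF QI(1) that] s(4,5) by auto
  moreover have "PA \<union> Q \<subseteq> {1..}" "finite (G - PA)" "G - PA \<subseteq> {1..}"
    using s(6) add_stripD[OF GA(1)] add_stripD[OF QI(1)] by auto
  ultimately show ?thesis
    unfolding Zstep_def e fst_conv snd_conv
    using add_stripD(1)[OF GA(1)] add_stripD(2)[OF QI(1)] by blast
qed

text \<open>The second components fix \<open>C\<close>, hence \<open>P\<close>, and what remains of
  the row growth fixes \<open>H\<close>.\<close>

lemma Z_data_unique:
  assumes "add_strip \<gamma>\<^sub>2 C \<alpha>\<^sub>2" "int ` P = rlab r \<alpha>\<^sub>2 ` C" "H \<subseteq> {1..}"
    "\<And>x. x \<ge> 1 \<Longrightarrow> prow \<gamma>\<^sub>1 x = prow \<alpha>\<^sub>1 x + of_bool (x \<in> P) + of_bool (x \<in> H)"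
    and "add_strip \<gamma>\<^sub>2 C' \<alpha>\<^sub>2" "int ` P' = rlab r \<alpha>\<^sub>2 ` C'" "H' \<subseteq> {1..}"
    "\<And>x. x \<ge> 1 \<Longrightarrow> prow \<gamma>\<^sub>1 x = prow \<alpha>\<^sub>1 x + of_bool (x \<in> P') + of_bool (x \<in> H')"
  shows "C = C'" "P = P'" "H = H'"
proof -
  show C: "C = C'" using assms(1,5) add_strip_set_unique by blast
  then have "int ` P = int ` P'" using assms(2,6) by simp
  then show P: "P = P'" by (simp add: inj_image_eq_iff)
  show "H = H'"
  proof (rule set_eqI)
    fix x show "x \<in> H \<longleftrightarrow> x \<in> H'"
    proof (cases "x \<ge> 1")
      case True
      have "of_bool (x \<in> H) = (of_bool (x \<in> H') :: nat)"
        using assms(4)[OF True] assms(8)[OF True] unfolding P by linarith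
      then show ?thesis by (simp add: of_bool_def split: if_splits)
    next
      case False
      then show ?thesis using assms(3,7) by auto
    qed
  qed
qed

text \<open>\<open>P\<close> and \<open>H\<close> depend only on the endpoints, and
  \<open>PA\<close> is a function of them by \<open>CN_structure\<close>; it determines both strips
  of the first step.\<close>

lemma CN_unique:
  assumes "Cstep (r + 1) p \<alpha> \<delta>" "Nstep r \<delta> \<gamma>" "Cstep (r + 1) p \<alpha> \<delta>'" "Nstep r \<delta>' \<gamma>"
  shows "\<delta> = \<delta>'"
proof -
  obtain \<alpha>\<^sub>1 \<alpha>\<^sub>2 \<delta>\<^sub>1 \<delta>\<^sub>2 \<gamma>\<^sub>1 \<gamma>\<^sub>2 \<delta>'\<^sub>1 \<delta>'\<^sub>2 where e: "\<alpha> = (\<alpha>\<^sub>1, \<alpha>\<^sub>2)" "\<delta> = (\<delta>\<^sub>1, \<delta>\<^sub>2)" "\<gamma> = (\<gamma>\<^sub>1, \<gamma>\<^sub>2)" "\<delta>' = (\<delta>'\<^sub>1, \<delta>'\<^sub>2)"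
    by (metis surj_pair)
  obtain G A where GA: "add_strip \<alpha>\<^sub>1 G \<delta>\<^sub>1" "add_strip \<delta>\<^sub>2 A \<alpha>\<^sub>2" "card G = p + card A"
    "\<And>i. i \<in> A \<Longrightarrow> \<exists>x\<ge>1. int (Suc x) = rlab (r + 1) \<alpha>\<^sub>2 i \<and> Suc x \<in> G \<and> prow \<alpha>\<^sub>1 (Suc x) = prow \<alpha>\<^sub>1 x"
    using assms(1) unfolding Cstep_def e fst_conv snd_conv by blast
  obtain Q I where QI: "add_strip \<delta>\<^sub>1 Q \<gamma>\<^sub>1" "add_strip \<gamma>\<^sub>2 I \<delta>\<^sub>2" "int ` Q = rlab r \<delta>\<^sub>2 ` I"
    using assms(2) unfolding Nstep_def e fst_conv snd_conv by blast
  obtain G' A' where GA': "add_strip \<alpha>\<^sub>1 G' \<delta>'\<^sub>1" "add_strip \<delta>'\<^sub>2 A' \<alpha>\<^sub>2" "card G' = p + card A'"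
    "\<And>i. i \<in> A' \<Longrightarrow> \<exists>x\<ge>1. int (Suc x) = rlab (r + 1) \<alpha>\<^sub>2 i \<and> Suc x \<in> G' \<and> prow \<alpha>\<^sub>1 (Suc x) = prow \<alpha>\<^sub>1 x"
    using assms(3) unfolding Cstep_def e fst_conv snd_conv by blast
  obtain Q' I' where QI': "add_strip \<delta>'\<^sub>1 Q' \<gamma>\<^sub>1" "add_strip \<gamma>\<^sub>2 I' \<delta>'\<^sub>2" "int ` Q' = rlab r \<delta>'\<^sub>2 ` I'"
    using assms(4) unfolding Nstep_def e fst_conv snd_conv by blast
  define PA where "PA = nat ` rlab r \<alpha>\<^sub>2 ` A"
  define PA' where "PA' = nat ` rlab r \<alpha>\<^sub>2 ` A'"
  note s = CN_structure[OF GA(1,2,4) QI PA_def] and s' = CN_structure[OF GA'(1,2,4) QI' PA'_def]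
  have u: "I \<union> A = I' \<union> A'" "PA \<union> Q = PA' \<union> Q'" "G - PA = G' - PA'"
  proof -
    have a: "add_strip \<gamma>\<^sub>2 (I \<union> A) \<alpha>\<^sub>2" using add_strip_union[OF QI(2) GA(2)] s(1) by blast
    have a': "add_strip \<gamma>\<^sub>2 (I' \<union> A') \<alpha>\<^sub>2" using add_strip_union[OF QI'(2) GA'(2)] s'(1) by blast
    have b: "int ` (PA \<union> Q) = rlab r \<alpha>\<^sub>2 ` (I \<union> A)" using s(2,3) by auto
    have b': "int ` (PA' \<union> Q') = rlab r \<alpha>\<^sub>2 ` (I' \<union> A')" using s'(2,3) by auto
    have c: "G - PA \<subseteq> {1..}" "G' - PA' \<subseteq> {1..}" using add_stripD(4)[OF GA(1)] add_stripD(4)[OF GA'(1)] by auto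
    have d: "prow \<gamma>\<^sub>1 x = prow \<alpha>\<^sub>1 x + of_bool (x \<in> PA \<union> Q) + of_bool (x \<in> G - PA)" if "x \<ge> 1" for x
      using add_stripD(5)[OF GA(1) that] add_stripD(5)[OF QI(1) that] s(4,5) by auto
    have d': "prow \<gamma>\<^sub>1 x = prow \<alpha>\<^sub>1 x + of_bool (x \<in> PA' \<union> Q') + of_bool (x \<in> G' - PA')" if "x \<ge> 1" for x
      using add_stripD(5)[OF GA'(1) that] add_stripD(5)[OF QI'(1) that] s'(4,5) by auto
    show "I \<union> A = I' \<union> A'" "PA \<union> Q = PA' \<union> Q'" "G - PA = G' - PA'"
      using Z_data_unique[OF a b c(1) d a' b' c(2) d'] by auto
  qed
  have PA: "PA = PA'" using s(7) s'(7) u by metis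
  then have "G = G'" using u(3) s(5) s'(5) by blast
  have "rlab r \<alpha>\<^sub>2 ` A = rlab r \<alpha>\<^sub>2 ` A'" using s(2) s'(2) PA by metis
  moreover have "inj_on (rlab r \<alpha>\<^sub>2) {1..}"
    using rlab_inj[OF add_stripD(2)[OF GA(2)]] by (auto simp: inj_on_def)
  ultimately have "A = A'"
    using inj_on_image_eq_iff add_stripD(4)[OF GA(2)] add_stripD(4)[OF GA'(2)] by metis
  then show ?thesis using \<open>G = G'\<close> GA(1,2) GA'(1,2) add_strip_upper_unique add_strip_lower_unique
    unfolding e by blast
qed


text \<open>Below a row of a run comes another row of it or the row of H - P that ends it. The next
  lemma is the converse, and \<open>up_runs\<close> has the mirror images.\<close>

lemma down_runs_step:
  assumes "x \<in> down_runs \<kappa> P H" "is_partition \<kappa>" "1 \<le> x"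
  shows "Suc x \<in> H - P \<or> Suc x \<in> down_runs \<kappa> P H" "prow \<kappa> (Suc x) = prow \<kappa> x"
proof -
  obtain y where y: "x \<in> P - H" "y > x" "y \<in> H - P" "{x..<y} \<subseteq> P - H" "prow \<kappa> x = prow \<kappa> y"
    using assms(1) unfolding down_runs_def by blast
  show c: "prow \<kappa> (Suc x) = prow \<kappa> x"
    using prow_const_between[OF assms(2,3), of "Suc x" y] y by auto
  show "Suc x \<in> H - P \<or> Suc x \<in> down_runs \<kappa> P H"
  proof (cases "y = Suc x")
    case False
    then have "y > Suc x" using y(2) by simp
    moreover have "{Suc x..<y} \<subseteq> {x..<y}" by auto
    moreover have "Suc x \<in> {x..<y}" using \<open>y > Suc x\<close> by simp
    ultimately have "Suc x \<in> P - H" "y > Suc x" "{Suc x..<y} \<subseteq> P - H" using y(4) by blast+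
    then have "Suc x \<in> down_runs \<kappa> P H" unfolding down_runs_def using y c by auto
    then show ?thesis ..
  qed (use y in auto)
qed

lemma down_runs_extend:
  assumes "Suc x \<in> (H - P) \<union> down_runs \<kappa> P H" "x \<in> P - H" "prow \<kappa> (Suc x) = prow \<kappa> x"
  shows "x \<in> down_runs \<kappa> P H"
proof (cases "Suc x \<in> H - P")
  case True
  have "{x..<Suc x} \<subseteq> P - H" using assms(2) by auto
  then show ?thesis using True assms unfolding down_runs_def by (auto intro!: exI[of _ "Suc x"])
next
  case False
  then obtain y where y: "y > Suc x" "y \<in> H - P" "{Suc x..<y} \<subseteq> P - H" "prow \<kappa> (Suc x) = prow \<kappa> y"
    using assms(1) unfolding down_runs_def by blast
  have "{x..<y} = insert x {Suc x..<y}" using y by auto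
  then have "{x..<y} \<subseteq> P - H" using y assms by auto
  moreover have "x < y" using y by simp
  moreover have "prow \<kappa> x = prow \<kappa> y" using y assms by simp
  ultimately show ?thesis unfolding down_runs_def using y(2) assms(2) by blast
qed

lemma up_runs_step:
  assumes "Suc x \<in> up_runs \<kappa> P H" "is_partition \<kappa>" "0 \<notin> H"
  shows "1 \<le> x" "x \<in> H - P \<or> x \<in> up_runs \<kappa> P H" "prow \<kappa> (Suc x) = prow \<kappa> x"
proof -
  obtain y where y: "Suc x \<in> P - H" "y < Suc x" "y \<in> H - P" "{y<..Suc x} \<subseteq> P - H" "prow \<kappa> (Suc x) = prow \<kappa> y"
    using assms(1) unfolding up_runs_def by blast
  have y1: "y \<ge> 1" using y assms(3) by (cases y) auto
  then show "1 \<le> x" using y by simp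
  show c: "prow \<kappa> (Suc x) = prow \<kappa> x"
    using prow_const_between[OF assms(2) y1, of x "Suc x"] y by auto
  show "x \<in> H - P \<or> x \<in> up_runs \<kappa> P H"
  proof (cases "y = x")
    case False
    then have "y < x" using y(2) by simp
    moreover have "{y<..x} \<subseteq> {y<..Suc x}" by auto
    moreover have "x \<in> {y<..Suc x}" using \<open>y < x\<close> by simp
    ultimately have "x \<in> P - H" "y < x" "{y<..x} \<subseteq> P - H" using y(4) by blast+
    then have "x \<in> up_runs \<kappa> P H" unfolding up_runs_def using y c by auto
    then show ?thesis ..
  qed (use y in auto)
qed

lemma up_runs_extend:
  assumes "x \<in> (H - P) \<union> up_runs \<kappa> P H" "Suc x \<in> P - H" "prow \<kappa> (Suc x) = prow \<kappa> x"
  shows "Suc x \<in> up_runs \<kappa> P H"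
proof (cases "x \<in> H - P")
  case True
  have "{x<..Suc x} \<subseteq> P - H" using assms(2) by (auto simp: less_Suc_eq_le le_Suc_eq)
  then show ?thesis using True assms unfolding up_runs_def by (auto intro!: exI[of _ x])
next
  case False
  then obtain y where y: "y < x" "y \<in> H - P" "{y<..x} \<subseteq> P - H" "prow \<kappa> x = prow \<kappa> y"
    using assms(1) unfolding up_runs_def by blast
  have "{y<..Suc x} = insert (Suc x) {y<..x}" using y by auto
  then have "{y<..Suc x} \<subseteq> P - H" using y assms by auto
  moreover have "y < Suc x" using y by simp
  moreover have "prow \<kappa> (Suc x) = prow \<kappa> y" using y assms by simp
  ultimately show ?thesis unfolding up_runs_def using y(2) assms(2) by blast
qed

text \<open>Removing only the boxes of \<open>A\<close> first can fail only between equally long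
  adjacent rows. There \<gamma>, being a partition, puts the lower row into \<open>C\<close>, and
  the last hypothesis then puts it into \<open>A\<close>.\<close>

lemma add_strip_split_exists:
  assumes g: "add_strip \<gamma> C \<alpha>" and A: "A \<subseteq> C"
    and c: "\<And>i. 1 \<le> i \<Longrightarrow> i \<in> A \<Longrightarrow> Suc i \<in> C \<Longrightarrow> prow \<alpha> (Suc i) = prow \<alpha> i \<Longrightarrow> Suc i \<in> A"
  shows "\<exists>\<delta>. add_strip \<delta> A \<alpha> \<and> add_strip \<gamma> (C - A) \<delta>"
proof -
  note p = add_stripD[OF g]
  have "\<exists>\<delta>. add_strip \<delta> A \<alpha>"
  proof (rule add_strip_exists_lower[OF p(2)])
    show "finite A" "A \<subseteq> {1..}" using A p finite_subset by auto
    show "1 \<le> prow \<alpha> i" if "i \<in> A" for i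
    proof -
      have "i \<in> C" "i \<ge> 1" using that A p by auto
      then show ?thesis using p(5)[of i] by simp
    qed
    show "Suc i \<in> A" if "1 \<le> i" "i \<in> A" "prow \<alpha> (Suc i) = prow \<alpha> i" for i
    proof -
      have "i \<in> C" using that A by auto
      then have "Suc i \<in> C"
        using prow_Suc_le[OF p(1) that(1)] p(5)[of i] p(5)[of "Suc i"] that
        by (auto simp: of_bool_def split: if_splits)
      then show ?thesis using c that by blast
    qed
  qed
  then obtain \<delta> where d: "add_strip \<delta> A \<alpha>" by blast
  have "prow \<delta> i = prow \<gamma> i + of_bool (i \<in> C - A)" if "i \<ge> 1" for i
    using add_stripD(5)[OF d that] p(5)[OF that] A by (auto simp: of_bool_def split: if_splits)
  then have "add_strip \<gamma> (C - A) \<delta>" using p add_stripD[OF d] by (auto simp: add_strip_def)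
  then show ?thesis using d by blast
qed

lemma rlab_lower:
  assumes "add_strip \<delta> A \<alpha>" "1 \<le> i" "i \<notin> A"
  shows "rlab r \<delta> i = rlab r \<alpha> i"
  using add_stripD(5)[OF assms(1,2)] assms(3) by (simp add: rlab_def)

text \<open>Both intermediate partitions must be shown to exist. On the first component, a row of P
  - H directly above a used row of equal length belongs to a run itself; on the second, labels of
  equally long adjacent rows are consecutive, so the removed boxes follow the runs.\<close>

lemma Z_imp_CN:
  assumes "Zstep r p \<alpha> \<gamma>"
  shows "\<exists>\<delta>. Cstep (r + 1) p \<alpha> \<delta> \<and> Nstep r \<delta> \<gamma>"
proof -
  obtain \<alpha>\<^sub>1 \<alpha>\<^sub>2 \<gamma>\<^sub>1 \<gamma>\<^sub>2 where e: "\<alpha> = (\<alpha>\<^sub>1, \<alpha>\<^sub>2)" "\<gamma> = (\<gamma>\<^sub>1, \<gamma>\<^sub>2)" by (metis surj_pair)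
  obtain C P H where Z: "is_partition \<alpha>\<^sub>1" "is_partition \<gamma>\<^sub>1" "add_strip \<gamma>\<^sub>2 C \<alpha>\<^sub>2" "int ` P = rlab r \<alpha>\<^sub>2 ` C"
    "P \<subseteq> {1..}" "finite H" "H \<subseteq> {1..}" "card H = p"
    "\<forall>x\<ge>1. prow \<gamma>\<^sub>1 x = prow \<alpha>\<^sub>1 x + of_bool (x \<in> P) + of_bool (x \<in> H)"
    using assms unfolding Zstep_def e fst_conv snd_conv by blast
  note pc = add_stripD[OF Z(3)]
  define D where "D = down_runs \<alpha>\<^sub>1 P H"
  have DP: "D \<subseteq> P - H" by (auto simp: D_def down_runs_def)
  have "finite (int ` P)" using Z(4) pc(3) by simp
  then have fP: "finite P" by (simp add: finite_image_iff)
  have fD: "finite D" using DP fP finite_subset by blast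
  define G where "G = H \<union> D"
  have "\<exists>\<delta>\<^sub>1. add_strip \<alpha>\<^sub>1 G \<delta>\<^sub>1"
  proof (rule add_strip_exists_upper[OF Z(1)])
    show "finite G" "G \<subseteq> {1..}" using fD Z DP by (auto simp: G_def)
    fix x :: nat assume x: "1 \<le> x" "Suc x \<in> G" "prow \<alpha>\<^sub>1 (Suc x) = prow \<alpha>\<^sub>1 x"
    \<comment> \<open>As the final shape is a partition, row x + 1 gains at most as much as the
      equally long row x.\<close>
    have le: "of_bool (Suc x \<in> P) + of_bool (Suc x \<in> H) \<le> (of_bool (x \<in> P) + of_bool (x \<in> H) :: nat)"
      using prow_Suc_le[OF Z(2) x(1)] Z(9)[rule_format, of x] Z(9)[rule_format, of "Suc x"] x by simp
    show "x \<in> G"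
    proof (rule ccontr)
      assume n: "x \<notin> G"
      then have "x \<notin> H" by (simp add: G_def)
      then have xP: "x \<in> P - H" "Suc x \<notin> P \<inter> H"
        using le x(2) DP by (auto simp: G_def of_bool_def split: if_splits)
      have "Suc x \<in> (H - P) \<union> D" using x(2) xP by (auto simp: G_def)
      then have "x \<in> D" unfolding D_def using down_runs_extend xP x(3) by blast
      then show False using n by (simp add: G_def)
    qed
  qed
  then obtain \<delta>\<^sub>1 where d1: "add_strip \<alpha>\<^sub>1 G \<delta>\<^sub>1" by blast
  define A where "A = {i \<in> C. \<exists>x\<in>D. int x = rlab r \<alpha>\<^sub>2 i}"
  have AD: "int ` D = rlab r \<alpha>\<^sub>2 ` A"
  proof
    show "int ` D \<subseteq> rlab r \<alpha>\<^sub>2 ` A"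
    proof clarify
      fix x assume x: "x \<in> D"
      then have "int x \<in> rlab r \<alpha>\<^sub>2 ` C" using DP Z(4) by blast
      then obtain i where "i \<in> C" "int x = rlab r \<alpha>\<^sub>2 i" by blast
      then show "int x \<in> rlab r \<alpha>\<^sub>2 ` A" using x unfolding A_def by blast
    qed
    show "rlab r \<alpha>\<^sub>2 ` A \<subseteq> int ` D" unfolding A_def by (auto intro: rev_image_eqI)
  qed
  have I: "int ` (P - D) = rlab r \<alpha>\<^sub>2 ` (C - A)"
  proof -
    have inj: "inj_on (rlab r \<alpha>\<^sub>2) C" using rlab_inj[OF pc(2)] pc(4) by (auto simp: inj_on_def)
    have "int ` (P - D) = int ` P - int ` D" by (simp add: image_set_diff)
    also have "\<dots> = rlab r \<alpha>\<^sub>2 ` (C - A)"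
      using inj_on_image_set_diff[OF inj, of C A] AD Z(4) by (auto simp: A_def)
    finally show ?thesis .
  qed
  have "\<exists>\<delta>\<^sub>2. add_strip \<delta>\<^sub>2 A \<alpha>\<^sub>2 \<and> add_strip \<gamma>\<^sub>2 (C - A) \<delta>\<^sub>2"
  proof (rule add_strip_split_exists[OF Z(3)])
    show "A \<subseteq> C" by (auto simp: A_def)
    fix i assume i: "1 \<le> i" "i \<in> A" "Suc i \<in> C" "prow \<alpha>\<^sub>2 (Suc i) = prow \<alpha>\<^sub>2 i"
    obtain x where x: "x \<in> D" "int x = rlab r \<alpha>\<^sub>2 i" using i by (auto simp: A_def)
    have sx: "int (Suc x) = rlab r \<alpha>\<^sub>2 (Suc i)" using x i by (simp add: rlab_def)
    then have "int (Suc x) \<in> int ` P" using i Z(4) by (metis imageI)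
    then have "Suc x \<in> P" by (metis imageE of_nat_eq_iff)
    then have "Suc x \<in> D" using down_runs_step(1)[of x \<alpha>\<^sub>1 P H] x DP Z unfolding D_def by blast
    then show "Suc i \<in> A" using sx i(3) unfolding A_def by blast
  qed
  then obtain \<delta>\<^sub>2 where d2: "add_strip \<delta>\<^sub>2 A \<alpha>\<^sub>2" "add_strip \<gamma>\<^sub>2 (C - A) \<delta>\<^sub>2" by blast
  have "card D = card A" using card_rlab[OF pc(2) add_stripD(4)[OF d2(1)] AD] .
  moreover have "card G = card H + card D" unfolding G_def
    using DP fD Z(6) by (intro card_Un_disjoint) auto
  ultimately have cG: "card G = p + card A" using Z(8) by simp
  \<comment> \<open>The label for r + 1 exceeds the one for r by one, so it names the row below x,
    which is the next row of the run or its end.\<close>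
  have "\<exists>x\<ge>1. int (Suc x) = rlab (r + 1) \<alpha>\<^sub>2 i \<and> Suc x \<in> G \<and> prow \<alpha>\<^sub>1 (Suc x) = prow \<alpha>\<^sub>1 x" if iA: "i \<in> A" for i
  proof -
    obtain x where x: "x \<in> D" "int x = rlab r \<alpha>\<^sub>2 i" using iA by (auto simp: A_def)
    have x1: "1 \<le> x" using x DP Z(5) by auto
    note st = down_runs_step[of x \<alpha>\<^sub>1 P H, folded D_def, OF x(1) Z(1) x1]
    then show ?thesis using x x1 by (intro exI[of _ x]) (auto simp: G_def rlab_def)
  qed
  then have C: "Cstep (r + 1) p \<alpha> (\<delta>\<^sub>1, \<delta>\<^sub>2)"
    unfolding Cstep_def e fst_conv snd_conv using d1 d2 cG by blast
  have "prow \<gamma>\<^sub>1 x = prow \<delta>\<^sub>1 x + of_bool (x \<in> P - D)" if "x \<ge> 1" for x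
    using add_stripD(5)[OF d1 that] Z(9)[rule_format, OF that] DP
    by (auto simp: G_def of_bool_def split: if_splits)
  then have "add_strip \<delta>\<^sub>1 (P - D) \<gamma>\<^sub>1"
    using add_stripD(2)[OF d1] Z(2,5) fP by (auto simp: add_strip_def)
  moreover have "rlab r \<delta>\<^sub>2 ` (C - A) = rlab r \<alpha>\<^sub>2 ` (C - A)"
  proof (rule image_cong[OF refl])
    fix i assume "i \<in> C - A"
    then show "rlab r \<delta>\<^sub>2 i = rlab r \<alpha>\<^sub>2 i" using rlab_lower[OF d2(1)] pc(4) by auto
  qed
  ultimately have "Nstep r (\<delta>\<^sub>1, \<delta>\<^sub>2) \<gamma>"
    unfolding Nstep_def e fst_conv snd_conv using d2(2) I by metis
  then show ?thesis using C by blast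
qed

section \<open>First N, then C\<close>

text \<open>The mirror image of \<open>CN_structure\<close>: the second step uses each named row
  together with the row above it, so its runs hang below a row of H - P.\<close>

lemma NC_structure:
  assumes Q: "add_strip \<alpha>\<^sub>1 Q \<delta>\<^sub>1" and A: "add_strip \<delta>\<^sub>2 A \<alpha>\<^sub>2" and QA: "int ` Q = rlab r \<alpha>\<^sub>2 ` A"
    and G: "add_strip \<delta>\<^sub>1 G \<gamma>\<^sub>1" and I: "add_strip \<gamma>\<^sub>2 I \<delta>\<^sub>2"
    and cI: "\<And>i. i \<in> I \<Longrightarrow> \<exists>x\<ge>1. int (Suc x) = rlab r \<delta>\<^sub>2 i \<and> Suc x \<in> G \<and> prow \<delta>\<^sub>1 (Suc x) = prow \<delta>\<^sub>1 x"
    and PI_def: "PI = nat ` rlab r \<alpha>\<^sub>2 ` I"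
  shows "A \<inter> I = {}" "int ` PI = rlab r \<alpha>\<^sub>2 ` I" "PI \<inter> Q = {}"
    "PI \<subseteq> G" "PI \<subseteq> {1..}" "PI = up_runs \<alpha>\<^sub>1 (PI \<union> Q) (G - PI)"
proof -
  note pa = add_stripD[OF Q] and pb = add_stripD[OF A] and pc = add_stripD[OF G] and pd = add_stripD[OF I]
  \<comment> \<open>Now the argument runs downwards: if row i loses two boxes, so does row i + 1,
    against the choice of the largest such i.\<close>
  show AI: "A \<inter> I = {}"
  proof (rule ccontr)
    assume ne: "A \<inter> I \<noteq> {}"
    define i where "i = Max (A \<inter> I)"
    have i: "i \<in> A" "i \<in> I" using Max_in[of "A \<inter> I"] ne pb(3) by (auto simp: i_def)
    have i1: "i \<ge> 1" using i pb by auto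
    obtain y where y: "y \<in> Q" "int y = rlab r \<alpha>\<^sub>2 i" using i QA by (metis imageI image_iff)
    have "rlab r \<delta>\<^sub>2 i = int (Suc y)" using pb(5)[OF i1] i y by (simp add: rlab_def)
    then have y1: "1 \<le> y" "prow \<delta>\<^sub>1 (Suc y) = prow \<delta>\<^sub>1 y" using cI[OF i(2)] by auto
    have "Suc y \<in> Q" using pa(5)[of y] pa(5)[of "Suc y"] y y1 prow_Suc_le[OF pa(1) y1(1)]
      by (auto simp: of_bool_def split: if_splits)
    then obtain j where j: "j \<in> A" "int (Suc y) = rlab r \<alpha>\<^sub>2 j" using QA by (metis imageI image_iff)
    have j1: "j \<ge> 1" using j pb by auto
    have st: "j = Suc i \<and> prow \<alpha>\<^sub>2 j = prow \<alpha>\<^sub>2 i"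
      using rlab_step[OF pb(2) i1 j1, of r] j(2) y(2) by linarith
    have "prow \<gamma>\<^sub>2 j \<le> prow \<gamma>\<^sub>2 i" using prow_antimono[OF pd(1) i1, of j] st by auto
    then have "j \<in> I" using pb(5)[OF i1] pb(5)[OF j1] pd(5)[OF i1] pd(5)[OF j1] i j st
      by (auto simp: of_bool_def split: if_splits)
    then have "j \<le> i" using j pb(3) unfolding i_def by (intro Max_ge) auto
    then show False using st by simp
  qed
  have lab: "rlab r \<delta>\<^sub>2 i = rlab r \<alpha>\<^sub>2 i" if "i \<in> I" for i
    using rlab_lower[OF A, of i] that AI pd(4) by auto
  have cI': "\<exists>x\<ge>1. int (Suc x) = rlab r \<alpha>\<^sub>2 i \<and> Suc x \<in> G \<and> prow \<delta>\<^sub>1 (Suc x) = prow \<delta>\<^sub>1 x" if "i \<in> I" for i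
    using cI[OF that] lab[OF that] by simp
  show PIA: "int ` PI = rlab r \<alpha>\<^sub>2 ` I"
  proof -
    have "int (nat (rlab r \<alpha>\<^sub>2 i)) = rlab r \<alpha>\<^sub>2 i" if i: "i \<in> I" for i
    proof -
      obtain x where "int (Suc x) = rlab r \<alpha>\<^sub>2 i" using cI'[OF i] by blast
      then show ?thesis by linarith
    qed
    then show ?thesis unfolding PI_def image_image by (rule image_cong[OF refl])
  qed
  have PIx: "\<exists>z\<ge>1. x = Suc z \<and> x \<in> G \<and> prow \<delta>\<^sub>1 x = prow \<delta>\<^sub>1 z" if xPI: "x \<in> PI" for x
  proof -
    obtain i where i: "i \<in> I" "int x = rlab r \<alpha>\<^sub>2 i" using xPI PIA by (metis imageI image_iff)
    obtain z where z: "z \<ge> 1" "int (Suc z) = rlab r \<alpha>\<^sub>2 i" "Suc z \<in> G" "prow \<delta>\<^sub>1 (Suc z) = prow \<delta>\<^sub>1 z"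
      using cI'[OF i(1)] by blast
    then have "x = Suc z" using i by (metis of_nat_eq_iff)
    then show ?thesis using z by auto
  qed
  show PQ: "PI \<inter> Q = {}"
  proof (rule ccontr)
    assume "PI \<inter> Q \<noteq> {}"
    then obtain x where x: "x \<in> PI" "x \<in> Q" by blast
    obtain i where i: "i \<in> I" "int x = rlab r \<alpha>\<^sub>2 i" using x PIA by (metis imageI image_iff)
    obtain j where j: "j \<in> A" "int x = rlab r \<alpha>\<^sub>2 j" using x QA by (metis imageI image_iff)
    have "i = j" using rlab_inj[OF pb(2), of i j r] i j pb(4) pd(4) by auto
    then show False using i j AI by auto
  qed
  show PG: "PI \<subseteq> G" and P1: "PI \<subseteq> {1..}" using PIx by auto
  show "PI = up_runs \<alpha>\<^sub>1 (PI \<union> Q) (G - PI)"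
  proof (rule set_eqI, rule iffI)
    fix x assume x: "x \<in> PI"
    \<comment> \<open>The row above x is in \<open>G\<close>, equally long and not in
      \<open>Q\<close>, so it either starts the run or belongs to \<open>PI\<close> again.\<close>
    then show "x \<in> up_runs \<alpha>\<^sub>1 (PI \<union> Q) (G - PI)"
    proof (induction x rule: less_induct)
      case (less x)
      obtain z where z: "z \<ge> 1" "x = Suc z" "x \<in> G" "prow \<delta>\<^sub>1 x = prow \<delta>\<^sub>1 z"
        using PIx[OF less.prems] by blast
      have zG: "z \<in> G" using add_strip_top[OF G, of z x] z by auto
      have xQ: "x \<notin> Q" using less.prems PQ by blast
      have zQ: "z \<notin> Q" and zc: "prow \<alpha>\<^sub>1 x = prow \<alpha>\<^sub>1 z"
        using pa(5)[of x] pa(5)[of z] z xQ prow_Suc_le[OF pa(1) z(1)]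
        by (auto simp: of_bool_def split: if_splits)
      have "z \<in> (G - PI) - (PI \<union> Q) \<union> up_runs \<alpha>\<^sub>1 (PI \<union> Q) (G - PI)"
        using less.IH[of z] z zG zQ by auto
      then show ?case using up_runs_extend[of z "G - PI" "PI \<union> Q" \<alpha>\<^sub>1] z zc less.prems by auto
    qed
  next
    fix x assume "x \<in> up_runs \<alpha>\<^sub>1 (PI \<union> Q) (G - PI)"
    then obtain y where y: "x \<in> PI \<union> Q" "x \<notin> G - PI" "y < x" "y \<in> G" "y \<notin> Q" "prow \<alpha>\<^sub>1 x = prow \<alpha>\<^sub>1 y"
      unfolding up_runs_def by blast
    have y1: "y \<ge> 1" using y pc(4) by auto
    have "prow \<delta>\<^sub>1 x \<le> prow \<delta>\<^sub>1 y" using prow_antimono[OF pa(2) y1] y by simp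
    then have "x \<notin> Q" using pa(5)[of x] pa(5)[OF y1] y y1 by (auto simp: of_bool_def split: if_splits)
    then show "x \<in> PI" using y by blast
  qed
qed

lemma NC_imp_Z:
  assumes "Nstep r \<alpha> \<delta>" "Cstep r p \<delta> \<gamma>"
  shows "Zstep r p \<alpha> \<gamma>"
proof -
  obtain \<alpha>\<^sub>1 \<alpha>\<^sub>2 \<delta>\<^sub>1 \<delta>\<^sub>2 \<gamma>\<^sub>1 \<gamma>\<^sub>2 where e: "\<alpha> = (\<alpha>\<^sub>1, \<alpha>\<^sub>2)" "\<delta> = (\<delta>\<^sub>1, \<delta>\<^sub>2)" "\<gamma> = (\<gamma>\<^sub>1, \<gamma>\<^sub>2)"
    by (metis surj_pair)
  obtain Q A where QA: "add_strip \<alpha>\<^sub>1 Q \<delta>\<^sub>1" "add_strip \<delta>\<^sub>2 A \<alpha>\<^sub>2" "int ` Q = rlab r \<alpha>\<^sub>2 ` A"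
    using assms(1) unfolding Nstep_def e fst_conv snd_conv by blast
  obtain G I where GI: "add_strip \<delta>\<^sub>1 G \<gamma>\<^sub>1" "add_strip \<gamma>\<^sub>2 I \<delta>\<^sub>2" "card G = p + card I"
    "\<And>i. i \<in> I \<Longrightarrow> \<exists>x\<ge>1. int (Suc x) = rlab r \<delta>\<^sub>2 i \<and> Suc x \<in> G \<and> prow \<delta>\<^sub>1 (Suc x) = prow \<delta>\<^sub>1 x"
    using assms(2) unfolding Cstep_def e fst_conv snd_conv by blast
  define PI where "PI = nat ` rlab r \<alpha>\<^sub>2 ` I"
  note s = NC_structure[OF QA GI(1,2,4) PI_def]
  have fP: "finite PI" using s(4) add_stripD(3)[OF GI(1)] finite_subset by blast
  have "card PI = card I"
    using card_rlab[OF add_stripD(2)[OF QA(2)] add_stripD(4)[OF GI(2)] s(2)] .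
  then have "card (G - PI) = p" using GI(3) s(4) fP by (simp add: card_Diff_subset)
  moreover have "add_strip \<gamma>\<^sub>2 (I \<union> A) \<alpha>\<^sub>2"
    using add_strip_union[OF GI(2) QA(2)] s(1) by blast
  moreover have "int ` (PI \<union> Q) = rlab r \<alpha>\<^sub>2 ` (I \<union> A)" using s(2) QA(3) by auto
  moreover have "prow \<gamma>\<^sub>1 x = prow \<alpha>\<^sub>1 x + of_bool (x \<in> PI \<union> Q) + of_bool (x \<in> G - PI)" if "x \<ge> 1" for x
    using add_stripD(5)[OF GI(1) that] add_stripD(5)[OF QA(1) that] s(3,4) by auto
  moreover have "PI \<union> Q \<subseteq> {1..}" "finite (G - PI)" "G - PI \<subseteq> {1..}"
    using s(5) add_stripD[OF GI(1)] add_stripD[OF QA(1)] by auto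
  ultimately show ?thesis
    unfolding Zstep_def e fst_conv snd_conv
    using add_stripD(2)[OF GI(1)] add_stripD(1)[OF QA(1)] by blast
qed

lemma NC_unique:
  assumes "Nstep r \<alpha> \<delta>" "Cstep r p \<delta> \<gamma>" "Nstep r \<alpha> \<delta>'" "Cstep r p \<delta>' \<gamma>"
  shows "\<delta> = \<delta>'"
proof -
  obtain \<alpha>\<^sub>1 \<alpha>\<^sub>2 \<delta>\<^sub>1 \<delta>\<^sub>2 \<gamma>\<^sub>1 \<gamma>\<^sub>2 \<delta>'\<^sub>1 \<delta>'\<^sub>2 where e: "\<alpha> = (\<alpha>\<^sub>1, \<alpha>\<^sub>2)" "\<delta> = (\<delta>\<^sub>1, \<delta>\<^sub>2)" "\<gamma> = (\<gamma>\<^sub>1, \<gamma>\<^sub>2)" "\<delta>' = (\<delta>'\<^sub>1, \<delta>'\<^sub>2)"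
    by (metis surj_pair)
  obtain Q A where QA: "add_strip \<alpha>\<^sub>1 Q \<delta>\<^sub>1" "add_strip \<delta>\<^sub>2 A \<alpha>\<^sub>2" "int ` Q = rlab r \<alpha>\<^sub>2 ` A"
    using assms(1) unfolding Nstep_def e fst_conv snd_conv by blast
  obtain G I where GI: "add_strip \<delta>\<^sub>1 G \<gamma>\<^sub>1" "add_strip \<gamma>\<^sub>2 I \<delta>\<^sub>2" "card G = p + card I"
    "\<And>i. i \<in> I \<Longrightarrow> \<exists>x\<ge>1. int (Suc x) = rlab r \<delta>\<^sub>2 i \<and> Suc x \<in> G \<and> prow \<delta>\<^sub>1 (Suc x) = prow \<delta>\<^sub>1 x"
    using assms(2) unfolding Cstep_def e fst_conv snd_conv by blast
  obtain Q' A' where QA': "add_strip \<alpha>\<^sub>1 Q' \<delta>'\<^sub>1" "add_strip \<delta>'\<^sub>2 A' \<alpha>\<^sub>2" "int ` Q' = rlab r \<alpha>\<^sub>2 ` A'"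
    using assms(3) unfolding Nstep_def e fst_conv snd_conv by blast
  obtain G' I' where GI': "add_strip \<delta>'\<^sub>1 G' \<gamma>\<^sub>1" "add_strip \<gamma>\<^sub>2 I' \<delta>'\<^sub>2" "card G' = p + card I'"
    "\<And>i. i \<in> I' \<Longrightarrow> \<exists>x\<ge>1. int (Suc x) = rlab r \<delta>'\<^sub>2 i \<and> Suc x \<in> G' \<and> prow \<delta>'\<^sub>1 (Suc x) = prow \<delta>'\<^sub>1 x"
    using assms(4) unfolding Cstep_def e fst_conv snd_conv by blast
  define PI where "PI = nat ` rlab r \<alpha>\<^sub>2 ` I"
  define PI' where "PI' = nat ` rlab r \<alpha>\<^sub>2 ` I'"
  note s = NC_structure[OF QA GI(1,2,4) PI_def] and s' = NC_structure[OF QA' GI'(1,2,4) PI'_def]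
  have u: "I \<union> A = I' \<union> A'" "PI \<union> Q = PI' \<union> Q'" "G - PI = G' - PI'"
  proof -
    have a: "add_strip \<gamma>\<^sub>2 (I \<union> A) \<alpha>\<^sub>2" using add_strip_union[OF GI(2) QA(2)] s(1) by blast
    have a': "add_strip \<gamma>\<^sub>2 (I' \<union> A') \<alpha>\<^sub>2" using add_strip_union[OF GI'(2) QA'(2)] s'(1) by blast
    have b: "int ` (PI \<union> Q) = rlab r \<alpha>\<^sub>2 ` (I \<union> A)" using s(2) QA(3) by auto
    have b': "int ` (PI' \<union> Q') = rlab r \<alpha>\<^sub>2 ` (I' \<union> A')" using s'(2) QA'(3) by auto
    have c: "G - PI \<subseteq> {1..}" "G' - PI' \<subseteq> {1..}" using add_stripD(4)[OF GI(1)] add_stripD(4)[OF GI'(1)] by auto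
    have d: "prow \<gamma>\<^sub>1 x = prow \<alpha>\<^sub>1 x + of_bool (x \<in> PI \<union> Q) + of_bool (x \<in> G - PI)" if "x \<ge> 1" for x
      using add_stripD(5)[OF GI(1) that] add_stripD(5)[OF QA(1) that] s(3,4) by auto
    have d': "prow \<gamma>\<^sub>1 x = prow \<alpha>\<^sub>1 x + of_bool (x \<in> PI' \<union> Q') + of_bool (x \<in> G' - PI')" if "x \<ge> 1" for x
      using add_stripD(5)[OF GI'(1) that] add_stripD(5)[OF QA'(1) that] s'(3,4) by auto
    show "I \<union> A = I' \<union> A'" "PI \<union> Q = PI' \<union> Q'" "G - PI = G' - PI'"
      using Z_data_unique[OF a b c(1) d a' b' c(2) d'] by auto
  qed
  have PI: "PI = PI'" using s(6) s'(6) u by metis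
  then have "Q = Q'" using u(2) s(3) s'(3) by blast
  have "rlab r \<alpha>\<^sub>2 ` A = rlab r \<alpha>\<^sub>2 ` A'" using QA(3) QA'(3) \<open>Q = Q'\<close> by metis
  moreover have "inj_on (rlab r \<alpha>\<^sub>2) {1..}"
    using rlab_inj[OF add_stripD(2)[OF QA(2)]] by (auto simp: inj_on_def)
  ultimately have "A = A'"
    using inj_on_image_eq_iff add_stripD(4)[OF QA(2)] add_stripD(4)[OF QA'(2)] by metis
  then show ?thesis using \<open>Q = Q'\<close> QA(1,2) QA'(1,2) add_strip_upper_unique add_strip_lower_unique
    unfolding e by blast
qed

text \<open>The counterpart of \<open>Z_imp_CN\<close>: the first step takes \<open>P\<close>
  without the runs hanging below rows of H - P, which are left to the second step.\<close>

lemma Z_imp_NC: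
  assumes "Zstep r p \<alpha> \<gamma>"
  shows "\<exists>\<delta>. Nstep r \<alpha> \<delta> \<and> Cstep r p \<delta> \<gamma>"
proof -
  obtain \<alpha>\<^sub>1 \<alpha>\<^sub>2 \<gamma>\<^sub>1 \<gamma>\<^sub>2 where e: "\<alpha> = (\<alpha>\<^sub>1, \<alpha>\<^sub>2)" "\<gamma> = (\<gamma>\<^sub>1, \<gamma>\<^sub>2)" by (metis surj_pair)
  obtain C P H where Z: "is_partition \<alpha>\<^sub>1" "is_partition \<gamma>\<^sub>1" "add_strip \<gamma>\<^sub>2 C \<alpha>\<^sub>2" "int ` P = rlab r \<alpha>\<^sub>2 ` C"
    "P \<subseteq> {1..}" "finite H" "H \<subseteq> {1..}" "card H = p"
    "\<forall>x\<ge>1. prow \<gamma>\<^sub>1 x = prow \<alpha>\<^sub>1 x + of_bool (x \<in> P) + of_bool (x \<in> H)"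
    using assms unfolding Zstep_def e fst_conv snd_conv by blast
  note pc = add_stripD[OF Z(3)]
  define U where "U = up_runs \<alpha>\<^sub>1 P H"
  have UP: "U \<subseteq> P - H" by (auto simp: U_def up_runs_def)
  have H0: "0 \<notin> H" using Z(7) by auto
  have "finite (int ` P)" using Z(4) pc(3) by simp
  then have fP: "finite P" by (simp add: finite_image_iff)
  have fU: "finite U" using UP fP finite_subset by blast
  have "\<exists>\<delta>\<^sub>1. add_strip \<alpha>\<^sub>1 (P - U) \<delta>\<^sub>1"
  proof (rule add_strip_exists_upper[OF Z(1)])
    show "finite (P - U)" "P - U \<subseteq> {1..}" using fP Z by auto
    fix x :: nat assume x: "1 \<le> x" "Suc x \<in> P - U" "prow \<alpha>\<^sub>1 (Suc x) = prow \<alpha>\<^sub>1 x"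
    have le: "of_bool (Suc x \<in> P) + of_bool (Suc x \<in> H) \<le> (of_bool (x \<in> P) + of_bool (x \<in> H) :: nat)"
      using prow_Suc_le[OF Z(2) x(1)] Z(9)[rule_format, of x] Z(9)[rule_format, of "Suc x"] x by simp
    show "x \<in> P - U"
    proof (rule ccontr)
      assume n: "x \<notin> P - U"
      have "x \<in> H - P \<union> U" "Suc x \<notin> H"
        using le x(2) n UP by (auto simp: of_bool_def split: if_splits)
      then have "Suc x \<in> U" unfolding U_def using up_runs_extend[of x H P \<alpha>\<^sub>1] x by blast
      then show False using x by simp
    qed
  qed
  then obtain \<delta>\<^sub>1 where d1: "add_strip \<alpha>\<^sub>1 (P - U) \<delta>\<^sub>1" by blast
  define I where "I = {i \<in> C. \<exists>x\<in>U. int x = rlab r \<alpha>\<^sub>2 i}"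
  have IU: "int ` U = rlab r \<alpha>\<^sub>2 ` I"
  proof
    show "int ` U \<subseteq> rlab r \<alpha>\<^sub>2 ` I"
    proof clarify
      fix x assume x: "x \<in> U"
      then have "int x \<in> rlab r \<alpha>\<^sub>2 ` C" using UP Z(4) by blast
      then obtain i where "i \<in> C" "int x = rlab r \<alpha>\<^sub>2 i" by blast
      then show "int x \<in> rlab r \<alpha>\<^sub>2 ` I" using x unfolding I_def by blast
    qed
    show "rlab r \<alpha>\<^sub>2 ` I \<subseteq> int ` U" unfolding I_def by (auto intro: rev_image_eqI)
  qed
  have A: "int ` (P - U) = rlab r \<alpha>\<^sub>2 ` (C - I)"
  proof -
    have inj: "inj_on (rlab r \<alpha>\<^sub>2) C" using rlab_inj[OF pc(2)] pc(4) by (auto simp: inj_on_def)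
    have "int ` (P - U) = int ` P - int ` U" by (simp add: image_set_diff)
    also have "\<dots> = rlab r \<alpha>\<^sub>2 ` (C - I)"
      using inj_on_image_set_diff[OF inj, of C I] IU Z(4) by (auto simp: I_def)
    finally show ?thesis .
  qed
  have "\<exists>\<delta>\<^sub>2. add_strip \<delta>\<^sub>2 (C - I) \<alpha>\<^sub>2 \<and> add_strip \<gamma>\<^sub>2 (C - (C - I)) \<delta>\<^sub>2"
  proof (rule add_strip_split_exists[OF Z(3)])
    fix i assume i: "1 \<le> i" "i \<in> C - I" "Suc i \<in> C" "prow \<alpha>\<^sub>2 (Suc i) = prow \<alpha>\<^sub>2 i"
    show "Suc i \<in> C - I"
    proof (rule ccontr)
      assume "Suc i \<notin> C - I"
      then obtain x' where x': "x' \<in> U" "int x' = rlab r \<alpha>\<^sub>2 (Suc i)" using i by (auto simp: I_def)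
      have "rlab r \<alpha>\<^sub>2 i \<in> int ` P" using i Z(4) by blast
      then obtain x where x: "x \<in> P" "int x = rlab r \<alpha>\<^sub>2 i" by (metis imageE)
      have "int x' = int x + 1" using x x' i by (simp add: rlab_def)
      then have "x' = Suc x" by simp
      then have "x \<in> U" using up_runs_step(2)[of x \<alpha>\<^sub>1 P H] x x' Z(1) H0 unfolding U_def by blast
      then show False using i x by (auto simp: I_def)
    qed
  qed auto
  moreover have "C - (C - I) = I" by (auto simp: I_def)
  ultimately obtain \<delta>\<^sub>2 where d2: "add_strip \<delta>\<^sub>2 (C - I) \<alpha>\<^sub>2" "add_strip \<gamma>\<^sub>2 I \<delta>\<^sub>2" by auto
  have N: "Nstep r \<alpha> (\<delta>\<^sub>1, \<delta>\<^sub>2)"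
    unfolding Nstep_def e fst_conv snd_conv using d1 d2 A by blast
  have cG: "card (H \<union> U) = p + card I"
  proof -
    have "card U = card I" using card_rlab[OF pc(2) add_stripD(4)[OF d2(2)] IU] .
    moreover have "card (H \<union> U) = card H + card U"
      using UP fU Z(6) by (intro card_Un_disjoint) auto
    ultimately show ?thesis using Z(8) by simp
  qed
  have "prow \<gamma>\<^sub>1 x = prow \<delta>\<^sub>1 x + of_bool (x \<in> H \<union> U)" if "x \<ge> 1" for x
    using add_stripD(5)[OF d1 that] Z(9)[rule_format, OF that] UP
    by (auto simp: of_bool_def split: if_splits)
  moreover have "U \<subseteq> {1..}" using UP Z(5) by auto
  ultimately have G: "add_strip \<delta>\<^sub>1 (H \<union> U) \<gamma>\<^sub>1"
    using add_stripD(2)[OF d1] Z(2,6,7) fU by (auto simp: add_strip_def)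
  have "\<exists>x\<ge>1. int (Suc x) = rlab r \<delta>\<^sub>2 i \<and> Suc x \<in> H \<union> U \<and> prow \<delta>\<^sub>1 (Suc x) = prow \<delta>\<^sub>1 x" if iI: "i \<in> I" for i
  proof -
    obtain x' where x': "x' \<in> U" "int x' = rlab r \<alpha>\<^sub>2 i" using iI by (auto simp: I_def)
    have "x' \<ge> 1" using x' UP Z(5) by auto
    then obtain x where x: "x' = Suc x" by (cases x') auto
    have "Suc x \<in> up_runs \<alpha>\<^sub>1 P H" using x' x by (simp add: U_def)
    note st = up_runs_step[OF this Z(1) H0, folded U_def]
    \<comment> \<open>Neither row grows in the first step, so they stay equally long.\<close>
    have "Suc x \<notin> P - U" "x \<notin> P - U" using x' x st(2) by auto
    then have "prow \<delta>\<^sub>1 (Suc x) = prow \<delta>\<^sub>1 x" using add_stripD(5)[OF d1, of x] add_stripD(5)[OF d1, of "Suc x"] st by simp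
    moreover have "rlab r \<delta>\<^sub>2 i = rlab r \<alpha>\<^sub>2 i" using rlab_lower[OF d2(1), of i r] iI pc(4) by (auto simp: I_def)
    ultimately show ?thesis using st x x' by auto
  qed
  then have "Cstep r p (\<delta>\<^sub>1, \<delta>\<^sub>2) \<gamma>"
    unfolding Cstep_def e fst_conv snd_conv using G d2(2) cG by blast
  then show ?thesis using N by blast
qed

text \<open>Each composite is multiplicity-free, the intermediate pair being unique, and both reach
  exactly the pairs described by \<open>Zstep\<close>.\<close>

lemma sum_CN_eq_sum_NC:
  fixes f :: "nat list \<times> nat list \<Rightarrow> 'a::comm_monoid_add"
  assumes fC: "\<And>r p \<alpha>. finite {\<gamma>. Cstep r p \<alpha> \<gamma>}" and fN: "\<And>r \<alpha>. finite {\<gamma>. Nstep r \<alpha> \<gamma>}"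
  shows "(\<Sum>\<delta> \<in> {\<delta>. Cstep (r + 1) p \<alpha> \<delta>}. \<Sum>\<gamma> \<in> {\<gamma>. Nstep r \<delta> \<gamma>}. f \<gamma>) =
    (\<Sum>\<delta> \<in> {\<delta>. Nstep r \<alpha> \<delta>}. \<Sum>\<gamma> \<in> {\<gamma>. Cstep r p \<delta> \<gamma>}. f \<gamma>)"
proof -
  have "(\<Sum>\<delta> \<in> {\<delta>. Cstep (r + 1) p \<alpha> \<delta>}. \<Sum>\<gamma> \<in> {\<gamma>. Nstep r \<delta> \<gamma>}. f \<gamma>) =
    (\<Sum>(\<delta>, \<gamma>) \<in> (SIGMA \<delta>:{\<delta>. Cstep (r + 1) p \<alpha> \<delta>}. {\<gamma>. Nstep r \<delta> \<gamma>}). f \<gamma>)"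
    by (rule sum.Sigma) (simp_all add: fC fN)
  also have "\<dots> = (\<Sum>\<gamma> \<in> {\<gamma>. Zstep r p \<alpha> \<gamma>}. f \<gamma>)"
  proof -
    have inj: "inj_on snd (SIGMA \<delta>:{\<delta>. Cstep (r + 1) p \<alpha> \<delta>}. {\<gamma>. Nstep r \<delta> \<gamma>})" (is "inj_on snd ?S")
    proof (rule inj_onI)
      fix a b assume "a \<in> ?S" "b \<in> ?S" "snd a = snd b"
      then show "a = b" using CN_unique[of r p \<alpha> "fst a" "snd a" "fst b"] by (auto simp: prod_eq_iff)
    qed
    have im: "snd ` (SIGMA \<delta>:{\<delta>. Cstep (r + 1) p \<alpha> \<delta>}. {\<gamma>. Nstep r \<delta> \<gamma>}) = {\<gamma>. Zstep r p \<alpha> \<gamma>}"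
    proof (rule set_eqI, rule iffI)
      fix \<gamma> assume "\<gamma> \<in> {\<gamma>. Zstep r p \<alpha> \<gamma>}"
      then obtain \<delta> where "(\<delta>, \<gamma>) \<in> ?S" using Z_imp_CN[of r p \<alpha> \<gamma>] by blast
      then show "\<gamma> \<in> snd ` ?S" by (metis image_eqI snd_conv)
    next
      fix \<gamma> assume "\<gamma> \<in> snd ` ?S"
      then obtain \<delta> where "(\<delta>, \<gamma>) \<in> ?S" by auto
      then show "\<gamma> \<in> {\<gamma>. Zstep r p \<alpha> \<gamma>}" using CN_imp_Z[of r p \<alpha> \<delta> \<gamma>] by blast
    qed
    show ?thesis using sum.reindex[OF inj, of f] unfolding im by (simp add: case_prod_unfold)
  qed
  also have "\<dots> = (\<Sum>(\<delta>, \<gamma>) \<in> (SIGMA \<delta>:{\<delta>. Nstep r \<alpha> \<delta>}. {\<gamma>. Cstep r p \<delta> \<gamma>}). f \<gamma>)"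
  proof -
    have inj: "inj_on snd (SIGMA \<delta>:{\<delta>. Nstep r \<alpha> \<delta>}. {\<gamma>. Cstep r p \<delta> \<gamma>})" (is "inj_on snd ?S")
    proof (rule inj_onI)
      fix a b assume "a \<in> ?S" "b \<in> ?S" "snd a = snd b"
      then show "a = b" using NC_unique[of r \<alpha> "fst a" p "snd a" "fst b"] by (auto simp: prod_eq_iff)
    qed
    have im: "snd ` (SIGMA \<delta>:{\<delta>. Nstep r \<alpha> \<delta>}. {\<gamma>. Cstep r p \<delta> \<gamma>}) = {\<gamma>. Zstep r p \<alpha> \<gamma>}"
    proof (rule set_eqI, rule iffI)
      fix \<gamma> assume "\<gamma> \<in> {\<gamma>. Zstep r p \<alpha> \<gamma>}"
      then obtain \<delta> where "(\<delta>, \<gamma>) \<in> ?S" using Z_imp_NC[of r p \<alpha> \<gamma>] by blast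
      then show "\<gamma> \<in> snd ` ?S" by (metis image_eqI snd_conv)
    next
      fix \<gamma> assume "\<gamma> \<in> snd ` ?S"
      then obtain \<delta> where "(\<delta>, \<gamma>) \<in> ?S" by auto
      then show "\<gamma> \<in> {\<gamma>. Zstep r p \<alpha> \<gamma>}" using NC_imp_Z[of r \<alpha> \<delta> p \<gamma>] by blast
    qed
    show ?thesis using sum.reindex[OF inj, of f] unfolding im by (simp add: case_prod_unfold)
  qed
  also have "\<dots> = (\<Sum>\<delta> \<in> {\<delta>. Nstep r \<alpha> \<delta>}. \<Sum>\<gamma> \<in> {\<gamma>. Cstep r p \<delta> \<gamma>}. f \<gamma>)"
    by (rule sum.Sigma[symmetric]) (simp_all add: fC fN)
  finally show ?thesis .
qed

section \<open>From one row rule to the next\<close>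

text \<open>The case \<gamma> = \<alpha> with the zero filling is included, so that sums over good
  fillings contain the term of the pair itself.\<close>

definition good_filling :: "int \<Rightarrow> nat list \<times> nat list \<Rightarrow> nat list \<times> nat list \<Rightarrow> (box \<Rightarrow> nat) \<Rightarrow> bool" where
  "good_filling r \<alpha> \<gamma> L \<longleftrightarrow> is_partition (fst \<alpha>) \<and> is_partition (snd \<alpha>) \<and>
     is_partition (fst \<gamma>) \<and> is_partition (snd \<gamma>) \<and> diagram (snd \<gamma>) \<subseteq> diagram (snd \<alpha>) \<and>
     lattice_filling (skew (snd \<alpha>) (snd \<gamma>)) (fst \<alpha>) (fst \<gamma>) L \<and>
     (\<forall>b\<in>skew (snd \<alpha>) (snd \<gamma>). row_rule_filling r b \<le> int (L b))"

text \<open>The entries attaining equality in the \<open>r\<close>-th row rule are the ones violating the next rule.\<close>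

definition tight :: "int \<Rightarrow> box set \<Rightarrow> (box \<Rightarrow> nat) \<Rightarrow> box set" where
  "tight r D L = {b \<in> D. int (L b) = row_rule_filling r b}"

lemma cnt_split:
  assumes "finite D" "X \<subseteq> D"
  shows "cnt D L a b = cnt (D - X) L a b + cnt X L a b"
proof -
  have "{c \<in> D. L c = a \<and> rdle c b} = {c \<in> D - X. L c = a \<and> rdle c b} \<union> {c \<in> X. L c = a \<and> rdle c b}"
    using assms(2) by blast
  moreover have "finite X" using assms finite_subset by blast
  ultimately show ?thesis unfolding cnt_def using assms(1) by (simp, intro card_Un_disjoint) auto
qed

lemma card_split:
  assumes "finite D" "X \<subseteq> D"
  shows "card {c \<in> D. L c = a} = card {c \<in> D - X. L c = a} + card {c \<in> X. L c = a}"
proof -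
  have "{c \<in> D. L c = a} = {c \<in> D - X. L c = a} \<union> {c \<in> X. L c = a}" using assms(2) by blast
  moreover have "finite X" using assms finite_subset by blast
  ultimately show ?thesis using assms(1) by (simp, intro card_Un_disjoint) auto
qed

lemma cnt_cong: "(\<And>c. c \<in> D \<Longrightarrow> L c = L' c) \<Longrightarrow> cnt D L a b = cnt D L' a b"
  unfolding cnt_def by (rule arg_cong[where f = card]) auto

text \<open>If a tight entry \<open>a\<close> is read before a non-tight entry \<open>a + 1\<close>, then the latter lies in the next
  row, strictly to the right, and the box below the tight one also carries \<open>a + 1\<close>; reading on to
  that box shows that the lattice inequality was strict.\<close>

lemma lattice_remove_tight:
  assumes D: "skew_convex D" and L: "lattice_filling D \<alpha> \<gamma> L"
    and good: "\<And>b. b \<in> D \<Longrightarrow> row_rule_filling r b \<le> int (L b)"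
    and inj: "\<And>b c. b \<in> tight r D L \<Longrightarrow> c \<in> tight r D L \<Longrightarrow> L b = L c \<Longrightarrow> b = c"
    and b: "b \<in> D - tight r D L" "1 \<le> a" "L b = Suc a"
  shows "prow \<alpha> (Suc a) + cnt (D - tight r D L) L (Suc a) b \<le> prow \<alpha> a + cnt (D - tight r D L) L a b"
proof -
  have fD: "finite D" using D by (simp add: skew_convex_def)
  note l = lattice_fillingD[OF L]
  define X where "X = tight r D L"
  have XD: "X \<subseteq> D" by (auto simp: X_def tight_def)
  have fX: "finite X" using XD fD finite_subset by blast
  have bD: "b \<in> D" using b by blast
  have base: "prow \<alpha> (Suc a) + cnt D L (Suc a) b \<le> prow \<alpha> a + cnt D L a b" using l(5) bD b by blast
  note sp = cnt_split[OF fD XD]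
  show ?thesis
  proof (cases "\<exists>x\<in>X. L x = a \<and> rdle x b")
    case False
    then have "{c \<in> X. L c = a \<and> rdle c b} = {}" by blast
    then have "cnt X L a b = 0" unfolding cnt_def by (metis card.empty)
    then show ?thesis using base sp[of L a b] sp[of L "Suc a" b] unfolding X_def by simp
  next
    case True
    then obtain x where x: "x \<in> X" "L x = a" "rdle x b" by blast
    obtain i j i' j' where ij: "x = (i, j)" "b = (i', j')" by (metis surj_pair)
    have xD: "(i, j) \<in> D" using x XD ij by blast
    have bD': "(i', j') \<in> D" using bD ij by simp
    have "int a = r + int i - int j" using x ij by (auto simp: X_def tight_def row_rule_filling_def)
    moreover have "r + int i' - int j' < int (Suc a)"
      using good[OF bD] b ij by (auto simp: tight_def row_rule_filling_def)
    ultimately have cmp: "int i' - int j' \<le> int i - int j" by simp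
    have "x \<noteq> b" using x b by auto
    then have i: "i < i'" using x(3) cmp ij by (auto simp: rdle_def)
    then have j: "j < j'" using cmp by simp
    have c1: "(i, j') \<in> D" using skew_convexD[OF D xD bD', of i j'] i j by simp
    have "L (i, j) \<le> L (i, j')" using row_weak_mono[where L = L, OF D l(3) xD c1] j by simp
    moreover have "L (i, j') + (i' - i) \<le> L (i', j')" using col_strict_mono[where L = L, OF D l(4) c1 bD'] i by simp
    ultimately have i': "i' = Suc i" using x(2) b(3) ij i by simp
    define z where "z = (Suc i, j)"
    have zD: "(Suc i, j) \<in> D" using skew_convexD[OF D xD bD', of "Suc i" j] i j i' by simp
    have bD2: "(Suc i, j') \<in> D" using bD' i' by simp
    have Lz: "L z = Suc a"
      using l(4)[OF xD zD] row_weak_mono[where L = L, OF D l(3) zD bD2] j x(2) b(3) ij i' by (simp add: z_def)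
    have zr: "prow \<alpha> (Suc a) + cnt D L (Suc a) z \<le> prow \<alpha> a + cnt D L a z"
      using l(5)[of z a] zD b(2) Lz by (simp add: z_def)
    have "rdle b z" "b \<noteq> z" using ij i' j by (auto simp: z_def rdle_def)
    then have more: "cnt D L (Suc a) b < cnt D L (Suc a) z"
      using cnt_less[where L = L, OF fD _ Lz] zD by (simp add: z_def)
    \<comment> \<open>Between \<open>b\<close> and \<open>z\<close> only boxes of row i + 1 from
      column j on are read, and their entries are at least a + 1.\<close>
    have "{c \<in> D. L c = a \<and> rdle c z} = {c \<in> D. L c = a \<and> rdle c b}"
    proof (rule set_eqI, rule iffI)
      fix c assume c: "c \<in> {c \<in> D. L c = a \<and> rdle c z}"
      obtain u q where uq: "c = (u, q)" by (cases c)
      have "\<not> (u = Suc i \<and> j \<le> q)"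
      proof
        assume h: "u = Suc i \<and> j \<le> q"
        then have "L z \<le> L c" using row_weak_mono[where L = L, OF D l(3) zD, of q] c uq by (simp add: z_def)
        then show False using Lz c by simp
      qed
      then show "c \<in> {c \<in> D. L c = a \<and> rdle c b}" using c uq ij i' by (auto simp: z_def rdle_def)
    qed (use \<open>rdle b z\<close> rdle_trans in blast)
    then have "cnt D L a z = cnt D L a b" by (simp add: cnt_def)
    \<comment> \<open>Tight values are distinct, so the removal costs row a at most one box, which
      the strict inequality affords.\<close>
    moreover have "cnt X L a b \<le> 1"
    proof -
      have "{c \<in> X. L c = a \<and> rdle c b} \<subseteq> {x}"
      proof
        fix c assume "c \<in> {c \<in> X. L c = a \<and> rdle c b}"
        then show "c \<in> {x}" using inj[of c x] x by (simp add: X_def)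
      qed
      then have "card {c \<in> X. L c = a \<and> rdle c b} \<le> card {x}" by (intro card_mono) auto
      then show ?thesis by (simp add: cnt_def)
    qed
    ultimately show ?thesis using zr more sp[of L a b] sp[of L "Suc a" b] unfolding X_def by linarith
  qed
qed

text \<open>The lattice inequality at the last entry \<open>Suc a\<close> controls the final row
  lengths; this is what makes the shape reached without the tight entries a partition.\<close>

lemma content_antimono:
  assumes "finite D" "is_partition \<alpha>" "1 \<le> a"
    and lat: "\<And>b. b \<in> D \<Longrightarrow> L b = Suc a \<Longrightarrow> prow \<alpha> (Suc a) + cnt D L (Suc a) b \<le> prow \<alpha> a + cnt D L a b"
  shows "prow \<alpha> (Suc a) + card {c \<in> D. L c = Suc a} \<le> prow \<alpha> a + card {c \<in> D. L c = a}"
proof (cases "\<exists>c\<in>D. L c = Suc a")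
  case True
  define S where "S = {c \<in> D. L c = Suc a}"
  have "finite S" "S \<noteq> {}" using True assms(1) by (auto simp: S_def)
  then have "Max (rdlab D ` S) \<in> rdlab D ` S" by (intro Max_in) auto
  then obtain c where c: "c \<in> S" "rdlab D c = Max (rdlab D ` S)" by (metis imageE)
  have "rdle x c" if "x \<in> S" for x
  proof -
    have "rdlab D x \<le> rdlab D c" using c \<open>finite S\<close> that by simp
    then show ?thesis using rdlab_le_iff[OF assms(1), of c x] c that by (auto simp: S_def)
  qed
  then have "S = {x \<in> D. L x = Suc a \<and> rdle x c}" by (auto simp: S_def)
  then have "card S = cnt D L (Suc a) c" by (simp add: cnt_def)
  moreover have "cnt D L a c \<le> card {c \<in> D. L c = a}"
    unfolding cnt_def by (rule card_mono) (use assms(1) in auto)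
  ultimately show ?thesis using lat[of c] c(1) by (simp add: S_def)
next
  case False
  then have "{c \<in> D. L c = Suc a} = {}" by blast
  then have "card {c \<in> D. L c = Suc a} = 0" by (metis card.empty)
  then show ?thesis using prow_Suc_le[OF assms(2,3)] by simp
qed

text \<open>The tight boxes form a vertical strip on the inner shape because of how bound and entry
  change: one step left the bound rises but the entry does not, and one step up the bound drops by 1
  and the entry by at least 1. Their values are labels of this strip, hence distinct, so the rows
  they fill in the first partition form a vertical strip too.\<close>

lemma good_filling_split:
  assumes g: "good_filling r \<alpha> \<gamma> L"
  shows "\<exists>\<delta> L'. good_filling (r + 1) \<alpha> \<delta> L' \<and> Nstep r \<delta> \<gamma> \<and>
    skew (snd \<delta>) (snd \<gamma>) = tight r (skew (snd \<alpha>) (snd \<gamma>)) L \<and>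
    L' = (\<lambda>b. if b \<in> tight r (skew (snd \<alpha>) (snd \<gamma>)) L then 0 else L b)"
proof -
  obtain \<alpha>\<^sub>1 \<alpha>\<^sub>2 \<gamma>\<^sub>1 \<gamma>\<^sub>2 where e: "\<alpha> = (\<alpha>\<^sub>1, \<alpha>\<^sub>2)" "\<gamma> = (\<gamma>\<^sub>1, \<gamma>\<^sub>2)" by (metis surj_pair)
  define D where "D = skew \<alpha>\<^sub>2 \<gamma>\<^sub>2"
  define X where "X = tight r D L"
  have h: "is_partition \<alpha>\<^sub>1" "is_partition \<alpha>\<^sub>2" "is_partition \<gamma>\<^sub>1" "is_partition \<gamma>\<^sub>2" "diagram \<gamma>\<^sub>2 \<subseteq> diagram \<alpha>\<^sub>2"
    and L: "lattice_filling D \<alpha>\<^sub>1 \<gamma>\<^sub>1 L"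
    and good: "\<And>b. b \<in> D \<Longrightarrow> row_rule_filling r b \<le> int (L b)"
    using g unfolding good_filling_def e fst_conv snd_conv D_def by blast+
  note l = lattice_fillingD[OF L]
  have D: "skew_convex D" unfolding D_def by (rule skew_convex_skew[OF h(2,4)])
  have fD: "finite D" using D by (simp add: skew_convex_def)
  have XD: "X \<subseteq> D" by (auto simp: X_def tight_def)
  have X_col: "j = Suc (prow \<gamma>\<^sub>2 i)" if "(i, j) \<in> X" for i j
  proof (rule ccontr)
    assume n: "j \<noteq> Suc (prow \<gamma>\<^sub>2 i)"
    have ijD: "(i, j) \<in> D" using that XD by blast
    then obtain k where k: "j = Suc k" "(i, k) \<in> D" using n by (cases j) (auto simp: D_def skew_iff)
    have "L (i, k) \<le> L (i, j)" using l(3)[OF k(2)] ijD k(1) by simp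
    then show False using that good[OF k(2)] k(1) by (simp add: X_def tight_def row_rule_filling_def)
  qed
  define I where "I = fst ` X"
  have XI: "(i, j) \<in> X \<longleftrightarrow> i \<in> I \<and> j = Suc (prow \<gamma>\<^sub>2 i)" for i j
    using X_col unfolding I_def by force
  have I1: "I \<subseteq> {1..}" using XD by (force simp: I_def D_def skew_iff)
  have "\<exists>\<delta>\<^sub>2. add_strip \<gamma>\<^sub>2 I \<delta>\<^sub>2"
  proof (rule add_strip_exists_upper[OF h(4) _ I1])
    show "finite I" using XD fD finite_subset by (auto simp: I_def)
    fix i :: nat assume i: "1 \<le> i" "Suc i \<in> I" "prow \<gamma>\<^sub>2 (Suc i) = prow \<gamma>\<^sub>2 i"
    define j where "j = Suc (prow \<gamma>\<^sub>2 i)"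
    have sX: "(Suc i, j) \<in> X" using i XI by (simp add: j_def)
    then have sD: "(Suc i, j) \<in> D" using XD by blast
    then have iD: "(i, j) \<in> D" using prow_Suc_le[OF h(2) i(1)] i by (auto simp: D_def skew_iff j_def)
    have "L (i, j) < L (Suc i, j)" using l(4)[OF iD sD] .
    then have "(i, j) \<in> X" using sX good[OF iD] iD by (auto simp: X_def tight_def row_rule_filling_def)
    then show "i \<in> I" using XI by simp
  qed
  then obtain \<delta>\<^sub>2 where d2: "add_strip \<gamma>\<^sub>2 I \<delta>\<^sub>2" by blast
  have skX: "skew \<delta>\<^sub>2 \<gamma>\<^sub>2 = X" using add_strip_skew[OF d2] XI by auto
  have sub: "diagram \<delta>\<^sub>2 \<subseteq> diagram \<alpha>\<^sub>2" "diagram \<gamma>\<^sub>2 \<subseteq> diagram \<delta>\<^sub>2"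
  proof -
    show "diagram \<gamma>\<^sub>2 \<subseteq> diagram \<delta>\<^sub>2" using add_strip_diagram_subset[OF d2] .
    have "diagram \<delta>\<^sub>2 \<subseteq> diagram \<gamma>\<^sub>2 \<union> X" using skX by (auto simp: skew_def)
    then show "diagram \<delta>\<^sub>2 \<subseteq> diagram \<alpha>\<^sub>2" using XD h(5) by (auto simp: D_def skew_def)
  qed
  have skD: "skew \<alpha>\<^sub>2 \<delta>\<^sub>2 = D - X" using skX sub by (auto simp: D_def skew_def)
  have Xval: "int (L b) = rlab r \<delta>\<^sub>2 (fst b)" if "b \<in> X" for b
  proof -
    obtain i j where ij: "b = (i, j)" by (cases b)
    then have "i \<in> I" "j = Suc (prow \<gamma>\<^sub>2 i)" using that XI by auto
    moreover have "prow \<delta>\<^sub>2 i = Suc (prow \<gamma>\<^sub>2 i)" using add_stripD(5)[OF d2, of i] I1 calculation by auto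
    ultimately show ?thesis using that ij by (simp add: X_def tight_def row_rule_filling_def rlab_def)
  qed
  have injX: "b = c" if bc: "b \<in> X" "c \<in> X" "L b = L c" for b c
  proof -
    obtain i j i' j' where ij: "b = (i, j)" "c = (i', j')" by (metis surj_pair)
    have i1: "i \<ge> 1" "i' \<ge> 1" using bc ij XI I1 by auto
    have "rlab r \<delta>\<^sub>2 i = rlab r \<delta>\<^sub>2 i'" using Xval[OF bc(1)] Xval[OF bc(2)] bc(3) ij by simp
    then have "i = i'" by (rule rlab_inj[OF add_stripD(2)[OF d2] i1])
    then show ?thesis using bc ij XI by auto
  qed
  have lat: "prow \<alpha>\<^sub>1 (Suc a) + cnt (D - X) L (Suc a) b \<le> prow \<alpha>\<^sub>1 a + cnt (D - X) L a b"
    if "b \<in> D - X" "1 \<le> a" "L b = Suc a" for a b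
    using lattice_remove_tight[OF D L good, of b a] injX that unfolding X_def by blast
  have "\<exists>\<delta>\<^sub>1. is_partition \<delta>\<^sub>1 \<and> (\<forall>a\<ge>1. prow \<delta>\<^sub>1 a = prow \<alpha>\<^sub>1 a + card {c \<in> D - X. L c = a})"
  proof (rule partition_of_fun)
    fix a :: nat assume a: "1 \<le> a"
    show "prow \<alpha>\<^sub>1 (Suc a) + card {c \<in> D - X. L c = Suc a} \<le> prow \<alpha>\<^sub>1 a + card {c \<in> D - X. L c = a}"
      by (rule content_antimono[OF _ h(1) a]) (use lat a fD in auto)
  next
    define N where "N = length \<gamma>\<^sub>1"
    have "card {c \<in> D - X. L c = Suc N} \<le> card {c \<in> D. L c = Suc N}" by (rule card_mono) (use fD in auto)
    then show "prow \<alpha>\<^sub>1 (Suc N) + card {c \<in> D - X. L c = Suc N} = 0"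
      using l(6)[of "Suc N"] prow_beyond[of \<gamma>\<^sub>1 "Suc N"] by (simp add: N_def)
  qed
  then obtain \<delta>\<^sub>1 where d1: "is_partition \<delta>\<^sub>1" "\<And>a. 1 \<le> a \<Longrightarrow> prow \<delta>\<^sub>1 a = prow \<alpha>\<^sub>1 a + card {c \<in> D - X. L c = a}"
    by blast
  define L' where "L' = (\<lambda>b. if b \<in> X then 0 else L b)"
  have LL: "L' c = L c" if "c \<in> D - X" for c using that by (simp add: L'_def)
  have cc: "cnt (D - X) L' a b = cnt (D - X) L a b" for a b by (rule cnt_cong) (rule LL)
  have cs: "{c \<in> D - X. L' c = a} = {c \<in> D - X. L c = a}" for a using LL by auto
  have "lattice_filling (D - X) \<alpha>\<^sub>1 \<delta>\<^sub>1 L'"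
    unfolding lattice_filling_def cc cs
  proof (intro conjI allI impI ballI)
    show "L' b = 0" if "b \<notin> D - X" for b using that l(1)[of b] by (auto simp: L'_def)
    show "1 \<le> L' b" if "b \<in> D - X" for b using l(2)[of b] LL that by auto
    show "L' (i, j) \<le> L' (i, Suc j)" if "(i, j) \<in> D - X \<and> (i, Suc j) \<in> D - X" for i j
      using l(3)[of i j] LL that by auto
    show "L' (i, j) < L' (Suc i, j)" if "(i, j) \<in> D - X \<and> (Suc i, j) \<in> D - X" for i j
      using l(4)[of i j] LL that by auto
    show "prow \<alpha>\<^sub>1 (Suc a) + cnt (D - X) L (Suc a) b \<le> prow \<alpha>\<^sub>1 a + cnt (D - X) L a b"
      if "b \<in> D - X" "1 \<le> a" "L' b = Suc a" for b a using lat that LL by simp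
    show "prow \<delta>\<^sub>1 a = prow \<alpha>\<^sub>1 a + card {c \<in> D - X. L c = a}" if "1 \<le> a" for a using d1(2) that .
  qed
  moreover have "row_rule_filling (r + 1) b \<le> int (L' b)" if b: "b \<in> D - X" for b
  proof -
    have "row_rule_filling r b < int (L b)" using good[of b] b by (auto simp: X_def tight_def)
    moreover have "row_rule_filling (r + 1) b = row_rule_filling r b + 1" by (simp add: row_rule_filling_def)
    ultimately show ?thesis using LL[OF b] by simp
  qed
  ultimately have gf: "good_filling (r + 1) \<alpha> (\<delta>\<^sub>1, \<delta>\<^sub>2) L'"
    unfolding good_filling_def e fst_conv snd_conv skD using h d1(1) add_stripD(2)[OF d2] sub(1) by blast
  define Q where "Q = L ` X"
  have fX: "finite X" using XD fD finite_subset by blast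
  have Qcard: "card {c \<in> X. L c = a} = of_bool (a \<in> Q)" for a
  proof (cases "a \<in> Q")
    case True
    then obtain x where x: "x \<in> X" "L x = a" by (auto simp: Q_def)
    have "{c \<in> X. L c = a} = {x}" using injX x by blast
    then show ?thesis using True by simp
  next
    case False
    then have "{c \<in> X. L c = a} = {}" by (auto simp: Q_def)
    then have "card {c \<in> X. L c = a} = 0" by (metis card.empty)
    then show ?thesis using False by simp
  qed
  have "prow \<gamma>\<^sub>1 a = prow \<delta>\<^sub>1 a + of_bool (a \<in> Q)" if "a \<ge> 1" for a
    using l(6)[OF that] d1(2)[OF that] card_split[OF fD XD, of L a] Qcard[of a] by simp
  moreover have "Q \<subseteq> {1..}" using l(2) XD by (auto simp: Q_def)
  ultimately have "add_strip \<delta>\<^sub>1 Q \<gamma>\<^sub>1" using d1(1) h(3) fX by (auto simp: add_strip_def Q_def)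
  moreover have "int ` Q = rlab r \<delta>\<^sub>2 ` I"
    unfolding Q_def I_def image_image using Xval by (rule image_cong[OF refl])
  ultimately have "Nstep r (\<delta>\<^sub>1, \<delta>\<^sub>2) \<gamma>" unfolding Nstep_def e fst_conv snd_conv using d2 by blast
  then show ?thesis
    using gf skX unfolding e fst_conv snd_conv D_def[symmetric] X_def[symmetric] L'_def by fastforce
qed

text \<open>Conversely, tight entries can be inserted: a non-tight \<open>a + 1\<close> read after a tight \<open>a + 1\<close>, or a
  non-tight \<open>a\<close> read after it, would have to be both strictly south-east of it and not larger.\<close>

lemma good_filling_merge:
  assumes g: "good_filling (r + 1) \<alpha> \<delta> L'" and N: "Nstep r \<delta> \<gamma>"
    and L: "L = (\<lambda>b. if b \<in> skew (snd \<delta>) (snd \<gamma>) then nat (row_rule_filling r b) else L' b)"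
  shows "good_filling r \<alpha> \<gamma> L \<and> tight r (skew (snd \<alpha>) (snd \<gamma>)) L = skew (snd \<delta>) (snd \<gamma>)"
proof -
  obtain \<alpha>\<^sub>1 \<alpha>\<^sub>2 \<delta>\<^sub>1 \<delta>\<^sub>2 \<gamma>\<^sub>1 \<gamma>\<^sub>2 where e: "\<alpha> = (\<alpha>\<^sub>1, \<alpha>\<^sub>2)" "\<delta> = (\<delta>\<^sub>1, \<delta>\<^sub>2)" "\<gamma> = (\<gamma>\<^sub>1, \<gamma>\<^sub>2)" by (metis surj_pair)
  define D' where "D' = skew \<alpha>\<^sub>2 \<delta>\<^sub>2"
  define D where "D = skew \<alpha>\<^sub>2 \<gamma>\<^sub>2"
  define X where "X = skew \<delta>\<^sub>2 \<gamma>\<^sub>2"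
  have h: "is_partition \<alpha>\<^sub>1" "is_partition \<alpha>\<^sub>2" "is_partition \<delta>\<^sub>1" "is_partition \<delta>\<^sub>2" "diagram \<delta>\<^sub>2 \<subseteq> diagram \<alpha>\<^sub>2"
    and L'f: "lattice_filling D' \<alpha>\<^sub>1 \<delta>\<^sub>1 L'"
    and good': "\<And>b. b \<in> D' \<Longrightarrow> row_rule_filling (r + 1) b \<le> int (L' b)"
    using g unfolding good_filling_def e fst_conv snd_conv D'_def by blast+
  note l = lattice_fillingD[OF L'f]
  obtain Q I where Q: "add_strip \<delta>\<^sub>1 Q \<gamma>\<^sub>1" and I: "add_strip \<gamma>\<^sub>2 I \<delta>\<^sub>2" and QI: "int ` Q = rlab r \<delta>\<^sub>2 ` I"
    using N unfolding Nstep_def e fst_conv snd_conv by blast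
  note pq = add_stripD[OF Q] and pi = add_stripD[OF I]
  have sub: "diagram \<gamma>\<^sub>2 \<subseteq> diagram \<delta>\<^sub>2" using add_strip_diagram_subset[OF I] .
  have DX: "D' = D - X" "X \<subseteq> D" using sub h(5) by (auto simp: D'_def D_def X_def skew_def)
  have Dc: "skew_convex D" unfolding D_def by (rule skew_convex_skew[OF h(2) pi(1)])
  have fD: "finite D" "finite D'" "finite X" by (auto simp: D_def D'_def X_def)
  have Xeq: "X = (\<lambda>i. (i, Suc (prow \<gamma>\<^sub>2 i))) ` I" unfolding X_def by (rule add_strip_skew[OF I])
  have Ld: "L = (\<lambda>b. if b \<in> X then nat (row_rule_filling r b) else L' b)" using L by (simp add: X_def e)
  have Xval: "int (L b) = row_rule_filling r b \<and> row_rule_filling r b = rlab r \<delta>\<^sub>2 (fst b) \<and> L b \<in> Q" if b: "b \<in> X" for b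
  proof -
    obtain i where i: "i \<in> I" "b = (i, Suc (prow \<gamma>\<^sub>2 i))" using b Xeq by blast
    have "prow \<delta>\<^sub>2 i = Suc (prow \<gamma>\<^sub>2 i)" using pi(4,5) i(1) by auto
    then have e2: "row_rule_filling r b = rlab r \<delta>\<^sub>2 (fst b)" using i by (simp add: row_rule_filling_def rlab_def)
    have "rlab r \<delta>\<^sub>2 i \<in> int ` Q" using QI i(1) by blast
    then obtain q where q: "q \<in> Q" "int q = rlab r \<delta>\<^sub>2 i" by (metis imageE)
    have "L b = q" using b e2 q i by (simp add: Ld)
    then show ?thesis using q e2 i by simp
  qed
  have LD': "L b = L' b" if "b \<in> D'" for b using that DX by (auto simp: Ld)
  have tightX: "row_rule_filling r b < int (L b)" if "b \<in> D'" for b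
    using good'[OF that] LD'[OF that] by (simp add: row_rule_filling_def)
  have XorD: "b \<in> X \<or> b \<in> D'" if "b \<in> D" for b using that DX by blast
  have good: "row_rule_filling r b \<le> int (L b)" if "b \<in> D" for b
    using XorD[OF that] Xval[of b] tightX[of b] by auto
  have tight_eq: "tight r D L = X" using Xval tightX DX by (fastforce simp: tight_def)
  have pos: "1 \<le> L b" if "b \<in> D" for b
    using XorD[OF that] Xval[of b] pq(4) l(2)[of b] LD'[of b] by auto
  have X_left: "(i, Suc j) \<notin> X" if "(i, j) \<in> D" for i j
    using that Xeq by (auto simp: D_def skew_iff)
  have rows: "L (i, j) \<le> L (i, Suc j)" if ij: "(i, j) \<in> D" "(i, Suc j) \<in> D" for i j
  proof -
    have s: "(i, Suc j) \<in> D'" using XorD[OF ij(2)] X_left[OF ij(1)] by blast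
    show ?thesis
    proof (cases "(i, j) \<in> X")
      case True
      then show ?thesis using Xval[OF True] tightX[OF s] by (simp add: row_rule_filling_def)
    next
      case False
      then have "(i, j) \<in> D'" using XorD[OF ij(1)] by blast
      then show ?thesis using l(3) s LD' by simp
    qed
  qed
  have cols: "L (i, j) < L (Suc i, j)" if ij: "(i, j) \<in> D" "(Suc i, j) \<in> D" for i j
  proof (cases "(i, j) \<in> X")
    case True
    then show ?thesis using Xval[OF True] good[OF ij(2)] by (simp add: row_rule_filling_def)
  next
    case False
    then have d: "(i, j) \<in> D'" using XorD[OF ij(1)] by blast
    have "(Suc i, j) \<notin> X"
      using d prow_Suc_le[OF h(4), of i] by (auto simp: X_def D'_def skew_iff)
    then have "(Suc i, j) \<in> D'" using XorD[OF ij(2)] by blast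
    then show ?thesis using l(4) d LD' by simp
  qed
  have se: "L (i, j) < L (i', j')" if "(i, j) \<in> D" "(i', j') \<in> D" "i < i'" "j \<le> j'" for i j i' j'
  proof -
    have c: "(i, j') \<in> D" using skew_convexD[OF Dc that(1,2), of i j'] that by simp
    have "L (i, j) \<le> L (i, j')" using row_weak_mono[where L = L, OF Dc rows that(1) c] that by simp
    moreover have "L (i, j') + (i' - i) \<le> L (i', j')"
      using col_strict_mono[where L = L, OF Dc cols c that(2)] that by simp
    ultimately show ?thesis using that by simp
  qed
  have injX: "b = c" if bc: "b \<in> X" "c \<in> X" "L b = L c" for b c
  proof -
    obtain i where i: "i \<in> I" "b = (i, Suc (prow \<gamma>\<^sub>2 i))" using bc Xeq by blast
    obtain i' where i': "i' \<in> I" "c = (i', Suc (prow \<gamma>\<^sub>2 i'))" using bc Xeq by blast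
    have "rlab r \<delta>\<^sub>2 i = rlab r \<delta>\<^sub>2 i'" using Xval[OF bc(1)] Xval[OF bc(2)] bc(3) i i' by simp
    then have "i = i'" using rlab_inj[OF h(4)] i i' pi(4) by auto
    then show ?thesis using i i' by simp
  qed
  have Q_X: "\<exists>x\<in>X. L x = a" if a: "a \<in> Q" for a
  proof -
    have "int a \<in> rlab r \<delta>\<^sub>2 ` I" using a QI by blast
    then obtain i where i: "i \<in> I" "int a = rlab r \<delta>\<^sub>2 i" by blast
    then have "(i, Suc (prow \<gamma>\<^sub>2 i)) \<in> X" using Xeq by blast
    moreover have "L (i, Suc (prow \<gamma>\<^sub>2 i)) = a" using Xval[OF calculation] i by simp
    ultimately show ?thesis by blast
  qed
  have Qcard: "card {c \<in> X. L c = a} = of_bool (a \<in> Q)" for a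
  proof (cases "a \<in> Q")
    case True
    then obtain x where x: "x \<in> X" "L x = a" using Q_X by blast
    have "{c \<in> X. L c = a} = {x}" using injX x by blast
    then show ?thesis using True by simp
  next
    case False
    then have "{c \<in> X. L c = a} = {}" using Xval by auto
    then have "card {c \<in> X. L c = a} = 0" by (metis card.empty)
    then show ?thesis using False by simp
  qed
  have cs': "{c \<in> D'. L' c = a} = {c \<in> D'. L c = a}" for a using LD' by auto
  have content: "prow \<gamma>\<^sub>1 a = prow \<alpha>\<^sub>1 a + card {c \<in> D. L c = a}" if "a \<ge> 1" for a
    using pq(5)[OF that] l(6)[OF that] card_split[OF fD(1) DX(2), of L a] Qcard[of a] cs'[of a] DX(1) by simp
  have sp: "cnt D L a b = cnt D' L' a b + cnt X L a b" for a b
    using cnt_split[OF fD(1) DX(2), of L a b] cnt_cong[of D' L L' a b] LD' DX(1) by simp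
  have cntX_le: "cnt X L a b \<le> of_bool (a \<in> Q)" for a b
    unfolding Qcard[symmetric] cnt_def by (rule card_mono) (use fD in auto)
  have cntX_1: "1 \<le> cnt X L a b" if "x \<in> X" "L x = a" "rdle x b" for x a b
  proof -
    have "x \<in> {c \<in> X. L c = a \<and> rdle c b}" using that by simp
    then have "card {c \<in> X. L c = a \<and> rdle c b} > 0" using fD(3) card_gt_0_iff by fastforce
    then show ?thesis by (simp add: cnt_def)
  qed
  have lat: "prow \<alpha>\<^sub>1 (Suc a) + cnt D L (Suc a) y \<le> prow \<alpha>\<^sub>1 a + cnt D L a y"
    if y: "y \<in> D" "1 \<le> a" "L y = Suc a" for y a
  proof -
    have base: "prow \<alpha>\<^sub>1 (Suc a) + cnt D' L' (Suc a) y \<le> prow \<alpha>\<^sub>1 a + cnt D' L' a y"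
      by (rule lattice_anywhere_Suc[OF L'f fD(2) h(1) y(2)])
    show ?thesis
    proof (cases "\<exists>w\<in>X. L w = Suc a \<and> rdle w y")
      case False
      then have "{c \<in> X. L c = Suc a \<and> rdle c y} = {}" by blast
      then have "cnt X L (Suc a) y = 0" unfolding cnt_def by (metis card.empty)
      then show ?thesis using base sp by simp
    next
      case True
      then obtain w where w: "w \<in> X" "L w = Suc a" "rdle w y" by blast
      obtain i j i' j' where ij: "w = (i, j)" "y = (i', j')" by (metis surj_pair)
      have wD: "(i, j) \<in> D" using w DX ij by blast
      have wa: "int (Suc a) = r + int i - int j" using Xval[OF w(1)] w(2) ij by (simp add: row_rule_filling_def)
      have yw: "y = w"
      proof (rule ccontr)
        assume n: "y \<noteq> w"
        then have "y \<in> D'" using XorD[OF y(1)] injX[of y w] w y by auto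
        then have "r + int i' - int j' < int (Suc a)" using tightX[of y] y(3) ij by (simp add: row_rule_filling_def)
        then have "int i' - int j' < int i - int j" using wa by simp
        then have "i < i'" "j < j'" using w(3) ij by (auto simp: rdle_def)
        then have "L w < L y" using se[OF wD, of i' j'] y(1) ij by simp
        then show False using w y by simp
      qed
      have "Suc a \<in> Q" using Xval[OF w(1)] w(2) by simp
      show ?thesis
      proof (cases "a \<in> Q")
        case True
        \<comment> \<open>Labels increase down the rows, so the tight \<open>a\<close> is read
          before the tight \<open>Suc a\<close>, and both sides have grown by one.\<close>
        then obtain x where x: "x \<in> X" "L x = a" using Q_X by blast
        obtain i0 j0 where x0: "x = (i0, j0)" by (cases x)
        have "rlab r \<delta>\<^sub>2 i0 < rlab r \<delta>\<^sub>2 i" using Xval[OF x(1)] Xval[OF w(1)] x w ij x0 by simp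
        then have "i0 < i"
          using rlab_mono[OF h(4), of i i0 r] wD Xeq ij
          by (cases i i0 rule: linorder_cases) (auto simp: D_def skew_iff)
        then have "rdle x y" using yw ij x0 by (auto simp: rdle_def)
        then have "1 \<le> cnt X L a y" using cntX_1 x by blast
        then show ?thesis using base sp cntX_le[of "Suc a" y] by (simp split: if_splits) (simp add: of_bool_def split: if_splits)
      next
        \<comment> \<open>With no tight \<open>a\<close> to compensate, the room comes from \<gamma>
          being a partition: at \<open>y\<close> all entries a have been read, so the final
          comparison applies already here.\<close>
        case False
        have a1: "1 \<le> Suc a" by simp
        have "prow \<gamma>\<^sub>1 (Suc a) \<le> prow \<gamma>\<^sub>1 a" by (rule prow_Suc_le[OF pq(2) y(2)])
        then have "prow \<alpha>\<^sub>1 (Suc a) + card {c \<in> D'. L' c = Suc a} + 1 \<le> prow \<alpha>\<^sub>1 a + card {c \<in> D'. L' c = a}"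
          using pq(5)[OF a1] pq(5)[OF y(2)] l(6)[OF a1] l(6)[OF y(2)] False \<open>Suc a \<in> Q\<close> by simp
        moreover have "cnt D' L' (Suc a) y \<le> card {c \<in> D'. L' c = Suc a}"
          unfolding cnt_def by (rule card_mono) (use fD in auto)
        moreover have "{c \<in> D'. L' c = a} = {c \<in> D'. L' c = a \<and> rdle c y}"
        proof -
          have "rdle c y" if c: "c \<in> D'" "L' c = a" for c
          proof (rule ccontr)
            assume n: "\<not> rdle c y"
            obtain u v where uv: "c = (u, v)" by (cases c)
            have "r + int u - int v < int a" using tightX[OF c(1)] LD'[OF c(1)] c(2) uv by (simp add: row_rule_filling_def)
            then have "int u - int v < int i - int j" using wa by simp
            moreover have "i < u \<or> i = u \<and> v < j" using n uv yw ij by (auto simp: rdle_def)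
            ultimately have "i < u" "j \<le> v" by auto
            then have "L w < L c" using se[OF wD, of u v] c(1) uv ij DX by simp
            then show False using LD'[OF c(1)] c(2) w(2) by simp
          qed
          then show ?thesis by blast
        qed
        then have "card {c \<in> D'. L' c = a} = cnt D' L' a y" by (simp add: cnt_def)
        ultimately show ?thesis using sp cntX_le[of "Suc a" y] \<open>Suc a \<in> Q\<close> by simp
      qed
    qed
  qed
  have "lattice_filling D \<alpha>\<^sub>1 \<gamma>\<^sub>1 L"
    unfolding lattice_filling_def
  proof (intro conjI allI impI ballI)
    show "L b = 0" if "b \<notin> D" for b
    proof -
      have "b \<notin> X" "b \<notin> D'" using that DX by auto
      then show ?thesis using l(1)[of b] by (simp add: Ld)
    qed
  qed (use pos rows cols lat content in blast)+
  then have "good_filling r \<alpha> \<gamma> L"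
    unfolding good_filling_def e fst_conv snd_conv D_def[symmetric]
    using h pq(2) pi(1) sub good by blast
  then show ?thesis using tight_eq by (simp add: e D_def X_def)
qed


section \<open>Schur products as sums over fillings\<close>

lemma good_fillingD:
  assumes "good_filling r \<alpha> \<gamma> L"
  shows "is_partition (fst \<gamma>)" "is_partition (snd \<gamma>)" "diagram (snd \<gamma>) \<subseteq> diagram (snd \<alpha>)"
    "diagram (fst \<alpha>) \<subseteq> diagram (fst \<gamma>)"
    "card (diagram (fst \<gamma>)) + card (diagram (snd \<gamma>)) = card (diagram (fst \<alpha>)) + card (diagram (snd \<alpha>))"
proof -
  have h: "is_partition (fst \<alpha>)" "is_partition (snd \<alpha>)" "is_partition (fst \<gamma>)" "is_partition (snd \<gamma>)"
    "diagram (snd \<gamma>) \<subseteq> diagram (snd \<alpha>)" and L: "lattice_filling (skew (snd \<alpha>) (snd \<gamma>)) (fst \<alpha>) (fst \<gamma>) L"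
    using assms by (auto simp: good_filling_def)
  then show "is_partition (fst \<gamma>)" "is_partition (snd \<gamma>)" "diagram (snd \<gamma>) \<subseteq> diagram (snd \<alpha>)" by auto
  show s: "diagram (fst \<alpha>) \<subseteq> diagram (fst \<gamma>)"
    unfolding diagram_subset_iff using lattice_fillingD(6)[OF L] by simp
  obtain T where "T \<in> RW (skew (fst \<gamma>) (fst \<alpha>)) (skew (snd \<alpha>) (snd \<gamma>))"
    using lattice_filling_imp_RW[OF h(1,3) skew_convex_skew[OF h(2,4)] L] by blast
  then have "card (skew (fst \<gamma>) (fst \<alpha>)) = card (skew (snd \<alpha>) (snd \<gamma>))" by (simp add: RW_def)
  then show "card (diagram (fst \<gamma>)) + card (diagram (snd \<gamma>)) = card (diagram (fst \<alpha>)) + card (diagram (snd \<alpha>))"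
    using card_diagram_skew[OF s] card_diagram_skew[OF h(5)] by simp
qed

text \<open>Entries name nonempty rows of the first target partition, whose number of rows is at
  most its size.\<close>

lemma finite_good_fillings: "finite {(\<gamma>, L). good_filling r \<alpha> \<gamma> L}"
proof -
  define n where "n = card (diagram (fst \<alpha>)) + card (diagram (snd \<alpha>))"
  define B where "B = {\<beta>. is_partition \<beta> \<and> card (diagram \<beta>) \<le> n}"
  define FS where "FS = {L :: box \<Rightarrow> nat. \<forall>b. (b \<in> diagram (snd \<alpha>) \<longrightarrow> L b \<in> {..n}) \<and> (b \<notin> diagram (snd \<alpha>) \<longrightarrow> L b = 0)}"
  have "finite FS" unfolding FS_def by (rule finite_set_of_finite_funs) auto
  moreover have "finite B" unfolding B_def by (rule finite_partitions)
  moreover have "{(\<gamma>, L). good_filling r \<alpha> \<gamma> L} \<subseteq> (B \<times> B) \<times> FS"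
  proof
    fix u assume u: "u \<in> {(\<gamma>, L). good_filling r \<alpha> \<gamma> L}"
    obtain \<gamma>\<^sub>1 \<gamma>\<^sub>2 L where ue: "u = ((\<gamma>\<^sub>1, \<gamma>\<^sub>2), L)" by (metis surj_pair)
    have g: "good_filling r \<alpha> (\<gamma>\<^sub>1, \<gamma>\<^sub>2) L" using u ue by simp
    note d = good_fillingD[OF g, simplified]
    have L: "lattice_filling (skew (snd \<alpha>) \<gamma>\<^sub>2) (fst \<alpha>) \<gamma>\<^sub>1 L" using g by (simp add: good_filling_def)
    note l = lattice_fillingD[OF L]
    have "L b \<le> n" if b: "b \<in> skew (snd \<alpha>) \<gamma>\<^sub>2" for b
    proof -
      have "{c \<in> skew (snd \<alpha>) \<gamma>\<^sub>2. L c = L b} \<noteq> {}" "finite {c \<in> skew (snd \<alpha>) \<gamma>\<^sub>2. L c = L b}"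
        using b by (blast, simp)
      then have "card {c \<in> skew (snd \<alpha>) \<gamma>\<^sub>2. L c = L b} > 0" using card_gt_0_iff by blast
      then have "prow \<gamma>\<^sub>1 (L b) > 0" using l(6)[OF l(2)[OF b]] by simp
      then have "L b \<le> length \<gamma>\<^sub>1" by (simp add: prow_def split: if_splits)
      then show ?thesis using length_le_card_diagram[OF d(1)] d(5) unfolding n_def by linarith
    qed
    then have "L b \<le> n" for b using l(1)[of b] by (cases "b \<in> skew (snd \<alpha>) \<gamma>\<^sub>2") auto
    moreover have "L b = 0" if "b \<notin> diagram (snd \<alpha>)" for b using l(1)[of b] that by (simp add: skew_def)
    ultimately have "L \<in> FS" by (simp add: FS_def)
    then show "u \<in> (B \<times> B) \<times> FS" using d by (simp add: ue B_def n_def)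
  qed
  ultimately show ?thesis by (meson finite_SigmaI finite_subset)
qed

lemma finite_Nstep: "finite {\<gamma>. Nstep r \<alpha> \<gamma>}"
proof (rule finite_subset)
  define n where "n = card (diagram (fst \<alpha>)) + card (diagram (snd \<alpha>))"
  show "{\<gamma>. Nstep r \<alpha> \<gamma>} \<subseteq> {\<beta>. is_partition \<beta> \<and> card (diagram \<beta>) \<le> n} \<times> {\<beta>. is_partition \<beta> \<and> card (diagram \<beta>) \<le> n}"
  proof
    fix \<gamma> assume "\<gamma> \<in> {\<gamma>. Nstep r \<alpha> \<gamma>}"
    moreover obtain \<gamma>\<^sub>1 \<gamma>\<^sub>2 where ge: "\<gamma> = (\<gamma>\<^sub>1, \<gamma>\<^sub>2)" by (cases \<gamma>)
    ultimately obtain Q I where q: "add_strip (fst \<alpha>) Q \<gamma>\<^sub>1" "add_strip \<gamma>\<^sub>2 I (snd \<alpha>)" "int ` Q = rlab r (snd \<alpha>) ` I"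
      unfolding Nstep_def by auto
    have "card Q = card I" using card_rlab[OF add_stripD(2)[OF q(2)] add_stripD(4)[OF q(2)] q(3)] .
    then show "\<gamma> \<in> {\<beta>. is_partition \<beta> \<and> card (diagram \<beta>) \<le> n} \<times> {\<beta>. is_partition \<beta> \<and> card (diagram \<beta>) \<le> n}"
      using add_strip_card[OF q(1)] add_strip_card[OF q(2)] add_stripD(2)[OF q(1)] add_stripD(1)[OF q(2)] by (simp add: n_def ge)
  qed
qed (intro finite_cartesian_product finite_partitions)

lemma good_filling_refl_iff:
  assumes "is_partition (fst \<alpha>)" "is_partition (snd \<alpha>)"
  shows "good_filling r \<alpha> \<alpha> L \<longleftrightarrow> L = (\<lambda>_. 0)"
proof -
  have s: "skew (snd \<alpha>) (snd \<alpha>) = {}" by (simp add: skew_def)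
  show ?thesis using assms unfolding good_filling_def s lattice_filling_def by auto
qed

abbreviation tau_at :: "int \<Rightarrow> nat list \<times> nat list \<Rightarrow> (nat + nat) mseries" where
  "tau_at r \<gamma> \<equiv> tau r (fst \<gamma>) (snd \<gamma>)"

text \<open>Arrows obeying the rule correspond to nonempty good fillings, and solving the recursion
  of \<open>tau\<close> for \<open>schur2\<close> adds the empty one. The left side is the same for
  every r.\<close>

lemma schur2_eq_sum_tau:
  assumes a: "is_partition \<alpha>\<^sub>1" "is_partition \<alpha>\<^sub>2"
  shows "schur2 \<alpha>\<^sub>1 \<alpha>\<^sub>2 = (\<Sum>(\<gamma>, L) \<in> {(\<gamma>, L). good_filling r (\<alpha>\<^sub>1, \<alpha>\<^sub>2) \<gamma> L}. tau_at r \<gamma>)"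
proof -
  define S where "S = {(\<gamma>, L). good_filling r (\<alpha>\<^sub>1, \<alpha>\<^sub>2) \<gamma> L}"
  define A where "A = {(\<beta>\<^sub>1, \<beta>\<^sub>2, T). arrow \<alpha>\<^sub>1 \<alpha>\<^sub>2 \<beta>\<^sub>1 \<beta>\<^sub>2 T \<and> row_rule r (skew \<alpha>\<^sub>2 \<beta>\<^sub>2) T}"
  define h where "h = (\<lambda>(\<beta>\<^sub>1 :: nat list, \<beta>\<^sub>2, T). ((\<beta>\<^sub>1, \<beta>\<^sub>2), filling_of (skew \<alpha>\<^sub>2 \<beta>\<^sub>2) T))"
  have z: "((\<alpha>\<^sub>1, \<alpha>\<^sub>2), \<lambda>_. 0) \<in> S" using good_filling_refl_iff[of "(\<alpha>\<^sub>1, \<alpha>\<^sub>2)"] a by (simp add: S_def)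
  have inj: "inj_on h A"
  proof (rule inj_onI)
    fix x y assume x: "x \<in> A" and y: "y \<in> A" and xy: "h x = h y"
    obtain \<beta>\<^sub>1 \<beta>\<^sub>2 T where xe: "x = (\<beta>\<^sub>1, \<beta>\<^sub>2, T)" by (cases x)
    obtain T' where ye: "y = (\<beta>\<^sub>1, \<beta>\<^sub>2, T')" using xy xe by (cases y) (simp add: h_def)
    have "T \<in> RW (skew \<beta>\<^sub>1 \<alpha>\<^sub>1) (skew \<alpha>\<^sub>2 \<beta>\<^sub>2)" "T' \<in> RW (skew \<beta>\<^sub>1 \<alpha>\<^sub>1) (skew \<alpha>\<^sub>2 \<beta>\<^sub>2)"
      using x y unfolding xe ye A_def arrow_def by blast+
    then have "T = T'" using filling_of_inj[OF finite_skew] xy xe ye by (simp add: h_def)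
    then show "x = y" using xe ye by simp
  qed
  have im: "h ` A = S - {((\<alpha>\<^sub>1, \<alpha>\<^sub>2), \<lambda>_. 0)}"
  proof
    show "h ` A \<subseteq> S - {((\<alpha>\<^sub>1, \<alpha>\<^sub>2), \<lambda>_. 0)}"
    proof
      fix u assume "u \<in> h ` A"
      then obtain x where x: "x \<in> A" "u = h x" by blast
      obtain \<beta>\<^sub>1 \<beta>\<^sub>2 T where xe: "x = (\<beta>\<^sub>1, \<beta>\<^sub>2, T)" by (cases x)
      have ar: "is_partition \<beta>\<^sub>1" "is_partition \<beta>\<^sub>2" "diagram \<alpha>\<^sub>1 \<subseteq> diagram \<beta>\<^sub>1" "diagram \<beta>\<^sub>2 \<subseteq> diagram \<alpha>\<^sub>2"
        "(\<alpha>\<^sub>1, \<alpha>\<^sub>2) \<noteq> (\<beta>\<^sub>1, \<beta>\<^sub>2)" "T \<in> RW (skew \<beta>\<^sub>1 \<alpha>\<^sub>1) (skew \<alpha>\<^sub>2 \<beta>\<^sub>2)" and rr: "row_rule r (skew \<alpha>\<^sub>2 \<beta>\<^sub>2) T"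
        using x(1) unfolding xe A_def arrow_def by blast+
      have "lattice_filling (skew \<alpha>\<^sub>2 \<beta>\<^sub>2) \<alpha>\<^sub>1 \<beta>\<^sub>1 (filling_of (skew \<alpha>\<^sub>2 \<beta>\<^sub>2) T)"
        by (rule RW_imp_lattice_filling[OF a(1) ar(1,3) skew_convex_skew[OF a(2) ar(2)] ar(6)])
      then have "good_filling r (\<alpha>\<^sub>1, \<alpha>\<^sub>2) (\<beta>\<^sub>1, \<beta>\<^sub>2) (filling_of (skew \<alpha>\<^sub>2 \<beta>\<^sub>2) T)"
        using rr row_rule_filling_of[OF finite_skew] a ar by (simp add: good_filling_def)
      then show "u \<in> S - {((\<alpha>\<^sub>1, \<alpha>\<^sub>2), \<lambda>_. 0)}" using x(2) xe ar(5) by (auto simp: S_def h_def)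
    qed
    show "S - {((\<alpha>\<^sub>1, \<alpha>\<^sub>2), \<lambda>_. 0)} \<subseteq> h ` A"
    proof
      fix u assume u: "u \<in> S - {((\<alpha>\<^sub>1, \<alpha>\<^sub>2), \<lambda>_. 0)}"
      obtain \<beta>\<^sub>1 \<beta>\<^sub>2 L where ue: "u = ((\<beta>\<^sub>1, \<beta>\<^sub>2), L)" by (metis surj_pair)
      have g: "good_filling r (\<alpha>\<^sub>1, \<alpha>\<^sub>2) (\<beta>\<^sub>1, \<beta>\<^sub>2) L" using u ue by (simp add: S_def)
      have ne: "(\<alpha>\<^sub>1, \<alpha>\<^sub>2) \<noteq> (\<beta>\<^sub>1, \<beta>\<^sub>2)" using g u ue good_filling_refl_iff[of "(\<alpha>\<^sub>1, \<alpha>\<^sub>2)"] a by auto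
      note d = good_fillingD[OF g, simplified]
      have L: "lattice_filling (skew \<alpha>\<^sub>2 \<beta>\<^sub>2) \<alpha>\<^sub>1 \<beta>\<^sub>1 L" and gl: "\<forall>b\<in>skew \<alpha>\<^sub>2 \<beta>\<^sub>2. row_rule_filling r b \<le> int (L b)"
        using g by (simp_all add: good_filling_def)
      obtain T where T: "T \<in> RW (skew \<beta>\<^sub>1 \<alpha>\<^sub>1) (skew \<alpha>\<^sub>2 \<beta>\<^sub>2)" "filling_of (skew \<alpha>\<^sub>2 \<beta>\<^sub>2) T = L"
        using lattice_filling_imp_RW[OF a(1) d(1) skew_convex_skew[OF a(2) d(2)] L] by blast
      have "row_rule r (skew \<alpha>\<^sub>2 \<beta>\<^sub>2) T" using row_rule_filling_of[OF finite_skew] gl T(2) by simp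
      then have "(\<beta>\<^sub>1, \<beta>\<^sub>2, T) \<in> A" using a d ne T(1) by (simp add: A_def arrow_def)
      then show "u \<in> h ` A" using ue T(2) by (intro image_eqI[of _ _ "(\<beta>\<^sub>1, \<beta>\<^sub>2, T)"]) (auto simp: h_def)
    qed
  qed
  have "(\<Sum>(\<gamma>, L) \<in> S. tau_at r \<gamma>) = tau r \<alpha>\<^sub>1 \<alpha>\<^sub>2 + (\<Sum>(\<gamma>, L) \<in> S - {((\<alpha>\<^sub>1, \<alpha>\<^sub>2), \<lambda>_. 0)}. tau_at r \<gamma>)"
    using sum.remove[OF _ z, of "\<lambda>(\<gamma>, L). tau_at r \<gamma>"] finite_good_fillings[of r "(\<alpha>\<^sub>1, \<alpha>\<^sub>2)"] by (simp add: S_def)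
  also have "(\<Sum>(\<gamma>, L) \<in> S - {((\<alpha>\<^sub>1, \<alpha>\<^sub>2), \<lambda>_. 0)}. tau_at r \<gamma>) = (\<Sum>(\<beta>\<^sub>1, \<beta>\<^sub>2, T) \<in> A. tau r \<beta>\<^sub>1 \<beta>\<^sub>2)"
    unfolding im[symmetric] sum.reindex[OF inj] by (rule sum.cong) (auto simp: h_def)
  also have "tau r \<alpha>\<^sub>1 \<alpha>\<^sub>2 + \<dots> = schur2 \<alpha>\<^sub>1 \<alpha>\<^sub>2"
    using tau.simps[of r \<alpha>\<^sub>1 \<alpha>\<^sub>2] by (simp add: A_def)
  finally show ?thesis by (simp add: S_def)
qed

text \<open>Splitting and merging are inverse to each other: a merged filling remembers the
  intermediate pair, because its tight boxes are the skew shape removed by the N-step.\<close>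

lemma sum_good_fillings_Nstep:
  fixes f :: "nat list \<times> nat list \<Rightarrow> 'a::comm_monoid_add"
  shows "(\<Sum>(\<gamma>, L) \<in> {(\<gamma>, L). good_filling r \<alpha> \<gamma> L}. f \<gamma>) =
    (\<Sum>(\<delta>, L) \<in> {(\<delta>, L). good_filling (r + 1) \<alpha> \<delta> L}. \<Sum>\<gamma> \<in> {\<gamma>. Nstep r \<delta> \<gamma>}. f \<gamma>)"
proof -
  define S where "S = {(\<delta>, L). good_filling (r + 1) \<alpha> \<delta> L}"
  define B where "B = (SIGMA x:S. {\<gamma>. Nstep r (fst x) \<gamma>})"
  define m where "m = (\<lambda>(\<delta> :: nat list \<times> nat list) (\<gamma> :: nat list \<times> nat list) (L :: box \<Rightarrow> nat) b. if b \<in> skew (snd \<delta>) (snd \<gamma>) then nat (row_rule_filling r b) else L b)"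
  define h where "h = (\<lambda>((\<delta>, L), \<gamma>). (\<gamma>, m \<delta> \<gamma> L))"
  have merge: "good_filling r \<alpha> \<gamma> (m \<delta> \<gamma> L) \<and> tight r (skew (snd \<alpha>) (snd \<gamma>)) (m \<delta> \<gamma> L) = skew (snd \<delta>) (snd \<gamma>)"
    if "good_filling (r + 1) \<alpha> \<delta> L" "Nstep r \<delta> \<gamma>" for \<delta> L \<gamma>
    by (rule good_filling_merge[OF that]) (simp add: m_def fun_eq_iff)
  have inj: "inj_on h B"
  proof (rule inj_onI)
    fix x y assume x: "x \<in> B" and y: "y \<in> B" and xy: "h x = h y"
    obtain \<delta> L \<gamma> where xe: "x = ((\<delta>, L), \<gamma>)" by (metis surj_pair)
    obtain \<delta>' L' where ye: "y = ((\<delta>', L'), \<gamma>)" using xy xe by (cases y) (auto simp: h_def)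
    have g: "good_filling (r + 1) \<alpha> \<delta> L" "Nstep r \<delta> \<gamma>" "good_filling (r + 1) \<alpha> \<delta>' L'" "Nstep r \<delta>' \<gamma>"
      using x y xe ye by (auto simp: B_def S_def)
    have meq: "m \<delta> \<gamma> L = m \<delta>' \<gamma> L'" using xy xe ye by (simp add: h_def)
    have sk: "skew (snd \<delta>) (snd \<gamma>) = skew (snd \<delta>') (snd \<gamma>)"
      using merge[OF g(1,2)] merge[OF g(3,4)] meq by metis
    obtain Q I where q: "add_strip (fst \<delta>) Q (fst \<gamma>)" "add_strip (snd \<gamma>) I (snd \<delta>)" "int ` Q = rlab r (snd \<delta>) ` I"
      using g(2) unfolding Nstep_def by blast
    obtain Q' I' where q': "add_strip (fst \<delta>') Q' (fst \<gamma>)" "add_strip (snd \<gamma>) I' (snd \<delta>')" "int ` Q' = rlab r (snd \<delta>') ` I'"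
      using g(4) unfolding Nstep_def by blast
    have "fst ` skew (snd \<delta>) (snd \<gamma>) = I" "fst ` skew (snd \<delta>') (snd \<gamma>) = I'"
      using add_strip_skew[OF q(2)] add_strip_skew[OF q'(2)] by (simp_all add: image_image)
    then have I: "I = I'" using sk by simp
    then have d2: "snd \<delta> = snd \<delta>'" using q(2) q'(2) add_strip_upper_unique by blast
    have "int ` Q = int ` Q'" using q(3) q'(3) I d2 by simp
    then have "Q = Q'" by (simp add: inj_image_eq_iff)
    then have "fst \<delta> = fst \<delta>'" using q(1) q'(1) add_strip_lower_unique by blast
    then have de: "\<delta> = \<delta>'" using d2 by (simp add: prod_eq_iff)
    have "L b = L' b" for b
    proof (cases "b \<in> skew (snd \<delta>) (snd \<gamma>)")
      case True
      then have "b \<notin> skew (snd \<alpha>) (snd \<delta>)" by (auto simp: skew_def)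
      moreover have "lattice_filling (skew (snd \<alpha>) (snd \<delta>)) (fst \<alpha>) (fst \<delta>) L"
        "lattice_filling (skew (snd \<alpha>) (snd \<delta>)) (fst \<alpha>) (fst \<delta>) L'"
        using g(1,3) de by (simp_all add: good_filling_def)
      ultimately show ?thesis using lattice_fillingD(1) by metis
    next
      case False
      then show ?thesis using fun_cong[OF meq, of b] de by (simp add: m_def)
    qed
    then show "x = y" using xe ye de by auto
  qed
  have im: "h ` B = {(\<gamma>, L). good_filling r \<alpha> \<gamma> L}"
  proof
    show "h ` B \<subseteq> {(\<gamma>, L). good_filling r \<alpha> \<gamma> L}" using merge by (auto simp: B_def S_def h_def)
    show "{(\<gamma>, L). good_filling r \<alpha> \<gamma> L} \<subseteq> h ` B"
    proof
      fix u assume "u \<in> {(\<gamma>, L). good_filling r \<alpha> \<gamma> L}"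
      then obtain \<gamma> L where u: "u = (\<gamma>, L)" "good_filling r \<alpha> \<gamma> L" by (cases u) auto
      obtain \<delta> L' where d: "good_filling (r + 1) \<alpha> \<delta> L'" "Nstep r \<delta> \<gamma>"
        and X: "skew (snd \<delta>) (snd \<gamma>) = tight r (skew (snd \<alpha>) (snd \<gamma>)) L"
        and L': "L' = (\<lambda>b. if b \<in> tight r (skew (snd \<alpha>) (snd \<gamma>)) L then 0 else L b)"
        using good_filling_split[OF u(2)] by blast
      have "m \<delta> \<gamma> L' = L"
      proof (rule ext)
        fix b show "m \<delta> \<gamma> L' b = L b"
        proof (cases "b \<in> tight r (skew (snd \<alpha>) (snd \<gamma>)) L")
          case True
          then have "int (L b) = row_rule_filling r b" by (simp add: tight_def)
          then have "nat (row_rule_filling r b) = L b" by linarith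
          then show ?thesis using True X by (simp add: m_def)
        next
          case False
          then show ?thesis using X L' by (simp add: m_def)
        qed
      qed
      then have "h ((\<delta>, L'), \<gamma>) = u" using u by (simp add: h_def)
      moreover have "((\<delta>, L'), \<gamma>) \<in> B" using d by (simp add: B_def S_def)
      ultimately show "u \<in> h ` B" by (metis image_eqI)
    qed
  qed
  have "(\<Sum>(\<gamma>, L) \<in> {(\<gamma>, L). good_filling r \<alpha> \<gamma> L}. f \<gamma>) = (\<Sum>(x, \<gamma>) \<in> B. f \<gamma>)"
    unfolding im[symmetric] sum.reindex[OF inj] by (rule sum.cong) (auto simp: h_def)
  also have "\<dots> = (\<Sum>x \<in> S. \<Sum>\<gamma> \<in> {\<gamma>. Nstep r (fst x) \<gamma>}. f \<gamma>)"
    unfolding B_def by (rule sum.Sigma[symmetric]) (simp_all add: S_def finite_good_fillings finite_Nstep)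
  finally show ?thesis by (simp add: S_def case_prod_unfold)
qed

text \<open>Two expansions of \<open>schur2\<close> are regrouped over the fillings for r + 1. Each
  of these except the empty one ends at a smaller second partition, where the identity is known, so
  only the terms of the empty filling are left to be equal.\<close>

lemma tau_Nstep:
  assumes "is_partition (fst \<alpha>)" "is_partition (snd \<alpha>)"
  shows "tau_at (r + 1) \<alpha> = (\<Sum>\<gamma> \<in> {\<gamma>. Nstep r \<alpha> \<gamma>}. tau_at r \<gamma>)"
  using assms
proof (induction "card (diagram (snd \<alpha>))" arbitrary: \<alpha> rule: less_induct)
  case less
  define S where "S = {(\<delta>, L). good_filling (r + 1) \<alpha> \<delta> L}"
  have fS: "finite S" unfolding S_def by (rule finite_good_fillings)
  have z: "(\<alpha>, \<lambda>_. 0) \<in> S" using good_filling_refl_iff less.prems by (simp add: S_def)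
  define f g where "f = (\<lambda>x :: (nat list \<times> nat list) \<times> (box \<Rightarrow> nat). tau_at (r + 1) (fst x))"
    and "g = (\<lambda>x :: (nat list \<times> nat list) \<times> (box \<Rightarrow> nat). \<Sum>\<gamma> \<in> {\<gamma>. Nstep r (fst x) \<gamma>}. tau_at r \<gamma>)"
  have "sum f S = sum g S"
    using schur2_eq_sum_tau[OF less.prems, of r] schur2_eq_sum_tau[OF less.prems, of "r + 1"]
      sum_good_fillings_Nstep[of "tau_at r" r \<alpha>]
    by (simp add: S_def f_def g_def case_prod_unfold)
  moreover have "sum f (S - {(\<alpha>, \<lambda>_. 0)}) = sum g (S - {(\<alpha>, \<lambda>_. 0)})"
  proof (rule sum.cong[OF refl])
    fix x assume x: "x \<in> S - {(\<alpha>, \<lambda>_. 0)}"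
    obtain \<delta> L where xe: "x = (\<delta>, L)" by (cases x)
    have gd: "good_filling (r + 1) \<alpha> \<delta> L" using x xe by (simp add: S_def)
    note d = good_fillingD[OF gd]
    have "\<delta> \<noteq> \<alpha>" using gd x xe good_filling_refl_iff[OF less.prems] by (auto simp: S_def)
    have "diagram (snd \<delta>) \<noteq> diagram (snd \<alpha>)"
    proof
      assume e: "diagram (snd \<delta>) = diagram (snd \<alpha>)"
      then have "card (diagram (fst \<delta>)) = card (diagram (fst \<alpha>))" using d(5) by simp
      then have "diagram (fst \<alpha>) = diagram (fst \<delta>)" using d(4) by (intro card_subset_eq) auto
      then show False using e \<open>\<delta> \<noteq> \<alpha>\<close> diagram_inject d less.prems by (metis prod_eqI)
    qed
    then have "card (diagram (snd \<delta>)) < card (diagram (snd \<alpha>))"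
      using d(3) by (intro psubset_card_mono) auto
    then show "f x = g x" using less.hyps[of \<delta>] d xe by (simp add: f_def g_def)
  qed
  ultimately have "f (\<alpha>, \<lambda>_. 0) = g (\<alpha>, \<lambda>_. 0)"
    using sum.remove[OF fS z, of f] sum.remove[OF fS z, of g] by simp
  then show ?case by (simp add: f_def g_def)
qed

section \<open>The product in terms of the two steps\<close>

lemma prow_le_card: "prow \<alpha> i \<le> card (diagram \<alpha>)"
proof (cases "1 \<le> i")
  case True
  have "Pair i ` {1..prow \<alpha> i} \<subseteq> diagram \<alpha>" using True by (auto simp: diagram_prow)
  then have "card (Pair i ` {1..prow \<alpha> i}) \<le> card (diagram \<alpha>)" by (intro card_mono) auto
  then show ?thesis by (simp add: card_image inj_on_def)
qed (simp add: prow_def)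

lemma Cstep_card:
  assumes "Cstep r p \<alpha> \<gamma>"
  shows "card (diagram (fst \<gamma>)) + card (diagram (snd \<gamma>)) = card (diagram (fst \<alpha>)) + card (diagram (snd \<alpha>)) + p"
    "is_partition (fst \<gamma>)" "is_partition (snd \<gamma>)"
proof -
  obtain G I where g: "add_strip (fst \<alpha>) G (fst \<gamma>)" "add_strip (snd \<gamma>) I (snd \<alpha>)" "card G = p + card I"
    using assms unfolding Cstep_def by blast
  show "card (diagram (fst \<gamma>)) + card (diagram (snd \<gamma>)) = card (diagram (fst \<alpha>)) + card (diagram (snd \<alpha>)) + p"
    using add_strip_card[OF g(1)] add_strip_card[OF g(2)] g(3) by simp
  show "is_partition (fst \<gamma>)" "is_partition (snd \<gamma>)" by (rule add_stripD(2)[OF g(1)], rule add_stripD(1)[OF g(2)])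
qed

lemma Nstep_card:
  assumes "Nstep r \<alpha> \<gamma>"
  shows "card (diagram (fst \<gamma>)) + card (diagram (snd \<gamma>)) = card (diagram (fst \<alpha>)) + card (diagram (snd \<alpha>))"
    "card (diagram (snd \<gamma>)) \<le> card (diagram (snd \<alpha>))"
    "\<gamma> \<noteq> \<alpha> \<Longrightarrow> card (diagram (snd \<gamma>)) < card (diagram (snd \<alpha>))"
    "is_partition (fst \<gamma>)" "is_partition (snd \<gamma>)"
proof -
  obtain Q I where q: "add_strip (fst \<alpha>) Q (fst \<gamma>)" "add_strip (snd \<gamma>) I (snd \<alpha>)" "int ` Q = rlab r (snd \<alpha>) ` I"
    using assms unfolding Nstep_def by blast
  have c: "card Q = card I" using card_rlab[OF add_stripD(2)[OF q(2)] add_stripD(4)[OF q(2)] q(3)] .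
  then show "card (diagram (fst \<gamma>)) + card (diagram (snd \<gamma>)) = card (diagram (fst \<alpha>)) + card (diagram (snd \<alpha>))"
    "card (diagram (snd \<gamma>)) \<le> card (diagram (snd \<alpha>))"
    using add_strip_card[OF q(1)] add_strip_card[OF q(2)] by simp_all
  show "is_partition (fst \<gamma>)" "is_partition (snd \<gamma>)" by (rule add_stripD(2)[OF q(1)], rule add_stripD(1)[OF q(2)])
  show "card (diagram (snd \<gamma>)) < card (diagram (snd \<alpha>))" if "\<gamma> \<noteq> \<alpha>"
  proof (rule ccontr)
    assume "\<not> ?thesis"
    then have "card I = 0" using add_strip_card[OF q(2)] by simp
    then have I0: "I = {}" using add_stripD(3)[OF q(2)] by simp
    have "card Q = 0" using c I0 by simp
    then have Q0: "Q = {}" using add_stripD(3)[OF q(1)] by simp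
    have "fst \<gamma> = fst \<alpha>" using q(1) unfolding Q0 add_strip_empty_iff by blast
    moreover have "snd \<alpha> = snd \<gamma>" using q(2) unfolding I0 add_strip_empty_iff by blast
    ultimately have "\<gamma> = \<alpha>" by (simp add: prod_eq_iff)
    then show False using that by blast
  qed
qed

lemma Nstep_refl: "is_partition (fst \<alpha>) \<Longrightarrow> is_partition (snd \<alpha>) \<Longrightarrow> Nstep r \<alpha> \<alpha>"
  unfolding Nstep_def by (rule exI[of _ "{}"], rule exI[of _ "{}"]) (simp add: add_strip_empty_iff)

lemma finite_Cstep: "finite {\<gamma>. Cstep r p \<alpha> \<gamma>}"
proof (rule finite_subset)
  define n where "n = card (diagram (fst \<alpha>)) + card (diagram (snd \<alpha>)) + p"
  show "{\<gamma>. Cstep r p \<alpha> \<gamma>} \<subseteq> {\<beta>. is_partition \<beta> \<and> card (diagram \<beta>) \<le> n} \<times> {\<beta>. is_partition \<beta> \<and> card (diagram \<beta>) \<le> n}"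
  proof
    fix \<gamma> assume "\<gamma> \<in> {\<gamma>. Cstep r p \<alpha> \<gamma>}"
    then have "Cstep r p \<alpha> \<gamma>" by simp
    from Cstep_card[OF this]
    show "\<gamma> \<in> {\<beta>. is_partition \<beta> \<and> card (diagram \<beta>) \<le> n} \<times> {\<beta>. is_partition \<beta> \<and> card (diagram \<beta>) \<le> n}"
      by (simp add: mem_Times_iff n_def)
  qed
qed (intro finite_cartesian_product finite_partitions)

lemma schur_Nil: "schur v [] = 1"
proof (rule mseries_eqI)
  fix m :: "'a multiset"
  have "{T. semistandard {} T \<and> {#} = m} = (if m = {#} then {Map.empty} else {})"
    by (auto simp: semistandard_def)
  then show "mcoeff (schur v []) m = mcoeff 1 m" by (simp add: schur_def mcoeff_simps)
qed

text \<open>Arrows shrink the second partition, so none leaves a pair whose second partition is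
  empty.\<close>

lemma tau_column: "tau r \<alpha> [] = schur Inl \<alpha>"
proof -
  have e: "{(\<beta>\<^sub>1, \<beta>\<^sub>2, T). arrow \<alpha> [] \<beta>\<^sub>1 \<beta>\<^sub>2 T \<and> row_rule r (skew [] \<beta>\<^sub>2) T} = {}"
    using arrow_card_less by fastforce
  show ?thesis by (subst tau.simps, subst e) (simp add: schur2_def schur_Nil)
qed

text \<open>An entry names a nonempty row of the first target partition, so it is at most the total
  number of boxes. The bound r + i - j exceeds this, as j is at most the size of the second
  partition; this explains the factor 2.\<close>

lemma tau_large:
  assumes p: "is_partition (fst \<alpha>)" "is_partition (snd \<alpha>)"
    and r: "int (card (diagram (fst \<alpha>)) + 2 * card (diagram (snd \<alpha>))) < r"
  shows "tau_at r \<alpha> = schur2 (fst \<alpha>) (snd \<alpha>)"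
proof -
  have "{(\<gamma>, L). good_filling r \<alpha> \<gamma> L} = {(\<alpha>, \<lambda>_. 0)}"
  proof
    show "{(\<alpha>, \<lambda>_. 0)} \<subseteq> {(\<gamma>, L). good_filling r \<alpha> \<gamma> L}" using good_filling_refl_iff[OF p] by simp
    show "{(\<gamma>, L). good_filling r \<alpha> \<gamma> L} \<subseteq> {(\<alpha>, \<lambda>_. 0)}"
    proof
      fix u assume "u \<in> {(\<gamma>, L). good_filling r \<alpha> \<gamma> L}"
      then obtain \<gamma> L where u: "u = (\<gamma>, L)" and g: "good_filling r \<alpha> \<gamma> L" by (cases u) simp
      note d = good_fillingD[OF g]
      have L: "lattice_filling (skew (snd \<alpha>) (snd \<gamma>)) (fst \<alpha>) (fst \<gamma>) L"
        and gl: "\<forall>b\<in>skew (snd \<alpha>) (snd \<gamma>). row_rule_filling r b \<le> int (L b)"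
        using g by (simp_all add: good_filling_def)
      note l = lattice_fillingD[OF L]
      have sk: "skew (snd \<alpha>) (snd \<gamma>) = {}"
      proof (rule ccontr)
        assume "skew (snd \<alpha>) (snd \<gamma>) \<noteq> {}"
        then obtain b where b: "b \<in> skew (snd \<alpha>) (snd \<gamma>)" by blast
        have "{c \<in> skew (snd \<alpha>) (snd \<gamma>). L c = L b} \<noteq> {}" "finite {c \<in> skew (snd \<alpha>) (snd \<gamma>). L c = L b}"
          using b by (blast, simp)
        then have "card {c \<in> skew (snd \<alpha>) (snd \<gamma>). L c = L b} > 0" using card_gt_0_iff by blast
        then have "prow (fst \<gamma>) (L b) > 0" using l(6)[OF l(2)[OF b]] by simp
        then have "L b \<le> length (fst \<gamma>)" by (simp add: prow_def split: if_splits)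
        then have "L b \<le> card (diagram (fst \<alpha>)) + card (diagram (snd \<alpha>))"
          using length_le_card_diagram[OF d(1)] d(5) by simp
        moreover obtain i j where ij: "b = (i, j)" by (cases b)
        moreover have "j \<le> prow (snd \<alpha>) i" "1 \<le> i" using b ij by (auto simp: skew_iff)
        moreover have "r + int i - int j \<le> int (L b)" using gl b ij by (auto simp: row_rule_filling_def)
        ultimately show False using r prow_le_card[of "snd \<alpha>" i] by simp
      qed
      then have d2: "diagram (snd \<gamma>) = diagram (snd \<alpha>)" using d(3) by (auto simp: skew_def)
      then have "card (diagram (fst \<gamma>)) = card (diagram (fst \<alpha>))" using d(5) by simp
      then have "diagram (fst \<alpha>) = diagram (fst \<gamma>)" using d(4) by (intro card_subset_eq) auto
      then have ga: "\<gamma> = \<alpha>" using d2 diagram_inject d p by (metis prod_eqI)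
      then have "L = (\<lambda>_. 0)" using g good_filling_refl_iff[OF p] by simp
      then show "u \<in> {(\<alpha>, \<lambda>_. 0)}" using u ga by simp
    qed
  qed
  then show ?thesis using schur2_eq_sum_tau[OF p, of r] by simp
qed

text \<open>The estimate of \<open>tau_large\<close>, now with a total grown by q, rules out any
  named row and hence any removed box.\<close>

lemma Cstep_large:
  assumes p: "is_partition (fst \<alpha>)" "is_partition (snd \<alpha>)"
    and r: "int (card (diagram (fst \<alpha>)) + 2 * card (diagram (snd \<alpha>)) + q) < r"
  shows "{\<gamma>. Cstep r q \<alpha> \<gamma>} = (\<lambda>\<mu>. (\<mu>, snd \<alpha>)) ` vstrips q (fst \<alpha>)"
proof
  show "(\<lambda>\<mu>. (\<mu>, snd \<alpha>)) ` vstrips q (fst \<alpha>) \<subseteq> {\<gamma>. Cstep r q \<alpha> \<gamma>}"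
  proof
    fix \<gamma> assume "\<gamma> \<in> (\<lambda>\<mu>. (\<mu>, snd \<alpha>)) ` vstrips q (fst \<alpha>)"
    then obtain \<mu> S where "\<gamma> = (\<mu>, snd \<alpha>)" "add_strip (fst \<alpha>) S \<mu>" "card S = q" by (auto simp: vstrips_def)
    then show "\<gamma> \<in> {\<gamma>. Cstep r q \<alpha> \<gamma>}"
      unfolding Cstep_def mem_Collect_eq
      by (intro exI[of _ S] exI[of _ "{}"]) (simp add: add_strip_empty_iff p)
  qed
  show "{\<gamma>. Cstep r q \<alpha> \<gamma>} \<subseteq> (\<lambda>\<mu>. (\<mu>, snd \<alpha>)) ` vstrips q (fst \<alpha>)"
  proof
    fix \<gamma> assume "\<gamma> \<in> {\<gamma>. Cstep r q \<alpha> \<gamma>}"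
    then have c: "Cstep r q \<alpha> \<gamma>" by simp
    then obtain G I where g: "add_strip (fst \<alpha>) G (fst \<gamma>)" "add_strip (snd \<gamma>) I (snd \<alpha>)" "card G = q + card I"
      "\<forall>i\<in>I. \<exists>x\<ge>1. int (Suc x) = rlab r (snd \<alpha>) i \<and> Suc x \<in> G \<and> prow (fst \<alpha>) (Suc x) = prow (fst \<alpha>) x"
      unfolding Cstep_def by blast
    have "I = {}"
    proof (rule ccontr)
      assume "I \<noteq> {}"
      then obtain i x where i: "i \<in> I" "int (Suc x) = rlab r (snd \<alpha>) i" "Suc x \<in> G" using g(4) by blast
      have "prow (fst \<gamma>) (Suc x) > 0" using add_stripD(5)[OF g(1), of "Suc x"] i(3) by simp
      then have "Suc x \<le> length (fst \<gamma>)" by (simp add: prow_def split: if_splits)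
      then have "Suc x \<le> card (diagram (fst \<alpha>)) + card (diagram (snd \<alpha>)) + q"
        using length_le_card_diagram[OF Cstep_card(2)[OF c]] Cstep_card(1)[OF c] by simp
      then show False using i(2) r prow_le_card[of "snd \<alpha>" i] by (simp add: rlab_def)
    qed
    then have "fst \<gamma> \<in> vstrips q (fst \<alpha>)" "snd \<gamma> = snd \<alpha>"
      using g by (auto simp: vstrips_def add_strip_empty_iff)
    then show "\<gamma> \<in> (\<lambda>\<mu>. (\<mu>, snd \<alpha>)) ` vstrips q (fst \<alpha>)" by (intro image_eqI[of _ _ "fst \<gamma>"]) (simp_all add: prod_eq_iff)
  qed
qed

theorem column_times_tau:
  assumes "is_partition (fst \<alpha>)" "is_partition (snd \<alpha>)"
  shows "schur Inl (replicate p 1) * tau_at r \<alpha> = (\<Sum>\<gamma> \<in> {\<gamma>. Cstep r p \<alpha> \<gamma>}. tau_at r \<gamma>)"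
proof -
  \<comment> \<open>The summand p leaves room for \<open>Cstep_large\<close> and for applying
    \<open>tau_large\<close> after p boxes have been added. The bound cannot increase along
    \<open>Nstep\<close>, so the inner induction keeps it.\<close>
  define bnd where "bnd \<alpha> = int (card (diagram (fst \<alpha>)) + 2 * card (diagram (snd \<alpha>)) + p)" for \<alpha> :: "nat list \<times> nat list"
  define e where "e = schur (Inl :: nat \<Rightarrow> nat + nat) (replicate p 1)"
  have main: "e * tau_at r \<alpha> = (\<Sum>\<gamma> \<in> {\<gamma>. Cstep r p \<alpha> \<gamma>}. tau_at r \<gamma>)"
    if "is_partition (fst \<alpha>)" "is_partition (snd \<alpha>)" "bnd \<alpha> < r + int n" for n r \<alpha>
    using that
  proof (induction n arbitrary: r \<alpha>)
    case 0
    have r: "int (card (diagram (fst \<alpha>)) + 2 * card (diagram (snd \<alpha>)) + p) < r" using 0 by (simp add: bnd_def)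
    have "tau_at r \<alpha> = schur2 (fst \<alpha>) (snd \<alpha>)" by (rule tau_large[OF 0(1,2)]) (use r in simp)
    then have "e * tau_at r \<alpha> = (e * schur Inl (fst \<alpha>)) * schur Inr (snd \<alpha>)" by (simp add: schur2_def mult.assoc)
    also have "\<dots> = (\<Sum>\<mu>\<in>vstrips p (fst \<alpha>). schur Inl \<mu>) * schur Inr (snd \<alpha>)"
      unfolding e_def using schur_pieri[OF _ 0(1), of "Inl :: nat \<Rightarrow> nat + nat" p] by simp
    also have "\<dots> = (\<Sum>\<mu>\<in>vstrips p (fst \<alpha>). tau_at r (\<mu>, snd \<alpha>))"
      unfolding sum_distrib_right
    proof (rule sum.cong[OF refl])
      fix \<mu> assume m: "\<mu> \<in> vstrips p (fst \<alpha>)"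
      have "is_partition \<mu>" using m by (auto simp: vstrips_def dest: add_stripD)
      moreover have "int (card (diagram \<mu>) + 2 * card (diagram (snd \<alpha>))) < r" using r vstrips_card[OF m] by simp
      ultimately show "schur Inl \<mu> * schur Inr (snd \<alpha>) = tau_at r (\<mu>, snd \<alpha>)"
        using tau_large[of "(\<mu>, snd \<alpha>)" r] 0(2) by (simp add: schur2_def)
    qed
    also have "\<dots> = (\<Sum>\<gamma> \<in> {\<gamma>. Cstep r p \<alpha> \<gamma>}. tau_at r \<gamma>)"
      unfolding Cstep_large[OF 0(1,2) r] by (subst sum.reindex) (auto simp: inj_on_def)
    finally show ?case .
  next
    case (Suc n)
    show ?case using Suc.prems
    proof (induction "card (diagram (snd \<alpha>))" arbitrary: \<alpha> rule: less_induct)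
      case less
      define N where "N = {\<delta>. Nstep r \<alpha> \<delta>}"
      have fN: "finite N" unfolding N_def by (rule finite_Nstep)
      have aN: "\<alpha> \<in> N" using Nstep_refl[OF less.prems(1,2)] by (simp add: N_def)
      define g where "g \<delta> = (\<Sum>\<gamma> \<in> {\<gamma>. Cstep r p \<delta> \<gamma>}. tau_at r \<gamma>)" for \<delta>
      \<comment> \<open>The claim for r + 1, rewritten by \<open>tau_Nstep\<close> on both sides and
        by the commutation, is the sum over \<open>N\<close> of the claims for r. All of these but
        the one at \<alpha> are known.\<close>
      have "(\<Sum>\<delta>\<in>N. e * tau_at r \<delta>) = e * tau_at (r + 1) \<alpha>"
        unfolding N_def tau_Nstep[OF less.prems(1,2)] sum_distrib_left ..
      also have "\<dots> = (\<Sum>\<delta> \<in> {\<delta>. Cstep (r + 1) p \<alpha> \<delta>}. tau_at (r + 1) \<delta>)"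
        by (rule Suc.IH[OF less.prems(1,2)]) (use less.prems(3) in simp)
      also have "\<dots> = (\<Sum>\<delta> \<in> {\<delta>. Cstep (r + 1) p \<alpha> \<delta>}. \<Sum>\<gamma> \<in> {\<gamma>. Nstep r \<delta> \<gamma>}. tau_at r \<gamma>)"
        by (rule sum.cong[OF refl], rule tau_Nstep) (auto dest: Cstep_card)
      also have "\<dots> = (\<Sum>\<delta>\<in>N. g \<delta>)"
        unfolding N_def g_def by (rule sum_CN_eq_sum_NC[OF finite_Cstep finite_Nstep])
      finally have all: "(\<Sum>\<delta>\<in>N. e * tau_at r \<delta>) = (\<Sum>\<delta>\<in>N. g \<delta>)" .
      have "(\<Sum>\<delta>\<in>N - {\<alpha>}. e * tau_at r \<delta>) = (\<Sum>\<delta>\<in>N - {\<alpha>}. g \<delta>)"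
      proof (rule sum.cong[OF refl])
        fix \<delta> assume "\<delta> \<in> N - {\<alpha>}"
        then have d: "Nstep r \<alpha> \<delta>" "\<delta> \<noteq> \<alpha>" by (auto simp: N_def)
        note c = Nstep_card[OF d(1)]
        have "bnd \<delta> \<le> bnd \<alpha>" using c(1,2) by (simp add: bnd_def)
        then show "e * tau_at r \<delta> = g \<delta>"
          unfolding g_def using less.hyps[OF c(3)[OF d(2)] c(4,5)] less.prems(3) by simp
      qed
      then have "e * tau_at r \<alpha> = g \<alpha>"
        using all sum.remove[OF fN aN, of "\<lambda>\<delta>. e * tau_at r \<delta>"] sum.remove[OF fN aN, of g] by simp
      then show ?case by (simp add: g_def)
    qed
  qed
  show ?thesis
    using main[OF assms, of r "nat (bnd \<alpha> - r + 1)"] unfolding e_def by simp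
qed

section \<open>Sliding a vertical strip into a vertical strip\<close>

text \<open>On members of \<open>A\<close> this is the rank, which is the label in a strip tableau;
  on all rows it is the counting function in which the row rules will be expressed.\<close>

definition rk :: "nat set \<Rightarrow> nat \<Rightarrow> nat" where
  "rk A x = card (A \<inter> {..x})"

lemma rk_mono: "x \<le> y \<Longrightarrow> rk A x \<le> rk A y"
  unfolding rk_def by (rule card_mono) auto

lemma rk_Suc: "rk A (Suc x) = rk A x + of_bool (Suc x \<in> A)"
proof -
  have "A \<inter> {..Suc x} = (if Suc x \<in> A then insert (Suc x) (A \<inter> {..x}) else A \<inter> {..x})"
    by (auto simp: le_Suc_eq)
  then show ?thesis by (simp add: rk_def)
qed

lemma rk_less: "x < y \<Longrightarrow> y \<in> A \<Longrightarrow> rk A x < rk A y"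
  by (cases y) (use rk_mono[of x _ A] in \<open>auto simp: rk_Suc less_Suc_eq_le le_imp_less_Suc\<close>)

lemma rk_inj: "x \<in> A \<Longrightarrow> y \<in> A \<Longrightarrow> rk A x = rk A y \<Longrightarrow> x = y"
  using rk_less[of x y A] rk_less[of y x A] by (cases x y rule: linorder_cases) auto

lemma rk_pos: "x \<in> A \<Longrightarrow> 1 \<le> rk A x"
proof -
  assume "x \<in> A"
  then have "card (A \<inter> {..x}) > 0" using card_gt_0_iff[of "A \<inter> {..x}"] by auto
  then show ?thesis by (simp add: rk_def)
qed

lemma rk_le_card: "finite A \<Longrightarrow> rk A x \<le> card A"
  unfolding rk_def by (rule card_mono) auto

lemma rk_eq_card: "(\<And>y. y \<in> A \<Longrightarrow> y \<le> x) \<Longrightarrow> rk A x = card A"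
  unfolding rk_def by (rule arg_cong[where f = card]) auto

lemma rk_bij:
  assumes "finite A"
  shows "bij_betw (rk A) A {1..card A}"
proof -
  have inj: "inj_on (rk A) A" using rk_inj by (auto intro: inj_onI)
  have "rk A ` A \<subseteq> {1..card A}" using rk_pos rk_le_card[OF assms] by auto
  moreover have "card (rk A ` A) = card {1..card A}" using inj by (simp add: card_image)
  ultimately have "rk A ` A = {1..card A}" by (intro card_subset_eq) auto
  then show ?thesis using inj by (simp add: bij_betw_def)
qed

lemma rk_surj: "finite A \<Longrightarrow> k \<in> {1..card A} \<Longrightarrow> \<exists>x\<in>A. rk A x = k"
  using rk_bij[of A] unfolding bij_betw_def by (metis imageE)

text \<open>The inner row lengths \<open>c\<close> are a bare function, so that every stage of the
  infusion has this form without naming intermediate inner partitions.\<close>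

definition strip_at :: "nat set \<Rightarrow> (nat \<Rightarrow> nat) \<Rightarrow> tableau" where
  "strip_at W c = (\<lambda>(i, j). if i \<in> W \<and> j = Suc (c i) then Some (rk W i) else None)"

lemma box_of_strip_at: "w \<in> W \<Longrightarrow> box_of (strip_at W c) (rk W w) = (w, Suc (c w))"
  by (rule box_of_eq) (auto simp: strip_at_def split: if_splits dest: rk_inj)

lemma strip_tableau_eq:
  assumes "add_strip \<mu> W \<gamma>"
  shows "strip_tableau (skew \<gamma> \<mu>) = strip_at W (prow \<mu>)"
proof (rule ext)
  fix b :: box
  obtain i j where b: "b = (i, j)" by (cases b)
  have "{b' \<in> skew \<gamma> \<mu>. fst b' \<le> i} = (\<lambda>i. (i, Suc (prow \<mu> i))) ` (W \<inter> {..i})"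
    unfolding add_strip_skew[OF assms] by auto
  then have "card {b' \<in> skew \<gamma> \<mu>. fst b' \<le> i} = rk W i"
    by (simp add: rk_def card_image inj_on_def)
  then show "strip_tableau (skew \<gamma> \<mu>) b = strip_at W (prow \<mu>) b"
    unfolding strip_tableau_def b strip_at_def add_strip_skew[OF assms] by auto
qed

text \<open>With one box per row, the reading order is the order of the rows.\<close>

lemma rl_strip_eq:
  assumes "add_strip \<nu> I \<beta>"
  shows "rl (skew \<beta> \<nu>) = strip_at I (prow \<nu>)"
proof (rule ext)
  fix b :: box
  obtain i j where b: "b = (i, j)" by (cases b)
  show "rl (skew \<beta> \<nu>) b = strip_at I (prow \<nu>) b"
  proof (cases "b \<in> skew \<beta> \<nu>")
    case True
    then have j: "j = Suc (prow \<nu> i)" "i \<in> I" using b unfolding add_strip_skew[OF assms] by auto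
    have "{b' \<in> skew \<beta> \<nu>. rdle b' b} = (\<lambda>i. (i, Suc (prow \<nu> i))) ` (I \<inter> {..i})"
      unfolding add_strip_skew[OF assms] b j(1) by (auto simp: rdle_def)
    then have "rdlab (skew \<beta> \<nu>) b = rk I i"
      by (simp add: rdlab_def rk_def card_image inj_on_def)
    then show ?thesis using True j by (simp add: rl_eq strip_at_def b)
  next
    case False
    then have "\<not> (i \<in> I \<and> j = Suc (prow \<nu> i))" using b unfolding add_strip_skew[OF assms] by auto
    then show ?thesis using False by (simp add: rl_eq strip_at_def b)
  qed
qed

text \<open>The strip has a box directly right of the hole. It moves into the hole, since a box
  below the hole has a larger label, and the slide stops: by the last hypothesis row x + 1 ends too
  early for a box below the new hole.\<close>

lemma jdt_slide_right:
  assumes x: "x \<in> W" and c: "c = c'(x := Suc (c' x))" and le: "c (Suc x) \<le> c' x"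
  shows "jdt_slide (x, Suc (c' x)) (strip_at W c) = strip_at W c'"
proof -
  define T where "T = strip_at W c"
  define k where "k = Suc (c' x)"
  have r: "T (x, Suc k) = Some (rk W x)" using x c by (simp add: T_def strip_at_def k_def)
  have d: "T (Suc x, k) = None \<or> T (Suc x, k) = Some (rk W (Suc x)) \<and> rk W x < rk W (Suc x)"
    by (auto simp: T_def strip_at_def rk_Suc)
  have step: "slide_step (T, (x, k)) = (T((x, k) := T (x, Suc k), (x, Suc k) := None), (x, Suc k))"
    using d r by (auto simp: Let_def split: option.splits)
  define T' where "T' = T((x, k) := T (x, Suc k), (x, Suc k) := None)"
  have n: "\<not> slide_cond (T', (x, Suc k))"
    using le c by (simp add: T'_def T_def strip_at_def k_def)
  have "while slide_cond slide_step (T, (x, k)) = while slide_cond slide_step (T', (x, Suc k))"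
    by (subst while_unfold) (simp del: slide_step.simps add: step T'_def r)
  also have "\<dots> = (T', (x, Suc k))" by (subst while_unfold) (simp del: slide_step.simps slide_cond.simps add: n)
  finally have "jdt_slide (x, k) T = T'" by (simp add: jdt_slide_def)
  moreover have "T' = strip_at W c'"
  proof (rule ext)
    fix b :: box
    obtain i j where b: "b = (i, j)" by (cases b)
    show "T' b = strip_at W c' b"
      using r x unfolding b T'_def T_def c by (auto simp: strip_at_def k_def)
  qed
  ultimately show ?thesis by (simp add: T_def k_def)
qed

text \<open>Row x has no strip box, so the hole descends through the strip boxes directly below it,
  down to row y, and each of them moves up by one row. In terms of rows, y is replaced by x.\<close>

lemma jdt_slide_down:
  assumes x: "x \<notin> W" and c: "c = c'(x := Suc (c' x))" and xy: "x \<le> y"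
    and run: "\<And>z. x < z \<Longrightarrow> z \<le> y \<Longrightarrow> z \<in> W \<and> c z = c' x"
    and stop: "\<not> (Suc y \<in> W \<and> c (Suc y) = c' x)"
  shows "jdt_slide (x, Suc (c' x)) (strip_at W c) = strip_at (if x = y then W else insert x (W - {y})) c'"
proof -
  define T where "T = strip_at W c"
  define k where "k = Suc (c' x)"
  \<comment> \<open>The tableau at the moment when the hole is in row z.\<close>
  define U where "U z = (\<lambda>(i, j). if j = k \<and> x \<le> i \<and> i < z then T (Suc i, k)
    else if i = z \<and> j = k then None else T (i, j))" for z
  have Tx: "T (i, j) = (if i \<in> W \<and> j = Suc (c i) then Some (rk W i) else None)" for i j
    by (simp add: T_def strip_at_def)
  have right: "T (z, Suc k) = None" if "x \<le> z" "z \<le> y" for z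
    using run[of z] x that by (cases "z = x") (auto simp: Tx k_def)
  have below: "T (Suc z, k) \<noteq> None" if "x \<le> z" "z < y" for z
    using run[of "Suc z"] that by (simp add: Tx k_def)
  have U0: "U x = T"
    using c x by (auto simp: U_def fun_eq_iff Tx)
  have step: "slide_cond (U z, (z, k)) \<and> slide_step (U z, (z, k)) = (U (Suc z), (Suc z, k))"
    if z: "x \<le> z" "z < y" for z
  proof -
    have u: "U z (z, Suc k) = None" "U z (Suc z, k) = T (Suc z, k)"
      using right[of z] z by (auto simp: U_def)
    obtain a where a: "T (Suc z, k) = Some a" using below[OF z] by auto
    have "(U z)((z, k) := U z (Suc z, k), (Suc z, k) := None) = U (Suc z)"
    proof (rule ext)
      fix b :: box
      obtain i j where b: "b = (i, j)" by (cases b)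
      show "((U z)((z, k) := U z (Suc z, k), (Suc z, k) := None)) b = U (Suc z) b"
        using z unfolding b u(2) by (auto simp: U_def less_Suc_eq)
    qed
    then show ?thesis using u a by (simp add: Let_def)
  qed
  have loop: "while slide_cond slide_step (T, (x, k)) = while slide_cond slide_step (U z, (z, k))"
    if "x \<le> z" "z \<le> y" for z
    using that
  proof (induction z rule: dec_induct)
    case base
    then show ?case by (simp add: U0)
  next
    case (step n)
    have "while slide_cond slide_step (U n, (n, k)) = while slide_cond slide_step (U (Suc n), (Suc n, k))"
      by (subst while_unfold)
        (use \<open>x \<le> n\<close> step.prems that(1) \<open>\<And>z. x \<le> z \<Longrightarrow> z < y \<Longrightarrow> slide_cond (U z, (z, k)) \<and> slide_step (U z, (z, k)) = (U (Suc z), (Suc z, k))\<close>[of n]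
          in \<open>simp del: slide_step.simps slide_cond.simps\<close>)
    then show ?case using step by simp
  qed
  have "\<not> slide_cond (U y, (y, k))"
    using right[of y] xy stop by (auto simp: U_def Tx k_def)
  then have "while slide_cond slide_step (U y, (y, k)) = (U y, (y, k))"
    by (subst while_unfold) (simp del: slide_step.simps slide_cond.simps)
  then have res: "jdt_slide (x, k) T = U y" using loop[OF xy order.refl] by (simp add: jdt_slide_def)
  define W' where "W' = (if x = y then W else insert x (W - {y}))"
  have "U y = strip_at W' c'"
  proof (cases "x = y")
    case True
    then show ?thesis using U0 x c by (auto simp: W'_def T_def strip_at_def fun_eq_iff)
  next
    case False
    then have lt: "x < y" using xy by simp
    have yW: "y \<in> W" "c y = c' x" using run[of y] lt by auto
    have W': "W' = insert x (W - {y})" using False by (simp add: W'_def)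
    have c'z: "c' z = c' x" if "x \<le> z" "z \<le> y" for z using run[of z] c that by (cases "z = x") auto
    \<comment> \<open>Inserting x raises the ranks from x up to y - 1 by one, which matches the
      labels carried up from the row below.\<close>
    have rk_in: "rk W' i = rk W (Suc i)" if "x \<le> i" "i < y" for i
    proof -
      have "W' \<inter> {..i} = insert x (W \<inter> {..i})" using W' that by auto
      then have "rk W' i = Suc (rk W i)" using x by (simp add: rk_def)
      then show ?thesis using run[of "Suc i"] that by (simp add: rk_Suc)
    qed
    have rk_lt: "rk W' i = rk W i" if "i < x" for i
    proof -
      have "W' \<inter> {..i} = W \<inter> {..i}" using W' that lt by auto
      then show ?thesis by (simp add: rk_def)
    qed
    have rk_gt: "rk W' i = rk W i" if "y < i" for i
    proof -
      have "W' \<inter> {..i} = insert x (W \<inter> {..i} - {y})" using W' that lt by auto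
      then have "rk W' i = Suc (card (W \<inter> {..i} - {y}))" using x by (simp add: rk_def)
      also have "\<dots> = rk W i" using yW that by (simp add: rk_def card_Suc_Diff1 del: card_Diff_insert)
      finally show ?thesis .
    qed
    show ?thesis
    proof (rule ext)
      fix b :: box
      obtain i j where b: "b = (i, j)" by (cases b)
      consider "i < x" | "x \<le> i" "i < y" | "i = y" | "y < i" by linarith
      then show "U y b = strip_at W' c' b"
      proof cases
        case 1
        then show ?thesis using rk_lt[of i] lt c by (auto simp: b U_def Tx strip_at_def W')
      next
        case 2
        have iW': "i \<in> W'" using 2 run[of i] W' by (cases "i = x") auto
        have "Suc i \<in> W" "c (Suc i) = c' x" using run[of "Suc i"] 2 by auto
        moreover have "T (i, j) = None" if "j \<noteq> k"
          using that x run[of i] 2 by (cases "i = x") (auto simp: Tx k_def)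
        ultimately show ?thesis using 2 rk_in[OF 2] iW' c'z[of i] by (auto simp: b U_def Tx strip_at_def k_def)
      next
        case 3
        then show ?thesis using yW lt W' by (auto simp: b U_def Tx strip_at_def k_def)
      next
        case 4
        then show ?thesis using rk_gt[of i] lt c by (auto simp: b U_def Tx strip_at_def W')
      qed
    qed
  qed
  then show ?thesis using res by (simp add: T_def k_def W'_def)
qed

text \<open>The outer boundary of the strip is weakly decreasing: what \<open>add_strip\<close> says
  when the inner shape is a bare function of rows.\<close>

definition strip_ok :: "(nat \<Rightarrow> nat) \<Rightarrow> nat set \<Rightarrow> bool" where
  "strip_ok c W \<longleftrightarrow> finite W \<and> W \<subseteq> {1..} \<and> (\<forall>i\<ge>1. c (Suc i) + of_bool (Suc i \<in> W) \<le> c i + of_bool (i \<in> W))"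

text \<open>A slide either keeps the rows of the strip or replaces y by x within a run of equal
  inner rows. So its counting function is unchanged above row x and wherever the new inner shape
  drops.\<close>

lemma jdt_slide_strip:
  assumes ok: "strip_ok c W" and x1: "1 \<le> x" and c: "c = c'(x := Suc (c' x))"
    and anti: "\<And>i. 1 \<le> i \<Longrightarrow> c (Suc i) \<le> c i" and le: "c (Suc x) \<le> c' x"
  shows "\<exists>W'. jdt_slide (x, Suc (c' x)) (strip_at W c) = strip_at W' c' \<and> strip_ok c' W' \<and> card W' = card W \<and>
    (\<forall>z. (z < x \<or> c' (Suc z) < c' z) \<longrightarrow> rk W' z = rk W z)"
proof -
  have fW: "finite W" and W1: "W \<subseteq> {1..}"
    and okW: "\<And>i. 1 \<le> i \<Longrightarrow> c (Suc i) + of_bool (Suc i \<in> W) \<le> c i + of_bool (i \<in> W)"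
    using ok by (auto simp: strip_ok_def)
  show ?thesis
  proof (cases "x \<in> W")
    case True
    have "c' (Suc i) + of_bool (Suc i \<in> W) \<le> c' i + of_bool (i \<in> W)" if "1 \<le> i" for i
      using okW[OF that] le c True by (cases "i = x"; cases "Suc i = x") auto
    then have "strip_ok c' W" using fW W1 by (simp add: strip_ok_def)
    then show ?thesis using jdt_slide_right[OF True c le] by blast
  next
    case False
    define R where "R y \<longleftrightarrow> (\<forall>z. x < z \<and> z \<le> y \<longrightarrow> z \<in> W \<and> c z = c' x)" for y
    obtain M where M: "\<And>z. z \<in> W \<Longrightarrow> z \<le> M" using fW finite_nat_set_iff_bounded_le by auto
    have bounded: "y \<le> max x M" if "R y" for y
      using that M[of y] by (cases "x < y") (auto simp: R_def)
    have Rx: "R x" by (auto simp: R_def)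
    \<comment> \<open>The last row reached by the hole; the run below x is finite because
      \<open>W\<close> is.\<close>
    define y where "y = (GREATEST y. R y)"
    have Ry: "R y" unfolding y_def by (rule GreatestI_nat[of R x "max x M"]) (use Rx bounded in auto)
    have ymax: "z \<le> y" if "R z" for z
      unfolding y_def by (rule Greatest_le_nat[of R z "max x M"]) (use that bounded in auto)
    have xy: "x \<le> y" using ymax[OF Rx] .
    have run: "z \<in> W \<and> c z = c' x" if "x < z" "z \<le> y" for z using Ry that by (simp add: R_def)
    have stop: "\<not> (Suc y \<in> W \<and> c (Suc y) = c' x)"
    proof
      assume "Suc y \<in> W \<and> c (Suc y) = c' x"
      then have "R (Suc y)" using run by (auto simp: R_def le_Suc_eq)
      then show False using ymax by fastforce
    qed
    define W' where "W' = (if x = y then W else insert x (W - {y}))"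
    have slide: "jdt_slide (x, Suc (c' x)) (strip_at W c) = strip_at W' c'"
      unfolding W'_def by (rule jdt_slide_down[OF False c xy run stop])
    have cy: "c' z = c' x" if "x \<le> z" "z \<le> y" for z using run[of z] c that by (cases "z = x") auto
    have cS: "c' (Suc y) \<le> c' x"
      using le anti[of y] run[of y] c xy x1 by (cases "x = y") auto
    \<comment> \<open>Row y ends up without a strip box, so the row below, with its strip box if
      any, must fit under the bare inner length of row y.\<close>
    have last: "c' (Suc y) + of_bool (Suc y \<in> W) \<le> c' x"
      using cS stop c xy by (auto simp: le_less of_bool_def)
    show ?thesis
    proof (cases "x = y")
      case True
      have "c' (Suc i) + of_bool (Suc i \<in> W) \<le> c' i + of_bool (i \<in> W)" if "1 \<le> i" for i
        using okW[OF that] last c True by (cases "i = x"; cases "Suc i = x") auto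
      then have "strip_ok c' W'" using fW W1 True by (simp add: strip_ok_def W'_def)
      then show ?thesis using slide True unfolding W'_def by auto
    next
      case ne: False
      then have lt: "x < y" using xy by simp
      have W': "W' = insert x (W - {y})" using ne by (simp add: W'_def)
      have yW: "y \<in> W" using run lt by blast
      have "c' (Suc i) + of_bool (Suc i \<in> W') \<le> c' i + of_bool (i \<in> W')" if i: "1 \<le> i" for i
      proof -
        consider "i = y" | "i = x" | "Suc i = x" | "Suc i = y" "i \<noteq> x" | "i \<noteq> y" "i \<noteq> x" "Suc i \<noteq> x" "Suc i \<noteq> y" by blast
        then show ?thesis
        proof cases
          case 1
          then show ?thesis using last W' lt cy[of y] by auto
        next
          case 2
          then show ?thesis using le c W' by (auto simp: of_bool_def)
        next
          case 3
          then show ?thesis using okW[OF i] c W' False lt by auto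
        next
          case 4
          then show ?thesis using okW[OF i] c W' lt by (auto simp: of_bool_def split: if_splits)
        next
          case 5
          then show ?thesis using okW[OF i] c W' by auto
        qed
      qed
      then have "strip_ok c' W'" using fW W1 x1 by (auto simp: strip_ok_def W')
      moreover have "card W' = card W"
        using False yW fW card_Suc_Diff1[of W y] by (simp add: W')
      moreover have "rk W' z = rk W z" if z: "z < x \<or> c' (Suc z) < c' z" for z
      proof -
        consider "z < x" | "y \<le> z" | "x \<le> z" "z < y" by linarith
        then show ?thesis
        proof cases
          case 1
          then have "W' \<inter> {..z} = W \<inter> {..z}" using W' lt by auto
          then show ?thesis by (simp add: rk_def)
        next
          case 2
          then have "W' \<inter> {..z} = insert x (W \<inter> {..z} - {y})" using W' lt by auto
          moreover have "y \<in> W \<inter> {..z}" using yW 2 by simp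
          ultimately show ?thesis
            using False card_Suc_Diff1[of "W \<inter> {..z}" y] by (simp add: rk_def)
        next
          case 3
          then show ?thesis using z cy[of z] cy[of "Suc z"] by simp
        qed
      qed
      ultimately show ?thesis using slide by blast
    qed
  qed
qed

text \<open>The slides take the boxes of the inner strip from the bottom up. Each one respects the
  counting function at the drops of \<kappa>, and this is the only information about the slid strip,
  besides its being a strip of the same size, that the reverse rule will require.\<close>

lemma Slide_strips:
  assumes V: "add_strip \<kappa> V \<mu>" and W: "add_strip \<mu> W \<gamma>"
  obtains M where "Slide (strip_tableau (skew \<mu> \<kappa>)) (strip_tableau (skew \<gamma> \<mu>)) = strip_at M (prow \<kappa>)"
    "strip_ok (prow \<kappa>) M" "card M = card W"
    "\<And>z. 1 \<le> z \<Longrightarrow> prow \<kappa> (Suc z) < prow \<kappa> z \<Longrightarrow> rk M z = rk W z"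
proof -
  note pv = add_stripD[OF V] and pw = add_stripD[OF W]
  \<comment> \<open>Row lengths of the inner shape when the k topmost boxes of \<open>V\<close> are
    still there.\<close>
  define C where "C k i = prow \<kappa> i + of_bool (i \<in> V \<and> rk V i \<le> k)" for k i
  define B where "B = strip_at V (prow \<kappa>)"
  have anti: "C k (Suc i) \<le> C k i" if i: "1 \<le> i" for k i
  proof (cases "prow \<kappa> (Suc i) = prow \<kappa> i")
    case True
    then have "i \<in> V" if "Suc i \<in> V" using add_strip_top[OF V, of i "Suc i"] i that by simp
    then show ?thesis using True rk_mono[of i "Suc i" V] by (auto simp: C_def)
  next
    case False
    then have "prow \<kappa> (Suc i) < prow \<kappa> i" using prow_Suc_le[OF pv(1) i] by simp
    then show ?thesis by (simp add: C_def)
  qed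
  have main: "\<exists>M. fold (\<lambda>k. jdt_slide (box_of B k)) (rev [1..<k + 1]) (strip_at W (C k)) = strip_at M (C 0) \<and>
      strip_ok (C 0) M \<and> card M = card W \<and> (\<forall>z\<ge>1. prow \<kappa> (Suc z) < prow \<kappa> z \<longrightarrow> rk M z = rk W z)"
    if "k \<le> card V" "strip_ok (C k) W" for k W
    using that
  proof (induction k arbitrary: W)
    case 0
    then show ?case by auto
  next
    case (Suc k)
    obtain x where x: "x \<in> V" "rk V x = Suc k" using rk_surj[OF pv(3), of "Suc k"] Suc.prems by auto
    have x1: "1 \<le> x" using x pv(4) by auto
    have bx: "box_of B (Suc k) = (x, Suc (C k x))"
      using box_of_strip_at[OF x(1), of "prow \<kappa>"] x(2) by (simp add: B_def C_def)
    have Cx: "C (Suc k) = (C k)(x := Suc (C k x))"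
    proof (rule ext)
      fix i
      have "i \<in> V \<and> rk V i = Suc k \<longleftrightarrow> i = x" using x rk_inj by metis
      then show "C (Suc k) i = ((C k)(x := Suc (C k x))) i" using x by (auto simp: C_def le_Suc_eq)
    qed
    have low: "C (Suc k) i = prow \<kappa> i" if "x < i" for i
      using rk_less[OF that, of V] x by (auto simp: C_def)
    have low': "C k i = prow \<kappa> i" if "x \<le> i" for i
      using rk_mono[OF that, of V] x by (auto simp: C_def)
    have le: "C (Suc k) (Suc x) \<le> C k x" using low[of "Suc x"] low'[of x] prow_Suc_le[OF pv(1) x1] by simp
    obtain W' where W': "jdt_slide (x, Suc (C k x)) (strip_at W (C (Suc k))) = strip_at W' (C k)"
      "strip_ok (C k) W'" "card W' = card W" "\<And>z. z < x \<or> C k (Suc z) < C k z \<Longrightarrow> rk W' z = rk W z"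
      using jdt_slide_strip[OF Suc.prems(2) x1 Cx anti le] by blast
    obtain M where M: "fold (\<lambda>k. jdt_slide (box_of B k)) (rev [1..<k + 1]) (strip_at W' (C k)) = strip_at M (C 0)"
      "strip_ok (C 0) M" "card M = card W'" "\<forall>z\<ge>1. prow \<kappa> (Suc z) < prow \<kappa> z \<longrightarrow> rk M z = rk W' z"
      using Suc.IH[of W'] W'(2) Suc.prems(1) by auto
    have "rk M z = rk W z" if z: "1 \<le> z" "prow \<kappa> (Suc z) < prow \<kappa> z" for z
    proof -
      \<comment> \<open>From row x on the current inner shape agrees with \<kappa>, so a drop of
        \<kappa> there is a drop of that shape.\<close>
      have "z < x \<or> C k (Suc z) < C k z" using z low'[of z] low'[of "Suc z"] by (cases "z < x") auto
      then show ?thesis using M(4) z W'(4) by simp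
    qed
    moreover have "rev [1..<Suc k + 1] = Suc k # rev [1..<k + 1]" by simp
    ultimately show ?case using M W' bx by auto
  qed
  have Cp: "C (card V) i = prow \<mu> i" if "1 \<le> i" for i
    using pv(5)[OF that] rk_le_card[OF pv(3), of i] by (simp add: C_def)
  have eqW: "strip_at W (C (card V)) = strip_at W (prow \<mu>)"
    using Cp pw(4) by (force simp: strip_at_def fun_eq_iff)
  have okW: "strip_ok (C (card V)) W"
    unfolding strip_ok_def
  proof (intro conjI allI impI)
    fix i :: nat assume i: "1 \<le> i"
    have "prow \<gamma> (Suc i) \<le> prow \<gamma> i" by (rule prow_Suc_le[OF pw(2) i])
    then show "C (card V) (Suc i) + of_bool (Suc i \<in> W) \<le> C (card V) i + of_bool (i \<in> W)"
      using pw(5)[OF i] pw(5)[of "Suc i"] Cp[OF i] Cp[of "Suc i"] by simp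
  qed (use pw in auto)
  have C0: "C 0 = prow \<kappa>"
    using rk_pos[of _ V] by (fastforce simp: C_def fun_eq_iff)
  have domB: "card (dom B) = card V"
  proof -
    have "dom B = (\<lambda>i. (i, Suc (prow \<kappa> i))) ` V" by (auto simp: B_def strip_at_def dom_def split: if_splits)
    then show ?thesis by (simp add: card_image inj_on_def)
  qed
  obtain M where "fold (\<lambda>k. jdt_slide (box_of B k)) (rev [1..<card V + 1]) (strip_at W (C (card V))) = strip_at M (C 0)"
      "strip_ok (C 0) M" "card M = card W" "\<forall>z\<ge>1. prow \<kappa> (Suc z) < prow \<kappa> z \<longrightarrow> rk M z = rk W z"
    using main[OF order.refl okW] by blast
  then have "Slide (strip_tableau (skew \<mu> \<kappa>)) (strip_tableau (skew \<gamma> \<mu>)) = strip_at M (prow \<kappa>)"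
    "strip_ok (prow \<kappa>) M" "card M = card W" "\<forall>z\<ge>1. prow \<kappa> (Suc z) < prow \<kappa> z \<longrightarrow> rk M z = rk W z"
    unfolding Slide_def strip_tableau_eq[OF V] strip_tableau_eq[OF W] B_def[symmetric] domB C0 eqW by simp_all
  then show thesis using that by blast
qed

section \<open>The row rules in terms of ranks\<close>

text \<open>Larger elements mean smaller counts, so comparing the k-th elements of two sets for
  every k amounts to comparing their counting functions in the reverse direction.\<close>

lemma rank_compare:
  assumes "finite A" "finite B" "card A = card B"
  shows "(\<forall>a\<in>A. \<forall>b\<in>B. rk A a = rk B b \<longrightarrow> a \<le> b) \<longleftrightarrow> (\<forall>x. rk B x \<le> rk A x)"
proof (intro iffI allI ballI impI)
  fix x assume h: "\<forall>a\<in>A. \<forall>b\<in>B. rk A a = rk B b \<longrightarrow> a \<le> b"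
  show "rk B x \<le> rk A x"
  proof (cases "B \<inter> {..x} = {}")
    case False
    define b where "b = Max (B \<inter> {..x})"
    have b: "b \<in> B" "b \<le> x" "\<And>y. y \<in> B \<Longrightarrow> y \<le> x \<Longrightarrow> y \<le> b"
      using Max_in[of "B \<inter> {..x}"] False assms(2) by (auto simp: b_def)
    have "B \<inter> {..b} = B \<inter> {..x}" using b by auto
    then have e: "rk B b = rk B x" by (simp add: rk_def)
    have "rk B b \<in> {1..card A}" using rk_pos[OF b(1)] rk_le_card[OF assms(2), of b] assms(3) by simp
    then obtain a where a: "a \<in> A" "rk A a = rk B b" using rk_surj[OF assms(1)] by blast
    then have "a \<le> x" using h b by fastforce
    then show ?thesis using rk_mono[of a x A] a e by simp
  qed (simp add: rk_def)
next
  fix a b assume h: "\<forall>x. rk B x \<le> rk A x" and ab: "a \<in> A" "b \<in> B" "rk A a = rk B b"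
  show "a \<le> b"
  proof (rule ccontr)
    assume "\<not> a \<le> b"
    then have "rk A b < rk A a" using rk_less[of b a A] ab by simp
    then show False using h ab by (metis linorder_not_le)
  qed
qed

lemma rk_Suc_image: "rk (Suc ` M) (Suc x) = rk M x" "rk (Suc ` M) 0 = 0"
proof -
  have "Suc ` M \<inter> {..Suc x} = Suc ` (M \<inter> {..x})" by auto
  then show "rk (Suc ` M) (Suc x) = rk M x" by (simp add: rk_def card_image)
  have "Suc ` M \<inter> {..0} = {}" by auto
  then show "rk (Suc ` M) 0 = 0" unfolding rk_def by simp
qed

text \<open>\<open>P\<close> interlaces with \<open>W\<close> from above, and with the strip obtained from \<open>W\<close> by moving it to the
  top of every block of equal rows of \<open>\<kappa>\<close> strictly from below.\<close>

definition interlaced :: "nat list \<Rightarrow> nat set \<Rightarrow> nat set \<Rightarrow> bool" where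
  "interlaced \<kappa> W P \<longleftrightarrow> finite P \<and> card P = card W \<and> (\<forall>x. rk W x \<le> rk P x) \<and> rk P 1 = 0 \<and>
     (\<forall>x\<ge>1. prow \<kappa> (Suc x) < prow \<kappa> x \<longrightarrow> rk P (Suc x) \<le> rk W x)"

text \<open>The image under \<open>Suc\<close> encodes the strict inequality, m < p being Suc m
  \<le> p. In a block of equal rows of \<kappa> the strip \<open>M\<close> fills the top, so its
  count grows with every row until it is exhausted there, while the count of \<open>P\<close> grows
  by at most one per row. A violation inside a block thus persists to its end.\<close>

lemma top_justified_strict_iff:
  assumes k: "is_partition \<kappa>" and M: "strip_ok (prow \<kappa>) M" and fP: "finite P" and c: "card P = card M"
  shows "(\<forall>x. rk P x \<le> rk (Suc ` M) x) \<longleftrightarrow>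
    rk P 1 = 0 \<and> (\<forall>x\<ge>1. prow \<kappa> (Suc x) < prow \<kappa> x \<longrightarrow> rk P (Suc x) \<le> rk M x)"
proof
  assume h: "\<forall>x. rk P x \<le> rk (Suc ` M) x"
  have "rk M 0 = 0" using M unfolding strip_ok_def rk_def by (auto simp: card_eq_0_iff)
  then have "rk P 1 = 0" using h rk_Suc_image(1)[of M 0] by (metis One_nat_def le_zero_eq)
  then show "rk P 1 = 0 \<and> (\<forall>x\<ge>1. prow \<kappa> (Suc x) < prow \<kappa> x \<longrightarrow> rk P (Suc x) \<le> rk M x)"
    using h rk_Suc_image(1)[of M] by metis
next
  assume h: "rk P 1 = 0 \<and> (\<forall>x\<ge>1. prow \<kappa> (Suc x) < prow \<kappa> x \<longrightarrow> rk P (Suc x) \<le> rk M x)"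
  have main: "rk P (Suc x) \<le> rk M x" for x
  proof (induction x)
    case 0
    then show ?case using h by simp
  next
    case (Suc x)
    show ?case
    proof (rule ccontr)
      assume n: "\<not> rk P (Suc (Suc x)) \<le> rk M (Suc x)"
      define x' where "x' = Suc x"
      have x1: "1 \<le> x'" by (simp add: x'_def)
      have "rk P (Suc x') \<le> Suc (rk P x')" by (simp add: rk_Suc)
      then have "rk M x' \<le> rk M x" using n Suc.IH by (simp add: x'_def)
      then have xM: "x' \<notin> M" unfolding x'_def rk_Suc by simp
      have gt: "rk M x' < rk P (Suc x')" using n by (simp add: x'_def)
      \<comment> \<open>Since \<kappa> satisfies the condition at every drop, a persisting violation
        never meets a drop: the block has no end and \<open>M\<close> has no rows left in
        it.\<close>
      have flat: "prow \<kappa> z = prow \<kappa> x' \<and> z \<notin> M \<and> rk M z = rk M x'" if "x' \<le> z" for z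
        using that
      proof (induction z rule: dec_induct)
        case (step z)
        then have z1: "1 \<le> z" using x1 by simp
        have "rk P (Suc x') \<le> rk P (Suc z)" by (rule rk_mono) (use step in simp)
        then have "\<not> prow \<kappa> (Suc z) < prow \<kappa> z" using h z1 step gt by fastforce
        then have e: "prow \<kappa> (Suc z) = prow \<kappa> z" using prow_Suc_le[OF k z1] by simp
        have "prow \<kappa> (Suc z) + of_bool (Suc z \<in> M) \<le> prow \<kappa> z + of_bool (z \<in> M)"
          using M z1 by (simp add: strip_ok_def)
        then have "Suc z \<notin> M" using e step by (auto simp: of_bool_def split: if_splits)
        then show ?case using e step by (simp add: rk_Suc)
      qed (simp add: xM)
      have "rk M x' = card M" by (rule rk_eq_card) (use flat in \<open>meson linorder_linear\<close>)
      then show False using gt rk_le_card[OF fP, of "Suc x'"] c by simp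
    qed
  qed
  show "\<forall>x. rk P x \<le> rk (Suc ` M) x"
  proof
    fix x show "rk P x \<le> rk (Suc ` M) x"
    proof (cases x)
      case 0
      then show ?thesis using h rk_mono[of 0 1 P] by simp
    next
      case (Suc z)
      then show ?thesis using main rk_Suc_image(1) by simp
    qed
  qed
qed

text \<open>Labels increase with the row, so passing from \<open>I\<close> to its labels preserves
  ranks.\<close>

lemma rk_of_rlab:
  assumes I: "add_strip \<nu> I \<beta>" and P: "int ` P = rlab r \<beta> ` I" and i: "i \<in> I" and p: "int p = rlab r \<beta> i"
  shows "rk P p = rk I i"
proof -
  have b: "is_partition \<beta>" and I1: "I \<subseteq> {1..}" using add_stripD[OF I] by auto
  have inj: "inj_on (rlab r \<beta>) I" using rlab_inj[OF b] I1 by (auto simp: inj_on_def)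
  have le: "rlab r \<beta> j \<le> rlab r \<beta> i \<longleftrightarrow> j \<le> i" if "j \<in> I" for j
  proof -
    have ge: "1 \<le> i" "1 \<le> j" using that i I1 by auto
    show ?thesis
      using rlab_mono[OF b ge(1), of j r] rlab_mono[OF b ge(2), of i r]
      by (cases i j rule: linorder_cases) fastforce+
  qed
  have "int ` (P \<inter> {..p}) = rlab r \<beta> ` (I \<inter> {..i})"
  proof
    show "int ` (P \<inter> {..p}) \<subseteq> rlab r \<beta> ` (I \<inter> {..i})"
    proof clarify
      fix q assume q: "q \<in> P" "q \<le> p"
      then obtain j where j: "j \<in> I" "int q = rlab r \<beta> j" using P by (metis imageE imageI)
      then have "j \<le> i" using le[of j] q p by simp
      then show "int q \<in> rlab r \<beta> ` (I \<inter> {..i})" using j by auto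
    qed
    show "rlab r \<beta> ` (I \<inter> {..i}) \<subseteq> int ` (P \<inter> {..p})"
    proof clarify
      fix j assume j: "j \<in> I" "j \<le> i"
      then obtain q where q: "q \<in> P" "int q = rlab r \<beta> j" using P by (metis imageE imageI)
      then have "q \<le> p" using le[of j] j p by simp
      then show "rlab r \<beta> j \<in> int ` (P \<inter> {..p})" using q by (metis IntI atMost_iff imageI)
    qed
  qed
  then have "card (int ` (P \<inter> {..p})) = card (rlab r \<beta> ` (I \<inter> {..i}))" by simp
  moreover have "card (int ` (P \<inter> {..p})) = card (P \<inter> {..p})" by (rule card_image) simp
  moreover have "card (rlab r \<beta> ` (I \<inter> {..i})) = card (I \<inter> {..i})"
    by (rule card_image) (rule inj_on_subset[OF inj], blast)
  ultimately show ?thesis by (simp add: rk_def)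
qed

text \<open>Both rules compare rows carrying equal labels in two strips, so they compare counting
  functions: those of \<open>P\<close> and \<open>W\<close> for the row rule, and those of
  \<open>P\<close> and the slid strip, shifted by one for strictness, for the reverse rule. At the
  drops of \<kappa> the slid strip may be replaced by \<open>W\<close>.\<close>

lemma rules_iff_interlaced:
  assumes V: "add_strip \<kappa> V \<mu>" and W: "add_strip \<mu> W \<gamma>" and I: "add_strip \<nu> I \<beta>" and c: "card W = card I"
  shows "row_rule r (skew \<beta> \<nu>) (strip_tableau (skew \<gamma> \<mu>)) \<and>
      reverse_row_rule r (skew \<beta> \<nu>) (Slide (strip_tableau (skew \<mu> \<kappa>)) (strip_tableau (skew \<gamma> \<mu>)))
    \<longleftrightarrow> (\<exists>P. int ` P = rlab r \<beta> ` I \<and> interlaced \<kappa> W P)" (is "?L \<longleftrightarrow> ?R")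
proof -
  note pw = add_stripD[OF W] and pi = add_stripD[OF I] and pv = add_stripD[OF V]
  obtain M where S: "Slide (strip_tableau (skew \<mu> \<kappa>)) (strip_tableau (skew \<gamma> \<mu>)) = strip_at M (prow \<kappa>)"
    and M: "strip_ok (prow \<kappa>) M" "card M = card W"
    and Mdrop: "\<And>z. 1 \<le> z \<Longrightarrow> prow \<kappa> (Suc z) < prow \<kappa> z \<Longrightarrow> rk M z = rk W z"
    using Slide_strips[OF V W] by blast
  have fM: "finite M" and M1: "M \<subseteq> {1..}" using M(1) by (auto simp: strip_ok_def)
  have cD: "card (skew \<beta> \<nu>) = card I" by (rule add_strip_card_skew[OF I])
  have entry: "row_rule_entry r (skew \<beta> \<nu>) (rk I i) = rlab r \<beta> i" if "i \<in> I" for i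
    using box_of_strip_at[OF that, of "prow \<nu>"] pi(5)[of i] pi(4) that
    by (auto simp: row_rule_entry_def rl_strip_eq[OF I] row_rule_filling_def rlab_def)
  have rowW: "row_of (strip_tableau (skew \<gamma> \<mu>)) (rk W w) = w" if "w \<in> W" for w
    using box_of_strip_at[OF that] by (simp add: strip_tableau_eq[OF W])
  have rowM: "row_of (strip_at M (prow \<kappa>)) (rk M m) = m" if "m \<in> M" for m
    using box_of_strip_at[OF that] by simp
  have ks: "{1..card I} = rk I ` I" using rk_bij[OF pi(3)] by (simp add: bij_betw_def)
  have rr: "row_rule r (skew \<beta> \<nu>) (strip_tableau (skew \<gamma> \<mu>)) \<longleftrightarrow>
    (\<forall>i\<in>I. \<forall>w\<in>W. rk I i = rk W w \<longrightarrow> rlab r \<beta> i \<le> int w)"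
  proof -
    have "row_rule r (skew \<beta> \<nu>) (strip_tableau (skew \<gamma> \<mu>)) \<longleftrightarrow>
      (\<forall>i\<in>I. rlab r \<beta> i \<le> int (row_of (strip_tableau (skew \<gamma> \<mu>)) (rk I i)))"
      unfolding row_rule_def cD ks using entry by auto
    also have "\<dots> \<longleftrightarrow> (\<forall>i\<in>I. \<forall>w\<in>W. rk I i = rk W w \<longrightarrow> rlab r \<beta> i \<le> int w)"
    proof (intro ball_cong refl iffI ballI impI)
      fix i assume i: "i \<in> I" and h: "\<forall>w\<in>W. rk I i = rk W w \<longrightarrow> rlab r \<beta> i \<le> int w"
      have "rk I i \<in> {1..card W}" using ks i c by auto
      then obtain w where "w \<in> W" "rk W w = rk I i" using rk_surj[OF pw(3)] by blast
      then show "rlab r \<beta> i \<le> int (row_of (strip_tableau (skew \<gamma> \<mu>)) (rk I i))" using h rowW by metis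
    qed (use rowW in metis)
    finally show ?thesis .
  qed
  have rv: "reverse_row_rule r (skew \<beta> \<nu>) (strip_at M (prow \<kappa>)) \<longleftrightarrow>
    (\<forall>i\<in>I. \<forall>m\<in>M. rk I i = rk M m \<longrightarrow> int m < rlab r \<beta> i)"
  proof -
    have "reverse_row_rule r (skew \<beta> \<nu>) (strip_at M (prow \<kappa>)) \<longleftrightarrow>
      (\<forall>i\<in>I. int (row_of (strip_at M (prow \<kappa>)) (rk I i)) < rlab r \<beta> i)"
      unfolding reverse_row_rule_def cD ks using entry by auto
    also have "\<dots> \<longleftrightarrow> (\<forall>i\<in>I. \<forall>m\<in>M. rk I i = rk M m \<longrightarrow> int m < rlab r \<beta> i)"
    proof (intro ball_cong refl iffI ballI impI)
      fix i assume i: "i \<in> I" and h: "\<forall>m\<in>M. rk I i = rk M m \<longrightarrow> int m < rlab r \<beta> i"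
      have "rk I i \<in> {1..card M}" using ks i c M(2) by auto
      then obtain m where "m \<in> M" "rk M m = rk I i" using rk_surj[OF fM] by blast
      then show "int (row_of (strip_at M (prow \<kappa>)) (rk I i)) < rlab r \<beta> i" using h rowM by metis
    qed (use rowM in metis)
    finally show ?thesis .
  qed
  have key: "?L \<longleftrightarrow> interlaced \<kappa> W P" if P: "int ` P = rlab r \<beta> ` I" for P
  proof -
    have cP: "card P = card I" using card_rlab[OF pi(2,4) P] .
    have "finite (int ` P)" using P pi(3) by simp
    then have fP: "finite P" by (simp add: finite_image_iff)
    have exP: "\<exists>p\<in>P. int p = rlab r \<beta> i \<and> rk P p = rk I i" if i: "i \<in> I" for i
    proof -
      obtain p where "p \<in> P" "int p = rlab r \<beta> i" using P i by (metis imageE imageI)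
      then show ?thesis using rk_of_rlab[OF I P i] by blast
    qed
    have exI': "\<exists>i\<in>I. int p = rlab r \<beta> i \<and> rk P p = rk I i" if p: "p \<in> P" for p
    proof -
      obtain i where "i \<in> I" "int p = rlab r \<beta> i" using P p by (metis imageE imageI)
      then show ?thesis using rk_of_rlab[OF I P] by blast
    qed
    have "(\<forall>i\<in>I. \<forall>w\<in>W. rk I i = rk W w \<longrightarrow> rlab r \<beta> i \<le> int w) \<longleftrightarrow>
      (\<forall>p\<in>P. \<forall>w\<in>W. rk P p = rk W w \<longrightarrow> p \<le> w)"
    proof (intro iffI ballI impI)
      fix p w assume h: "\<forall>i\<in>I. \<forall>w\<in>W. rk I i = rk W w \<longrightarrow> rlab r \<beta> i \<le> int w"
        and pw: "p \<in> P" "w \<in> W" "rk P p = rk W w"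
      then obtain i where "i \<in> I" "int p = rlab r \<beta> i" "rk P p = rk I i" using exI' by blast
      then show "p \<le> w" using h pw by fastforce
    next
      fix i w assume h: "\<forall>p\<in>P. \<forall>w\<in>W. rk P p = rk W w \<longrightarrow> p \<le> w"
        and iw: "i \<in> I" "w \<in> W" "rk I i = rk W w"
      then obtain p where "p \<in> P" "int p = rlab r \<beta> i" "rk P p = rk I i" using exP by blast
      then show "rlab r \<beta> i \<le> int w" using h iw by fastforce
    qed
    also have "\<dots> \<longleftrightarrow> (\<forall>x. rk W x \<le> rk P x)" by (rule rank_compare[OF fP pw(3)]) (simp add: cP c)
    finally have 1: "row_rule r (skew \<beta> \<nu>) (strip_tableau (skew \<gamma> \<mu>)) \<longleftrightarrow> (\<forall>x. rk W x \<le> rk P x)"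
      using rr by simp
    have "(\<forall>i\<in>I. \<forall>m\<in>M. rk I i = rk M m \<longrightarrow> int m < rlab r \<beta> i) \<longleftrightarrow>
      (\<forall>s\<in>Suc ` M. \<forall>p\<in>P. rk (Suc ` M) s = rk P p \<longrightarrow> s \<le> p)"
    proof (intro iffI ballI impI)
      fix s p assume h: "\<forall>i\<in>I. \<forall>m\<in>M. rk I i = rk M m \<longrightarrow> int m < rlab r \<beta> i"
        and sp: "s \<in> Suc ` M" "p \<in> P" "rk (Suc ` M) s = rk P p"
      obtain m where m: "m \<in> M" "s = Suc m" using sp by blast
      obtain i where i: "i \<in> I" "int p = rlab r \<beta> i" "rk P p = rk I i" using exI' sp by blast
      have "rk I i = rk M m" using sp m i rk_Suc_image(1) by simp
      then have "int m < int p" using h i m by simp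
      then show "s \<le> p" using m by simp
    next
      fix i m assume h: "\<forall>s\<in>Suc ` M. \<forall>p\<in>P. rk (Suc ` M) s = rk P p \<longrightarrow> s \<le> p"
        and im: "i \<in> I" "m \<in> M" "rk I i = rk M m"
      obtain p where p: "p \<in> P" "int p = rlab r \<beta> i" "rk P p = rk I i" using exP im by blast
      have "Suc m \<le> p" using h im p rk_Suc_image(1)[of M m] by simp
      then show "int m < rlab r \<beta> i" using p by simp
    qed
    also have "\<dots> \<longleftrightarrow> (\<forall>x. rk P x \<le> rk (Suc ` M) x)"
      by (rule rank_compare) (simp_all add: fM fP card_image cP c M(2))
    also have "\<dots> \<longleftrightarrow> rk P 1 = 0 \<and> (\<forall>x\<ge>1. prow \<kappa> (Suc x) < prow \<kappa> x \<longrightarrow> rk P (Suc x) \<le> rk M x)"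
      by (rule top_justified_strict_iff[OF pv(1) M(1) fP]) (simp add: cP c M(2))
    also have "\<dots> \<longleftrightarrow> rk P 1 = 0 \<and> (\<forall>x\<ge>1. prow \<kappa> (Suc x) < prow \<kappa> x \<longrightarrow> rk P (Suc x) \<le> rk W x)"
      using Mdrop by auto
    finally have 2: "reverse_row_rule r (skew \<beta> \<nu>) (strip_at M (prow \<kappa>)) \<longleftrightarrow>
      rk P 1 = 0 \<and> (\<forall>x\<ge>1. prow \<kappa> (Suc x) < prow \<kappa> x \<longrightarrow> rk P (Suc x) \<le> rk W x)"
      using rv by simp
    show ?thesis unfolding S 1 2 interlaced_def using fP cP c by simp
  qed
  show ?thesis
  proof
    assume L: ?L
    \<comment> \<open>The reverse rule puts every label above a row number, so the labels are
      natural numbers and can serve as \<open>P\<close>.\<close>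
    have nn: "0 \<le> rlab r \<beta> i" if i: "i \<in> I" for i
    proof -
      have "rk I i \<in> {1..card M}" using ks i c M(2) by auto
      then obtain m where "m \<in> M" "rk M m = rk I i" using rk_surj[OF fM] by blast
      then have "int m < rlab r \<beta> i" using L rv i unfolding S by simp
      then show ?thesis by simp
    qed
    have P: "int ` (nat ` rlab r \<beta> ` I) = rlab r \<beta> ` I"
      unfolding image_image by (rule image_cong) (use nn in auto)
    show ?R using key[OF P] P L by blast
  next
    assume ?R
    then show ?L using key by blast
  qed
qed

section \<open>Splitting a vertical strip\<close>

text \<open>Wherever the count of \<open>P\<close> at row z + 1 is ahead of that of \<open>W\<close>
  at row z, interlacing forces rows z and z + 1 of \<kappa> to be equally long. Such equalities are
  spread along a block until they contradict that \<open>V\<close> and \<open>W\<close> fill blocks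
  from the top.\<close>

lemma interlaced_imp_split:
  assumes V: "add_strip \<kappa> V \<mu>" and W: "add_strip \<mu> W \<gamma>" and i: "interlaced \<kappa> W P"
  shows "V \<inter> W = {}" "\<And>x. x \<in> P \<Longrightarrow> \<exists>z\<ge>1. x = Suc z \<and> x \<in> V \<union> W \<and> prow \<kappa> x = prow \<kappa> z"
proof -
  note pv = add_stripD[OF V] and pw = add_stripD[OF W]
  have fP: "finite P" and c: "card P = card W" and C1: "\<And>x. rk W x \<le> rk P x" and P1: "rk P 1 = 0"
    and C2: "\<And>x. 1 \<le> x \<Longrightarrow> prow \<kappa> (Suc x) < prow \<kappa> x \<Longrightarrow> rk P (Suc x) \<le> rk W x"
    using i by (auto simp: interlaced_def)
  have flat: "prow \<kappa> (Suc z) = prow \<kappa> z" if "1 \<le> z" "rk W z < rk P (Suc z)" for z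
    using C2[OF that(1)] prow_Suc_le[OF pv(1) that(1)] that(2) by fastforce
  \<comment> \<open>A row in both strips passes this property to the row above, and so up to row 1,
    where the count of \<open>P\<close> is still zero.\<close>
  have "x \<notin> V \<inter> W" for x
  proof (induction x rule: less_induct)
    case (less x)
    show ?case
    proof
      assume x: "x \<in> V \<inter> W"
      then have "1 \<le> rk P x" using rk_pos[of x W] C1[of x] by simp
      then have "x \<noteq> 1" using P1 by auto
      then obtain z where z: "x = Suc z" "1 \<le> z" using x pv(4) by (cases x) auto
      have "rk W z < rk W x" using rk_less[of z x W] x z by simp
      then have f: "prow \<kappa> x = prow \<kappa> z" using flat[OF z(2)] C1[of x] z(1) by simp
      have zV: "z \<in> V" using add_strip_top[OF V, of z x] f x z by simp
      then have "prow \<mu> x = prow \<mu> z" using pv(5)[of x] pv(5)[of z] x z f by simp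
      then have "z \<in> W" using add_strip_top[OF W, of z x] x z by simp
      then show False using less.IH[of z] zV z by simp
    qed
  qed
  then show "V \<inter> W = {}" by blast
  fix x assume x: "x \<in> P"
  have "x \<noteq> 0 \<and> x \<noteq> 1"
    using P1 rk_pos[OF x] rk_mono[of x 1 P] by (cases "x \<le> 1") auto
  then obtain z where z: "x = Suc z" "1 \<le> z" by (cases x) auto
  have f: "prow \<kappa> x = prow \<kappa> z"
    using flat[OF z(2)] rk_less[of z x P] x C1[of z] z(1) by fastforce
  have "x \<in> V \<union> W"
  proof (rule ccontr)
    assume n: "x \<notin> V \<union> W"
    have "rk W x = rk W z" using n z by (simp add: rk_Suc)
    then have pend: "rk W x < rk P x" using rk_less[of z x P] x C1[of z] z(1) by fastforce
    have ex: "\<exists>y. x < y \<and> y \<in> W"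
    proof (rule ccontr)
      assume "\<not> ?thesis"
      then have "rk W x = card W" by (intro rk_eq_card) (auto simp: not_less)
      then show False using pend rk_le_card[OF fP, of x] c by simp
    qed
    \<comment> \<open>The next row of \<open>W\<close>. Until then an element of \<open>P\<close> is
      unmatched, so the rows from x to y are equally long; as x is in neither strip, y cannot be in
      \<open>W\<close>.\<close>
    define y where "y = (LEAST y. x < y \<and> y \<in> W)"
    have y: "x < y" "y \<in> W" using LeastI_ex[OF ex] by (auto simp: y_def)
    have bet: "u \<notin> W" if "x < u" "u < y" for u using not_less_Least[of u "\<lambda>y. x < y \<and> y \<in> W"] that by (auto simp: y_def)
    have const: "prow \<kappa> u = prow \<kappa> x \<and> (u < y \<longrightarrow> rk W u = rk W x)" if "x \<le> u" "u \<le> y" for u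
      using that
    proof (induction u rule: dec_induct)
      case (step u)
      then have u: "prow \<kappa> u = prow \<kappa> x" "rk W u = rk W x" by auto
      have "rk P x \<le> rk P (Suc u)" by (rule rk_mono) (use step in simp)
      then have "prow \<kappa> (Suc u) = prow \<kappa> u" using flat[of u] u pend step z by simp
      then show ?case using u bet[of "Suc u"] step by (auto simp: rk_Suc)
    qed simp
    have "y \<notin> V" using add_strip_top[OF V, of x y] const[of y] y z n by auto
    then have "prow \<mu> x = prow \<mu> y" using pv(5)[of x] pv(5)[of y] n const[of y] y z by simp
    then show False using add_strip_top[OF W, of x y] y z n by auto
  qed
  then show "\<exists>z\<ge>1. x = Suc z \<and> x \<in> V \<union> W \<and> prow \<kappa> x = prow \<kappa> z" using z f by blast
qed

text \<open>At every drop of \<kappa> interlacing squeezes the count of \<open>W\<close> to that of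
  \<open>P\<close>. The union of both strips being fixed, the counts of \<open>V\<close> at the
  drops are determined too, and they determine \<open>V\<close> because it fills each block from the
  top.\<close>

lemma interlaced_unique:
  assumes V: "add_strip \<kappa> V \<mu>" and W: "add_strip \<mu> W \<gamma>" and i: "interlaced \<kappa> W P"
    and V': "add_strip \<kappa> V' \<mu>'" and W': "add_strip \<mu>' W' \<gamma>" and i': "interlaced \<kappa> W' P"
  shows "\<mu> = \<mu>'"
proof -
  note pv = add_stripD[OF V] and pw = add_stripD[OF W] and pv' = add_stripD[OF V'] and pw' = add_stripD[OF W']
  have dj: "V \<inter> W = {}" "V' \<inter> W' = {}"
    using interlaced_imp_split(1)[OF V W i] interlaced_imp_split(1)[OF V' W' i'] .
  have "V \<union> W = V' \<union> W'"
    using add_strip_set_unique add_strip_union[OF V W dj(1)] add_strip_union[OF V' W' dj(2)] by blast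
  note un = this
  have add: "rk (A \<union> B) x = rk A x + rk B x" if "A \<inter> B = {}" for A B x
    unfolding rk_def Int_Un_distrib2 using that by (intro card_Un_disjoint) auto
  have cW: "card W = card W'" using i i' by (simp add: interlaced_def)
  have "card (V \<union> W) = card V + card W" "card (V' \<union> W') = card V' + card W'"
    using dj pv(3) pw(3) pv'(3) pw'(3) by (simp_all add: card_Un_disjoint)
  then have cV: "card V = card V'" using un cW by simp
  have drop: "rk V z = rk V' z" if z: "1 \<le> z" "prow \<kappa> (Suc z) < prow \<kappa> z" for z
  proof -
    have "rk P z \<le> rk P (Suc z)" by (rule rk_mono) simp
    moreover have "rk P (Suc z) \<le> rk W z" "rk W z \<le> rk P z" "rk P (Suc z) \<le> rk W' z" "rk W' z \<le> rk P z"
      using i i' z by (auto simp: interlaced_def)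
    ultimately have "rk W z = rk W' z" by simp
    then show ?thesis using add[OF dj(1), of z] add[OF dj(2), of z] un by simp
  qed
  \<comment> \<open>At the first difference x the set without x has no further row in the block, so
    the counts differ at the end of the block, or in total if the block has no end.\<close>
  have half: False
    if A: "add_strip \<kappa> A \<mu>A" and B: "add_strip \<kappa> B \<mu>B" and c: "card A = card B"
      and dr: "\<And>z. 1 \<le> z \<Longrightarrow> prow \<kappa> (Suc z) < prow \<kappa> z \<Longrightarrow> rk A z = rk B z"
      and lt: "\<And>z. z < x \<Longrightarrow> z \<in> A \<longleftrightarrow> z \<in> B" and x: "x \<in> A" "x \<notin> B" for A B \<mu>A \<mu>B x
  proof -
    have x1: "1 \<le> x" using x add_stripD(4)[OF A] by auto
    have "A \<inter> {..x} = insert x (B \<inter> {..x})" using lt x by (auto simp: le_less)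
    then have rx: "rk A x = Suc (rk B x)" using x by (simp add: rk_def)
    have flat: "prow \<kappa> z = prow \<kappa> x \<and> rk B z = rk B x" if "x \<le> z" for z
      using that
    proof (induction z rule: dec_induct)
      case (step z)
      have "rk A x \<le> rk A z" by (rule rk_mono) (use step in simp)
      then have "\<not> prow \<kappa> (Suc z) < prow \<kappa> z" using dr[of z] step rx x1 by auto
      then have e: "prow \<kappa> (Suc z) = prow \<kappa> x"
        using prow_Suc_le[OF pv(1), of z] step x1 by simp
      then have "Suc z \<notin> B" using add_strip_top[OF B, of x "Suc z"] step x x1 by auto
      then show ?case using e step by (simp add: rk_Suc)
    qed simp
    obtain N where N: "\<And>y. y \<in> B \<Longrightarrow> y \<le> N" using add_stripD(3)[OF B] finite_nat_set_iff_bounded_le by auto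
    have "rk B (max x N) = card B" by (rule rk_eq_card) (use N in fastforce)
    then have "rk B x = card B" using flat[of "max x N"] by simp
    then show False using rx rk_le_card[OF add_stripD(3)[OF A], of x] c by simp
  qed
  have "x \<in> V \<longleftrightarrow> x \<in> V'" for x
  proof (induction x rule: less_induct)
    case (less x)
    show ?case using half[OF V V' cV drop, of x] half[OF V' V cV[symmetric] drop[symmetric], of x] less by blast
  qed
  then have "V = V'" by blast
  then show ?thesis using V V' add_strip_upper_unique by blast
qed

text \<open>\<open>W\<close> is pushed down as far as its counts allow: \<open>P\<close> itself is a
  candidate, and a candidate of largest row sum leaves a complement in \<open>G\<close> that fills
  each block from the top, as a vertical strip must.\<close>

lemma interlaced_exists:
  assumes G: "add_strip \<kappa> G \<gamma>" and P: "\<And>x. x \<in> P \<Longrightarrow> \<exists>z\<ge>1. x = Suc z \<and> x \<in> G \<and> prow \<kappa> x = prow \<kappa> z"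
  shows "\<exists>V W \<mu>. add_strip \<kappa> V \<mu> \<and> add_strip \<mu> W \<gamma> \<and> interlaced \<kappa> W P \<and> card G = card V + card P"
proof -
  note pg = add_stripD[OF G]
  have PG: "P \<subseteq> G" using P by blast
  have fP: "finite P" using PG pg(3) finite_subset by blast
  define F where "F = {W. W \<subseteq> G \<and> card W = card P \<and> (\<forall>x. rk W x \<le> rk P x) \<and>
    (\<forall>x\<ge>1. prow \<kappa> (Suc x) < prow \<kappa> x \<longrightarrow> rk W x = rk P x)}"
  have fF: "finite F" by (rule finite_subset[of _ "Pow G"]) (auto simp: F_def pg(3))
  have PF: "P \<in> F" using PG by (auto simp: F_def)
  define s where "s = Max (sum id ` F)"
  have "s \<in> sum id ` F" unfolding s_def by (rule Max_in) (use fF PF in auto)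
  then obtain W where W: "W \<in> F" "sum id W = s" by blast
  have maxW: "sum id W' \<le> sum id W" if "W' \<in> F" for W' unfolding W(2) s_def using fF that by simp
  have WG: "W \<subseteq> G" and cW: "card W = card P" and C1: "\<And>x. rk W x \<le> rk P x"
    and dr: "\<And>x. 1 \<le> x \<Longrightarrow> prow \<kappa> (Suc x) < prow \<kappa> x \<Longrightarrow> rk W x = rk P x"
    using W(1) by (auto simp: F_def)
  have fW: "finite W" using WG pg(3) finite_subset by blast
  have "\<exists>\<mu>. add_strip \<kappa> (G - W) \<mu>"
  proof (rule add_strip_exists_upper[OF pg(1)])
    show "finite (G - W)" "G - W \<subseteq> {1..}" using pg by auto
    fix x assume x: "1 \<le> x" "Suc x \<in> G - W" "prow \<kappa> (Suc x) = prow \<kappa> x"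
    have xG: "x \<in> G" using add_strip_top[OF G, of x "Suc x"] x by simp
    show "x \<in> G - W"
    proof (rule ccontr)
      assume "x \<notin> G - W"
      then have xW: "x \<in> W" using xG by simp
      \<comment> \<open>Moving x to x + 1 lowers the count at x and no other. Since \<kappa> does
        not drop at x, the result is a candidate of larger sum.\<close>
      define W' where "W' = insert (Suc x) (W - {x})"
      have rk': "rk W' z = (if z = x then rk W x - 1 else rk W z)" for z
      proof -
        consider "z < x" | "z = x" | "Suc x \<le> z" by linarith
        then show ?thesis
        proof cases
          case 1
          then have "W' \<inter> {..z} = W \<inter> {..z}" by (auto simp: W'_def)
          then show ?thesis using 1 by (simp add: rk_def)
        next
          case 2
          then have "W' \<inter> {..z} = W \<inter> {..z} - {x}" by (auto simp: W'_def)
          then show ?thesis using 2 xW by (simp add: rk_def)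
        next
          case 3
          then have "W' \<inter> {..z} = insert (Suc x) (W \<inter> {..z} - {x})" by (auto simp: W'_def)
          moreover have "x \<in> W \<inter> {..z}" "Suc x \<notin> W" using xW x 3 by auto
          ultimately show ?thesis using 3 card_Suc_Diff1[of "W \<inter> {..z}" x] by (simp add: rk_def)
        qed
      qed
      have "W' \<in> F"
        unfolding F_def mem_Collect_eq
      proof (intro conjI allI impI)
        show "W' \<subseteq> G" using WG x by (auto simp: W'_def)
        show "card W' = card P" using cW x xW fW card_Suc_Diff1[of W x] by (simp add: W'_def)
        show "rk W' z \<le> rk P z" for z using C1[of z] C1[of x] by (auto simp: rk' intro: le_trans[OF diff_le_self])
        show "rk W' z = rk P z" if "1 \<le> z" "prow \<kappa> (Suc z) < prow \<kappa> z" for z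
          using dr[OF that] that x(3) by (auto simp: rk')
      qed
      moreover have "sum id W' = Suc (sum id W)"
        using x xW fW sum.remove[OF fW xW, of id] by (simp add: W'_def)
      ultimately show False using maxW[of W'] by simp
    qed
  qed
  then obtain \<mu> where mu: "add_strip \<kappa> (G - W) \<mu>" by blast
  have "prow \<gamma> x = prow \<mu> x + of_bool (x \<in> W)" if "1 \<le> x" for x
    using add_stripD(5)[OF mu that] pg(5)[OF that] WG by (auto simp: of_bool_def split: if_splits)
  then have "add_strip \<mu> W \<gamma>" using add_stripD(2)[OF mu] pg WG fW by (auto simp: add_strip_def)
  moreover have "interlaced \<kappa> W P"
    unfolding interlaced_def
  proof (intro conjI allI impI)
    show "finite P" "card P = card W" "rk W x \<le> rk P x" for x using fP cW C1 by auto
    have "x \<ge> 2" if "x \<in> P" for x using P[OF that] by auto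
    then have "P \<inter> {..1} = {}" by fastforce
    then show "rk P 1 = 0" unfolding rk_def by simp
    show "rk P (Suc x) \<le> rk W x" if x: "1 \<le> x" "prow \<kappa> (Suc x) < prow \<kappa> x" for x
    proof -
      have "Suc x \<notin> P" using P[of "Suc x"] x by auto
      then show ?thesis using dr[OF x] by (simp add: rk_Suc)
    qed
  qed
  moreover have "card G = card (G - W) + card P" using WG pg(3) fW cW card_mono[OF pg(3) WG] by (simp add: card_Diff_subset)
  ultimately show ?thesis using mu by blast
qed

text \<open>There is one box of \<open>rl\<close> per row, so the row condition is vacuous. The
  column condition holds because labels of a strip tableau increase downwards, and lower boxes of a
  vertical strip lie weakly to the left.\<close>

lemma strip_tableau_in_RW:
  assumes W: "add_strip \<mu> W \<gamma>" and I: "add_strip \<nu> I \<beta>" and c: "card W = card I"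
  shows "strip_tableau (skew \<gamma> \<mu>) \<in> RW (skew \<gamma> \<mu>) (skew \<beta> \<nu>)"
proof -
  note pw = add_stripD[OF W] and pi = add_stripD[OF I]
  define T where "T = strip_at W (prow \<mu>)"
  have T: "strip_tableau (skew \<gamma> \<mu>) = T" by (simp add: T_def strip_tableau_eq[OF W])
  have G: "skew \<gamma> \<mu> = (\<lambda>i. (i, Suc (prow \<mu> i))) ` W" by (rule add_strip_skew[OF W])
  have cG: "card (skew \<gamma> \<mu>) = card W" "card (skew \<beta> \<nu>) = card I"
    by (rule add_strip_card_skew[OF W], rule add_strip_card_skew[OF I])
  have Tv: "T (i, Suc (prow \<mu> i)) = Some (rk W i)" if "i \<in> W" for i using that by (simp add: T_def strip_at_def)
  have st: "standard (skew \<gamma> \<mu>) T"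
    unfolding standard_def
  proof (intro conjI allI impI)
    show "dom T = skew \<gamma> \<mu>" unfolding G by (auto simp: T_def strip_at_def split: if_splits)
    have "bij_betw fst (skew \<gamma> \<mu>) W"
      unfolding G by (rule bij_betw_imageI) (auto simp: inj_on_def image_image)
    then have "bij_betw (rk W \<circ> fst) (skew \<gamma> \<mu>) {1..card W}" using rk_bij[OF pw(3)] by (rule bij_betw_trans)
    moreover have "(rk W \<circ> fst) b = (the \<circ> T) b" if "b \<in> skew \<gamma> \<mu>" for b
    proof -
      obtain i where "i \<in> W" "b = (i, Suc (prow \<mu> i))" using \<open>b \<in> skew \<gamma> \<mu>\<close> G by blast
      then show ?thesis using Tv by simp
    qed
    ultimately show "bij_betw (the \<circ> T) (skew \<gamma> \<mu>) {1..card (skew \<gamma> \<mu>)}"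
      unfolding cG by (rule bij_betw_cong[THEN iffD1, rotated])
    show "the (T (i, j)) < the (T (i, j'))" if "(i, j) \<in> skew \<gamma> \<mu> \<and> (i, j') \<in> skew \<gamma> \<mu> \<and> j < j'" for i j j'
      using that unfolding G by auto
    show "the (T (i, j)) < the (T (i', j))" if "(i, j) \<in> skew \<gamma> \<mu> \<and> (i', j) \<in> skew \<gamma> \<mu> \<and> i < i'" for i i' j
    proof -
      have h: "i \<in> W" "j = Suc (prow \<mu> i)" "i' \<in> W" "j = Suc (prow \<mu> i')" "i < i'" using that unfolding G by auto
      then show ?thesis using Tv[OF h(1)] Tv[OF h(3)] rk_less[OF h(5,3)] by simp
    qed
  qed
  have boxT: "\<exists>w\<in>W. rk W w = k \<and> box_of T k = (w, Suc (prow \<mu> w))" if k: "k \<in> {1..card I}" for k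
  proof -
    obtain w where "w \<in> W" "rk W w = k" using rk_surj[OF pw(3), of k] k c by auto
    then show ?thesis using box_of_strip_at[of w W "prow \<mu>"] by (auto simp: T_def)
  qed
  have boxI: "\<exists>i\<in>I. rk I i = k \<and> box_of (rl (skew \<beta> \<nu>)) k = (i, Suc (prow \<nu> i))" if k: "k \<in> {1..card I}" for k
  proof -
    obtain i where "i \<in> I" "rk I i = k" using rk_surj[OF pi(3), of k] k by auto
    then show ?thesis using box_of_strip_at[of i I "prow \<nu>"] by (auto simp: rl_strip_eq[OF I])
  qed
  show ?thesis
    unfolding RW_def T mem_Collect_eq
  proof (intro conjI allI ballI impI)
    show "standard (skew \<gamma> \<mu>) T" by (rule st)
    show "card (skew \<gamma> \<mu>) = card (skew \<beta> \<nu>)" using cG c by simp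
  next
    fix k assume h: "1 \<le> k \<and> k + 1 \<le> card (skew \<beta> \<nu>) \<and> row_of (rl (skew \<beta> \<nu>)) k = row_of (rl (skew \<beta> \<nu>)) (k + 1)"
    then have k: "k \<in> {1..card I}" "k + 1 \<in> {1..card I}" using cG by auto
    obtain i where i: "i \<in> I" "rk I i = k" "box_of (rl (skew \<beta> \<nu>)) k = (i, Suc (prow \<nu> i))" using boxI[OF k(1)] by blast
    obtain i' where i': "i' \<in> I" "rk I i' = k + 1" "box_of (rl (skew \<beta> \<nu>)) (k + 1) = (i', Suc (prow \<nu> i'))" using boxI[OF k(2)] by blast
    have "i = i'" using h i(3) i'(3) by simp
    then have False using i(2) i'(2) by simp
    then show "col_of T k < col_of T (k + 1)" "row_of T (k + 1) \<le> row_of T k" by blast+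
  next
    fix k m assume km: "k \<in> {1..card (skew \<beta> \<nu>)}" "m \<in> {1..card (skew \<beta> \<nu>)}"
      and h: "row_of (rl (skew \<beta> \<nu>)) m = row_of (rl (skew \<beta> \<nu>)) k + 1 \<and> col_of (rl (skew \<beta> \<nu>)) m = col_of (rl (skew \<beta> \<nu>)) k"
    have km': "k \<in> {1..card I}" "m \<in> {1..card I}" using km cG by auto
    obtain i where i: "i \<in> I" "rk I i = k" "box_of (rl (skew \<beta> \<nu>)) k = (i, Suc (prow \<nu> i))" using boxI[OF km'(1)] by blast
    obtain i' where i': "i' \<in> I" "rk I i' = m" "box_of (rl (skew \<beta> \<nu>)) m = (i', Suc (prow \<nu> i'))" using boxI[OF km'(2)] by blast
    obtain w where w: "w \<in> W" "rk W w = k" "box_of T k = (w, Suc (prow \<mu> w))" using boxT[OF km'(1)] by blast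
    obtain w' where w': "w' \<in> W" "rk W w' = m" "box_of T m = (w', Suc (prow \<mu> w'))" using boxT[OF km'(2)] by blast
    have "i < i'" using h i(3) i'(3) by simp
    then have "k < m" using rk_less[of i i' I] i i' by simp
    then have ww: "w < w'" using rk_mono[of w' w W] w w' by (metis linorder_not_le)
    then have "prow \<mu> w' \<le> prow \<mu> w" using prow_antimono[OF pw(1), of w w'] w pw(4) by auto
    then show "row_of T k < row_of T m" "col_of T m \<le> col_of T k" using ww w(3) w'(3) by simp_all
  qed
qed


text \<open>The pairs contributed by a fixed \<mu> to the right-hand side, in terms of ranks. Over
  all \<mu> they make up the targets of \<open>Cstep\<close> without repetition.\<close>

definition slid_step :: "int \<Rightarrow> nat list \<Rightarrow> nat list \<Rightarrow> nat list \<Rightarrow> nat list \<times> nat list \<Rightarrow> bool" where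
  "slid_step r \<kappa> \<beta> \<mu> \<gamma> \<longleftrightarrow> (\<exists>W I P. add_strip \<mu> W (fst \<gamma>) \<and> add_strip (snd \<gamma>) I \<beta> \<and> card W = card I \<and>
     int ` P = rlab r \<beta> ` I \<and> interlaced \<kappa> W P)"

text \<open>The rows added by C are the union of \<open>V\<close> and \<open>W\<close>, disjoint by
  \<open>interlaced_imp_split\<close>.\<close>

lemma slid_step_imp_Cstep:
  assumes V: "add_strip \<kappa> V \<mu>" "card V = p" and s: "slid_step r \<kappa> \<beta> \<mu> \<gamma>"
  shows "Cstep r p (\<kappa>, \<beta>) \<gamma>"
proof -
  obtain W I P where W: "add_strip \<mu> W (fst \<gamma>)" and I: "add_strip (snd \<gamma>) I \<beta>" and c: "card W = card I"
    and P: "int ` P = rlab r \<beta> ` I" and i: "interlaced \<kappa> W P"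
    using s unfolding slid_step_def by blast
  note sp = interlaced_imp_split[OF V(1) W i]
  have "add_strip \<kappa> (V \<union> W) (fst \<gamma>)" by (rule add_strip_union[OF V(1) W sp(1)])
  moreover have "card (V \<union> W) = p + card I"
    using sp(1) V(2) c add_stripD(3)[OF V(1)] add_stripD(3)[OF W] by (simp add: card_Un_disjoint)
  moreover have "\<exists>x\<ge>1. int (Suc x) = rlab r \<beta> i \<and> Suc x \<in> V \<union> W \<and> prow \<kappa> (Suc x) = prow \<kappa> x" if iI: "i \<in> I" for i
  proof -
    obtain x where "x \<in> P" "int x = rlab r \<beta> i" using P iI by (metis imageE imageI)
    then show ?thesis using sp(2)[of x] by auto
  qed
  ultimately show ?thesis unfolding Cstep_def fst_conv snd_conv using I by blast
qed

text \<open>With the labels of the removed boxes as \<open>P\<close>,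
  \<open>interlaced_exists\<close> splits the added rows into both strips; \<open>card V = p\<close>
  follows by counting.\<close>

lemma Cstep_imp_slid_step:
  assumes "Cstep r p (\<kappa>, \<beta>) \<gamma>"
  shows "\<exists>V \<mu>. add_strip \<kappa> V \<mu> \<and> card V = p \<and> slid_step r \<kappa> \<beta> \<mu> \<gamma>"
proof -
  obtain G I where G: "add_strip \<kappa> G (fst \<gamma>)" and I: "add_strip (snd \<gamma>) I \<beta>" and c: "card G = p + card I"
    and x: "\<And>i. i \<in> I \<Longrightarrow> \<exists>x\<ge>1. int (Suc x) = rlab r \<beta> i \<and> Suc x \<in> G \<and> prow \<kappa> (Suc x) = prow \<kappa> x"
    using assms unfolding Cstep_def fst_conv snd_conv by blast
  define P where "P = nat ` rlab r \<beta> ` I"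
  have "int (nat (rlab r \<beta> i)) = rlab r \<beta> i" if "i \<in> I" for i using x[OF that] by linarith
  then have P: "int ` P = rlab r \<beta> ` I" unfolding P_def image_image by (rule image_cong[OF refl])
  have cP: "card P = card I" using card_rlab[OF add_stripD(2)[OF I] add_stripD(4)[OF I] P] .
  have PG: "\<exists>z\<ge>1. y = Suc z \<and> y \<in> G \<and> prow \<kappa> y = prow \<kappa> z" if y: "y \<in> P" for y
  proof -
    obtain i where i: "i \<in> I" "int y = rlab r \<beta> i" using P y by (metis imageE imageI)
    obtain z where z: "z \<ge> 1" "int (Suc z) = rlab r \<beta> i" "Suc z \<in> G" "prow \<kappa> (Suc z) = prow \<kappa> z"
      using x[OF i(1)] by blast
    then have "y = Suc z" using i(2) by (metis of_nat_eq_iff)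
    then show ?thesis using z by blast
  qed
  obtain V W \<mu> where V: "add_strip \<kappa> V \<mu>" "add_strip \<mu> W (fst \<gamma>)" "interlaced \<kappa> W P" "card G = card V + card P"
    using interlaced_exists[OF G PG] by blast
  then have "card V = p" "card W = card I" using c cP by (simp_all add: interlaced_def)
  then show ?thesis unfolding slid_step_def using V(1-3) I P by blast
qed

lemma slid_step_unique:
  assumes "add_strip \<kappa> V \<mu>" "slid_step r \<kappa> \<beta> \<mu> \<gamma>" "add_strip \<kappa> V' \<mu>'" "slid_step r \<kappa> \<beta> \<mu>' \<gamma>"
  shows "\<mu> = \<mu>'"
proof -
  obtain W I P where W: "add_strip \<mu> W (fst \<gamma>)" "add_strip (snd \<gamma>) I \<beta>" "int ` P = rlab r \<beta> ` I" "interlaced \<kappa> W P"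
    using assms(2) unfolding slid_step_def by blast
  obtain W' I' P' where W': "add_strip \<mu>' W' (fst \<gamma>)" "add_strip (snd \<gamma>) I' \<beta>" "int ` P' = rlab r \<beta> ` I'" "interlaced \<kappa> W' P'"
    using assms(4) unfolding slid_step_def by blast
  have "I = I'" using W(2) W'(2) add_strip_set_unique by blast
  then have "int ` P = int ` P'" using W(3) W'(3) by simp
  then have "P = P'" by (simp add: inj_image_eq_iff)
  then show ?thesis using interlaced_unique[OF assms(1) W(1,4) assms(3) W'(1)] W'(4) by blast
qed

text \<open>Strips with \<open>q = 0\<close> boxes account for the summand \<open>\<tau>\<^sub>\<mu>\<^sub>,\<^sub>\<beta>\<close>.\<close>

lemma slid_step_iff:
  assumes p: "is_partition \<beta>" and V: "add_strip \<kappa> V \<mu>"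
  shows "slid_step r \<kappa> \<beta> \<mu> (\<gamma>\<^sub>1, \<gamma>\<^sub>2) \<longleftrightarrow> (\<gamma>\<^sub>1, \<gamma>\<^sub>2) = (\<mu>, \<beta>) \<or>
    is_partition \<gamma>\<^sub>1 \<and> is_partition \<gamma>\<^sub>2 \<and>
    (\<exists>q\<ge>1. vertical_strip \<gamma>\<^sub>1 \<mu> q \<and> vertical_strip \<beta> \<gamma>\<^sub>2 q \<and>
       strip_tableau (skew \<gamma>\<^sub>1 \<mu>) \<in> RW (skew \<gamma>\<^sub>1 \<mu>) (skew \<beta> \<gamma>\<^sub>2) \<and>
       row_rule r (skew \<beta> \<gamma>\<^sub>2) (strip_tableau (skew \<gamma>\<^sub>1 \<mu>)) \<and>
       reverse_row_rule r (skew \<beta> \<gamma>\<^sub>2) (Slide (strip_tableau (skew \<mu> \<kappa>)) (strip_tableau (skew \<gamma>\<^sub>1 \<mu>))))"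
    (is "_ \<longleftrightarrow> _ \<or> ?R")
proof -
  have pm: "is_partition \<mu>" using add_stripD(2)[OF V] .
  show ?thesis
  proof
    assume "slid_step r \<kappa> \<beta> \<mu> (\<gamma>\<^sub>1, \<gamma>\<^sub>2)"
    then obtain W I P where W: "add_strip \<mu> W \<gamma>\<^sub>1" and I: "add_strip \<gamma>\<^sub>2 I \<beta>" and c: "card W = card I"
      and P: "int ` P = rlab r \<beta> ` I" "interlaced \<kappa> W P"
      unfolding slid_step_def fst_conv snd_conv by blast
    show "(\<gamma>\<^sub>1, \<gamma>\<^sub>2) = (\<mu>, \<beta>) \<or> ?R"
    proof (cases "card W = 0")
      case True
      have "W = {}" using True add_stripD(3)[OF W] by simp
      moreover have "I = {}" using True c add_stripD(3)[OF I] by simp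
      ultimately show ?thesis using W I by (simp add: add_strip_empty_iff)
    next
      case False
      have pg: "is_partition \<gamma>\<^sub>1" "is_partition \<gamma>\<^sub>2" using add_stripD(2)[OF W] add_stripD(1)[OF I] .
      have "vertical_strip \<gamma>\<^sub>1 \<mu> (card W)" using vertical_strip_iff[OF pg(1) pm] W by blast
      moreover have "vertical_strip \<beta> \<gamma>\<^sub>2 (card W)" using vertical_strip_iff[OF p pg(2)] I c by auto
      moreover have "1 \<le> card W" using False by simp
      ultimately have ?R
        using pg strip_tableau_in_RW[OF W I c] rules_iff_interlaced[OF V W I c, of r] P by blast
      then show ?thesis ..
    qed
  next
    assume "(\<gamma>\<^sub>1, \<gamma>\<^sub>2) = (\<mu>, \<beta>) \<or> ?R"
    then show "slid_step r \<kappa> \<beta> \<mu> (\<gamma>\<^sub>1, \<gamma>\<^sub>2)"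
    proof
      assume e: "(\<gamma>\<^sub>1, \<gamma>\<^sub>2) = (\<mu>, \<beta>)"
      have "interlaced \<kappa> {} {}" by (simp add: interlaced_def rk_def)
      then show ?thesis using e p pm unfolding slid_step_def
        by (intro exI[of _ "{}"]) (simp add: add_strip_empty_iff)
    next
      assume R: ?R
      then obtain q where pg: "is_partition \<gamma>\<^sub>1" "is_partition \<gamma>\<^sub>2"
        and q: "vertical_strip \<gamma>\<^sub>1 \<mu> q" "vertical_strip \<beta> \<gamma>\<^sub>2 q"
          "row_rule r (skew \<beta> \<gamma>\<^sub>2) (strip_tableau (skew \<gamma>\<^sub>1 \<mu>))"
          "reverse_row_rule r (skew \<beta> \<gamma>\<^sub>2) (Slide (strip_tableau (skew \<mu> \<kappa>)) (strip_tableau (skew \<gamma>\<^sub>1 \<mu>)))"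
        by blast
      obtain W where W: "add_strip \<mu> W \<gamma>\<^sub>1" "card W = q" using q(1) vertical_strip_iff[OF pg(1) pm] by blast
      obtain I where I: "add_strip \<gamma>\<^sub>2 I \<beta>" "card I = q" using q(2) vertical_strip_iff[OF p pg(2)] by blast
      have c: "card W = card I" using W I by simp
      then show ?thesis
        using rules_iff_interlaced[OF V W(1) I(1) c, of r] q(3,4) W(1) I(1)
        unfolding slid_step_def fst_conv snd_conv by blast
    qed
  qed
qed

theorem mainTheorem8:
  fixes r :: int and p :: nat and \<beta>\<^sub>1 \<beta>\<^sub>2 :: "nat list"
  assumes "r > 0" and "p \<ge> 1" and "is_partition \<beta>\<^sub>1" and "is_partition \<beta>\<^sub>2"
  shows "tau r (replicate p 1) [] * tau r \<beta>\<^sub>1 \<beta>\<^sub>2 =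
    (\<Sum>\<mu> \<in> {\<mu>. is_partition \<mu> \<and> vertical_strip \<mu> \<beta>\<^sub>1 p}.
       tau r \<mu> \<beta>\<^sub>2 +
       (\<Sum>(\<gamma>\<^sub>1, \<gamma>\<^sub>2) \<in> {(\<gamma>\<^sub>1, \<gamma>\<^sub>2). is_partition \<gamma>\<^sub>1 \<and> is_partition \<gamma>\<^sub>2 \<and>
            (\<exists>q\<ge>1. vertical_strip \<gamma>\<^sub>1 \<mu> q \<and> vertical_strip \<beta>\<^sub>2 \<gamma>\<^sub>2 q \<and>
               strip_tableau (skew \<gamma>\<^sub>1 \<mu>) \<in> RW (skew \<gamma>\<^sub>1 \<mu>) (skew \<beta>\<^sub>2 \<gamma>\<^sub>2) \<and>
               row_rule r (skew \<beta>\<^sub>2 \<gamma>\<^sub>2) (strip_tableau (skew \<gamma>\<^sub>1 \<mu>)) \<and>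
               reverse_row_rule r (skew \<beta>\<^sub>2 \<gamma>\<^sub>2)
                 (Slide (strip_tableau (skew \<mu> \<beta>\<^sub>1)) (strip_tableau (skew \<gamma>\<^sub>1 \<mu>))))}.
          tau r \<gamma>\<^sub>1 \<gamma>\<^sub>2))"
proof -
  define A where "A = {\<mu>. is_partition \<mu> \<and> vertical_strip \<mu> \<beta>\<^sub>1 p}"
  define B where "B \<mu> = {(\<gamma>\<^sub>1, \<gamma>\<^sub>2). is_partition \<gamma>\<^sub>1 \<and> is_partition \<gamma>\<^sub>2 \<and>
            (\<exists>q\<ge>1. vertical_strip \<gamma>\<^sub>1 \<mu> q \<and> vertical_strip \<beta>\<^sub>2 \<gamma>\<^sub>2 q \<and>
               strip_tableau (skew \<gamma>\<^sub>1 \<mu>) \<in> RW (skew \<gamma>\<^sub>1 \<mu>) (skew \<beta>\<^sub>2 \<gamma>\<^sub>2) \<and>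
               row_rule r (skew \<beta>\<^sub>2 \<gamma>\<^sub>2) (strip_tableau (skew \<gamma>\<^sub>1 \<mu>)) \<and>
               reverse_row_rule r (skew \<beta>\<^sub>2 \<gamma>\<^sub>2)
                 (Slide (strip_tableau (skew \<mu> \<beta>\<^sub>1)) (strip_tableau (skew \<gamma>\<^sub>1 \<mu>))))}" for \<mu>
  define K where "K \<mu> = {\<gamma>. slid_step r \<beta>\<^sub>1 \<beta>\<^sub>2 \<mu> \<gamma>}" for \<mu>
  have A: "\<mu> \<in> A \<longleftrightarrow> (\<exists>V. add_strip \<beta>\<^sub>1 V \<mu> \<and> card V = p)" for \<mu>
    unfolding A_def using vertical_strip_iff[OF _ assms(3)] add_stripD(2) by blast
  have K: "K \<mu> = insert (\<mu>, \<beta>\<^sub>2) (B \<mu>)" if \<mu>: "\<mu> \<in> A" for \<mu>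
  proof -
    obtain V where V: "add_strip \<beta>\<^sub>1 V \<mu>" using \<mu> A by blast
    show ?thesis
    proof (rule set_eqI)
      fix \<gamma> show "\<gamma> \<in> K \<mu> \<longleftrightarrow> \<gamma> \<in> insert (\<mu>, \<beta>\<^sub>2) (B \<mu>)"
        unfolding K_def B_def using slid_step_iff[OF assms(4) V, of r "fst \<gamma>" "snd \<gamma>"]
        by (cases \<gamma>) simp
    qed
  qed
  \<comment> \<open>The strips in \<open>B \<mu>\<close> have q \<ge> 1 boxes, so the separate
    summand for \<mu> is not counted twice.\<close>
  have notB: "(\<mu>, \<beta>\<^sub>2) \<notin> B \<mu>" for \<mu> by (auto simp: B_def vertical_strip_def skew_def)
  have KC: "K \<mu> \<subseteq> {\<gamma>. Cstep r p (\<beta>\<^sub>1, \<beta>\<^sub>2) \<gamma>}" if "\<mu> \<in> A" for \<mu>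
    using that slid_step_imp_Cstep unfolding A K_def by blast
  have fK: "finite (K \<mu>)" if "\<mu> \<in> A" for \<mu> using KC[OF that] finite_Cstep by (rule finite_subset)
  have fA: "finite A"
    by (rule finite_subset[OF _ finite_vstrips[of p \<beta>\<^sub>1]]) (auto simp: A vstrips_def)
  \<comment> \<open>Each target comes from only one \<mu>, so the double sum is a sum over the
    targets of \<open>Cstep\<close>.\<close>
  have inj: "inj_on snd (SIGMA \<mu>:A. K \<mu>)"
  proof (rule inj_onI)
    fix u w assume uw: "u \<in> (SIGMA \<mu>:A. K \<mu>)" "w \<in> (SIGMA \<mu>:A. K \<mu>)" "snd u = snd w"
    obtain \<mu> \<gamma> \<mu>' where e: "u = (\<mu>, \<gamma>)" "w = (\<mu>', \<gamma>)" using uw(3) by (metis prod.collapse)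
    obtain V V' where "add_strip \<beta>\<^sub>1 V \<mu>" "add_strip \<beta>\<^sub>1 V' \<mu>'" using uw e A by blast
    then have "\<mu> = \<mu>'" using slid_step_unique uw(1,2) unfolding e K_def by blast
    then show "u = w" using e by simp
  qed
  have im: "snd ` (SIGMA \<mu>:A. K \<mu>) = {\<gamma>. Cstep r p (\<beta>\<^sub>1, \<beta>\<^sub>2) \<gamma>}"
  proof
    show "snd ` (SIGMA \<mu>:A. K \<mu>) \<subseteq> {\<gamma>. Cstep r p (\<beta>\<^sub>1, \<beta>\<^sub>2) \<gamma>}" using KC by fastforce
    show "{\<gamma>. Cstep r p (\<beta>\<^sub>1, \<beta>\<^sub>2) \<gamma>} \<subseteq> snd ` (SIGMA \<mu>:A. K \<mu>)"
    proof
      fix \<gamma> assume "\<gamma> \<in> {\<gamma>. Cstep r p (\<beta>\<^sub>1, \<beta>\<^sub>2) \<gamma>}"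
      then obtain V \<mu> where "add_strip \<beta>\<^sub>1 V \<mu>" "card V = p" "slid_step r \<beta>\<^sub>1 \<beta>\<^sub>2 \<mu> \<gamma>"
        using Cstep_imp_slid_step by blast
      then have "(\<mu>, \<gamma>) \<in> (SIGMA \<mu>:A. K \<mu>)" using A by (auto simp: K_def)
      then show "\<gamma> \<in> snd ` (SIGMA \<mu>:A. K \<mu>)" by (metis image_eqI snd_conv)
    qed
  qed
  have "tau r (replicate p 1) [] * tau r \<beta>\<^sub>1 \<beta>\<^sub>2 = (\<Sum>\<gamma> \<in> {\<gamma>. Cstep r p (\<beta>\<^sub>1, \<beta>\<^sub>2) \<gamma>}. tau_at r \<gamma>)"
    unfolding tau_column using column_times_tau[of "(\<beta>\<^sub>1, \<beta>\<^sub>2)" p r] assms(3,4) by simp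
  also have "\<dots> = (\<Sum>(\<mu>, \<gamma>) \<in> (SIGMA \<mu>:A. K \<mu>). tau_at r \<gamma>)"
    unfolding im[symmetric] sum.reindex[OF inj] by (simp add: case_prod_unfold)
  also have "\<dots> = (\<Sum>\<mu>\<in>A. \<Sum>\<gamma>\<in>K \<mu>. tau_at r \<gamma>)"
    by (rule sum.Sigma[symmetric]) (use fA fK in auto)
  also have "\<dots> = (\<Sum>\<mu>\<in>A. tau r \<mu> \<beta>\<^sub>2 + (\<Sum>(\<gamma>\<^sub>1, \<gamma>\<^sub>2)\<in>B \<mu>. tau r \<gamma>\<^sub>1 \<gamma>\<^sub>2))"
  proof (rule sum.cong[OF refl])
    fix \<mu> assume m: "\<mu> \<in> A"
    have "finite (B \<mu>)" using fK[OF m] K[OF m] by simp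
    then show "(\<Sum>\<gamma>\<in>K \<mu>. tau_at r \<gamma>) = tau r \<mu> \<beta>\<^sub>2 + (\<Sum>(\<gamma>\<^sub>1, \<gamma>\<^sub>2)\<in>B \<mu>. tau r \<gamma>\<^sub>1 \<gamma>\<^sub>2)"
      unfolding K[OF m] using notB by (simp add: case_prod_unfold)
  qed
  finally show ?thesis unfolding A_def B_def .
qed

end
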